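(* Let $X$ be a rearrangement invariant space over $(-1,1)$ satisfying $0<\underline{\alpha}_X\le\overline{\alpha}_X<1$. Then $[T,X]$ is the largest Banach function space (over $(-1,1)$, in $L^0$) containing $X$ to which $T_X\colon X\to X$ admits an $X$-valued, continuous linear extension. That is, $[T,X]$ is a Banach function space containing $X$ to which $T_X$ admits an $X$-valued continuous linear extension, and whenever $Z\subseteq L^0$ is a Banach function space over $(-1,1)$ with $X\subseteq Z$ for which there exists a continuous linear operator $S\colon Z\to X$ with $S(f)=T_X(f)$ for all $f\in X$, then $Z\subseteq[T,X]$.
   Context: Let $\mu$ be Lebesgue measure on the Borel $\sigma$-algebra $\mathscr{B}$ of $(-1,1)$, let $\mathrm{sim}\,\mathscr{B}$ be the space of all $\mathbb{C}$-valued $\mathscr{B}$-simple functions, and let $L^0$ be the complex vector lattice of all $\mathbb{C}$-valued $\mathscr{B}$-measurable functions on $(-1,1)$ (functions equal a.e. are identified). $L^p$ means $L^p(-1,1)$. A Banach function space (B.f.s.) over $(-1,1)$ is an order ideal $X$ of $L^0$ with $\mathrm{sim}\,\mathscr{B}\subseteq X$, equipped with a lattice norm $\|\cdot\|_X$ for which $X$ is complete. It has the Fatou property if, whenever $\{f_n\}$ is a norm-bounded increasing sequence of positive functions in $X$ with $f=\sup_n f_n$ in $L^0$, then $f\in X$ and $\|f_n\|_X\to\|f\|_X$. For $f\in L^0$ the decreasing rearrangement $f^*\colon[0,2]\to[0,\infty]$ is the right continuous inverse of the distribution function $\lambda\mapsto\mu(\{|f|>\lambda\})$. A B.f.s. $X$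 over $(-1,1)$ with the Fatou property is rearrangement invariant (r.i.) if $g\in L^0$ and $g^*\le f^*$ for some $f\in X$ imply $g\in X$. Then $L^\infty\subseteq X\subseteq L^1$ continuously. For $t>0$ the dilation operator $E_t\colon X\to X$ is $E_t(f)(x)=f(tx)$ if $-1<tx<1$ and $0$ otherwise. The Boyd indices are $\underline{\alpha}_X=\sup_{0<t<1}\frac{\log\|E_{1/t}\|_{\mathrm{op}}}{\log t}$ and $\overline{\alpha}_X=\inf_{1<t<\infty}\frac{\log\|E_{1/t}\|_{\mathrm{op}}}{\log t}$. The finite Hilbert transform of $f\in L^1$ is $T(f)(t)=\lim_{\varepsilon\to0+}\frac1\pi\left(\int_{-1}^{t-\varepsilon}+\int_{t+\varepsilon}^1\right)\frac{f(x)}{x-t}\,dx$, which exists for a.e. $t\in(-1,1)$; $T(f)\in L^0$. If $X$ is r.i. with $0<\underline{\alpha}_X\le\overline{\alpha}_X<1$, then $T$ maps $X$ boundedly into $X$ and $T_X\colon X\to X$ denotes this operator. Define $[T,X]=\{f\in L^1: T(h)\in X\text{ for all }h\in L^0\text{ with }|h|\le|f|\text{ a.e.}\}$ with norm $\|f\|_{[T,X]}=\sup_{|h|\le|f|}\|T(h)\|_X$. *)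

theory Defs
  imports "HOL-Analysis.Analysis"
begin

text \<open>
  Elements of \<open>L\<^sup>0\<close> and of its subspaces are handled through representatives: a space is a set of
  functions \<^typ>\<open>real \<Rightarrow> complex\<close> (whose values outside \<open>(-1,1)\<close> are irrelevant), and all
  relations between functions hold almost everywhere.
\<close>

abbreviation mu :: "real measure" where
  "mu \<equiv> restrict_space lborel {-1<..<1}"

abbreviation L0 :: "(real \<Rightarrow> complex) set" where
  "L0 \<equiv> borel_measurable mu"

text \<open>
  The order ideal condition (\<open>ideal\<close>) forces \<open>X\<close> to be closed under almost everywhere equality,
  and \<open>norm_mono\<close> forces \<open>N\<close> to respect it. Only the values of \<open>N\<close> on \<open>X\<close> matter.
\<close>

locale banach_function_space =
  fixes X :: "(real \<Rightarrow> complex) set" and N :: "(real \<Rightarrow> complex) \<Rightarrow> real"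
  assumes subset_L0: "X \<subseteq> L0"
    and add: "\<And>f g. f \<in> X \<Longrightarrow> g \<in> X \<Longrightarrow> (\<lambda>x. f x + g x) \<in> X"
    and scale: "\<And>c f. f \<in> X \<Longrightarrow> (\<lambda>x. c * f x) \<in> X"
    and ideal: "\<And>f g. f \<in> X \<Longrightarrow> g \<in> L0 \<Longrightarrow> (AE x in mu. cmod (g x) \<le> cmod (f x)) \<Longrightarrow> g \<in> X"
    and simple: "\<And>f. simple_function mu f \<Longrightarrow> f \<in> X"
    and norm_zero_iff: "\<And>f. f \<in> X \<Longrightarrow> N f = 0 \<longleftrightarrow> (AE x in mu. f x = 0)"
    and norm_scale: "\<And>c f. f \<in> X \<Longrightarrow> N (\<lambda>x. c * f x) = cmod c * N f"
    and norm_triangle: "\<And>f g. f \<in> X \<Longrightarrow> g \<in> X \<Longrightarrow> N (\<lambda>x. f x + g x) \<le> N f + N g"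
    and norm_mono: "\<And>f g. f \<in> X \<Longrightarrow> g \<in> X \<Longrightarrow> (AE x in mu. cmod (g x) \<le> cmod (f x)) \<Longrightarrow> N g \<le> N f"
    and complete: "\<And>F :: nat \<Rightarrow> real \<Rightarrow> complex.
      (\<And>n. F n \<in> X) \<Longrightarrow>
      (\<forall>e>0. \<exists>K. \<forall>m\<ge>K. \<forall>n\<ge>K. N (\<lambda>x. F m x - F n x) < e) \<Longrightarrow>
      \<exists>f\<in>X. (\<lambda>n. N (\<lambda>x. F n x - f x)) \<longlonglongrightarrow> 0"

text \<open>
  The supremum in \<open>L\<^sup>0\<close> of an increasing sequence is its pointwise supremum almost everywhere,
  which is required to be finite almost everywhere because \<open>f\<close> is real-valued.
\<close>

definition fatou_property :: "(real \<Rightarrow> complex) set \<Rightarrow> ((real \<Rightarrow> complex) \<Rightarrow> real) \<Rightarrow> bool" where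
  "fatou_property X N \<longleftrightarrow>
    (\<forall>(u :: nat \<Rightarrow> real \<Rightarrow> real) (f :: real \<Rightarrow> real).
      (\<forall>n. (\<lambda>x. complex_of_real (u n x)) \<in> X) \<longrightarrow>
      (\<forall>n. AE x in mu. 0 \<le> u n x) \<longrightarrow>
      (\<forall>n. AE x in mu. u n x \<le> u (Suc n) x) \<longrightarrow>
      bdd_above (range (\<lambda>n. N (\<lambda>x. complex_of_real (u n x)))) \<longrightarrow>
      f \<in> borel_measurable mu \<longrightarrow>
      (AE x in mu. ereal (f x) = (SUP n. ereal (u n x))) \<longrightarrow>
      (\<lambda>x. complex_of_real (f x)) \<in> X \<and>
      (\<lambda>n. N (\<lambda>x. complex_of_real (u n x))) \<longlonglongrightarrow> N (\<lambda>x. complex_of_real (f x)))"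

definition distribution_function :: "(real \<Rightarrow> complex) \<Rightarrow> real \<Rightarrow> real" where
  "distribution_function f l = measure mu {x \<in> space mu. l < cmod (f x)}"

definition decreasing_rearrangement :: "(real \<Rightarrow> complex) \<Rightarrow> real \<Rightarrow> ennreal" where
  "decreasing_rearrangement f s = (INF l \<in> {l. 0 \<le> l \<and> distribution_function f l \<le> s}. ennreal l)"

locale rearrangement_invariant_space = banach_function_space +
  assumes fatou: "fatou_property X N"
    and rearrangement: "\<And>f g. f \<in> X \<Longrightarrow> g \<in> L0 \<Longrightarrow>
      (\<forall>s\<in>{0..2}. decreasing_rearrangement g s \<le> decreasing_rearrangement f s) \<Longrightarrow> g \<in> X"

definition dilation :: "real \<Rightarrow> (real \<Rightarrow> complex) \<Rightarrow> real \<Rightarrow> complex" where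
  "dilation t f x = (if -1 < t * x \<and> t * x < 1 then f (t * x) else 0)"

text \<open>The real supremum is meaningful for bounded operators; dilations are bounded on every
  rearrangement invariant space.\<close>

definition op_norm ::
  "(real \<Rightarrow> complex) set \<Rightarrow> ((real \<Rightarrow> complex) \<Rightarrow> real) \<Rightarrow> ((real \<Rightarrow> complex) \<Rightarrow> real \<Rightarrow> complex) \<Rightarrow> real"
where
  "op_norm X N A = (SUP f \<in> {f \<in> X. N f \<le> 1}. N (A f))"

text \<open>Supremum and infimum are taken in \<^typ>\<open>ereal\<close>, so they need no boundedness proviso.\<close>

definition lower_boyd_index ::
  "(real \<Rightarrow> complex) set \<Rightarrow> ((real \<Rightarrow> complex) \<Rightarrow> real) \<Rightarrow> ereal" where
  "lower_boyd_index X N = (SUP t \<in> {0<..<1}. ereal (ln (op_norm X N (dilation (1 / t))) / ln t))"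

definition upper_boyd_index ::
  "(real \<Rightarrow> complex) set \<Rightarrow> ((real \<Rightarrow> complex) \<Rightarrow> real) \<Rightarrow> ereal" where
  "upper_boyd_index X N = (INF t \<in> {1<..}. ereal (ln (op_norm X N (dilation (1 / t))) / ln t))"

text \<open>For integrable \<open>f\<close> the limit exists for almost every \<open>t\<close> in \<open>(-1,1)\<close>; elsewhere the value is
  unspecified.\<close>

definition finite_hilbert_transform :: "(real \<Rightarrow> complex) \<Rightarrow> real \<Rightarrow> complex" where
  "finite_hilbert_transform f t =
    Lim (at_right 0) (\<lambda>e. complex_of_real (1 / pi) *
      ((LINT x:{-1<..<t - e}|mu. f x / complex_of_real (x - t)) +
       (LINT x:{t + e<..<1}|mu. f x / complex_of_real (x - t))))"

definition dominated :: "(real \<Rightarrow> complex) \<Rightarrow> (real \<Rightarrow> complex) set" where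
  "dominated f = {h \<in> L0. AE x in mu. cmod (h x) \<le> cmod (f x)}"

definition opt_domain :: "(real \<Rightarrow> complex) set \<Rightarrow> (real \<Rightarrow> complex) set" where
  "opt_domain X = {f. integrable mu f \<and> (\<forall>h\<in>dominated f. finite_hilbert_transform h \<in> X)}"

definition opt_domain_norm :: "((real \<Rightarrow> complex) \<Rightarrow> real) \<Rightarrow> (real \<Rightarrow> complex) \<Rightarrow> real" where
  "opt_domain_norm N f = (SUP h\<in>dominated f. N (finite_hilbert_transform h))"

text \<open>Linearity is required almost everywhere, i.e. as an identity in \<open>L\<^sup>0\<close>. Together with continuity
  it makes \<open>S\<close> compatible with almost everywhere equality.\<close>

definition continuous_linear_operator ::
  "(real \<Rightarrow> complex) set \<Rightarrow> ((real \<Rightarrow> complex) \<Rightarrow> real) \<Rightarrow>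
   (real \<Rightarrow> complex) set \<Rightarrow> ((real \<Rightarrow> complex) \<Rightarrow> real) \<Rightarrow>
   ((real \<Rightarrow> complex) \<Rightarrow> real \<Rightarrow> complex) \<Rightarrow> bool" where
  "continuous_linear_operator Z NZ X N S \<longleftrightarrow>
    (\<forall>f\<in>Z. S f \<in> X) \<and>
    (\<forall>f\<in>Z. \<forall>g\<in>Z. AE x in mu. S (\<lambda>y. f y + g y) x = S f x + S g x) \<and>
    (\<forall>c. \<forall>f\<in>Z. AE x in mu. S (\<lambda>y. c * f y) x = c * S f x) \<and>
    (\<forall>f\<in>Z. \<forall>e>0. \<exists>d>0. \<forall>g\<in>Z. NZ (\<lambda>x. g x - f x) < d \<longrightarrow> N (\<lambda>x. S g x - S f x) < e)"

definition admits_extension ::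
  "(real \<Rightarrow> complex) set \<Rightarrow> ((real \<Rightarrow> complex) \<Rightarrow> real) \<Rightarrow>
   (real \<Rightarrow> complex) set \<Rightarrow> ((real \<Rightarrow> complex) \<Rightarrow> real) \<Rightarrow> bool" where
  "admits_extension Z NZ X N \<longleftrightarrow>
    (\<exists>S. continuous_linear_operator Z NZ X N S \<and>
      (\<forall>f\<in>X. AE x in mu. S f x = finite_hilbert_transform f x))"

end

theory Submission
  imports Defs "HOL-Complex_Analysis.Complex_Analysis" "HOL-Probability.Probability"
begin

text \<open>
  Write \<open>H\<close> for the finite Hilbert transform and \<open>rho f\<close> for the supremum of \<open>N (H h)\<close> over all
  \<open>h\<close> with \<open>\<bar>h\<bar> \<le> \<bar>f\<bar>\<close>. Once \<open>H\<close> is known to map \<open>X\<close> into itself, two properties of \<open>H\<close> on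
  integrable functions decide everything about the optimal domain.

  The first is the identity \<open>H (x h) = x H h + (1/\<pi>) \<integral> h\<close>, which holds because
  \<open>x / (x - t) = 1 + t / (x - t)\<close>. Since \<open>\<bar>x h\<bar> \<le> \<bar>h\<bar>\<close> on \<open>(-1,1)\<close>, it bounds \<open>\<integral> \<bar>f\<bar>\<close> by a multiple
  of \<open>rho f\<close> (\<open>integral_bound\<close>). The second is that \<open>H\<close> is continuous from \<open>L\<^sup>1\<close> to convergence
  in measure (\<open>weak_type\<close>); together with the Fatou property of \<open>X\<close> it makes \<open>h \<mapsto> N (H h)\<close>
  lower semicontinuous for \<open>L\<^sup>1\<close> convergence (\<open>norm_lower_semicontinuous\<close>). From these two,
  \<open>rho\<close> is finite by a gliding hump argument (\<open>dominated_norm_bounded\<close>), and it is complete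
  because a function dominated by a series splits into functions dominated by its terms
  (\<open>opt_domain_rapid_limit\<close>). If \<open>S\<close> extends \<open>H\<close> continuously to \<open>Z\<close> and \<open>f\<close> lies in \<open>Z\<close>, then bounded
  functions dominated by \<open>f\<close> lie in \<open>X\<close> and have transforms of uniformly bounded norm; the first
  property makes \<open>f\<close> integrable and the second one passes from the truncations of a dominated
  function \<open>h\<close> to \<open>h\<close> itself (\<open>opt_domain_maximal\<close>).

  The facts about \<open>H\<close> come from complex analysis. For a positive density \<open>f\<close> on \<open>(-1,1)\<close> the
  function \<open>F z = \<integral> f(t) \<i> / (z - t) dt\<close> maps the upper half-plane into the right one, its real part
  is \<open>\<pi>\<close> times the Poisson average of \<open>f\<close> and its imaginary part is close to \<open>-\<pi>\<close> times a truncated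
  Hilbert integral. If \<open>G\<close> is holomorphic and \<open>G w = O(w\<^sup>2)\<close>, then \<open>G \<circ> F\<close> has integral \<open>0\<close> over every
  horizontal line (\<open>integral_holomorphic_herglotz_eq_0\<close>). The choices \<open>2 w\<^sup>2 / (l (w + l))\<close> and
  \<open>cos (w/4) - 1\<close> of \<open>G\<close> give the weak type estimate and, for densities at most \<open>1\<close>, an exponential
  estimate. The difference of \<open>F\<close> on two horizontal lines satisfies the analogous identity for the
  square. With the weak type estimate this gives convergence in measure of \<open>F (x + iy)\<close> as
  \<open>y \<rightarrow> 0\<close>, hence convergence at almost every \<open>x\<close> along a sequence. The bounded function
  \<open>1 / (1 + F)\<close> is the Poisson integral of its limit along that sequence, so by Lebesgue's theorem
  it converges almost everywhere, and so do \<open>F\<close> and the principal value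
  (\<open>AE_herglotz_boundary_limit\<close>, \<open>AE_finite_hilbert_transform\<close>).

  That \<open>X\<close> is invariant under \<open>H\<close> is Boyd's theorem. The weak type estimate for the large values of
  \<open>f\<close> and the exponential estimate for slices of the small ones bound the rearrangement of \<open>H f\<close> at
  \<open>t\<close> by a series in the rearrangement of \<open>f\<close> at \<open>A\<^sup>k t\<close> and \<open>B\<^sup>-\<^sup>k t\<close> (\<open>calderon_bound\<close>). The lower
  Boyd index is positive and the upper one less than \<open>1\<close>, so for suitable \<open>A\<close>, \<open>B > 1\<close> the dilations
  by \<open>A\<close> and \<open>1/B\<close> have norms less than \<open>1\<close> and \<open>B\<close>, and the series converges in \<open>X\<close>.
\<close>

section \<open>Lebesgue points and Poisson averages\<close>

text \<open>
  The Poisson kernel of the upper half-plane without its factor \<open>1 / \<pi>\<close>.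
\<close>

definition poisson_kernel :: "real \<Rightarrow> real \<Rightarrow> real" where
  "poisson_kernel y s = y / (s\<^sup>2 + y\<^sup>2)"

lemma poisson_kernel_measurable [measurable]: "poisson_kernel y \<in> borel_measurable borel"
  unfolding poisson_kernel_def by measurable

lemma poisson_kernel_nonneg: "0 < y \<Longrightarrow> 0 \<le> poisson_kernel y s"
  by (simp add: poisson_kernel_def)

lemma poisson_kernel_commute: "poisson_kernel y (x - t) = poisson_kernel y (t - x)"
  by (simp add: poisson_kernel_def power2_commute)

lemma poisson_kernel_le: "0 < y \<Longrightarrow> poisson_kernel y s \<le> 1 / y"
proof -
  assume y: "0 < y"
  have "y / (s\<^sup>2 + y\<^sup>2) \<le> y / (y\<^sup>2)"
    using y by (intro divide_left_mono) (auto intro!: mult_pos_pos add_nonneg_pos)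
  then show ?thesis using y by (simp add: poisson_kernel_def power2_eq_square)
qed

lemma nn_integral_poisson_kernel:
  assumes y: "0 < y"
  shows "(\<integral>\<^sup>+t. ennreal (poisson_kernel y (t - x)) \<partial>lborel) = ennreal pi"
proof -
  have i: "integrable lborel (\<lambda>x::real. inverse (1 + x^2))"
    using integrable_inverse_1_plus_square by (simp add: set_integrable_def)
  have v: "(\<integral>x. inverse (1 + x^2) \<partial>lborel) = pi"
    using LBINT_inverse_1_plus_square by (simp add: interval_lebesgue_integral_def set_lebesgue_integral_def)
  have n: "(\<integral>\<^sup>+x. ennreal (inverse (1 + x^2)) \<partial>lborel) = ennreal pi"
    using nn_integral_eq_integral[OF i] v by simp
  have "(\<integral>\<^sup>+t. ennreal (poisson_kernel y (t - x)) \<partial>lborel)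
      = \<bar>y\<bar> * (\<integral>\<^sup>+u. ennreal (poisson_kernel y ((x + y * u) - x)) \<partial>lborel)"
    using y by (subst nn_integral_real_affine[where c=y and t=x]) auto
  also have "\<dots> = (\<integral>\<^sup>+u. ennreal y * ennreal (poisson_kernel y ((x + y * u) - x)) \<partial>lborel)"
    using y by (subst nn_integral_cmult) auto
  also have "\<dots> = (\<integral>\<^sup>+x. ennreal (inverse (1 + x^2)) \<partial>lborel)"
  proof (intro nn_integral_cong)
    fix u :: real
    have "y * (y / ((y*u)\<^sup>2 + y\<^sup>2)) = inverse (1 + u\<^sup>2)"
    proof -
      have "(y*u)\<^sup>2 + y\<^sup>2 = y * y * (1 + u\<^sup>2)" by (simp add: power2_eq_square algebra_simps)
      then show ?thesis using y by (simp add: divide_simps)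
    qed
    then show "ennreal y * ennreal (poisson_kernel y ((x + y * u) - x)) = ennreal (inverse (1 + u^2))"
      using y by (simp add: ennreal_mult'[symmetric] poisson_kernel_def)
  qed
  finally show ?thesis using n by simp
qed

lemma integrable_poisson_kernel: "0 < y \<Longrightarrow> integrable lborel (\<lambda>t. poisson_kernel y (t - x))"
  using nn_integral_poisson_kernel[of y x] poisson_kernel_nonneg[of y]
  by (intro integrableI_nonneg) auto

lemma integral_poisson_kernel: "0 < y \<Longrightarrow> (\<integral>t. poisson_kernel y (t - x) \<partial>lborel) = pi"
  using nn_integral_poisson_kernel[of y x] poisson_kernel_nonneg[of y]
  by (subst integral_eq_nn_integral) auto

text \<open>
  Let \<open>E\<close> be the set where \<open>h < \<alpha>\<close> although arbitrarily small balls have averages above \<open>\<beta>\<close>. By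
  Vitali's theorem disjoint such balls inside an open \<open>U\<close> cover almost all of \<open>E\<close>, so \<open>\<beta> \<bar>E\<bar>\<close> is at most
  the integral of \<open>h\<close> over \<open>U\<close>. Outer regularity shrinks \<open>U\<close> to \<open>E\<close>, where that integral is at most
  \<open>\<alpha> \<bar>E\<bar>\<close>; hence \<open>E\<close> is a null set.
\<close>

lemma AE_averages_le:
  fixes h :: "real \<Rightarrow> real"
  assumes h: "integrable lborel h" and h0: "\<And>x. 0 \<le> h x" and ab: "0 \<le> \<alpha>" "\<alpha> < \<beta>"
  shows "AE x in lborel. h x < \<alpha> \<longrightarrow>
    (\<exists>\<delta>>0. \<forall>r. 0 < r \<and> r < \<delta> \<longrightarrow> (\<integral>\<^sup>+t\<in>ball x r. ennreal (h t) \<partial>lborel) \<le> ennreal (\<beta> * (2 * r)))"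
proof -
  have [measurable]: "h \<in> borel_measurable borel" using h by auto
  define M where "M = density lborel (\<lambda>x. ennreal (h x))"
  have [simp]: "sets M = sets borel" "space M = UNIV" by (auto simp: M_def)
  have em: "emeasure M A = (\<integral>\<^sup>+t\<in>A. ennreal (h t) \<partial>lborel)" if "A \<in> sets borel" for A
    using that by (simp add: M_def emeasure_density)
  have fin: "emeasure M A < \<infinity>" if "A \<in> sets borel" for A
  proof -
    have "emeasure M A \<le> (\<integral>\<^sup>+t. ennreal (h t) \<partial>lborel)"
      unfolding em[OF that] by (intro nn_integral_mono) (auto simp: indicator_def)
    also have "\<dots> < \<infinity>" using h h0 by (simp add: nn_integral_eq_integral)
    finally show ?thesis .
  qed
  \<comment> \<open>Open balls make \<open>V r\<close> open, and this makes \<open>E\<close> measurable.\<close>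
  define V where "V r = {x. ennreal (\<beta> * (2 * r)) < emeasure M (ball x r)}" for r :: real
  have Vo: "open (V r)" for r
  proof (subst open_contains_ball, intro ballI)
    fix x assume x: "x \<in> V r"
    have "(\<lambda>n. emeasure M (ball x (r - 1 / Suc n))) \<longlonglongrightarrow> emeasure M (\<Union>n. ball x (r - 1 / Suc n))"
    proof (rule Lim_emeasure_incseq)
      show "incseq (\<lambda>n. ball x (r - 1 / real (Suc n)))"
        unfolding incseq_def by (auto simp: field_simps intro!: subset_ball)
    qed auto
    moreover have "(\<Union>n. ball x (r - 1 / Suc n)) = ball x r"
    proof safe
      fix z n assume "z \<in> ball x (r - 1 / real (Suc n))"
      moreover have "0 < 1 / real (Suc n)" by simp
      ultimately have "dist x z < r" unfolding mem_ball by linarith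
      then show "z \<in> ball x r" by simp
    next
      fix z assume "z \<in> ball x r"
      then obtain n where "inverse (real (Suc n)) < r - dist x z"
        using reals_Archimedean[of "r - dist x z"] by auto
      then show "z \<in> (\<Union>n. ball x (r - 1 / Suc n))" by (auto simp: inverse_eq_divide algebra_simps intro!: exI[of _ n])
    qed
    ultimately have "(\<lambda>n. emeasure M (ball x (r - 1 / Suc n))) \<longlonglongrightarrow> emeasure M (ball x r)" by simp
    moreover have "ennreal (\<beta> * (2 * r)) < emeasure M (ball x r)" using x by (simp add: V_def)
    ultimately have "eventually (\<lambda>n. ennreal (\<beta> * (2 * r)) < emeasure M (ball x (r - 1 / Suc n))) sequentially"
      by (rule order_tendstoD)
    then obtain n where n: "ennreal (\<beta> * (2 * r)) < emeasure M (ball x (r - 1 / Suc n))"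
      by (auto simp: eventually_sequentially)
    have "ball x (1 / Suc n) \<subseteq> V r"
    proof
      fix z assume z: "z \<in> ball x (1 / Suc n)"
      have "ball x (r - 1 / Suc n) \<subseteq> ball z r"
      proof
        fix w assume "w \<in> ball x (r - 1 / Suc n)"
        then show "w \<in> ball z r" using z dist_triangle[of z w x] unfolding mem_ball by (simp add: dist_commute)
      qed
      then have "emeasure M (ball x (r - 1 / Suc n)) \<le> emeasure M (ball z r)"
        by (intro emeasure_mono) auto
      with n show "z \<in> V r" by (simp add: V_def)
    qed
    then show "\<exists>e>0. ball x e \<subseteq> V r" by (intro exI[of _ "1 / Suc n"]) auto
  qed
  define E where "E = {x. h x < \<alpha>} \<inter> (\<Inter>n. \<Union>r\<in>{0<..<1 / real (Suc n)}. V r)"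
  have [measurable]: "E \<in> sets borel"
  proof -
    have "(\<Union>r\<in>{0<..<1 / real (Suc n)}. V r) \<in> sets borel" for n
      by (intro borel_open open_UN) (simp add: Vo)
    then have v: "(\<Inter>n. \<Union>r\<in>{0<..<1 / real (Suc n)}. V r) \<in> sets borel"
      by (intro sets.countable_INT'') simp_all
    show ?thesis unfolding E_def by (intro sets.Int v) measurable
  qed
  have open_bd: "ennreal \<beta> * emeasure lborel E \<le> emeasure M U" if U: "open U" "E \<subseteq> U" for U
  proof -
    \<comment> \<open>Vitali gets the pairs of a centre and a radius that stay inside \<open>U\<close>.\<close>
    define K where "K = {(x::real, r). 0 < r \<and> x \<in> V r \<and> cball x r \<subseteq> U}"
    obtain C where C: "countable C" "C \<subseteq> K"
      "pairwise (\<lambda>i j. disjnt (cball (fst i) (snd i)) (cball (fst j) (snd j))) C"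
      "negligible (E - (\<Union>i\<in>C. cball (fst i) (snd i)))"
    proof (rule Vitali_covering_theorem_cballs[of K snd E fst])
      show "0 < snd i" if "i \<in> K" for i using that by (auto simp: K_def)
      fix x d :: real assume x: "x \<in> E" and d: "0 < d"
      obtain e where e: "0 < e" "cball x e \<subseteq> U" using U x open_contains_cball by (metis subsetD)
      obtain n where n: "inverse (real (Suc n)) < min e d"
        using reals_Archimedean[of "min e d"] e d by auto
      have "\<exists>r\<in>{0<..<1 / real (Suc n)}. x \<in> V r"
        using x unfolding E_def by blast
      then obtain r where r: "0 < r" "r < 1 / real (Suc n)" "x \<in> V r"
        by (auto simp del: of_nat_Suc)
      have "r < min e d" using r n by (simp add: inverse_eq_divide)
      then have "(x, r) \<in> K" using r e subset_cball[of r e x] by (auto simp: K_def)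
      then show "\<exists>i. i \<in> K \<and> x \<in> cball (fst i) (snd i) \<and> snd i < d"
        using r \<open>r < min e d\<close> by (intro exI[of _ "(x, r)"]) auto
    qed
    have dis: "disjoint_family_on (\<lambda>i. cball (fst i) (snd i)) C"
      using C(3) by (auto simp: disjoint_family_on_def pairwise_def disjnt_def)
    have [measurable]: "(\<Union>i\<in>C. cball (fst i) (snd i)) \<in> sets borel"
      using C(1) by (intro sets.countable_UN') auto
    have "E - (\<Union>i\<in>C. cball (fst i) (snd i)) \<in> null_sets lborel"
      using C(4) by (simp add: negligible_iff_null_sets null_sets_completion_iff)
    then have "emeasure lborel E \<le> emeasure lborel (\<Union>i\<in>C. cball (fst i) (snd i))"
    proof -
      assume a: "E - (\<Union>i\<in>C. cball (fst i) (snd i)) \<in> null_sets lborel"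
      have "emeasure lborel E \<le> emeasure lborel ((\<Union>i\<in>C. cball (fst i) (snd i)) \<union> (E - (\<Union>i\<in>C. cball (fst i) (snd i))))"
        by (intro emeasure_mono) auto
      also have "\<dots> = emeasure lborel (\<Union>i\<in>C. cball (fst i) (snd i))"
        by (intro emeasure_Un_null_set a) auto
      finally show ?thesis .
    qed
    also have "\<dots> = (\<integral>\<^sup>+i. emeasure lborel (cball (fst i) (snd i)) \<partial>count_space C)"
      using C(1) dis by (intro emeasure_UN_countable) auto
    finally have "ennreal \<beta> * emeasure lborel E \<le> ennreal \<beta> * (\<integral>\<^sup>+i. emeasure lborel (cball (fst i) (snd i)) \<partial>count_space C)"
      by (intro mult_left_mono) auto
    also have "\<dots> = (\<integral>\<^sup>+i. ennreal \<beta> * emeasure lborel (cball (fst i) (snd i)) \<partial>count_space C)"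
      by (simp add: nn_integral_cmult)
    also have "\<dots> \<le> (\<integral>\<^sup>+i. emeasure M (cball (fst i) (snd i)) \<partial>count_space C)"
    proof (intro nn_integral_mono)
      fix i assume "i \<in> space (count_space C)"
      then have i: "0 < snd i" "fst i \<in> V (snd i)" using C(2) by (auto simp: K_def)
      have "emeasure lborel (cball (fst i) (snd i)) = ennreal (2 * snd i)"
        using i by (simp add: cball_eq_atLeastAtMost)
      then have "ennreal \<beta> * emeasure lborel (cball (fst i) (snd i)) = ennreal (\<beta> * (2 * snd i))"
        using ab i by (simp add: ennreal_mult)
      also have "\<dots> \<le> emeasure M (ball (fst i) (snd i))" using i by (simp add: V_def)
      also have "\<dots> \<le> emeasure M (cball (fst i) (snd i))" by (intro emeasure_mono) auto
      finally show "ennreal \<beta> * emeasure lborel (cball (fst i) (snd i)) \<le> emeasure M (cball (fst i) (snd i))" .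
    qed
    also have "\<dots> = emeasure M (\<Union>i\<in>C. cball (fst i) (snd i))"
      using C(1) dis by (intro emeasure_UN_countable[symmetric]) auto
    also have "\<dots> \<le> emeasure M U"
    proof (intro emeasure_mono UN_least)
      show "cball (fst i) (snd i) \<subseteq> U" if "i \<in> C" for i
        using subsetD[OF C(2) that] by (simp add: K_def case_prod_unfold)
    qed (use U in auto)
    finally show ?thesis .
  qed
  have "ennreal \<beta> * emeasure lborel E \<le> (INF U \<in> {U. E \<subseteq> U \<and> open U}. emeasure M U)"
    using open_bd by (intro INF_greatest) auto
  also have "\<dots> = emeasure M E"
    using fin[of UNIV] by (intro outer_regular[symmetric]) auto
  finally have 1: "ennreal \<beta> * emeasure lborel E \<le> emeasure M E" .
  have "emeasure M E \<le> (\<integral>\<^sup>+t. ennreal \<alpha> * indicator E t \<partial>lborel)"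
    unfolding em[OF \<open>E \<in> sets borel\<close>]
    by (intro nn_integral_mono) (auto simp: indicator_def E_def intro!: ennreal_leI)
  also have "\<dots> = ennreal \<alpha> * emeasure lborel E" by (simp add: nn_integral_cmult)
  finally have 2: "emeasure M E \<le> ennreal \<alpha> * emeasure lborel E" .
  have "emeasure lborel E \<noteq> \<infinity>"
  proof
    assume "emeasure lborel E = \<infinity>"
    then have "ennreal \<beta> * emeasure lborel E = \<infinity>" using ab by (simp add: ennreal_mult_top)
    with 1 fin[of E] show False by simp
  qed
  then obtain m where m: "emeasure lborel E = ennreal m" "0 \<le> m"
    by (cases "emeasure lborel E") auto
  have "ennreal (\<beta> * m) \<le> ennreal (\<alpha> * m)"
    using order_trans[OF 1 2] m ab by (simp add: ennreal_mult)
  then have "\<beta> * m \<le> \<alpha> * m" using m ab by simp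
  then have "m = 0" using m ab by (metis mult_right_mono order_antisym_conv mult_le_cancel_right not_less)
  then have null: "E \<in> null_sets lborel" using m by (auto simp: null_sets_def)
  show ?thesis
  proof (rule AE_I'[OF null], clarsimp)
    fix x assume x: "h x < \<alpha>"
      "\<forall>\<delta>>0. \<exists>r. 0 < r \<and> r < \<delta> \<and> \<not> (\<integral>\<^sup>+t\<in>ball x r. ennreal (h t) \<partial>lborel) \<le> ennreal (\<beta> * (2 * r))"
    show "x \<in> E" unfolding E_def
    proof (intro IntI INT_I, goal_cases)
      case 1 then show ?case using x by simp
    next
      case (2 n)
      have "0 < 1 / real (Suc n)" by simp
      then obtain r where "0 < r" "r < 1 / real (Suc n)" "\<not> (\<integral>\<^sup>+t\<in>ball x r. ennreal (h t) \<partial>lborel) \<le> ennreal (\<beta> * (2 * r))"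
        using x(2) by blast
      then show ?case by (auto simp: V_def em not_le)
    qed
  qed
qed

definition lebesgue_point :: "(real \<Rightarrow> complex) \<Rightarrow> real \<Rightarrow> bool" where
  "lebesgue_point f x \<longleftrightarrow> (\<forall>\<eta>>0. \<exists>\<delta>>0. \<forall>r. 0 < r \<and> r < \<delta> \<longrightarrow>
     (\<integral>\<^sup>+t\<in>ball x r. ennreal (cmod (f t - f x)) \<partial>lborel) \<le> ennreal (\<eta> * r))"

text \<open>
  Apply \<open>AE_averages_le\<close> to the functions \<open>\<bar>f - q\<bar>\<close> for the countably many \<open>q\<close> with rational
  coordinates; one of them is close to \<open>f x\<close>.
\<close>

theorem AE_lebesgue_point:
  fixes f :: "real \<Rightarrow> complex"
  assumes [measurable]: "f \<in> borel_measurable borel"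
    and int: "\<And>n::nat. integrable lborel (\<lambda>x. indicator {-real n..real n} x * f x)"
  shows "AE x in lborel. lebesgue_point f x"
proof -
  define D where "D = (\<lambda>(a, b). Complex a b) ` (\<rat> \<times> \<rat>)"
  have cD: "countable D" unfolding D_def by (intro countable_image countable_SIGMA countable_rat)
  define P where "P q \<alpha> n x \<longleftrightarrow> (indicator {-real n..real n} x * cmod (f x - q) < \<alpha> \<longrightarrow>
    (\<exists>\<delta>>0. \<forall>r. 0 < r \<and> r < \<delta> \<longrightarrow> (\<integral>\<^sup>+t\<in>ball x r. ennreal (indicator {-real n..real n} t * cmod (f t - q)) \<partial>lborel)
       \<le> ennreal ((2 * \<alpha>) * (2 * r))))" for q \<alpha> n x
  have "AE x in lborel. P q \<alpha> n x" if "0 < \<alpha>" for q \<alpha> n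
    unfolding P_def
  proof (rule AE_averages_le)
    have "integrable lborel (\<lambda>x. indicator {-real n..real n} x *\<^sub>R q)"
      by (intro integrable_scaleR_left integrable_real_indicator) (auto simp: emeasure_lborel_Icc)
    then have "integrable lborel (\<lambda>x. indicator {-real n..real n} x * q)"
      by (rule Bochner_Integration.integrable_cong[THEN iffD1, rotated -1]) (auto simp: indicator_def)
    then have "integrable lborel (\<lambda>x. indicator {-real n..real n} x * f x - indicator {-real n..real n} x * q)"
      by (intro Bochner_Integration.integrable_diff int)
    then have "integrable lborel (\<lambda>x. cmod (indicator {-real n..real n} x * f x - indicator {-real n..real n} x * q))"
      by (rule integrable_norm)
    then show "integrable lborel (\<lambda>x. indicator {-real n..real n} x * cmod (f x - q))"
      by (rule Bochner_Integration.integrable_cong[THEN iffD1, rotated -1]) (auto simp: indicator_def)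
  qed (use that in auto)
  then have "AE x in lborel. \<forall>q\<in>D. \<forall>\<alpha>\<in>\<rat> \<inter> {0<..}. \<forall>n. P q \<alpha> n x"
    by (intro AE_ball_countable[THEN iffD2] ballI cD AE_all_countable[THEN iffD2] allI countable_Int1 countable_rat) auto
  then show ?thesis
  proof (rule AE_mp, intro AE_I2 impI)
    fix x assume all: "\<forall>q\<in>D. \<forall>\<alpha>\<in>\<rat> \<inter> {0<..}. \<forall>n. P q \<alpha> n x"
    show "lebesgue_point f x" unfolding lebesgue_point_def
    proof (intro allI impI)
      fix \<eta> :: real assume "0 < \<eta>"
      then obtain \<alpha> where \<alpha>: "\<alpha> \<in> \<rat>" "0 < \<alpha>" "\<alpha> < \<eta> / 6" using Rats_dense_in_real[of 0 "\<eta>/6"] by auto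
      obtain a where a: "a \<in> \<rat>" "\<bar>Re (f x) - a\<bar> < \<alpha> / 2"
        using Rats_dense_in_real[of "Re (f x) - \<alpha>/2" "Re (f x) + \<alpha>/2"] \<alpha> by (auto simp: abs_if)
      obtain b where b: "b \<in> \<rat>" "\<bar>Im (f x) - b\<bar> < \<alpha> / 2"
        using Rats_dense_in_real[of "Im (f x) - \<alpha>/2" "Im (f x) + \<alpha>/2"] \<alpha> by (auto simp: abs_if)
      define q where "q = Complex a b"
      have qD: "q \<in> D" using a b by (auto simp: q_def D_def)
      have fq: "cmod (f x - q) < \<alpha>"
        using cmod_le[of "f x - q"] a b by (simp add: q_def)
      obtain n where n: "\<bar>x\<bar> + 1 < real n" using reals_Archimedean2 by blast
      have "P q \<alpha> n x" using all qD \<alpha> by auto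
      moreover have "indicator {-real n..real n} x * cmod (f x - q) < \<alpha>" using fq n \<alpha> by (auto simp: indicator_def)
      ultimately obtain \<delta> where \<delta>: "0 < \<delta>" "\<And>r. 0 < r \<Longrightarrow> r < \<delta> \<Longrightarrow>
         (\<integral>\<^sup>+t\<in>ball x r. ennreal (indicator {-real n..real n} t * cmod (f t - q)) \<partial>lborel) \<le> ennreal ((2 * \<alpha>) * (2 * r))"
        unfolding P_def by blast
      show "\<exists>\<delta>>0. \<forall>r. 0 < r \<and> r < \<delta> \<longrightarrow> (\<integral>\<^sup>+t\<in>ball x r. ennreal (cmod (f t - f x)) \<partial>lborel) \<le> ennreal (\<eta> * r)"
      proof (intro exI[of _ "min \<delta> 1"] conjI allI impI)
        fix r assume r: "0 < r \<and> r < min \<delta> 1"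
        have "(\<integral>\<^sup>+t\<in>ball x r. ennreal (cmod (f t - f x)) \<partial>lborel) \<le>
          (\<integral>\<^sup>+t. ennreal (indicator {-real n..real n} t * cmod (f t - q)) * indicator (ball x r) t
             + ennreal \<alpha> * indicator (ball x r) t \<partial>lborel)"
        proof (intro nn_integral_mono)
          fix t
          have "cmod (f t - f x) \<le> cmod (f t - q) + \<alpha>"
            using norm_triangle_ineq4[of "f t - q" "f x - q"] fq by simp
          moreover have "t \<in> ball x r \<Longrightarrow> t \<in> {-real n..real n}" using n r by (auto simp: dist_real_def)
          ultimately show "ennreal (cmod (f t - f x)) * indicator (ball x r) t
            \<le> ennreal (indicator {-real n..real n} t * cmod (f t - q)) * indicator (ball x r) t + ennreal \<alpha> * indicator (ball x r) t"
            using \<alpha> by (auto simp: indicator_def ennreal_plus[symmetric] simp del: ennreal_plus intro!: ennreal_leI)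
        qed
        also have "\<dots> = (\<integral>\<^sup>+t\<in>ball x r. ennreal (indicator {-real n..real n} t * cmod (f t - q)) \<partial>lborel)
            + ennreal \<alpha> * emeasure lborel (ball x r)"
        proof (subst nn_integral_add)
          have [measurable]: "ball x r \<in> sets borel" by simp
          show "(\<lambda>t. ennreal (indicator {-real n..real n} t * cmod (f t - q)) * indicator (ball x r) t) \<in> borel_measurable lborel"
            "(\<lambda>t. ennreal \<alpha> * indicator (ball x r) t) \<in> borel_measurable lborel"
            by measurable
        qed (simp add: nn_integral_cmult_indicator)
        also have "\<dots> \<le> ennreal ((2 * \<alpha>) * (2 * r)) + ennreal (\<alpha> * (2 * r))"
          using \<delta>(2)[of r] r \<alpha> by (intro add_mono) (auto simp: ball_eq_greaterThanLessThan ennreal_mult)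
        also have "\<dots> = ennreal (6 * \<alpha> * r)" using \<alpha> r by (subst ennreal_plus[symmetric]) (auto simp: algebra_simps)
        also have "\<dots> \<le> ennreal (\<eta> * r)" using \<alpha> r by (intro ennreal_leI mult_right_mono) auto
        finally show "(\<integral>\<^sup>+t\<in>ball x r. ennreal (cmod (f t - f x)) \<partial>lborel) \<le> ennreal (\<eta> * r)" .
      qed (use \<delta> in auto)
    qed
  qed
qed

text \<open>
  Outside the ball of radius \<open>2 ^ (j - 1) * y\<close> the kernel is at most \<open>4 * (1/4) ^ j / y\<close>, so multiples
  of indicators of balls dominate it. The radii are capped at \<open>d\<close>, since the integrals over balls are
  under control only for small radii; beyond \<open>d\<close> the factor \<open>y\<close> makes the kernel small.
\<close>

lemma poisson_kernel_layers:
  assumes y: "0 < y" and d: "0 < d"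
  shows "ennreal (poisson_kernel y (t - x)) \<le>
    (\<Sum>j. ennreal (4 * (1/4)^j / y) * indicator (ball x (min (2 * 2^j * y) d)) t)
      + ennreal (y * (1 + 1/d\<^sup>2) / (1 + (t - x)\<^sup>2))"
proof (cases "\<bar>t - x\<bar> < d")
  case False
  then have "d\<^sup>2 \<le> (t - x)\<^sup>2" using d by (metis abs_le_square_iff abs_of_pos not_less)
  then have "1 + (t-x)\<^sup>2 \<le> (1 + 1/d\<^sup>2) * (t-x)\<^sup>2" using d by (simp add: field_simps)
  moreover have "0 < (t-x)\<^sup>2" using d \<open>d\<^sup>2 \<le> (t - x)\<^sup>2\<close> by (meson less_le_trans zero_less_power)
  ultimately have "1 / (t-x)\<^sup>2 \<le> (1 + 1/d\<^sup>2) / (1 + (t - x)\<^sup>2)"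
    by (simp add: divide_simps add_pos_nonneg)
  then have "y * (1 / (t-x)\<^sup>2) \<le> y * ((1 + 1/d\<^sup>2) / (1 + (t - x)\<^sup>2))"
    using y by (intro mult_left_mono) auto
  moreover have "poisson_kernel y (t - x) \<le> y * (1 / (t-x)\<^sup>2)"
    using y \<open>0 < (t-x)\<^sup>2\<close> unfolding poisson_kernel_def by (simp add: frac_le)
  ultimately have "ennreal (poisson_kernel y (t - x)) \<le> ennreal (y * (1 + 1/d\<^sup>2) / (1 + (t - x)\<^sup>2))"
    by (intro ennreal_leI) auto
  then show ?thesis by (simp add: add_increasing)
next
  case True
  have "\<exists>j. \<bar>t - x\<bar> < 2 ^ j * y"
    using real_arch_pow[of 2 "\<bar>t-x\<bar>/y"] y by (auto simp: field_simps)
  then obtain j where j: "\<bar>t - x\<bar> < 2 ^ j * y" "\<And>i. i < j \<Longrightarrow> 2 ^ i * y \<le> \<bar>t - x\<bar>"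
    using exists_least_iff[of "\<lambda>j. \<bar>t - x\<bar> < 2 ^ j * y"] by (auto simp: not_less)
  have "poisson_kernel y (t - x) \<le> 4 * (1/4)^j / y"
  proof (cases j)
    case 0
    have "1 / y \<le> 4 / y" using y by (simp add: divide_right_mono)
    then show ?thesis using poisson_kernel_le[OF y, of "t-x"] 0 by simp
  next
    case (Suc i)
    have "(2 ^ i * y)\<^sup>2 \<le> (t - x)\<^sup>2" using j(2)[of i] Suc y by (metis abs_le_square_iff abs_of_nonneg lessI mult_nonneg_nonneg less_imp_le zero_le_numeral zero_le_power)
    then have "y / ((t-x)\<^sup>2 + y\<^sup>2) \<le> y / (2 ^ i * y)\<^sup>2"
      using y by (intro divide_left_mono) (auto intro!: mult_pos_pos add_nonneg_pos add_increasing2)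
    also have "\<dots> = 4 * (1/4)^j / y" using y Suc
      by (simp add: power2_eq_square field_simps power_mult_distrib[symmetric] power_one_over)
    finally show ?thesis by (simp add: poisson_kernel_def)
  qed
  moreover have "t \<in> ball x (min (2 * 2^j * y) d)" using True j y by (auto simp: dist_real_def)
  ultimately have "ennreal (poisson_kernel y (t - x)) \<le> ennreal (4 * (1/4)^j / y) * indicator (ball x (min (2 * 2^j * y) d)) t"
    by (simp add: ennreal_leI)
  also have "\<dots> \<le> (\<Sum>j. ennreal (4 * (1/4)^j / y) * indicator (ball x (min (2 * 2^j * y) d)) t)"
    using sum_le_suminf[OF summableI, of "{j}" "\<lambda>j. ennreal (4 * (1/4)^j / y) * indicator (ball x (min (2 * 2^j * y) d)) t"]
    by (simp del: mem_ball indicator_simps sum_mult_indicator)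
  finally show ?thesis by (simp add: add_increasing2)
qed

text \<open>
  Integrated against \<open>p\<close>, the layers of the kernel contribute a geometric series of multiples
  of \<open>\<eta>\<close>, and the tail is \<open>O(y)\<close>.
\<close>

theorem poisson_average_tendsto_0:
  fixes p :: "real \<Rightarrow> real"
  assumes [measurable]: "p \<in> borel_measurable borel" and p0: "\<And>t. 0 \<le> p t"
    and small: "\<And>\<eta>. 0 < \<eta> \<Longrightarrow> \<exists>\<delta>>0. \<forall>r. 0 < r \<and> r < \<delta> \<longrightarrow> (\<integral>\<^sup>+t\<in>ball x r. ennreal (p t) \<partial>lborel) \<le> ennreal (\<eta> * r)"
    and fin: "(\<integral>\<^sup>+t. ennreal (p t * (1 / (1 + (t - x)\<^sup>2))) \<partial>lborel) < \<infinity>"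
  shows "((\<lambda>y. \<integral>\<^sup>+t. ennreal (p t * poisson_kernel y (t - x)) \<partial>lborel) \<longlongrightarrow> 0) (at_right 0)"
proof -
  obtain J where J: "(\<integral>\<^sup>+t. ennreal (p t * (1 / (1 + (t - x)\<^sup>2))) \<partial>lborel) = ennreal J" "0 \<le> J"
    using fin unfolding infinity_ennreal_def less_top_ennreal by blast
  have main: "\<exists>y0>0. \<forall>y. 0 < y \<and> y < y0 \<longrightarrow> (\<integral>\<^sup>+t. ennreal (p t * poisson_kernel y (t - x)) \<partial>lborel) \<le> ennreal (17 * \<eta>)"
    if \<eta>: "0 < \<eta>" for \<eta> :: real
  proof -
    obtain \<delta> where \<delta>: "0 < \<delta>" "\<And>r. 0 < r \<Longrightarrow> r < \<delta> \<Longrightarrow> (\<integral>\<^sup>+t\<in>ball x r. ennreal (p t) \<partial>lborel) \<le> ennreal (\<eta> * r)"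
      using small[OF \<eta>] by blast
    \<comment> \<open>Radii up to \<open>d\<close> stay strictly below \<open>\<delta>\<close>; \<open>y0\<close> makes the tail at most \<open>\<eta>\<close>.\<close>
    define d where "d = \<delta> / 2"
    have d: "0 < d" "d < \<delta>" using \<delta> by (auto simp: d_def)
    define K where "K = 1 + 1/d\<^sup>2"
    have K: "0 < K" using d by (simp add: K_def add_pos_nonneg)
    define y0 where "y0 = \<eta> / (K * (J + 1))"
    have y0: "0 < y0" using \<eta> K J by (auto simp: y0_def intro!: divide_pos_pos mult_pos_pos)
    show ?thesis
    proof (intro exI[of _ y0] conjI allI impI y0)
      fix y assume yy: "0 < y \<and> y < y0"
      then have y: "0 < y" by simp
      have "(\<integral>\<^sup>+t. ennreal (p t * poisson_kernel y (t - x)) \<partial>lborel)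
        \<le> (\<integral>\<^sup>+t. (\<Sum>j. ennreal (4 * (1/4)^j / y) * (ennreal (p t) * indicator (ball x (min (2 * 2^j * y) d)) t))
             + ennreal (y * K) * ennreal (p t * (1 / (1 + (t - x)\<^sup>2))) \<partial>lborel)"
      proof (intro nn_integral_mono)
        fix t
        have "ennreal (p t * poisson_kernel y (t - x)) = ennreal (p t) * ennreal (poisson_kernel y (t - x))"
          using p0 poisson_kernel_nonneg[OF y] by (simp add: ennreal_mult)
        also have "\<dots> \<le> ennreal (p t) * ((\<Sum>j. ennreal (4 * (1/4)^j / y) * indicator (ball x (min (2 * 2^j * y) d)) t)
            + ennreal (y * (1 + 1/d\<^sup>2) / (1 + (t - x)\<^sup>2)))"
          by (intro mult_left_mono poisson_kernel_layers y d) simp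
        also have "\<dots> = (\<Sum>j. ennreal (4 * (1/4)^j / y) * (ennreal (p t) * indicator (ball x (min (2 * 2^j * y) d)) t))
             + ennreal (p t) * ennreal (y * K / (1 + (t - x)\<^sup>2))"
          unfolding K_def by (simp only: distrib_left ennreal_suminf_cmult[symmetric] mult.left_commute)
        also have "ennreal (p t) * ennreal (y * K / (1 + (t - x)\<^sup>2)) = ennreal (y * K) * ennreal (p t * (1 / (1 + (t - x)\<^sup>2)))"
          using p0 y K by (simp add: ennreal_mult'[symmetric] algebra_simps)
        finally show "ennreal (p t * poisson_kernel y (t - x)) \<le> (\<Sum>j. ennreal (4 * (1/4)^j / y) * (ennreal (p t) * indicator (ball x (min (2 * 2^j * y) d)) t))
             + ennreal (y * K) * ennreal (p t * (1 / (1 + (t - x)\<^sup>2)))" .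
      qed
      also have "\<dots> = (\<Sum>j. ennreal (4 * (1/4)^j / y) * (\<integral>\<^sup>+t\<in>ball x (min (2 * 2^j * y) d). ennreal (p t) \<partial>lborel)) + ennreal (y * K) * ennreal J"
      proof -
        have [measurable]: "ball x r \<in> sets borel" for r by simp
        have m: "(\<lambda>t. ennreal (4 * (1/4)^j / y) * (ennreal (p t) * indicator (ball x (min (2 * 2^j * y) d)) t)) \<in> borel_measurable lborel" for j
          by measurable
        have m': "(\<lambda>t. ennreal (p t) * indicator (ball x (min (2 * 2^j * y) d)) t) \<in> borel_measurable lborel" for j
          by measurable
        have m2: "(\<lambda>t. ennreal (p t * (1 / (1 + (t - x)\<^sup>2)))) \<in> borel_measurable lborel" by measurable
        show ?thesis
          by (subst nn_integral_add)
            (use m m2 in \<open>measurable, simp only: nn_integral_suminf[OF m] nn_integral_cmult[OF m'] nn_integral_cmult[OF m2] J\<close>)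
      qed
      also have "\<dots> \<le> (\<Sum>j. ennreal (8 * \<eta> * (1/2)^j)) + ennreal \<eta>"
      proof (intro add_mono suminf_le summableI)
        fix j
        have "(\<integral>\<^sup>+t\<in>ball x (min (2 * 2^j * y) d). ennreal (p t) \<partial>lborel) \<le> ennreal (\<eta> * (min (2 * 2^j * y) d))"
          using y d by (intro \<delta>) auto
        also have "\<dots> \<le> ennreal (\<eta> * (2 * 2^j * y))" using \<eta> by (intro ennreal_leI mult_left_mono) auto
        finally have "ennreal (4 * (1/4)^j / y) * (\<integral>\<^sup>+t\<in>ball x (min (2 * 2^j * y) d). ennreal (p t) \<partial>lborel)
          \<le> ennreal (4 * (1/4)^j / y) * ennreal (\<eta> * (2 * 2^j * y))" by (intro mult_left_mono) auto
        also have "\<dots> = ennreal (4 * (1/4)^j / y * (\<eta> * (2 * 2^j * y)))" using y \<eta> by (simp add: ennreal_mult'[symmetric])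
        also have "4 * (1/4)^j / y * (\<eta> * (2 * 2^j * y)) = 8 * \<eta> * ((1/4)^j * 2^j)" using y by simp
        also have "(1/4)^j * 2^j = (1/2::real)^j" by (simp flip: power_mult_distrib)
        finally show "ennreal (4 * (1/4)^j / y) * (\<integral>\<^sup>+t\<in>ball x (min (2 * 2^j * y) d). ennreal (p t) \<partial>lborel) \<le> ennreal (8 * \<eta> * (1/2)^j)" .
      next
        have "y * K * J \<le> y0 * K * (J+1)" using yy K J by (intro mult_mono) auto
        also have "\<dots> = \<eta>" using K J by (simp add: y0_def)
        finally show "ennreal (y * K) * ennreal J \<le> ennreal \<eta>" using y K J by (simp add: ennreal_mult'[symmetric] ennreal_leI)
      qed
      also have "(\<Sum>j. ennreal (8 * \<eta> * (1/2)^j)) = ennreal (\<Sum>j. 8 * \<eta> * (1/2)^j)"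
        using \<eta> by (intro suminf_ennreal2) (auto intro!: summable_mult)
      also have "(\<Sum>j. 8 * \<eta> * (1/2::real)^j) = 16 * \<eta>"
        by (subst suminf_mult) (auto simp: suminf_geometric)
      also have "ennreal (16 * \<eta>) + ennreal \<eta> = ennreal (17 * \<eta>)" using \<eta> by (simp flip: ennreal_plus)
      finally show "(\<integral>\<^sup>+t. ennreal (p t * poisson_kernel y (t - x)) \<partial>lborel) \<le> ennreal (17 * \<eta>)" .
    qed
  qed
  show ?thesis
  proof (rule order_tendstoI)
    fix a :: ennreal assume a: "0 < a"
    obtain \<eta> :: real where \<eta>: "0 < \<eta>" "ennreal (17 * \<eta>) < a"
    proof -
      obtain b where b: "0 < b" "b < a" using dense[OF a] by blast
      then have "b < top" by (meson less_le_trans top_greatest)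
      then obtain c where c: "b = ennreal c" "0 \<le> c" unfolding less_top_ennreal by blast
      then have "b = ennreal c" "0 < c" using b by (auto simp: less_le)
      with b that[of "c/17"] show thesis by simp
    qed
    obtain y0 where "0 < y0" "\<And>y. 0 < y \<Longrightarrow> y < y0 \<Longrightarrow> (\<integral>\<^sup>+t. ennreal (p t * poisson_kernel y (t - x)) \<partial>lborel) \<le> ennreal (17 * \<eta>)"
      using main[OF \<eta>(1)] by blast
    then show "\<forall>\<^sub>F y in at_right 0. (\<integral>\<^sup>+t. ennreal (p t * poisson_kernel y (t - x)) \<partial>lborel) < a"
      unfolding eventually_at_right_field using \<eta>(2) by (intro exI[of _ y0]) (auto intro: le_less_trans)
  qed auto
qed

section \<open>The Herglotz transform of a positive density\<close>

text \<open>
  Closing the segment from \<open>-n\<close> to \<open>n\<close> by a half circle in the upper half-plane costs only \<open>O(1/n)\<close>.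
\<close>

lemma integral_real_line_holomorphic_eq_0:
  fixes h :: "complex \<Rightarrow> complex"
  assumes d: "0 < d" and hol: "h holomorphic_on {z. - d < Im z}"
    and C: "0 \<le> C" and R0: "0 < R0"
    and decay: "\<And>z. 0 \<le> Im z \<Longrightarrow> R0 \<le> cmod z \<Longrightarrow> cmod (h z) \<le> C / (cmod z)\<^sup>2"
  shows "integrable lborel (\<lambda>x. h (complex_of_real x))" "(\<integral>x. h (complex_of_real x) \<partial>lborel) = 0"
proof -
  have cont: "continuous_on UNIV (\<lambda>x. h (complex_of_real x))"
    using d by (intro continuous_on_compose2[OF holomorphic_on_imp_continuous_on[OF hol]] continuous_intros) auto
  then have [measurable]: "(\<lambda>x. h (complex_of_real x)) \<in> borel_measurable borel"
    by (rule borel_measurable_continuous_onI)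
  obtain M where M: "\<And>x. x \<in> {-R0..R0} \<Longrightarrow> cmod (h (complex_of_real x)) \<le> M"
  proof -
    have "compact ((\<lambda>x. h (complex_of_real x)) ` {-R0..R0})"
      by (intro compact_continuous_image continuous_on_subset[OF cont]) auto
    then have "bounded ((\<lambda>x. h (complex_of_real x)) ` {-R0..R0})" by (rule compact_imp_bounded)
    then obtain a where "\<forall>x\<in>{-R0..R0}. cmod (h (complex_of_real x)) \<le> a" by (auto simp: bounded_iff)
    then show thesis using that by blast
  qed
  define K where "K = \<bar>M\<bar> * (1 + R0\<^sup>2) + C * (1 + 1 / R0\<^sup>2)"
  have bound: "norm (h (complex_of_real x)) \<le> K * inverse (1 + x\<^sup>2)" for x
  proof (cases "\<bar>x\<bar> \<le> R0")
    case True
    then have "x\<^sup>2 \<le> R0\<^sup>2" using R0 by (simp flip: abs_le_square_iff)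
    have "cmod (h (complex_of_real x)) \<le> \<bar>M\<bar>" using M[of x] True by (auto simp: abs_le_iff)
    also have "\<dots> \<le> \<bar>M\<bar> * ((1 + R0\<^sup>2) * inverse (1 + x\<^sup>2))"
    proof -
      have "1 \<le> (1 + R0\<^sup>2) / (1 + x\<^sup>2)" using \<open>x\<^sup>2 \<le> R0\<^sup>2\<close> by (simp add: le_divide_eq add_pos_nonneg)
      then have "\<bar>M\<bar> * 1 \<le> \<bar>M\<bar> * ((1 + R0\<^sup>2) / (1 + x\<^sup>2))" by (intro mult_left_mono) auto
      then show ?thesis by (simp add: divide_inverse)
    qed
    also have "\<dots> \<le> K * inverse (1 + x\<^sup>2)" using C unfolding K_def by (simp add: algebra_simps)
    finally show ?thesis .
  next
    case False
    then have x: "R0\<^sup>2 \<le> x\<^sup>2" using R0 by (simp flip: abs_le_square_iff)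
    then have "0 < x\<^sup>2" using R0 by (meson less_le_trans zero_less_power)
    have "1 + x\<^sup>2 \<le> (1 + 1/R0\<^sup>2) * x\<^sup>2" using x R0 by (simp add: field_simps)
    then have "1 / x\<^sup>2 \<le> (1 + 1/R0\<^sup>2) * inverse (1 + x\<^sup>2)"
      using \<open>0 < x\<^sup>2\<close> by (simp add: divide_simps add_pos_nonneg)
    then have "C * (1 / x\<^sup>2) \<le> C * ((1 + 1/R0\<^sup>2) * inverse (1 + x\<^sup>2))" using C by (intro mult_left_mono)
    moreover have "cmod (h (complex_of_real x)) \<le> C * (1 / x\<^sup>2)"
      using decay[of "complex_of_real x"] False by simp
    moreover have "C * ((1 + 1/R0\<^sup>2) * inverse (1 + x\<^sup>2)) \<le> K * inverse (1 + x\<^sup>2)"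
      unfolding K_def by (simp add: algebra_simps)
    ultimately show ?thesis by linarith
  qed
  have iK: "integrable lborel (\<lambda>x. K * inverse (1 + x\<^sup>2))"
    using integrable_inverse_1_plus_square by (simp add: set_integrable_def)
  show int: "integrable lborel (\<lambda>x. h (complex_of_real x))"
    by (rule Bochner_Integration.integrable_bound[OF iK]) (auto intro!: order_trans[OF bound])
  define J where "J n = (\<integral>x. indicator {-real n..real n} x *\<^sub>R h (complex_of_real x) \<partial>lborel)" for n
  have 1: "J \<longlonglongrightarrow> (\<integral>x. h (complex_of_real x) \<partial>lborel)"
    unfolding J_def
  proof (rule integral_dominated_convergence[where w="\<lambda>x. norm (h (complex_of_real x))"])
    show "AE x in lborel. (\<lambda>n. indicator {-real n..real n} x *\<^sub>R h (complex_of_real x)) \<longlonglongrightarrow> h (complex_of_real x)"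
    proof (intro AE_I2 tendsto_eventually)
      fix x
      obtain N where "\<bar>x\<bar> < real N" using reals_Archimedean2 by blast
      then show "\<forall>\<^sub>F n in sequentially. indicator {-real n..real n} x *\<^sub>R h (complex_of_real x) = h (complex_of_real x)"
        unfolding eventually_sequentially by (intro exI[of _ N]) (auto simp: indicator_def)
    qed
  qed (use int in \<open>auto simp: indicator_def\<close>)
  have Jb: "cmod (J n) \<le> C * pi / real n" if n: "R0 \<le> real n" "0 < n" for n
  proof -
    define g where "g = linepath (- complex_of_real n) (complex_of_real n) +++ part_circlepath 0 (real n) 0 pi"
    have ends: "pathfinish (linepath (- complex_of_real n) (complex_of_real n)) = pathstart (part_circlepath 0 (real n) 0 pi)"
      "pathfinish (part_circlepath 0 (real n) 0 pi) = pathstart (linepath (- complex_of_real n) (complex_of_real n))"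
      by (auto simp: mult.commute)
    have arc: "0 \<le> Im z \<and> cmod z = real n" if z: "z \<in> path_image (part_circlepath 0 (real n) 0 pi)" for z
    proof -
      obtain t where t: "0 \<le> t" "t \<le> pi" "z = real n * exp (\<i> * of_real t)"
        using z unfolding path_image_part_circlepath[OF pi_ge_zero] by auto
      have "z = real n * cis t" using t by (simp add: cis_conv_exp)
      then show ?thesis using t(1,2) by (simp add: norm_mult sin_ge_zero)
    qed
    have line: "path_image (linepath (- complex_of_real n) (complex_of_real n)) \<subseteq> {z. - d < Im z}"
      using d by (auto simp: path_image_linepath closed_segment_def)
    have cv: "convex {z. - d < Im z}" by (rule convex_halfspace_Im_gt)
    have "(h has_contour_integral 0) g"
    proof (rule Cauchy_theorem_convex_simple[OF hol cv])
      show "valid_path g" unfolding g_def using ends by (intro valid_path_join) auto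
      show "path_image g \<subseteq> {z. - d < Im z}"
        unfolding g_def using line arc d by (intro subset_path_image_join) force+
      show "pathfinish g = pathstart g" unfolding g_def using ends by simp
    qed
    moreover have i1: "h contour_integrable_on linepath (- complex_of_real n) (complex_of_real n)"
      using line by (intro contour_integrable_continuous_linepath holomorphic_on_imp_continuous_on holomorphic_on_subset[OF hol]) auto
    moreover have i2: "h contour_integrable_on part_circlepath 0 (real n) 0 pi"
      using arc d by (intro contour_integrable_continuous_part_circlepath holomorphic_on_imp_continuous_on holomorphic_on_subset[OF hol]) force
    ultimately have "contour_integral (linepath (- complex_of_real n) (complex_of_real n)) h
        + contour_integral (part_circlepath 0 (real n) 0 pi) h = 0"
      unfolding g_def using ends by (metis contour_integral_join contour_integral_unique valid_path_linepath valid_path_part_circlepath)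
    moreover have "cmod (contour_integral (part_circlepath 0 (real n) 0 pi) h) \<le> C / (real n)\<^sup>2 * real n * (pi - 0)"
    proof (intro has_contour_integral_bound_part_circlepath[OF has_contour_integral_integral[OF i2]])
      show "cmod (h z) \<le> C / (real n)\<^sup>2" if "z \<in> path_image (part_circlepath 0 (real n) 0 pi)" for z
        using decay[of z] arc[OF that] n by simp
    qed (use C n in auto)
    moreover have "contour_integral (linepath (- complex_of_real n) (complex_of_real n)) h = J n"
    proof -
      have "contour_integral (linepath (- complex_of_real n) (complex_of_real n)) h
        = integral {Re (- complex_of_real n)..Re (complex_of_real n)} (\<lambda>x. h (complex_of_real x))"
        using n by (intro contour_integral_linepath_Reals_eq) auto
      also have "\<dots> = (LINT x:{-real n..real n}|lborel. h (complex_of_real x))"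
        by (subst set_borel_integral_eq_integral) (auto simp: set_integrable_def intro!: integrable_mult_indicator int)
      finally show ?thesis by (simp add: J_def set_lebesgue_integral_def)
    qed
    ultimately have "J n = - contour_integral (part_circlepath 0 (real n) 0 pi) h"
      "cmod (contour_integral (part_circlepath 0 (real n) 0 pi) h) \<le> C * pi / real n"
      using n by (simp_all add: power2_eq_square add_eq_0_iff2)
    then show ?thesis by simp
  qed
  have "J \<longlonglongrightarrow> 0"
  proof (rule Lim_null_comparison)
    obtain N where N: "R0 < real N" using reals_Archimedean2 by blast
    show "\<forall>\<^sub>F n in sequentially. norm (J n) \<le> C * pi / real n"
      unfolding eventually_sequentially
    proof (intro exI[of _ N] allI impI)
      fix n assume "N \<le> n" then have "R0 \<le> real n" "0 < n" using N R0 by (auto intro: Suc_leI)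
      then show "norm (J n) \<le> C * pi / real n" by (rule Jb)
    qed
    show "(\<lambda>n. C * pi / real n) \<longlonglongrightarrow> 0" by (rule lim_const_over_n)
  qed
  with 1 show "(\<integral>x. h (complex_of_real x) \<partial>lborel) = 0" by (rule LIMSEQ_unique)
qed

text \<open>
  The kernel \<open>\<i> / (z - t)\<close> is normalised so that a positive density produces values in the right
  half-plane.
\<close>

definition herglotz :: "(real \<Rightarrow> real) \<Rightarrow> complex \<Rightarrow> complex" where
  "herglotz f z = (\<integral>t. complex_of_real (f t) * (\<i> / (z - complex_of_real t)) \<partial>lborel)"

locale positive_density =
  fixes f :: "real \<Rightarrow> real"
  assumes integrable: "integrable lborel f"
    and nonneg: "\<And>t. 0 \<le> f t"
    and support: "\<And>t. 1 \<le> \<bar>t\<bar> \<Longrightarrow> f t = 0"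
begin

definition mass :: real where "mass = (\<integral>t. f t \<partial>lborel)"

lemma measurable_f [measurable]: "f \<in> borel_measurable borel"
  using integrable by auto

lemma mass_nonneg: "0 \<le> mass" unfolding mass_def by (rule Bochner_Integration.integral_nonneg) (rule nonneg)

lemma nn_integral_f: "(\<integral>\<^sup>+t. ennreal (f t) \<partial>lborel) = ennreal mass"
  unfolding mass_def by (rule nn_integral_eq_integral) (auto intro: integrable nonneg)

lemma bounded_multiple_integrable:
  fixes g :: "real \<Rightarrow> complex"
  assumes [measurable]: "g \<in> borel_measurable borel" and "\<And>t. f t \<noteq> 0 \<Longrightarrow> cmod (g t) \<le> B"
  shows "integrable lborel (\<lambda>t. complex_of_real (f t) * g t)"
    "cmod (\<integral>t. complex_of_real (f t) * g t \<partial>lborel) \<le> B * mass"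
proof -
  have b: "norm (complex_of_real (f t) * g t) \<le> B * f t" for t
    using assms(2)[of t] nonneg[of t] by (cases "f t = 0") (auto simp: norm_mult mult.commute intro: mult_left_mono)
  have i: "integrable lborel (\<lambda>t. B * f t)" using integrable by simp
  show "integrable lborel (\<lambda>t. complex_of_real (f t) * g t)"
    by (rule Bochner_Integration.integrable_bound[OF i]) (auto intro!: order_trans[OF b])
  show "cmod (\<integral>t. complex_of_real (f t) * g t \<partial>lborel) \<le> B * mass"
    using Bochner_Integration.integral_norm_bound_integral[OF \<open>integrable lborel (\<lambda>t. complex_of_real (f t) * g t)\<close> i b]
    by (simp add: mass_def)
qed

lemma cmod_sub_real_ge: "0 < Im z \<Longrightarrow> Im z \<le> cmod (z - complex_of_real t)"
  using abs_Im_le_cmod[of "z - complex_of_real t"] by simp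

lemma kernel_bound: "0 < Im z \<Longrightarrow> cmod (\<i> / (z - complex_of_real t)) \<le> 1 / Im z"
  using cmod_sub_real_ge[of z t] by (simp add: norm_divide frac_le)

lemma herglotz_integrable: "0 < Im z \<Longrightarrow> integrable lborel (\<lambda>t. complex_of_real (f t) * (\<i> / (z - complex_of_real t)))"
  by (rule bounded_multiple_integrable[where B="1 / Im z"]) (auto intro: kernel_bound)

lemma herglotz_le: "0 < Im z \<Longrightarrow> cmod (herglotz f z) \<le> mass / Im z"
  unfolding herglotz_def using bounded_multiple_integrable(2)[of "\<lambda>t. \<i> / (z - complex_of_real t)" "1 / Im z"] kernel_bound
  by auto

text \<open>
  Here the compact support of the density enters: this decay makes the square of the transform
  integrable along horizontal lines.
\<close>

lemma herglotz_decay: assumes "0 < Im z" "2 \<le> cmod z" shows "cmod (herglotz f z) \<le> 2 * mass / cmod z"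
proof -
  have "cmod (\<i> / (z - complex_of_real t)) \<le> 2 / cmod z" if "f t \<noteq> 0" for t
  proof -
    have "\<bar>t\<bar> < 1" using support[of t] that by force
    then have "cmod z / 2 \<le> cmod (z - complex_of_real t)"
      using norm_triangle_ineq2[of z "complex_of_real t"] assms by simp
    then have "1 / cmod (z - complex_of_real t) \<le> 1 / (cmod z / 2)" using assms by (intro divide_left_mono mult_pos_pos) auto
    then show ?thesis by (simp add: norm_divide)
  qed
  then show ?thesis
    unfolding herglotz_def using bounded_multiple_integrable(2)[of "\<lambda>t. \<i> / (z - complex_of_real t)" "2 / cmod z"]
    by auto
qed

lemma herglotz_Re: "0 < Im z \<Longrightarrow> Re (herglotz f z) = (\<integral>t. f t * poisson_kernel (Im z) (t - Re z) \<partial>lborel)"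
  unfolding herglotz_def
  by (subst integral_Re[symmetric, OF herglotz_integrable])
     (auto intro!: Bochner_Integration.integral_cong simp: Re_divide poisson_kernel_def power2_commute cmod_def)

lemma herglotz_Im: "0 < Im z \<Longrightarrow> Im (herglotz f z) = (\<integral>t. f t * ((Re z - t) / ((Re z - t)\<^sup>2 + (Im z)\<^sup>2)) \<partial>lborel)"
  unfolding herglotz_def
  by (subst integral_Im[symmetric, OF herglotz_integrable])
     (auto intro!: Bochner_Integration.integral_cong simp: Im_divide)

lemma herglotz_Re_nonneg: "0 < Im z \<Longrightarrow> 0 \<le> Re (herglotz f z)"
  unfolding herglotz_Re by (intro Bochner_Integration.integral_nonneg mult_nonneg_nonneg nonneg poisson_kernel_nonneg)

lemma herglotz_has_field_derivative:
  assumes z: "0 < Im z"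
  shows "(herglotz f has_field_derivative (\<integral>t. complex_of_real (f t) * (- \<i> / (z - complex_of_real t)\<^sup>2) \<partial>lborel)) (at z)"
proof -
  define D where "D = (\<integral>t. complex_of_real (f t) * (- \<i> / (z - complex_of_real t)\<^sup>2) \<partial>lborel)"
  define y where "y = Im z"
  have y: "0 < y" using z by (simp add: y_def)
  have bd: "cmod ((herglotz f w - herglotz f z) / (w - z) - D) \<le> cmod (w - z) * (2 / y^3) * mass"
    if w: "w \<noteq> z" "dist w z < y / 2" for w
  proof -
    have "\<bar>Im (w - z)\<bar> \<le> cmod (w - z)" by (rule abs_Im_le_cmod)
    then have Iw: "y / 2 < Im w" using w(2) unfolding y_def dist_norm by (simp add: abs_le_iff)
    then have Iw0: "0 < Im w" using y by simp
    have nz: "z - complex_of_real t \<noteq> 0" "w - complex_of_real t \<noteq> 0" for t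
      using z Iw0 by (auto simp: complex_eq_iff)
    have D1: "integrable lborel (\<lambda>t. complex_of_real (f t) * (- \<i> / (z - complex_of_real t)\<^sup>2))"
    proof (rule bounded_multiple_integrable)
      show "cmod (- \<i> / (z - complex_of_real t)\<^sup>2) \<le> 1 / y\<^sup>2" for t
        using cmod_sub_real_ge[OF z, of t] y by (simp add: norm_divide norm_power y_def frac_le power_mono)
    qed simp
    have eq: "(herglotz f w - herglotz f z) / (w - z) - D
      = (\<integral>t. complex_of_real (f t) * (\<i> * (w - z) / ((z - complex_of_real t)\<^sup>2 * (w - complex_of_real t))) \<partial>lborel)"
    proof -
      have "(herglotz f w - herglotz f z) / (w - z) - D
        = (\<integral>t. (complex_of_real (f t) * (\<i> / (w - complex_of_real t)) - complex_of_real (f t) * (\<i> / (z - complex_of_real t))) / (w - z)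
              - complex_of_real (f t) * (- \<i> / (z - complex_of_real t)\<^sup>2) \<partial>lborel)"
        unfolding herglotz_def D_def
        using herglotz_integrable[OF Iw0] herglotz_integrable[OF z] D1 by simp
      also have "\<dots> = (\<integral>t. complex_of_real (f t) * (\<i> * (w - z) / ((z - complex_of_real t)\<^sup>2 * (w - complex_of_real t))) \<partial>lborel)"
      proof (intro Bochner_Integration.integral_cong refl)
        fix t
        define a where "a = z - complex_of_real t"
        define b where "b = w - complex_of_real t"
        have ab: "a \<noteq> 0" "b \<noteq> 0" "w - z = b - a" "b - a \<noteq> 0" using nz w(1) by (auto simp: a_def b_def)
        have "(1 / b - 1 / a) / (b - a) = - 1 / (a * b)" using ab by (simp add: field_simps)
        then have "\<i> * ((1 / b - 1 / a) / (b - a)) + \<i> / a\<^sup>2 = \<i> * (b - a) / (a\<^sup>2 * b)"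
          using ab by (simp add: field_simps power2_eq_square)
        then have "complex_of_real (f t) * (\<i> * ((1 / b - 1 / a) / (b - a)) + \<i> / a\<^sup>2) = complex_of_real (f t) * (\<i> * (b - a) / (a\<^sup>2 * b))"
          by simp
        then show "(complex_of_real (f t) * (\<i> / (w - complex_of_real t)) - complex_of_real (f t) * (\<i> / (z - complex_of_real t))) / (w - z)
              - complex_of_real (f t) * (- \<i> / (z - complex_of_real t)\<^sup>2)
            = complex_of_real (f t) * (\<i> * (w - z) / ((z - complex_of_real t)\<^sup>2 * (w - complex_of_real t)))"
          unfolding ab(3) a_def[symmetric] b_def[symmetric]
          by (simp add: algebra_simps diff_divide_distrib)
      qed
      finally show ?thesis .
    qed
    show ?thesis unfolding eq
    proof (rule bounded_multiple_integrable(2))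
      fix t
      have "y\<^sup>2 * (y / 2) \<le> (cmod (z - complex_of_real t))\<^sup>2 * cmod (w - complex_of_real t)"
        using cmod_sub_real_ge[OF z, of t] cmod_sub_real_ge[OF Iw0, of t] Iw y unfolding y_def
        by (intro mult_mono power_mono) auto
      then have "1 / ((cmod (z - complex_of_real t))\<^sup>2 * cmod (w - complex_of_real t)) \<le> 1 / (y\<^sup>2 * (y / 2))"
        using y nz by (intro divide_left_mono mult_pos_pos) auto
      also have "1 / (y\<^sup>2 * (y / 2)) = 2 / y ^ 3" using y by (simp add: power2_eq_square power3_eq_cube)
      finally have "cmod (w - z) * (1 / ((cmod (z - complex_of_real t))\<^sup>2 * cmod (w - complex_of_real t))) \<le> cmod (w - z) * (2 / y ^ 3)"
        by (intro mult_left_mono) auto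
      then show "cmod (\<i> * (w - z) / ((z - complex_of_real t)\<^sup>2 * (w - complex_of_real t))) \<le> cmod (w - z) * (2 / y ^ 3)"
        by (simp add: norm_mult norm_divide norm_power)
    qed simp
  qed
  have "((\<lambda>w. (herglotz f w - herglotz f z) / (w - z) - D) \<longlongrightarrow> 0) (at z)"
  proof (rule Lim_null_comparison)
    show "\<forall>\<^sub>F w in at z. norm ((herglotz f w - herglotz f z) / (w - z) - D) \<le> cmod (w - z) * (2 / y^3) * mass"
      unfolding eventually_at using bd y by (intro exI[of _ "y/2"]) auto
    show "((\<lambda>w. cmod (w - z) * (2 / y ^ 3) * mass) \<longlongrightarrow> 0) (at z)"
      by (rule tendsto_eq_rhs, (rule tendsto_intros)+) simp
  qed
  then show ?thesis unfolding has_field_derivative_iff D_def[symmetric] using LIM_zero_iff by blast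
qed

lemma herglotz_holomorphic: "herglotz f holomorphic_on {z. 0 < Im z}"
  using herglotz_has_field_derivative by (auto simp: holomorphic_on_def field_differentiable_def intro: has_field_derivative_at_within)

lemma herglotz_measurable [measurable]: "0 < y \<Longrightarrow> (\<lambda>x. herglotz f (Complex x y)) \<in> borel_measurable borel"
proof (rule borel_measurable_continuous_onI)
  assume y: "0 < y"
  have e: "(\<lambda>x. Complex x y) = (\<lambda>x. complex_of_real x + \<i> * of_real y)" by (auto simp: complex_eq_iff)
  show "continuous_on UNIV (\<lambda>x. herglotz f (Complex x y))"
    by (rule continuous_on_compose2[OF holomorphic_on_imp_continuous_on[OF herglotz_holomorphic], of _ "\<lambda>x. Complex x y"])
       (use y in \<open>auto simp: e intro!: continuous_intros\<close>)
qed

lemma nn_integral_herglotz_Re: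
  assumes y: "0 < y" shows "(\<integral>\<^sup>+x. ennreal (Re (herglotz f (Complex x y))) \<partial>lborel) = ennreal (pi * mass)"
proof -
  have i: "integrable lborel (\<lambda>t. f t * poisson_kernel y (t - x))" for x
  proof (rule Bochner_Integration.integrable_bound[of _ "\<lambda>t. f t * (1 / y)"])
    show "AE t in lborel. norm (f t * poisson_kernel y (t - x)) \<le> norm (f t * (1 / y))"
      using y nonneg poisson_kernel_nonneg[OF y] mult_left_mono[OF poisson_kernel_le[OF y] nonneg]
      by (intro AE_I2) (simp add: abs_mult del: times_divide_eq_right)
  qed (use integrable in auto)
  have "(\<integral>\<^sup>+x. ennreal (Re (herglotz f (Complex x y))) \<partial>lborel)
     = (\<integral>\<^sup>+x. (\<integral>\<^sup>+t. ennreal (f t * poisson_kernel y (t - x)) \<partial>lborel) \<partial>lborel)"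
  proof (intro nn_integral_cong)
    fix x
    show "ennreal (Re (herglotz f (Complex x y))) = (\<integral>\<^sup>+t. ennreal (f t * poisson_kernel y (t - x)) \<partial>lborel)"
      using y i[of x] nonneg poisson_kernel_nonneg[OF y]
      by (subst nn_integral_eq_integral) (simp_all add: herglotz_Re)
  qed
  also have "\<dots> = (\<integral>\<^sup>+t. (\<integral>\<^sup>+x. ennreal (f t * poisson_kernel y (t - x)) \<partial>lborel) \<partial>lborel)"
    by (rule lborel_pair.Fubini') measurable
  also have "\<dots> = (\<integral>\<^sup>+t. ennreal (f t) * ennreal pi \<partial>lborel)"
  proof (intro nn_integral_cong)
    fix t
    have "(\<integral>\<^sup>+x. ennreal (f t * poisson_kernel y (t - x)) \<partial>lborel) = (\<integral>\<^sup>+x. ennreal (f t) * ennreal (poisson_kernel y (x - t)) \<partial>lborel)"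
      by (intro nn_integral_cong) (simp add: ennreal_mult nonneg poisson_kernel_nonneg[OF y] poisson_kernel_commute[of y _ t])
    then show "(\<integral>\<^sup>+x. ennreal (f t * poisson_kernel y (t - x)) \<partial>lborel) = ennreal (f t) * ennreal pi"
      using y by (simp add: nn_integral_cmult nn_integral_poisson_kernel)
  qed
  also have "\<dots> = ennreal (pi * mass)"
    using mass_nonneg by (subst nn_integral_multc) (auto simp: nn_integral_f ennreal_mult mult.commute)
  finally show ?thesis .
qed

lemma integrable_herglotz_Re: "0 < y \<Longrightarrow> integrable lborel (\<lambda>x. Re (herglotz f (Complex x y)))"
  using herglotz_measurable[of y]
  by (intro integrableI_nonneg) (simp_all add: nn_integral_herglotz_Re herglotz_Re_nonneg)

lemma integral_herglotz_Re: "0 < y \<Longrightarrow> (\<integral>x. Re (herglotz f (Complex x y)) \<partial>lborel) = pi * mass"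
  using nn_integral_herglotz_Re[of y] mass_nonneg herglotz_measurable[of y]
  by (subst integral_eq_nn_integral) (simp_all add: herglotz_Re_nonneg)

text \<open>
  The source of the distribution estimates: a suitable \<open>G\<close> turns the integral of
  \<open>Re (herglotz f)\<close>, which equals \<open>\<pi>\<close> times the mass, into information on \<open>\<bar>herglotz f\<bar>\<close>.
\<close>

lemma integral_holomorphic_herglotz_eq_0:
  assumes y: "0 < y" and a: "0 < a" and G: "G holomorphic_on {w. - a < Re w}" and C: "0 \<le> C"
    and G2: "\<And>w. 0 \<le> Re w \<Longrightarrow> cmod w \<le> mass / y \<Longrightarrow> cmod (G w) \<le> C * (cmod w)\<^sup>2"
  shows "integrable lborel (\<lambda>x. G (herglotz f (Complex x y)))" "(\<integral>x. G (herglotz f (Complex x y)) \<partial>lborel) = 0"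
proof -
  define h where "h z = G (herglotz f (z + \<i> * of_real y))" for z
  have hx: "h (complex_of_real x) = G (herglotz f (Complex x y))" for x
    by (simp add: h_def Complex_eq)
  have hol: "h holomorphic_on {z. - y < Im z}"
  proof -
    have "(herglotz f \<circ> (\<lambda>z. z + \<i> * of_real y)) holomorphic_on {z. - y < Im z}"
      by (rule holomorphic_on_compose_gen[OF _ herglotz_holomorphic]) (auto intro!: holomorphic_intros)
    then have "(G \<circ> (herglotz f \<circ> (\<lambda>z. z + \<i> * of_real y))) holomorphic_on {z. - y < Im z}"
    proof (rule holomorphic_on_compose_gen[OF _ G], clarsimp)
      fix z assume "- y < Im z"
      then show "- a < Re (herglotz f (z + \<i> * of_real y))"
        using herglotz_Re_nonneg[of "z + \<i> * of_real y"] a by simp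
    qed
    then show ?thesis by (simp add: h_def[abs_def] o_def)
  qed
  have dec: "cmod (h z) \<le> (4 * C * mass\<^sup>2) / (cmod z)\<^sup>2" if z: "0 \<le> Im z" "2 \<le> cmod z" for z
  proof -
    define w where "w = z + \<i> * of_real y"
    have w: "0 < Im w" "y \<le> Im w" using z y by (auto simp: w_def)
    have zw: "cmod z \<le> cmod w" unfolding w_def cmod_def using z y by (auto intro!: real_sqrt_le_mono power_mono add_mono)
    have 1: "cmod (herglotz f w) \<le> mass / y"
      by (rule order_trans[OF herglotz_le[OF w(1)]]) (use w y mass_nonneg in \<open>auto intro!: divide_left_mono mult_pos_pos\<close>)
    have "cmod (herglotz f w) \<le> 2 * mass / cmod w" using herglotz_decay[OF w(1)] zw z by simp
    also have "\<dots> \<le> 2 * mass / cmod z" using zw z mass_nonneg by (intro divide_left_mono mult_pos_pos) auto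
    finally have "(cmod (herglotz f w))\<^sup>2 \<le> (2 * mass / cmod z)\<^sup>2" by (intro power_mono) auto
    then have "C * (cmod (herglotz f w))\<^sup>2 \<le> C * (2 * mass / cmod z)\<^sup>2" using C by (intro mult_left_mono)
    moreover have "cmod (h z) \<le> C * (cmod (herglotz f w))\<^sup>2"
      unfolding h_def w_def[symmetric] using 1 w by (intro G2 herglotz_Re_nonneg) auto
    moreover have "C * (2 * mass / cmod z)\<^sup>2 = (4 * C * mass\<^sup>2) / (cmod z)\<^sup>2"
      by (simp add: power_divide power_mult_distrib)
    ultimately show ?thesis by linarith
  qed
  show "integrable lborel (\<lambda>x. G (herglotz f (Complex x y)))" "(\<integral>x. G (herglotz f (Complex x y)) \<partial>lborel) = 0"
    using integral_real_line_holomorphic_eq_0[OF y hol _ zero_less_numeral dec, simplified hx] C by simp_all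
qed

end

section \<open>Distribution estimates and the Poisson formula\<close>

context positive_density begin

text \<open>
  Kolmogorov's estimate. For \<open>G w = 2 w\<^sup>2 / (l (w + l))\<close> the difference \<open>2 w / l - G w\<close> is
  \<open>2 w / (w + l)\<close>. Its real part is nonnegative on the right half-plane and at least \<open>1\<close> where
  \<open>\<bar>w\<bar> > l\<close>, while the integral of \<open>G\<close> along the line vanishes.
\<close>

lemma herglotz_weak_type:
  assumes y: "0 < y" and l: "0 < l"
  shows "emeasure lborel {x. l < cmod (herglotz f (Complex x y))} \<le> ennreal (2 * pi * mass / l)"
proof -
  define G where "G w = 2 * w\<^sup>2 / (of_real l * (w + of_real l))" for w :: complex
  have nz: "w + of_real l \<noteq> 0" if "- l < Re w" for w :: complex using that by (auto simp: complex_eq_iff)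
  have G: "integrable lborel (\<lambda>x. G (herglotz f (Complex x y)))" "(\<integral>x. G (herglotz f (Complex x y)) \<partial>lborel) = 0"
  proof -
    have hol: "G holomorphic_on {w. - l < Re w}"
      unfolding G_def using nz l by (auto intro!: holomorphic_intros)
    have bd: "cmod (G w) \<le> (2 / l\<^sup>2) * (cmod w)\<^sup>2" if w: "0 \<le> Re w" for w
    proof -
      have "l \<le> cmod (w + of_real l)" using complex_Re_le_cmod[of "w + of_real l"] w by simp
      then have "2 * (cmod w)\<^sup>2 / (l * cmod (w + of_real l)) \<le> 2 * (cmod w)\<^sup>2 / (l * l)"
        using l by (intro divide_left_mono mult_left_mono mult_pos_pos) auto
      then show ?thesis using l by (simp add: G_def norm_divide norm_mult norm_power power2_eq_square)
    qed
    show "integrable lborel (\<lambda>x. G (herglotz f (Complex x y)))" "(\<integral>x. G (herglotz f (Complex x y)) \<partial>lborel) = 0"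
      using integral_holomorphic_herglotz_eq_0[OF y l hol, of "2 / l\<^sup>2"] bd by simp_all
  qed
  define R where "R x = 2 / l * Re (herglotz f (Complex x y)) - Re (G (herglotz f (Complex x y)))" for x
  have R_eq: "R x = 2 * ((cmod w)\<^sup>2 + l * Re w) / ((cmod w)\<^sup>2 + 2 * l * Re w + l\<^sup>2)"
    if w: "w = herglotz f (Complex x y)" for x w
  proof -
    have w0: "0 \<le> Re w" unfolding w using y by (intro herglotz_Re_nonneg) simp
    have wl: "w + of_real l \<noteq> 0" using nz[of w] w0 l by simp
    have "R x = Re (2 * w / of_real l - G w)" by (simp add: R_def w)
    also have "2 * w / of_real l - G w = 2 * w / (w + of_real l)"
    proof -
      define v where "v = w + of_real l"
      have v: "v \<noteq> 0" "w = v - of_real l" using wl by (auto simp: v_def)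
      have l0: "complex_of_real l \<noteq> 0" using l by simp
      have "2 * w / of_real l = 2 * w * v / (of_real l * v)" using v(1) by simp
      then have "2 * w / of_real l - G w = (2 * w * v - 2 * w\<^sup>2) / (of_real l * v)"
        by (simp only: G_def v_def[symmetric] diff_divide_distrib)
      also have "2 * w * v - 2 * w\<^sup>2 = of_real l * (2 * w)" by (simp add: v_def power2_eq_square algebra_simps)
      finally show ?thesis using l0 by (simp add: v_def)
    qed
    also have "Re (2 * w / (w + of_real l)) = Re (2 * w * cnj (w + of_real l)) / (cmod (w + of_real l))\<^sup>2"
      by (simp add: complex_div_cnj[of "2 * w"])
    also have "(cmod (w + of_real l))\<^sup>2 = (cmod w)\<^sup>2 + 2 * l * Re w + l\<^sup>2"
      unfolding cmod_power2 by (simp add: power2_eq_square algebra_simps)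
    also have "Re (2 * w * cnj (w + of_real l)) = 2 * ((cmod w)\<^sup>2 + l * Re w)"
      unfolding cmod_power2 by (simp add: power2_eq_square algebra_simps)
    finally show ?thesis .
  qed
  have ind: "indicator {x. l < cmod (herglotz f (Complex x y))} x \<le> R x" for x
  proof -
    define w where "w = herglotz f (Complex x y)"
    have w0: "0 \<le> Re w" unfolding w_def using y by (intro herglotz_Re_nonneg) simp
    have pos: "0 < (cmod w)\<^sup>2 + 2 * l * Re w + l\<^sup>2" using w0 l by (intro add_nonneg_pos) auto
    have "R x \<ge> 0" unfolding R_eq[OF w_def] using w0 l pos by (intro divide_nonneg_pos) auto
    moreover have "R x \<ge> 1" if "l < cmod w"
    proof -
      have "l\<^sup>2 \<le> (cmod w)\<^sup>2" using that l by (intro power_mono) auto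
      then show ?thesis unfolding R_eq[OF w_def] using pos by (simp add: le_divide_eq algebra_simps)
    qed
    ultimately show ?thesis by (simp add: indicator_def w_def)
  qed
  have iR: "integrable lborel R" unfolding R_def
    using integrable_herglotz_Re[OF y] integrable_Re[OF G(1)] by simp
  have "(\<integral>x. R x \<partial>lborel) = 2 * pi * mass / l" unfolding R_def
    using integrable_herglotz_Re[OF y] integrable_Re[OF G(1)] G integral_herglotz_Re[OF y]
    by (simp add: integral_Re)
  then have nR: "(\<integral>\<^sup>+x. ennreal (R x) \<partial>lborel) = ennreal (2 * pi * mass / l)"
    using iR ind by (subst nn_integral_eq_integral) (auto intro!: AE_I2 order_trans[OF _ ind])
  have [measurable]: "{x. l < cmod (herglotz f (Complex x y))} \<in> sets borel"
    using herglotz_measurable[OF y] by measurable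
  have "emeasure lborel {x. l < cmod (herglotz f (Complex x y))}
     = (\<integral>\<^sup>+x. indicator {x. l < cmod (herglotz f (Complex x y))} x \<partial>lborel)" by simp
  also have "\<dots> \<le> (\<integral>\<^sup>+x. ennreal (R x) \<partial>lborel)"
  proof (intro nn_integral_mono)
    fix x show "indicator {x. l < cmod (herglotz f (Complex x y))} x \<le> ennreal (R x)"
      using ind[of x] by (cases "l < cmod (herglotz f (Complex x y))") simp_all
  qed
  finally show ?thesis using nR by simp
qed

lemma herglotz_Re_le_pi:
  assumes f1: "\<And>t. f t \<le> 1" and y: "0 < Im z"
  shows "Re (herglotz f z) \<le> pi"
proof -
  have "Re (herglotz f z) \<le> (\<integral>t. poisson_kernel (Im z) (t - Re z) \<partial>lborel)"
    unfolding herglotz_Re[OF y]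
  proof (rule integral_mono')
    show "integrable lborel (\<lambda>t. poisson_kernel (Im z) (t - Re z))" by (rule integrable_poisson_kernel[OF y])
    show "f t * poisson_kernel (Im z) (t - Re z) \<le> poisson_kernel (Im z) (t - Re z)" for t
      using mult_right_mono[OF f1 poisson_kernel_nonneg[OF y]] by simp
  qed (rule poisson_kernel_nonneg[OF y])
  then show ?thesis by (simp add: integral_poisson_kernel[OF y])
qed

text \<open>
  For a density at most \<open>1\<close> the real part \<open>u\<close> stays in \<open>[0, \<pi>]\<close>, so \<open>cos (u/4) \<ge> 1/2\<close>. As the
  integral of \<open>Re (cos (w/4)) - 1 = cos (u/4) cosh (v/4) - 1\<close> vanishes, that of \<open>cosh (v/4) - 1\<close> is at most
  twice that of \<open>1 - cos (u/4) \<le> u/8\<close>. From \<open>l \<ge> 8\<close> on, \<open>cosh (l/4) - 1\<close> is at least \<open>exp (l/4) / 4\<close>.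
\<close>

lemma herglotz_exponential_type:
  assumes f1: "\<And>t. f t \<le> 1" and y: "0 < y" and l: "8 \<le> l"
  shows "emeasure lborel {x. l < \<bar>Im (herglotz f (Complex x y))\<bar>} \<le> ennreal (4 * mass * exp (- l / 4))"
proof -
  define G where "G w = cos (w / 4) - 1" for w :: complex
  have G: "integrable lborel (\<lambda>x. G (herglotz f (Complex x y)))" "(\<integral>x. G (herglotz f (Complex x y)) \<partial>lborel) = 0"
  proof -
    have hol: "G holomorphic_on {w. - 1 < Re w}"
      unfolding G_def by (auto intro!: holomorphic_intros)
    have bd: "cmod (G w) \<le> exp (mass / y) * (cmod w)\<^sup>2" if w: "cmod w \<le> mass / y" for w
    proof -
      have "cmod (cos (w/4) - (\<Sum>k\<le>1. complex_of_real (cos_coeff k) * (w/4)^k))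
          \<le> exp \<bar>Im (w/4)\<bar> * (cmod (w/4))^Suc 1 / fact 1"
        by (rule Taylor_cos)
      then have "cmod (G w) \<le> exp (\<bar>Im (w/4)\<bar>) * (cmod w)\<^sup>2 / 16"
        by (simp add: G_def cos_coeff_def numeral_2_eq_2[symmetric] norm_divide power_divide)
      also have "\<dots> \<le> exp (\<bar>Im (w/4)\<bar>) * (cmod w)\<^sup>2" by simp
      also have "\<dots> \<le> exp (mass / y) * (cmod w)\<^sup>2"
      proof (intro mult_right_mono)
        have "\<bar>Im (w/4)\<bar> \<le> \<bar>Im w\<bar>" by simp
        then have "\<bar>Im (w/4)\<bar> \<le> mass / y" using abs_Im_le_cmod[of w] w by linarith
        then show "exp \<bar>Im (w/4)\<bar> \<le> exp (mass / y)" by (simp only: exp_le_cancel_iff)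
      qed simp
      finally show ?thesis .
    qed
    show "integrable lborel (\<lambda>x. G (herglotz f (Complex x y)))" "(\<integral>x. G (herglotz f (Complex x y)) \<partial>lborel) = 0"
      using integral_holomorphic_herglotz_eq_0[OF y zero_less_one hol, of "exp (mass / y)"] bd by simp_all
  qed
  define R where "R x = 2 * Re (G (herglotz f (Complex x y))) + Re (herglotz f (Complex x y)) / 4" for x
  have ind: "indicator {x. l < \<bar>Im (herglotz f (Complex x y))\<bar>} x * (exp (l / 4) / 4) \<le> R x" for x
  proof -
    define u where "u = Re (herglotz f (Complex x y))"
    define v where "v = Im (herglotz f (Complex x y))"
    have u0: "0 \<le> u" unfolding u_def using y by (intro herglotz_Re_nonneg) simp
    have u1: "u \<le> pi" unfolding u_def using y by (intro herglotz_Re_le_pi f1) simp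
    have RG: "Re (G (herglotz f (Complex x y))) = cos (u / 4) * cosh (v / 4) - 1"
      by (simp add: G_def Re_cos u_def v_def cosh_def exp_minus)
    have "cos (pi / 3) \<le> cos (u / 4)" using u0 u1 by (intro cos_monotone_0_pi_le) auto
    then have c: "1 / 2 \<le> cos (u / 4)" by (simp add: cos_60)
    have c2: "1 - cos (u / 4) \<le> u / 8"
    proof -
      have "1 - cos (u / 4) = 2 * (sin (u / 8))\<^sup>2" using cos_double_sin[of "u / 8"] by simp
      also have "\<dots> \<le> 2 * (u / 8)\<^sup>2"
        using abs_sin_x_le_abs_x[of "u / 8"] by (intro mult_left_mono) (auto simp flip: abs_le_square_iff)
      also have "\<dots> = u * u / 32" by (simp add: power2_eq_square)
      also have "\<dots> \<le> u * 4 / 32" using u0 u1 pi_less_4 by (intro divide_right_mono mult_left_mono) auto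
      finally show ?thesis by simp
    qed
    have "1 / 2 * (cosh (v / 4) - 1) \<le> cos (u / 4) * (cosh (v / 4) - 1)"
      using c by (intro mult_right_mono) (auto simp: cosh_real_ge_1)
    then have "cosh (v / 4) - 1 \<le> 2 * (cos (u / 4) * cosh (v / 4) - cos (u / 4))" by (simp add: algebra_simps)
    also have "\<dots> \<le> 2 * (cos (u / 4) * cosh (v / 4) - 1) + u / 4" using c2 by simp
    finally have R: "cosh (v / 4) - 1 \<le> R x" unfolding R_def RG u_def[symmetric] .
    show ?thesis
    proof (cases "l < \<bar>v\<bar>")
      case True
      have "exp (l / 4) \<le> exp \<bar>v / 4\<bar>" using True by simp
      also have "exp \<bar>v / 4\<bar> \<le> 2 * cosh (v / 4)" by (auto simp: cosh_def abs_if)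
      finally have 1: "exp (l / 4) / 2 \<le> cosh (v / 4)" by simp
      have "4 \<le> exp (l / 4)"
      proof -
        have "(1 + l / 8)\<^sup>2 \<le> (exp (l / 8))\<^sup>2" using l exp_ge_add_one_self[of "l / 8"] by (intro power_mono) auto
        moreover have "(2::real)\<^sup>2 \<le> (1 + l / 8)\<^sup>2" using l by (intro power_mono) auto
        moreover have "(exp (l / 8))\<^sup>2 = exp (l / 4)" by (simp flip: exp_of_nat_mult)
        ultimately show ?thesis by simp
      qed
      then show ?thesis using R 1 True by (simp add: v_def)
    next
      case False
      then show ?thesis using order_trans[OF _ R, of 0] cosh_real_ge_1[of "v/4"] by (simp add: v_def)
    qed
  qed
  have ind0: "0 \<le> R x" for x using order_trans[OF _ ind[of x], of 0] by simp
  have iR: "integrable lborel R" unfolding R_def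
    using integrable_herglotz_Re[OF y] integrable_Re[OF G(1)] by simp
  have iv: "(\<integral>x. R x \<partial>lborel) = pi * mass / 4" unfolding R_def
    using integrable_herglotz_Re[OF y] integrable_Re[OF G(1)] G integral_herglotz_Re[OF y]
    by (simp add: integral_Re)
  have nR: "(\<integral>\<^sup>+x. ennreal (R x) \<partial>lborel) = ennreal (pi * mass / 4)"
    unfolding nn_integral_eq_integral[OF iR AE_I2[OF ind0]] iv ..
  define A where "A = {x. l < \<bar>Im (herglotz f (Complex x y))\<bar>}"
  have [measurable]: "A \<in> sets borel"
    using herglotz_measurable[OF y] unfolding A_def by measurable
  have "ennreal (exp (l / 4) / 4) * emeasure lborel A = (\<integral>\<^sup>+x. ennreal (exp (l / 4) / 4) * indicator A x \<partial>lborel)"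
    by (simp add: nn_integral_cmult_indicator)
  also have "\<dots> \<le> (\<integral>\<^sup>+x. ennreal (R x) \<partial>lborel)"
  proof (intro nn_integral_mono)
    fix x show "ennreal (exp (l / 4) / 4) * indicator A x \<le> ennreal (R x)"
      using ennreal_leI[OF ind[of x]] by (cases "l < \<bar>Im (herglotz f (Complex x y))\<bar>") (simp_all add: A_def)
  qed
  also have "\<dots> \<le> ennreal mass" unfolding nR using mult_right_mono[of pi 4 mass] pi_less_4 mass_nonneg by (intro ennreal_leI) simp
  finally have "ennreal (4 * exp (- l / 4)) * (ennreal (exp (l / 4) / 4) * emeasure lborel A) \<le> ennreal (4 * exp (- l / 4)) * ennreal mass"
    by (intro mult_left_mono) auto
  moreover have "ennreal (4 * exp (- l / 4)) * (ennreal (exp (l / 4) / 4) * emeasure lborel A) = emeasure lborel A"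
  proof -
    have "4 * exp (- l / 4) * (exp (l / 4) / 4) = 1" by (simp flip: exp_add)
    then have "ennreal (4 * exp (- l / 4)) * ennreal (exp (l / 4) / 4) = 1" by (subst ennreal_mult[symmetric]) auto
    then show ?thesis by (simp add: mult.assoc[symmetric])
  qed
  ultimately show ?thesis using mass_nonneg by (simp add: A_def ennreal_mult'[symmetric] mult_ac)
qed

text \<open>
  The integral of \<open>D\<^sup>2\<close> along the line vanishes, so the real and the imaginary part of \<open>D\<close> have
  the same \<open>L\<^sup>2\<close> norm.
\<close>

lemma herglotz_L2_diff:
  assumes s: "0 < s" and r: "0 < r"
  defines "D \<equiv> \<lambda>x. herglotz f (Complex x s) - herglotz f (Complex x r)"
  shows "(\<integral>\<^sup>+x. ennreal ((cmod (D x))\<^sup>2) \<partial>lborel) = (\<integral>\<^sup>+x. ennreal (2 * (Re (D x))\<^sup>2) \<partial>lborel)"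
    and "integrable lborel (\<lambda>x. (cmod (D x))\<^sup>2)"
proof -
  define h where "h z = (herglotz f (z + \<i> * of_real s) - herglotz f (z + \<i> * of_real r))\<^sup>2" for z
  have hx: "h (complex_of_real x) = (D x)\<^sup>2" for x by (simp add: h_def D_def Complex_eq)
  have d: "0 < min s r" using s r by simp
  have hol0: "(\<lambda>z. herglotz f (z + \<i> * of_real c)) holomorphic_on {z. - min s r < Im z}" if "min s r \<le> c" for c
  proof -
    have "(herglotz f \<circ> (\<lambda>z. z + \<i> * of_real c)) holomorphic_on {z. - min s r < Im z}"
      using that by (intro holomorphic_on_compose_gen[OF _ herglotz_holomorphic]) (auto intro!: holomorphic_intros)
    then show ?thesis by (simp add: o_def)
  qed
  have hol: "h holomorphic_on {z. - min s r < Im z}"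
    unfolding h_def by (intro holomorphic_intros hol0) auto
  have dec1: "cmod (herglotz f (z + \<i> * of_real c)) \<le> 2 * mass / cmod z" if z: "0 \<le> Im z" "2 \<le> cmod z" "0 < c" for z c
  proof -
    have zw: "cmod z \<le> cmod (z + \<i> * of_real c)" unfolding cmod_def using z by (auto intro!: real_sqrt_le_mono power_mono add_mono)
    have "cmod (herglotz f (z + \<i> * of_real c)) \<le> 2 * mass / cmod (z + \<i> * of_real c)"
      using z zw by (intro herglotz_decay) auto
    also have "\<dots> \<le> 2 * mass / cmod z" using zw z mass_nonneg by (intro divide_left_mono mult_pos_pos) auto
    finally show ?thesis .
  qed
  have dec: "cmod (h z) \<le> (16 * mass\<^sup>2) / (cmod z)\<^sup>2" if z: "0 \<le> Im z" "2 \<le> cmod z" for z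
  proof -
    have "cmod (herglotz f (z + \<i> * of_real s) - herglotz f (z + \<i> * of_real r)) \<le> 4 * mass / cmod z"
      using dec1[OF z s] dec1[OF z r] norm_triangle_ineq4[of "herglotz f (z + \<i> * of_real s)" "herglotz f (z + \<i> * of_real r)"] by simp
    then have "cmod (h z) \<le> (4 * mass / cmod z)\<^sup>2" unfolding h_def norm_power by (intro power_mono) auto
    then show ?thesis by (simp add: power_divide power_mult_distrib)
  qed
  have h: "integrable lborel (\<lambda>x. (D x)\<^sup>2)" "(\<integral>x. (D x)\<^sup>2 \<partial>lborel) = 0"
    using integral_real_line_holomorphic_eq_0[OF d hol _ zero_less_numeral dec, simplified hx] by simp_all
  have [measurable]: "D \<in> borel_measurable borel"
    using herglotz_measurable[OF s] herglotz_measurable[OF r] by (simp add: D_def)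
  show i: "integrable lborel (\<lambda>x. (cmod (D x))\<^sup>2)" using integrable_norm[OF h(1)] by (simp add: norm_power)
  have iR: "integrable lborel (\<lambda>x. (Re (D x))\<^sup>2)"
    by (rule Bochner_Integration.integrable_bound[OF i]) (auto simp: cmod_power2)
  have "(\<integral>x. Re ((D x)\<^sup>2) \<partial>lborel) = 0" using h by (simp only: integral_Re) simp
  moreover have "Re ((D x)\<^sup>2) = 2 * (Re (D x))\<^sup>2 - (cmod (D x))\<^sup>2" for x
    unfolding cmod_power2 by (simp add: power2_eq_square)
  ultimately have "(\<integral>x. (cmod (D x))\<^sup>2 \<partial>lborel) = (\<integral>x. 2 * (Re (D x))\<^sup>2 \<partial>lborel)"
    using i iR by simp
  then show "(\<integral>\<^sup>+x. ennreal ((cmod (D x))\<^sup>2) \<partial>lborel) = (\<integral>\<^sup>+x. ennreal (2 * (Re (D x))\<^sup>2) \<partial>lborel)"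
    using i iR by (simp add: nn_integral_eq_integral)
qed

end

text \<open>
  With \<open>z = Complex x y\<close>, the function \<open>(Q w - Q z) / ((w - z) (w - cnj z))\<close> has a removable singularity
  at \<open>z\<close>, its pole \<open>cnj z\<close> lies below the real line, and it decays quadratically; so its integral over the
  real line is \<open>0\<close>. There the denominator is \<open>(t - x)\<^sup>2 + y\<^sup>2\<close>.
\<close>

lemma poisson_formula:
  assumes d: "0 < d" and hol: "Q holomorphic_on {z. - d < Im z}"
    and B: "\<And>z. 0 \<le> Im z \<Longrightarrow> cmod (Q z) \<le> B" and y: "0 < y"
  shows "Q (Complex x y) * of_real pi = (\<integral>t. Q (complex_of_real t) * of_real (poisson_kernel y (t - x)) \<partial>lborel)"
proof -
  define z where "z = Complex x y"
  define e where "e = min d y"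
  have e: "0 < e" "e \<le> d" "e \<le> y" using d y by (auto simp: e_def)
  define q where "q = (\<lambda>w. if w = z then deriv Q z else (Q w - Q z) / (w - z))"
  have op: "open {z. - d < Im z}" by (rule open_halfspace_Im_gt)
  have qh: "q holomorphic_on {z. - d < Im z}" unfolding q_def by (rule pole_lemma_open[OF hol op])
  define h where "h w = q w / (w - cnj z)" for w
  have hh: "h holomorphic_on {z. - e < Im z}"
    unfolding h_def using e by (intro holomorphic_intros holomorphic_on_subset[OF qh]) (auto simp: z_def complex_eq_iff)
  have B0: "0 \<le> B" using B[of 0] by (auto intro: order_trans[OF norm_ge_zero])
  define R where "R = 2 * cmod z + 1"
  have dec: "cmod (h w) \<le> 8 * B / (cmod w)\<^sup>2" if w: "0 \<le> Im w" "R \<le> cmod w" for w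
  proof -
    have w0: "0 < cmod w" using w norm_ge_zero[of z] unfolding R_def by linarith
    have a: "cmod w / 2 \<le> cmod (w - z)" using norm_triangle_ineq2[of w z] w by (simp add: R_def)
    have b: "cmod w / 2 \<le> cmod (w - cnj z)" using norm_triangle_ineq2[of w "cnj z"] w by (simp add: R_def)
    have nz: "w \<noteq> z" using w0 a by auto
    have "cmod (Q w - Q z) \<le> 2 * B"
      using norm_triangle_ineq4[of "Q w" "Q z"] B[of w] B[of z] w y by (simp add: z_def)
    then have "cmod (Q w - Q z) / (cmod (w - z) * cmod (w - cnj z)) \<le> 2 * B / ((cmod w / 2) * (cmod w / 2))"
      using a b w0 B0 by (intro frac_le mult_mono mult_pos_pos) auto
    then show ?thesis using nz w0 by (simp add: h_def q_def norm_divide norm_mult power2_eq_square mult.assoc)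
  qed
  have "0 < R" by (simp add: R_def add_nonneg_pos)
  then have hi: "integrable lborel (\<lambda>t. h (complex_of_real t))" "(\<integral>t. h (complex_of_real t) \<partial>lborel) = 0"
    using integral_real_line_holomorphic_eq_0[OF e(1) hh _ _ dec] B0 by simp_all
  have hx: "of_real y * h (complex_of_real t) = Q (complex_of_real t) * of_real (poisson_kernel y (t - x)) - of_real (poisson_kernel y (t - x)) * Q z" for t
  proof -
    have "complex_of_real t \<noteq> z" using y by (auto simp: z_def complex_eq_iff)
    moreover have "(complex_of_real t - z) * (complex_of_real t - cnj z) = of_real ((t - x)\<^sup>2 + y\<^sup>2)"
      by (simp add: z_def complex_eq_iff power2_eq_square algebra_simps)
    ultimately have 1: "h (complex_of_real t) = (Q (complex_of_real t) - Q z) / of_real ((t - x)\<^sup>2 + y\<^sup>2)"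
      by (simp add: h_def q_def)
    define c where "c = (t - x)\<^sup>2 + y\<^sup>2"
    have "of_real y * ((Q (complex_of_real t) - Q z) / of_real c) = (Q (complex_of_real t) - Q z) * of_real (y / c)" by simp
    then show ?thesis unfolding 1 poisson_kernel_def c_def[symmetric]
      by (simp add: left_diff_distrib mult.commute[of "of_real (y / c)"] del: of_real_divide)
  qed
  have ip: "integrable lborel (\<lambda>t. complex_of_real (poisson_kernel y (t - x)) * Q z)"
    using integrable_poisson_kernel[OF y, of x] by simp
  have "(\<lambda>t. Q (complex_of_real t) * of_real (poisson_kernel y (t - x)))
      = (\<lambda>t. of_real y * h (complex_of_real t) + of_real (poisson_kernel y (t - x)) * Q z)"
    unfolding hx by simp
  moreover have "(\<integral>t. of_real y * h (complex_of_real t) + of_real (poisson_kernel y (t - x)) * Q z \<partial>lborel) = of_real pi * Q z"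
    using hi ip integrable_poisson_kernel[OF y, of x] integral_poisson_kernel[OF y, of x] by (subst Bochner_Integration.integral_add) auto
  ultimately show ?thesis by (simp add: z_def mult.commute)
qed

section \<open>Boundary limits and principal values\<close>

text \<open>
  Choose the subsequence so that consecutive differences exceed \<open>2\<^sup>-\<^sup>k\<close> only on sets of measure at
  most \<open>2\<^sup>-\<^sup>k\<close>, and use the Borel-Cantelli lemma.
\<close>

lemma AE_convergent_subseq_of_Cauchy_in_measure:
  fixes F :: "nat \<Rightarrow> 'a \<Rightarrow> complex"
  assumes [measurable]: "\<And>n. F n \<in> borel_measurable M"
    and C: "\<And>\<delta> \<eta>. 0 < \<delta> \<Longrightarrow> 0 < \<eta> \<Longrightarrow> \<exists>N. \<forall>n\<ge>N. \<forall>m\<ge>N. emeasure M {x\<in>space M. \<delta> < cmod (F n x - F m x)} \<le> ennreal \<eta>"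
  shows "\<exists>r. strict_mono (r :: nat \<Rightarrow> nat) \<and> (AE x in M. convergent (\<lambda>k. F (r k) x))"
proof -
  have "\<exists>N. \<forall>n\<ge>N. \<forall>m\<ge>N. emeasure M {x\<in>space M. (1/2)^k < cmod (F n x - F m x)} \<le> ennreal ((1/2)^k)" for k :: nat
    by (rule C) auto
  then obtain N where N: "\<And>k n m. N k \<le> n \<Longrightarrow> N k \<le> m \<Longrightarrow> emeasure M {x\<in>space M. (1/2)^k < cmod (F n x - F m x)} \<le> ennreal ((1/2)^k)"
    by metis
  define r where "r = rec_nat (N 0) (\<lambda>k a. max (Suc a) (N (Suc k)))"
  have r: "r 0 = N 0" "r (Suc k) = max (Suc (r k)) (N (Suc k))" for k by (auto simp: r_def)
  have sm: "strict_mono r" by (auto simp: strict_mono_Suc_iff r)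
  have rN: "N k \<le> r k" for k by (cases k) (auto simp: r)
  define A where "A k = {x\<in>space M. (1/2)^k < cmod (F (r (Suc k)) x - F (r k) x)}" for k
  have [measurable]: "A k \<in> sets M" for k unfolding A_def by measurable
  have Ak: "emeasure M (A k) \<le> ennreal ((1/2)^k)" for k
    unfolding A_def using rN[of k] sm by (intro N) (auto simp: strict_mono_Suc_iff intro: order_trans less_imp_le)
  have fin: "emeasure M (A k) < \<infinity>" for k using Ak[of k] by (auto intro: le_less_trans)
  have "measure M (A k) \<le> (1/2)^k" for k
    using Ak[of k] fin[of k] by (simp add: measure_def enn2real_leI)
  then have sum: "summable (\<lambda>k. measure M (A k))"
    by (intro summable_comparison_test[OF _ summable_geometric[of "1/2::real"]]) auto
  have "AE x in M. eventually (\<lambda>k. x \<in> space M - A k) sequentially"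
    using fin sum by (intro borel_cantelli_AE1) auto
  then have "AE x in M. convergent (\<lambda>k. F (r k) x)"
  proof (rule AE_mp, intro AE_I2 impI)
    fix x assume "x \<in> space M" "eventually (\<lambda>k. x \<in> space M - A k) sequentially"
    then have "eventually (\<lambda>k. norm (F (r (Suc k)) x - F (r k) x) \<le> (1/2)^k) sequentially"
      by (auto elim!: eventually_mono simp: A_def)
    then have "summable (\<lambda>k. F (r (Suc k)) x - F (r k) x)"
      by (rule summable_comparison_test_ev) (simp add: summable_geometric)
    then have "convergent (\<lambda>n. \<Sum>k<n. F (r (Suc k)) x - F (r k) x)" by (simp add: summable_iff_convergent)
    then have "convergent (\<lambda>n. F (r n) x - F (r 0) x)"
      unfolding sum_lessThan_telescope[of "\<lambda>k. F (r k) x"] .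
    from convergent_add[OF this convergent_const[of "F (r 0) x"]]
    show "convergent (\<lambda>k. F (r k) x)" by simp
  qed
  with sm show ?thesis by blast
qed

lemma positive_density_min: "positive_density f \<Longrightarrow> 0 \<le> c \<Longrightarrow> positive_density (\<lambda>t. min (f t) c)"
proof
  assume f: "positive_density f" and c: "0 \<le> c"
  interpret positive_density f by (rule f)
  show "integrable lborel (\<lambda>t. min (f t) c)"
    by (rule Bochner_Integration.integrable_bound[OF integrable]) (use nonneg c in \<open>auto simp: min_def\<close>)
  show "0 \<le> min (f t) c" for t using nonneg c by auto
  show "min (f t) c = 0" if "1 \<le> \<bar>t\<bar>" for t using support[OF that] c by auto
qed

lemma positive_density_diff_min: "positive_density f \<Longrightarrow> 0 \<le> c \<Longrightarrow> positive_density (\<lambda>t. f t - min (f t) c)"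
proof
  assume f: "positive_density f" and c: "0 \<le> c"
  interpret positive_density f by (rule f)
  interpret m: positive_density "\<lambda>t. min (f t) c" using f c by (rule positive_density_min)
  show "integrable lborel (\<lambda>t. f t - min (f t) c)" using integrable m.integrable by simp
  show "0 \<le> f t - min (f t) c" for t by auto
  show "f t - min (f t) c = 0" if "1 \<le> \<bar>t\<bar>" for t using support[OF that] c by auto
qed

lemma tendsto_at_right_imp_inverse_Suc: "(g \<longlongrightarrow> L) (at_right (0::real)) \<Longrightarrow> (\<lambda>n. g (1 / Suc n)) \<longlonglongrightarrow> L"
proof (erule filterlim_compose)
  have "(\<lambda>n. 1 / real (Suc n)) \<longlonglongrightarrow> 0" using LIMSEQ_inverse_real_of_nat by (simp add: inverse_eq_divide)
  then show "filterlim (\<lambda>n. 1 / real (Suc n)) (at_right 0) sequentially"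
    unfolding at_within_def by (auto simp: filterlim_inf filterlim_principal)
qed

context positive_density begin

lemma AE_lebesgue_point_f: "AE x in lborel. lebesgue_point (\<lambda>t. complex_of_real (f t)) x"
proof (rule AE_lebesgue_point)
  show "integrable lborel (\<lambda>x. indicator {-real n..real n} x * complex_of_real (f x))" for n
    by (rule Bochner_Integration.integrable_bound[OF integrable]) (auto simp: indicator_def)
qed simp

lemma poisson_average_f:
  assumes "lebesgue_point (\<lambda>t. complex_of_real (f t)) x"
  shows "((\<lambda>y. \<integral>\<^sup>+t. ennreal (\<bar>f t - f x\<bar> * poisson_kernel y (t - x)) \<partial>lborel) \<longlongrightarrow> 0) (at_right 0)"
proof (rule poisson_average_tendsto_0)
  fix \<eta> :: real assume "0 < \<eta>"
  then show "\<exists>\<delta>>0. \<forall>r. 0 < r \<and> r < \<delta> \<longrightarrow> (\<integral>\<^sup>+t\<in>ball x r. ennreal \<bar>f t - f x\<bar> \<partial>lborel) \<le> ennreal (\<eta> * r)"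
    using assms unfolding lebesgue_point_def by (simp flip: of_real_diff)
next
  have "(\<integral>\<^sup>+t. ennreal (\<bar>f t - f x\<bar> * (1 / (1 + (t - x)\<^sup>2))) \<partial>lborel)
     \<le> (\<integral>\<^sup>+t. ennreal (f t) + ennreal (f x) * ennreal (poisson_kernel 1 (t - x)) \<partial>lborel)"
  proof (intro nn_integral_mono)
    fix t
    have "f t * (1 / (1 + (t - x)\<^sup>2)) \<le> f t * 1" using nonneg by (intro mult_left_mono) (auto simp: divide_le_eq_1 add_pos_nonneg)
    moreover have "\<bar>f t - f x\<bar> * (1 / (1 + (t - x)\<^sup>2)) \<le> (f t + f x) * (1 / (1 + (t - x)\<^sup>2))"
      using nonneg[of t] nonneg[of x] by (intro mult_right_mono) auto
    moreover have "f x * poisson_kernel 1 (t - x) = f x * (1 / (1 + (t - x)\<^sup>2))" by (simp add: poisson_kernel_def add.commute)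
    ultimately have "\<bar>f t - f x\<bar> * (1 / (1 + (t - x)\<^sup>2)) \<le> f t + f x * poisson_kernel 1 (t - x)"
      using distrib_right[of "f t" "f x" "1 / (1 + (t - x)\<^sup>2)"] by linarith
    then show "ennreal (\<bar>f t - f x\<bar> * (1 / (1 + (t - x)\<^sup>2))) \<le> ennreal (f t) + ennreal (f x) * ennreal (poisson_kernel 1 (t - x))"
      using nonneg poisson_kernel_nonneg[of 1] by (simp add: ennreal_mult'[symmetric] ennreal_plus[symmetric] ennreal_leI del: ennreal_plus)
  qed
  also have "\<dots> = ennreal mass + ennreal (f x) * ennreal pi"
    by (subst nn_integral_add) (auto simp: nn_integral_f nn_integral_cmult nn_integral_poisson_kernel)
  also have "\<dots> < \<infinity>" by (simp add: ennreal_mult_less_top)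
  finally show "(\<integral>\<^sup>+t. ennreal (\<bar>f t - f x\<bar> * (1 / (1 + (t - x)\<^sup>2))) \<partial>lborel) < \<infinity>" .
qed auto

text \<open>
  This covers the Poisson kernel itself (\<open>c = \<pi>\<close>) and the difference between the truncated kernel
  \<open>1 / s\<close> and the conjugate Poisson kernel (\<open>c = 0\<close>).
\<close>

lemma kernel_integral_tendsto:
  assumes lp: "lebesgue_point (\<lambda>t. complex_of_real (f t)) x"
    and [measurable]: "\<And>y. k y \<in> borel_measurable borel"
    and k: "\<And>y s. 0 < y \<Longrightarrow> \<bar>k y s\<bar> \<le> poisson_kernel y s" and c: "\<And>y. 0 < y \<Longrightarrow> (\<integral>t. k y (t - x) \<partial>lborel) = c"
  shows "((\<lambda>y. \<integral>t. f t * k y (t - x) \<partial>lborel) \<longlongrightarrow> c * f x) (at_right 0)"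
proof (rule LIM_zero_cancel, rule Lim_null_comparison)
  show "((\<lambda>y. enn2real (\<integral>\<^sup>+t. ennreal (\<bar>f t - f x\<bar> * poisson_kernel y (t - x)) \<partial>lborel)) \<longlongrightarrow> 0) (at_right 0)"
    using poisson_average_f[OF lp] by (intro tendsto_enn2real[where l=0, simplified])
  have ev: "eventually (\<lambda>y. (\<integral>\<^sup>+t. ennreal (\<bar>f t - f x\<bar> * poisson_kernel y (t - x)) \<partial>lborel) < 1) (at_right 0)"
    using poisson_average_f[OF lp] by (rule order_tendstoD) simp
  have pos: "eventually (\<lambda>y::real. 0 < y) (at_right 0)" by (simp add: eventually_at_right_less)
  show "\<forall>\<^sub>F y in at_right 0. norm ((\<integral>t. f t * k y (t - x) \<partial>lborel) - c * f x)
      \<le> enn2real (\<integral>\<^sup>+t. ennreal (\<bar>f t - f x\<bar> * poisson_kernel y (t - x)) \<partial>lborel)"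
    using ev pos
  proof eventually_elim
    case (elim y)
    then have y: "0 < y" by simp
    have i1: "integrable lborel (\<lambda>t. k y (t - x))"
      by (rule Bochner_Integration.integrable_bound[OF integrable_poisson_kernel[OF y, of x]])
         (use k[OF y] poisson_kernel_nonneg[OF y] in \<open>auto intro: order_trans\<close>)
    have i2: "integrable lborel (\<lambda>t. f t * k y (t - x))"
    proof (rule Bochner_Integration.integrable_bound[of _ "\<lambda>t. f t * (1 / y)"])
      show "AE t in lborel. norm (f t * k y (t - x)) \<le> norm (f t * (1 / y))"
        using y nonneg mult_left_mono[OF order_trans[OF k[OF y] poisson_kernel_le[OF y]] nonneg]
        by (intro AE_I2) (simp add: abs_mult del: times_divide_eq_right)
    qed (use integrable in auto)
    have i3: "integrable lborel (\<lambda>t. (f t - f x) * k y (t - x))"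
      using i1 i2 by (simp add: left_diff_distrib)
    have "(\<integral>t. f t * k y (t - x) \<partial>lborel) - c * f x = (\<integral>t. (f t - f x) * k y (t - x) \<partial>lborel)"
      using i1 i2 c[OF y] by (simp add: left_diff_distrib mult.commute)
    then have "ennreal (norm ((\<integral>t. f t * k y (t - x) \<partial>lborel) - c * f x)) \<le> (\<integral>\<^sup>+t. ennreal (norm ((f t - f x) * k y (t - x))) \<partial>lborel)"
      using integral_norm_bound_ennreal[OF i3] by simp
    also have "\<dots> \<le> (\<integral>\<^sup>+t. ennreal (\<bar>f t - f x\<bar> * poisson_kernel y (t - x)) \<partial>lborel)"
      using k[OF y] by (intro nn_integral_mono ennreal_leI) (auto simp: abs_mult intro: mult_left_mono)
    finally have le: "ennreal (norm ((\<integral>t. f t * k y (t - x) \<partial>lborel) - c * f x)) \<le> (\<integral>\<^sup>+t. ennreal (\<bar>f t - f x\<bar> * poisson_kernel y (t - x)) \<partial>lborel)" .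
    moreover have "(\<integral>\<^sup>+t. ennreal (\<bar>f t - f x\<bar> * poisson_kernel y (t - x)) \<partial>lborel) < top"
      using elim(1) by (rule order.strict_trans) simp
    ultimately show ?case using enn2real_mono by fastforce
  qed
qed

lemma herglotz_Re_tendsto:
  assumes lp: "lebesgue_point (\<lambda>t. complex_of_real (f t)) x"
  shows "((\<lambda>y. Re (herglotz f (Complex x y))) \<longlongrightarrow> pi * f x) (at_right 0)"
proof -
  have "((\<lambda>y. \<integral>t. f t * poisson_kernel y (t - x) \<partial>lborel) \<longlongrightarrow> pi * f x) (at_right 0)"
    by (rule kernel_integral_tendsto[OF lp]) (auto simp: poisson_kernel_nonneg integral_poisson_kernel)
  then show ?thesis
    by (rule Lim_transform_eventually)
       (auto intro!: eventually_mono[OF eventually_at_right_less[of 0]] simp: herglotz_Re)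
qed

text \<open>
  The real parts converge to \<open>\<pi> f\<close> almost everywhere and their integrals are constant, so they converge
  in \<open>L\<^sup>1\<close> by Scheffe's lemma; they are bounded, so they converge in \<open>L\<^sup>2\<close>. The equality of the \<open>L\<^sup>2\<close> norms
  of real and imaginary parts transfers this to the whole function.
\<close>

lemma bounded_herglotz_L2_Cauchy:
  assumes b: "\<And>t. f t \<le> B"
  shows "\<exists>e :: nat \<Rightarrow> ennreal. e \<longlonglongrightarrow> 0 \<and> (\<forall>n m.
    (\<integral>\<^sup>+x. ennreal ((cmod (herglotz f (Complex x (1 / Suc n)) - herglotz f (Complex x (1 / Suc m))))\<^sup>2) \<partial>lborel) \<le> e n + e m)"
proof -
  define u where "u n x = Re (herglotz f (Complex x (1 / Suc n)))" for n x
  have [measurable]: "u n \<in> borel_measurable borel" for n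
    unfolding u_def using herglotz_measurable[of "1 / Suc n"] by simp
  have u0: "0 \<le> u n x" for n x unfolding u_def by (rule herglotz_Re_nonneg) simp
  have B0: "0 \<le> B" using b[of 0] nonneg[of 0] by linarith
  define e where "e n = (\<integral>\<^sup>+x. ennreal (norm (u n x - pi * f x)) \<partial>lborel)" for n
  have uB: "u n x \<le> B * pi" for n x
  proof -
    have y: "0 < 1 / real (Suc n)" by simp
    have "u n x \<le> (\<integral>t. B * poisson_kernel (1 / Suc n) (t - x) \<partial>lborel)"
      unfolding u_def
    proof (subst herglotz_Re)
      show "(\<integral>t. f t * poisson_kernel (Im (Complex x (1 / real (Suc n)))) (t - Re (Complex x (1 / real (Suc n)))) \<partial>lborel)
         \<le> (\<integral>t. B * poisson_kernel (1 / Suc n) (t - x) \<partial>lborel)"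
        using b B0 poisson_kernel_nonneg[OF y] integrable_poisson_kernel[OF y, of x] by (intro integral_mono') (auto intro: mult_right_mono)
    qed simp
    then show ?thesis using integral_poisson_kernel[OF y, of x] by simp
  qed
  have "e \<longlonglongrightarrow> 0" unfolding e_def
  proof (rule Scheffe_lemma2)
    show "integrable lborel (\<lambda>x. pi * f x)" using integrable by simp
    show "AE x in lborel. (\<lambda>n. u n x) \<longlonglongrightarrow> pi * f x"
      using AE_lebesgue_point_f by (rule AE_mp) (intro AE_I2 impI, unfold u_def, erule tendsto_at_right_imp_inverse_Suc[OF herglotz_Re_tendsto])
    show "(\<integral>\<^sup>+x. ennreal (norm (u n x)) \<partial>lborel) \<le> (\<integral>\<^sup>+x. ennreal (norm (pi * f x)) \<partial>lborel)" for n
    proof -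
      have "(\<integral>\<^sup>+x. ennreal (norm (u n x)) \<partial>lborel) = ennreal (pi * mass)"
        using nn_integral_herglotz_Re[of "1 / Suc n"] u0 by (simp add: u_def)
      also have "\<dots> = ennreal pi * (\<integral>\<^sup>+x. ennreal (f x) \<partial>lborel)" by (simp add: nn_integral_f ennreal_mult mass_nonneg)
      also have "\<dots> = (\<integral>\<^sup>+x. ennreal (norm (pi * f x)) \<partial>lborel)"
        using nonneg by (subst nn_integral_cmult[symmetric]) (auto simp: abs_mult ennreal_mult)
      finally show ?thesis by simp
    qed
  qed auto
  then have "(\<lambda>n. ennreal (4 * B * pi) * e n) \<longlonglongrightarrow> ennreal (4 * B * pi) * 0"
    by (intro ennreal_tendsto_cmult) auto
  moreover have "(\<integral>\<^sup>+x. ennreal ((cmod (herglotz f (Complex x (1 / Suc n)) - herglotz f (Complex x (1 / Suc m))))\<^sup>2) \<partial>lborel)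
      \<le> ennreal (4 * B * pi) * e n + ennreal (4 * B * pi) * e m" for n m
  proof -
    have "(\<integral>\<^sup>+x. ennreal ((cmod (herglotz f (Complex x (1 / Suc n)) - herglotz f (Complex x (1 / Suc m))))\<^sup>2) \<partial>lborel)
      = (\<integral>\<^sup>+x. ennreal (2 * (u n x - u m x)\<^sup>2) \<partial>lborel)"
      by (subst herglotz_L2_diff) (auto simp: u_def)
    also have "\<dots> \<le> (\<integral>\<^sup>+x. ennreal (4 * B * pi) * ennreal (norm (u n x - pi * f x)) + ennreal (4 * B * pi) * ennreal (norm (u m x - pi * f x)) \<partial>lborel)"
    proof (intro nn_integral_mono)
      fix x
      have "(u n x - u m x)\<^sup>2 = \<bar>u n x - u m x\<bar> * \<bar>u n x - u m x\<bar>" by (simp add: power2_eq_square)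
      also have "\<dots> \<le> (2 * B * pi) * (\<bar>u n x - pi * f x\<bar> + \<bar>u m x - pi * f x\<bar>)"
        using uB[of n x] uB[of m x] u0[of n x] u0[of m x] B0 by (intro mult_mono) auto
      finally have "2 * (u n x - u m x)\<^sup>2 \<le> 4 * B * pi * \<bar>u n x - pi * f x\<bar> + 4 * B * pi * \<bar>u m x - pi * f x\<bar>"
        by (simp add: algebra_simps)
      then show "ennreal (2 * (u n x - u m x)\<^sup>2) \<le> ennreal (4 * B * pi) * ennreal (norm (u n x - pi * f x)) + ennreal (4 * B * pi) * ennreal (norm (u m x - pi * f x))"
        using B0 by (simp add: ennreal_mult'[symmetric] ennreal_plus[symmetric] ennreal_leI del: ennreal_plus)
    qed
    also have "\<dots> = ennreal (4 * B * pi) * e n + ennreal (4 * B * pi) * e m"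
      unfolding e_def by (subst nn_integral_add) (auto simp: nn_integral_cmult)
    finally show ?thesis .
  qed
  ultimately show ?thesis by (intro exI[of _ "\<lambda>n. ennreal (4 * B * pi) * e n"]) auto
qed

lemma mass_diff_min_tendsto_0: "(\<lambda>n. \<integral>t. f t - min (f t) (real n) \<partial>lborel) \<longlonglongrightarrow> 0"
proof -
  have "(\<lambda>n. \<integral>t. f t - min (f t) (real n) \<partial>lborel) \<longlonglongrightarrow> (\<integral>t. 0 \<partial>(lborel :: real measure))"
  proof (rule integral_dominated_convergence[where w=f and f="\<lambda>_. 0" and s="\<lambda>n t. f t - min (f t) (real n)"])
    show "AE x in lborel. (\<lambda>n. f x - min (f x) (real n)) \<longlonglongrightarrow> 0"
    proof (intro AE_I2 tendsto_eventually)
      fix x obtain N where "f x < real N" using reals_Archimedean2 by blast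
      then show "\<forall>\<^sub>F n in sequentially. f x - min (f x) (real n) = 0"
        unfolding eventually_sequentially by (intro exI[of _ N]) auto
    qed
  qed (use integrable nonneg in \<open>auto simp: min_def\<close>)
  then show ?thesis by simp
qed

text \<open>
  Cut the density at a large height: the lower part is bounded and handled in \<open>L\<^sup>2\<close>, the upper part has
  small mass and is handled by the weak type estimate.
\<close>

lemma herglotz_Cauchy_in_measure:
  assumes d: "0 < d" and eta: "0 < \<eta>"
  shows "\<exists>N. \<forall>n\<ge>N. \<forall>m\<ge>N. emeasure lborel {x\<in>space lborel.
    d < cmod (herglotz f (Complex x (1 / Suc n)) - herglotz f (Complex x (1 / Suc m)))} \<le> ennreal \<eta>"
proof -
  define d' where "d' = d / 3"
  have d': "0 < d'" using d by (simp add: d'_def)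
  have "eventually (\<lambda>n. (\<integral>t. f t - min (f t) (real n) \<partial>lborel) < \<eta> * d' / (8 * pi)) sequentially"
    using mass_diff_min_tendsto_0 d' eta by (intro order_tendstoD(2)) (auto intro!: divide_pos_pos mult_pos_pos)
  then obtain B :: nat where B: "(\<integral>t. f t - min (f t) (real B) \<partial>lborel) < \<eta> * d' / (8 * pi)"
    by (auto simp: eventually_sequentially)
  interpret p: positive_density "\<lambda>t. min (f t) (real B)"
    by (rule positive_density_min[OF positive_density_axioms]) simp
  interpret b: positive_density "\<lambda>t. f t - min (f t) (real B)"
    by (rule positive_density_diff_min[OF positive_density_axioms]) simp
  have split: "herglotz f z = herglotz (\<lambda>t. min (f t) (real B)) z + herglotz (\<lambda>t. f t - min (f t) (real B)) z" if "0 < Im z" for z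
    unfolding herglotz_def
    by (subst Bochner_Integration.integral_add[symmetric, OF p.herglotz_integrable[OF that] b.herglotz_integrable[OF that]])
       (auto intro!: Bochner_Integration.integral_cong simp: algebra_simps)
  obtain e :: "nat \<Rightarrow> ennreal" where e: "e \<longlonglongrightarrow> 0" and eb: "\<And>n m. (\<integral>\<^sup>+x. ennreal ((cmod (herglotz (\<lambda>t. min (f t) (real B)) (Complex x (1 / Suc n))
      - herglotz (\<lambda>t. min (f t) (real B)) (Complex x (1 / Suc m))))\<^sup>2) \<partial>lborel) \<le> e n + e m"
    using p.bounded_herglotz_L2_Cauchy[of "real B"] by auto
  have "eventually (\<lambda>n. e n < ennreal (\<eta> * d'\<^sup>2 / 4)) sequentially"
    using e d' eta by (intro order_tendstoD(2)) (auto intro!: divide_pos_pos mult_pos_pos)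
  then obtain N where N: "\<And>n. N \<le> n \<Longrightarrow> e n < ennreal (\<eta> * d'\<^sup>2 / 4)" by (auto simp: eventually_sequentially)
  show ?thesis
  proof (intro exI[of _ N] allI impI)
    fix n m assume nm: "N \<le> n" "N \<le> m"
    define P where "P n x = herglotz (\<lambda>t. min (f t) (real B)) (Complex x (1 / Suc n))" for n x
    define S where "S n x = herglotz (\<lambda>t. f t - min (f t) (real B)) (Complex x (1 / Suc n))" for n x
    have [measurable]: "P n \<in> borel_measurable borel" "S n \<in> borel_measurable borel" for n
      unfolding P_def S_def using p.herglotz_measurable[of "1 / Suc n"] b.herglotz_measurable[of "1 / Suc n"] by simp_all
    have PS: "herglotz f (Complex x (1 / Suc n)) = P n x + S n x" for n x unfolding P_def S_def by (rule split) simp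
    have S: "emeasure lborel {x. d' < cmod (S n x)} \<le> ennreal (\<eta> / 4)" for n
    proof -
      have "emeasure lborel {x. d' < cmod (S n x)} \<le> ennreal (2 * pi * b.mass / d')"
        unfolding S_def using d' by (intro b.herglotz_weak_type) auto
      also have "\<dots> \<le> ennreal (\<eta> / 4)" using B d' by (intro ennreal_leI) (simp add: b.mass_def field_simps)
      finally show ?thesis .
    qed
    have P: "emeasure lborel {x. d' < cmod (P n x - P m x)} \<le> ennreal (\<eta> / 2)"
    proof -
      have "ennreal (d'\<^sup>2) * emeasure lborel {x. d' < cmod (P n x - P m x)}
         = (\<integral>\<^sup>+x. ennreal (d'\<^sup>2) * indicator {x. d' < cmod (P n x - P m x)} x \<partial>lborel)"
        by (subst nn_integral_cmult_indicator) auto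
      also have "\<dots> \<le> (\<integral>\<^sup>+x. ennreal ((cmod (P n x - P m x))\<^sup>2) \<partial>lborel)"
        using d' by (intro nn_integral_mono) (auto simp: indicator_def intro!: ennreal_leI power_mono)
      also have "\<dots> \<le> e n + e m" using eb by (simp add: P_def)
      also have "\<dots> \<le> ennreal (\<eta> * d'\<^sup>2 / 4) + ennreal (\<eta> * d'\<^sup>2 / 4)" using N nm by (intro add_mono) (auto intro: less_imp_le)
      also have "\<dots> = ennreal (d'\<^sup>2) * ennreal (\<eta> / 2)" using eta by (simp add: ennreal_mult'[symmetric] ennreal_plus[symmetric] del: ennreal_plus)
      finally show ?thesis using d' by (subst (asm) ennreal_mult_le_mult_iff) (auto simp: ennreal_zero_less_mult_iff)
    qed
    have "emeasure lborel {x\<in>space lborel. d < cmod (herglotz f (Complex x (1 / Suc n)) - herglotz f (Complex x (1 / Suc m)))}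
       \<le> emeasure lborel ({x. d' < cmod (P n x - P m x)} \<union> ({x. d' < cmod (S n x)} \<union> {x. d' < cmod (S m x)}))"
    proof (intro emeasure_mono subsetI)
      fix x assume "x \<in> {x\<in>space lborel. d < cmod (herglotz f (Complex x (1 / Suc n)) - herglotz f (Complex x (1 / Suc m)))}"
      then have "d < cmod ((P n x + S n x) - (P m x + S m x))" by (simp only: PS mem_Collect_eq)
      then have "d < cmod ((P n x - P m x) + (S n x - S m x))" by (simp add: algebra_simps)
      also have "\<dots> \<le> cmod (P n x - P m x) + (cmod (S n x) + cmod (S m x))"
        by (intro order_trans[OF norm_triangle_ineq] add_left_mono norm_triangle_ineq4)
      finally show "x \<in> {x. d' < cmod (P n x - P m x)} \<union> ({x. d' < cmod (S n x)} \<union> {x. d' < cmod (S m x)})"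
        by (auto simp: d'_def not_less)
    qed auto
    also have "\<dots> \<le> emeasure lborel {x. d' < cmod (P n x - P m x)} + (emeasure lborel {x. d' < cmod (S n x)} + emeasure lborel {x. d' < cmod (S m x)})"
      by (intro order_trans[OF emeasure_subadditive] add_left_mono emeasure_subadditive) auto
    also have "\<dots> \<le> ennreal (\<eta> / 2) + (ennreal (\<eta> / 4) + ennreal (\<eta> / 4))" by (intro add_mono P S)
    also have "\<dots> = ennreal \<eta>" using eta by (simp add: ennreal_plus[symmetric] del: ennreal_plus)
    finally show "emeasure lborel {x\<in>space lborel. d < cmod (herglotz f (Complex x (1 / Suc n)) - herglotz f (Complex x (1 / Suc m)))} \<le> ennreal \<eta>" .
  qed
qed

text \<open>
  Convergence in measure provides a limit almost everywhere along a sequence \<open>s k\<close> of heights. The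
  bounded function \<open>Q = 1 / (1 + herglotz f)\<close> at height \<open>y + s k\<close> is the Poisson average of \<open>Q\<close> at
  height \<open>s k\<close>; for \<open>k \<rightarrow> \<infinity>\<close> it becomes the Poisson average of the boundary function \<open>Q0\<close>, which
  converges to \<open>Q0\<close> at its Lebesgue points as \<open>y \<rightarrow> 0\<close>. As the sequential limit of the transform is finite,
  \<open>Q0\<close> does not vanish, and the limit of \<open>Q\<close> can be inverted.
\<close>

theorem AE_herglotz_boundary_limit:
  "AE x in lborel. \<exists>L. ((\<lambda>y. herglotz f (Complex x y)) \<longlongrightarrow> L) (at_right 0)"
proof -
  define F where "F n x = herglotz f (Complex x (1 / Suc n))" for n x
  have [measurable]: "F n \<in> borel_measurable borel" for n
    unfolding F_def using herglotz_measurable[of "1 / Suc n"] by simp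
  obtain r :: "nat \<Rightarrow> nat" where r: "strict_mono r" and conv: "AE x in lborel. convergent (\<lambda>k. F (r k) x)"
    using AE_convergent_subseq_of_Cauchy_in_measure[of F lborel] herglotz_Cauchy_in_measure
    unfolding F_def[symmetric] by auto
  define Q where "Q z = 1 / (1 + herglotz f z)" for z
  have Re1: "1 \<le> Re (1 + herglotz f z)" if "0 < Im z" for z using herglotz_Re_nonneg[OF that] by simp
  have nz: "1 + herglotz f z \<noteq> 0" if "0 < Im z" for z
  proof
    assume "1 + herglotz f z = 0" then have "Re (1 + herglotz f z) = 0" by simp
    then show False using Re1[OF that] by simp
  qed
  have Q1: "cmod (Q z) \<le> 1" if "0 < Im z" for z
    using complex_Re_le_cmod[of "1 + herglotz f z"] Re1[OF that] by (simp add: Q_def norm_divide divide_le_eq_1)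
  have Qhol: "Q holomorphic_on {z. 0 < Im z}"
    unfolding Q_def using nz by (intro holomorphic_intros herglotz_holomorphic) auto
  define s where "s k = 1 / real (Suc (r k))" for k
  have s0: "0 < s k" for k by (simp add: s_def)
  have sl: "s \<longlonglongrightarrow> 0"
    using LIMSEQ_subseq_LIMSEQ[OF LIMSEQ_inverse_real_of_nat r] by (simp add: s_def[abs_def] inverse_eq_divide o_def)
  define l where "l x = lim (\<lambda>k. Q (Complex x (s k)))" for x
  have Qm [measurable]: "(\<lambda>x. Q (Complex x (s k))) \<in> borel_measurable borel" for k
    unfolding Q_def using herglotz_measurable[OF s0[of k]] by measurable
  have [measurable]: "l \<in> borel_measurable borel"
    unfolding l_def by (rule borel_measurable_lim_metric) (rule Qm)
  \<comment> \<open>Where the limit does not exist, \<open>l\<close> is arbitrary; \<open>Q0\<close> has to be bounded everywhere.\<close>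
  define Q0 where "Q0 x = (if cmod (l x) \<le> 1 then l x else 0)" for x
  have [measurable]: "Q0 \<in> borel_measurable borel" unfolding Q0_def by measurable
  have Q01: "cmod (Q0 x) \<le> 1" for x by (simp add: Q0_def)
  have lim0: "AE x in lborel. (\<lambda>k. Q (Complex x (s k))) \<longlonglongrightarrow> Q0 x \<and> Q0 x \<noteq> 0"
    using conv
  proof (rule AE_mp, intro AE_I2 impI)
    fix x assume "convergent (\<lambda>k. F (r k) x)"
    then obtain F0 where F0: "(\<lambda>k. herglotz f (Complex x (s k))) \<longlonglongrightarrow> F0" by (auto simp: convergent_def F_def s_def)
    have "0 \<le> Re F0"
      by (rule LIMSEQ_le_const[OF tendsto_Re[OF F0]]) (use s0 herglotz_Re_nonneg in auto)
    then have nz0: "1 + F0 \<noteq> 0" by (auto simp: complex_eq_iff)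
    have 1: "(\<lambda>k. Q (Complex x (s k))) \<longlonglongrightarrow> 1 / (1 + F0)"
      unfolding Q_def using nz0 by (intro tendsto_intros F0) auto
    then have l: "l x = 1 / (1 + F0)" unfolding l_def by (rule limI)
    have "cmod (1 / (1 + F0)) \<le> 1" using s0 by (intro LIMSEQ_le_const2[OF tendsto_norm[OF 1]]) (auto intro!: exI Q1)
    then show "(\<lambda>k. Q (Complex x (s k))) \<longlonglongrightarrow> Q0 x \<and> Q0 x \<noteq> 0" using 1 l nz0 by (simp add: Q0_def)
  qed
  have rep: "Q (Complex x y) * of_real pi = (\<integral>t. Q0 t * of_real (poisson_kernel y (t - x)) \<partial>lborel)" if y: "0 < y" for x y
  proof (rule LIMSEQ_unique)
    have shift: "Q (Complex x (y + s k)) * of_real pi = (\<integral>t. Q (Complex t (s k)) * of_real (poisson_kernel y (t - x)) \<partial>lborel)" for k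
    proof -
      define q where "q z = Q (z + \<i> * of_real (s k))" for z
      have "(Q \<circ> (\<lambda>z. z + \<i> * of_real (s k))) holomorphic_on {z. - s k < Im z}"
        by (intro holomorphic_on_compose_gen[OF _ Qhol]) (auto intro!: holomorphic_intros)
      then have "q holomorphic_on {z. - s k < Im z}" by (simp add: q_def[abs_def] o_def)
      moreover have "cmod (q z) \<le> 1" if "0 \<le> Im z" for z unfolding q_def using that s0[of k] by (intro Q1) simp
      ultimately have "q (Complex x y) * of_real pi = (\<integral>t. q (complex_of_real t) * of_real (poisson_kernel y (t - x)) \<partial>lborel)"
        using s0 y by (intro poisson_formula[of "s k" q 1]) auto
      moreover have "q (Complex x y) = Q (Complex x (y + s k))" "\<And>t. q (complex_of_real t) = Q (Complex t (s k))"
        by (simp_all add: q_def Complex_eq algebra_simps)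
      ultimately show ?thesis by simp
    qed
    have "isCont Q (Complex x y)"
      using Qhol y by (intro holomorphic_on_imp_continuous_on[THEN continuous_on_interior]) (auto simp: interior_open open_halfspace_Im_gt)
    moreover have "(\<lambda>k. Complex x (y + s k)) \<longlonglongrightarrow> Complex x (y + 0)"
      by (intro tendsto_Complex tendsto_add tendsto_const sl)
    ultimately show "(\<lambda>k. Q (Complex x (y + s k)) * of_real pi) \<longlonglongrightarrow> Q (Complex x y) * of_real pi"
      by (intro tendsto_mult tendsto_const isCont_tendsto_compose[where g=Q]) auto
    show "(\<lambda>k. Q (Complex x (y + s k)) * of_real pi) \<longlonglongrightarrow> (\<integral>t. Q0 t * of_real (poisson_kernel y (t - x)) \<partial>lborel)"
      unfolding shift
    proof (rule integral_dominated_convergence[where w="\<lambda>t. poisson_kernel y (t - x)"])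
      show "AE t in lborel. (\<lambda>k. Q (Complex t (s k)) * of_real (poisson_kernel y (t - x))) \<longlonglongrightarrow> Q0 t * of_real (poisson_kernel y (t - x))"
        using lim0 by (rule AE_mp) (auto intro!: AE_I2 tendsto_intros)
      show "AE t in lborel. cmod (Q (Complex t (s k)) * of_real (poisson_kernel y (t - x))) \<le> poisson_kernel y (t - x)" for k
        using Q1[of "Complex _ (s k)"] s0[of k] poisson_kernel_nonneg[OF y]
        by (intro AE_I2) (auto simp: norm_mult intro!: mult_left_le_one_le)
    qed (use integrable_poisson_kernel[OF y] in auto)
  qed
  have "AE x in lborel. lebesgue_point Q0 x"
  proof (rule AE_lebesgue_point)
    fix n :: nat
    have "integrable lborel (indicator {-real n..real n} :: real \<Rightarrow> real)" by (auto simp: emeasure_lborel_Icc)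
    then show "integrable lborel (\<lambda>x. indicator {-real n..real n} x * Q0 x)"
      by (rule Bochner_Integration.integrable_bound) (use Q01 in \<open>auto simp: indicator_def\<close>)
  qed simp
  with lim0 show ?thesis
  proof eventually_elim
    case (elim x)
    then have lp: "lebesgue_point Q0 x" and Q0nz: "Q0 x \<noteq> 0" by auto
    have ave: "((\<lambda>y. \<integral>\<^sup>+t. ennreal (cmod (Q0 t - Q0 x) * poisson_kernel y (t - x)) \<partial>lborel) \<longlongrightarrow> 0) (at_right 0)"
    proof (rule poisson_average_tendsto_0)
      fix \<eta> :: real assume "0 < \<eta>"
      then show "\<exists>\<delta>>0. \<forall>r. 0 < r \<and> r < \<delta> \<longrightarrow> (\<integral>\<^sup>+t\<in>ball x r. ennreal (cmod (Q0 t - Q0 x)) \<partial>lborel) \<le> ennreal (\<eta> * r)"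
        using lp unfolding lebesgue_point_def by blast
    next
      have "(\<integral>\<^sup>+t. ennreal (cmod (Q0 t - Q0 x) * (1 / (1 + (t - x)\<^sup>2))) \<partial>lborel) \<le> (\<integral>\<^sup>+t. ennreal 2 * ennreal (poisson_kernel 1 (t - x)) \<partial>lborel)"
      proof (intro nn_integral_mono)
        fix t
        have "cmod (Q0 t - Q0 x) \<le> 2" using norm_triangle_ineq4[of "Q0 t" "Q0 x"] Q01[of t] Q01[of x] by simp
        then have "cmod (Q0 t - Q0 x) * (1 / (1 + (t - x)\<^sup>2)) \<le> 2 * poisson_kernel 1 (t - x)"
          unfolding poisson_kernel_def by (intro mult_mono) (auto simp: add.commute)
        then show "ennreal (cmod (Q0 t - Q0 x) * (1 / (1 + (t - x)\<^sup>2))) \<le> ennreal 2 * ennreal (poisson_kernel 1 (t - x))"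
          using poisson_kernel_nonneg[of 1] by (simp only: ennreal_mult[symmetric] zero_le_numeral zero_less_one ennreal_leI)
      qed
      also have "\<dots> < \<infinity>" by (simp add: nn_integral_cmult nn_integral_poisson_kernel ennreal_mult_less_top)
      finally show "(\<integral>\<^sup>+t. ennreal (cmod (Q0 t - Q0 x) * (1 / (1 + (t - x)\<^sup>2))) \<partial>lborel) < \<infinity>" .
    qed auto
    have "((\<lambda>y. Q (Complex x y) * of_real pi - Q0 x * of_real pi) \<longlongrightarrow> 0) (at_right 0)"
    proof (rule Lim_null_comparison)
      show "((\<lambda>y. enn2real (\<integral>\<^sup>+t. ennreal (cmod (Q0 t - Q0 x) * poisson_kernel y (t - x)) \<partial>lborel)) \<longlongrightarrow> 0) (at_right 0)"
        using ave by (intro tendsto_enn2real[where l=0, simplified])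
      have ev: "eventually (\<lambda>y. (\<integral>\<^sup>+t. ennreal (cmod (Q0 t - Q0 x) * poisson_kernel y (t - x)) \<partial>lborel) < 1) (at_right 0)"
        using ave by (rule order_tendstoD) simp
      have pos: "eventually (\<lambda>y::real. 0 < y) (at_right 0)" by (simp add: eventually_at_right_less)
      show "\<forall>\<^sub>F y in at_right 0. norm (Q (Complex x y) * of_real pi - Q0 x * of_real pi)
         \<le> enn2real (\<integral>\<^sup>+t. ennreal (cmod (Q0 t - Q0 x) * poisson_kernel y (t - x)) \<partial>lborel)"
        using ev pos
      proof eventually_elim
        case (elim y)
        then have y: "0 < y" by simp
        have i0: "integrable lborel (\<lambda>t. complex_of_real (poisson_kernel y (t - x)))" using integrable_poisson_kernel[OF y] by simp
        have i1: "integrable lborel (\<lambda>t. Q0 t * of_real (poisson_kernel y (t - x)))"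
          by (rule Bochner_Integration.integrable_bound[OF i0]) (use Q01 poisson_kernel_nonneg[OF y] in \<open>auto simp: norm_mult intro!: mult_left_le_one_le\<close>)
        have i3: "integrable lborel (\<lambda>t. (Q0 t - Q0 x) * of_real (poisson_kernel y (t - x)))"
          using i0 i1 by (simp add: left_diff_distrib)
        have "Q (Complex x y) * of_real pi - Q0 x * of_real pi = (\<integral>t. (Q0 t - Q0 x) * of_real (poisson_kernel y (t - x)) \<partial>lborel)"
          unfolding rep[OF y] using i0 i1 integral_poisson_kernel[OF y, of x] by (simp add: left_diff_distrib)
        then have "ennreal (norm (Q (Complex x y) * of_real pi - Q0 x * of_real pi)) \<le> (\<integral>\<^sup>+t. ennreal (norm ((Q0 t - Q0 x) * of_real (poisson_kernel y (t - x)))) \<partial>lborel)"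
          using integral_norm_bound_ennreal[OF i3] by simp
        also have "\<dots> = (\<integral>\<^sup>+t. ennreal (cmod (Q0 t - Q0 x) * poisson_kernel y (t - x)) \<partial>lborel)"
          using poisson_kernel_nonneg[OF y] by (simp add: norm_mult)
        finally have "ennreal (norm (Q (Complex x y) * of_real pi - Q0 x * of_real pi)) \<le> (\<integral>\<^sup>+t. ennreal (cmod (Q0 t - Q0 x) * poisson_kernel y (t - x)) \<partial>lborel)" .
        moreover have "(\<integral>\<^sup>+t. ennreal (cmod (Q0 t - Q0 x) * poisson_kernel y (t - x)) \<partial>lborel) < top"
          using elim(1) by (rule order.strict_trans) simp
        ultimately show ?case using enn2real_mono by fastforce
      qed
    qed
    then have "((\<lambda>y. Q (Complex x y) * of_real pi) \<longlongrightarrow> Q0 x * of_real pi) (at_right 0)" by (rule LIM_zero_cancel)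
    then have "((\<lambda>y. of_real pi / (Q (Complex x y) * of_real pi) - 1) \<longlongrightarrow> of_real pi / (Q0 x * of_real pi) - 1) (at_right 0)"
      using Q0nz by (intro tendsto_intros) auto
    then have "((\<lambda>y. herglotz f (Complex x y)) \<longlongrightarrow> of_real pi / (Q0 x * of_real pi) - 1) (at_right 0)"
      by (rule Lim_transform_eventually)
         (use nz in \<open>auto intro!: eventually_mono[OF eventually_at_right_less[of 0]] simp: Q_def\<close>)
    then show ?case by blast
  qed
qed

definition truncated :: "real \<Rightarrow> real \<Rightarrow> real" where
  "truncated e x = (\<integral>t. f t * (if e < \<bar>t - x\<bar> then 1 / (t - x) else 0) \<partial>lborel)"

lemma truncated_integrable: "0 < e \<Longrightarrow> integrable lborel (\<lambda>t. f t * (if e < \<bar>t - x\<bar> then 1 / (t - x) else 0))"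
proof (rule Bochner_Integration.integrable_bound[of _ "\<lambda>t. f t * (1 / e)"])
  assume e: "0 < e"
  have "\<bar>if e < \<bar>t - x\<bar> then 1 / (t - x) else 0\<bar> \<le> 1 / e" for t
    using e by (auto simp: frac_le)
  from mult_left_mono[OF this nonneg]
  show "AE t in lborel. norm (f t * (if e < \<bar>t - x\<bar> then 1 / (t - x) else 0)) \<le> norm (f t * (1 / e))"
    using e nonneg by (intro AE_I2) (simp add: abs_mult del: times_divide_eq_right)
qed (use integrable in auto)

text \<open>
  The difference of the kernels is odd and dominated by the Poisson kernel.
\<close>

theorem truncated_plus_herglotz_tendsto:
  assumes lp: "lebesgue_point (\<lambda>t. complex_of_real (f t)) x"
  shows "((\<lambda>e. truncated e x + Im (herglotz f (Complex x e))) \<longlongrightarrow> 0) (at_right 0)"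
proof -
  \<comment> \<open>The truncated kernel minus the conjugate Poisson kernel.\<close>
  define k where "k e s = (if e < \<bar>s\<bar> then 1 / s else 0) - s / (s\<^sup>2 + e\<^sup>2)" for e s :: real
  have [measurable]: "k e \<in> borel_measurable borel" for e unfolding k_def by measurable
  have kb: "\<bar>k e s\<bar> \<le> poisson_kernel e s" if e: "0 < e" for e s
  proof (cases "e < \<bar>s\<bar>")
    case True
    then have s: "s \<noteq> 0" and pos: "0 < s\<^sup>2 + e\<^sup>2" using e by (auto intro: add_nonneg_pos)
    have "k e s = (s\<^sup>2 + e\<^sup>2 - s * s) / (s * (s\<^sup>2 + e\<^sup>2))" using True s pos by (simp add: k_def diff_frac_eq)
    then have "k e s = (e / s) * (e / (s\<^sup>2 + e\<^sup>2))" by (simp add: power2_eq_square)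
    then have "\<bar>k e s\<bar> = (e / \<bar>s\<bar>) * (e / (s\<^sup>2 + e\<^sup>2))" using e pos by (simp add: abs_mult)
    also have "\<dots> \<le> 1 * (e / (s\<^sup>2 + e\<^sup>2))" using True e pos by (intro mult_right_mono) auto
    finally show ?thesis by (simp add: poisson_kernel_def)
  next
    case False
    have "0 < s\<^sup>2 + e\<^sup>2" using e by (auto intro: add_nonneg_pos)
    then show ?thesis using False by (auto simp: k_def poisson_kernel_def divide_right_mono)
  qed
  have k0: "(\<integral>t. k e (t - x) \<partial>lborel) = 0" if "0 < e" for e
  proof -
    have odd: "k e (- s) = - k e s" for s by (simp add: k_def)
    have "(\<integral>t. k e (t - x) \<partial>lborel) = (\<integral>t. k e (2 * x + (-1) * t - x) \<partial>lborel)"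
      by (subst lborel_integral_real_affine[of "-1" _ "2 * x"]) auto
    also have "\<dots> = (\<integral>t. - k e (t - x) \<partial>lborel)"
      by (intro Bochner_Integration.integral_cong refl, subst odd[symmetric]) (simp add: algebra_simps)
    finally show ?thesis by simp
  qed
  have "((\<lambda>e. \<integral>t. f t * k e (t - x) \<partial>lborel) \<longlongrightarrow> 0 * f x) (at_right 0)"
    by (rule kernel_integral_tendsto[OF lp]) (auto simp: kb k0)
  then have "((\<lambda>e. \<integral>t. f t * k e (t - x) \<partial>lborel) \<longlongrightarrow> 0) (at_right 0)" by simp
  then show ?thesis
  proof (rule Lim_transform_eventually)
    show "\<forall>\<^sub>F e in at_right 0. (\<integral>t. f t * k e (t - x) \<partial>lborel) = truncated e x + Im (herglotz f (Complex x e))"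
    proof (rule eventually_mono[OF eventually_at_right_less[of 0]])
      fix e :: real assume e: "0 < e"
      have i: "integrable lborel (\<lambda>t. f t * ((x - t) / ((x - t)\<^sup>2 + e\<^sup>2)))"
        using integrable_Im[OF herglotz_integrable[of "Complex x e"]] e by (simp add: Im_divide)
      show "(\<integral>t. f t * k e (t - x) \<partial>lborel) = truncated e x + Im (herglotz f (Complex x e))"
        unfolding truncated_def using e i truncated_integrable[OF e, of x]
        by (subst herglotz_Im, simp, subst Bochner_Integration.integral_add[symmetric])
           (auto intro!: Bochner_Integration.integral_cong simp: k_def power2_commute[of t x for t] algebra_simps minus_divide_left diff_divide_distrib)
    qed
  qed
qed

theorem AE_truncated_convergent: "AE x in lborel. \<exists>L. ((\<lambda>e. truncated e x) \<longlongrightarrow> L) (at_right 0)"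
  using AE_herglotz_boundary_limit AE_lebesgue_point_f
proof eventually_elim
  case (elim x)
  then obtain L where L: "((\<lambda>y. herglotz f (Complex x y)) \<longlongrightarrow> L) (at_right 0)" by blast
  have "((\<lambda>e. (truncated e x + Im (herglotz f (Complex x e))) - Im (herglotz f (Complex x e))) \<longlongrightarrow> 0 - Im L) (at_right 0)"
    by (intro tendsto_diff truncated_plus_herglotz_tendsto elim tendsto_Im L)
  then show ?case by auto
qed

text \<open>
  Fatou's lemma carries distribution estimates from the half-plane to the boundary.
\<close>

lemma emeasure_truncated_limit_le:
  assumes [measurable]: "H \<in> borel_measurable borel"
    and H: "AE x in lborel. ((\<lambda>e. truncated e x) \<longlongrightarrow> H x) (at_right 0)"
    and b: "\<And>y. 0 < y \<Longrightarrow> emeasure lborel {x. l < \<bar>Im (herglotz f (Complex x y))\<bar>} \<le> b"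
  shows "emeasure lborel {x. l < \<bar>H x\<bar>} \<le> b"
proof -
  define A where "A n = {x. l < \<bar>Im (herglotz f (Complex x (1 / Suc n)))\<bar>}" for n
  have [measurable]: "A n \<in> sets borel" for n
    unfolding A_def using herglotz_measurable[of "1 / Suc n"] by measurable
  have "AE x in lborel. indicator {x. l < \<bar>H x\<bar>} x \<le> (liminf (\<lambda>n. indicator (A n) x) :: ennreal)"
    using H AE_lebesgue_point_f
  proof eventually_elim
    case (elim x)
    have "((\<lambda>e. (truncated e x + Im (herglotz f (Complex x e))) - truncated e x) \<longlongrightarrow> 0 - H x) (at_right 0)"
      by (intro tendsto_diff truncated_plus_herglotz_tendsto elim)
    then have "((\<lambda>e. \<bar>Im (herglotz f (Complex x e))\<bar>) \<longlongrightarrow> \<bar>- H x\<bar>) (at_right 0)"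
      by (intro tendsto_rabs) simp
    then have lim: "(\<lambda>n. \<bar>Im (herglotz f (Complex x (1 / Suc n)))\<bar>) \<longlonglongrightarrow> \<bar>H x\<bar>"
      using tendsto_at_right_imp_inverse_Suc by fastforce
    show ?case
    proof (cases "l < \<bar>H x\<bar>")
      case True
      then have "eventually (\<lambda>n. 1 \<le> (indicator (A n) x :: ennreal)) sequentially"
        using order_tendstoD(1)[OF lim True] by (auto elim!: eventually_mono simp: A_def)
      then have "1 \<le> (liminf (\<lambda>n. indicator (A n) x) :: ennreal)" by (rule Liminf_bounded)
      then show ?thesis using True by simp
    qed simp
  qed
  then have "(\<integral>\<^sup>+x. indicator {x. l < \<bar>H x\<bar>} x \<partial>lborel) \<le> (\<integral>\<^sup>+x. liminf (\<lambda>n. indicator (A n) x) \<partial>lborel)"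
    by (rule nn_integral_mono_AE)
  moreover have "(\<integral>\<^sup>+x. indicator {x. l < \<bar>H x\<bar>} x \<partial>lborel) = emeasure lborel {x. l < \<bar>H x\<bar>}"
    by (rule nn_integral_indicator) simp
  ultimately have "emeasure lborel {x. l < \<bar>H x\<bar>} \<le> (\<integral>\<^sup>+x. liminf (\<lambda>n. indicator (A n) x) \<partial>lborel)" by simp
  also have "\<dots> \<le> liminf (\<lambda>n. \<integral>\<^sup>+x. indicator (A n) x \<partial>lborel)"
    by (rule nn_integral_liminf) auto
  also have "\<dots> = liminf (\<lambda>n. emeasure lborel (A n))" by simp
  also have "\<dots> \<le> liminf (\<lambda>n. b)"
    by (intro Liminf_mono always_eventually allI) (auto simp: A_def intro: b)
  also have "\<dots> = b" by (simp add: Liminf_const)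
  finally show ?thesis .
qed

end

section \<open>The finite Hilbert transform of integrable functions\<close>

abbreviation \<H> :: "(real \<Rightarrow> complex) \<Rightarrow> real \<Rightarrow> complex" where "\<H> \<equiv> finite_hilbert_transform"

definition pv_kernel :: "real \<Rightarrow> real \<Rightarrow> real" where
  "pv_kernel e s = (if e < \<bar>s\<bar> then 1 / s else 0)"

lemma pv_kernel_measurable [measurable]: "pv_kernel e \<in> borel_measurable borel"
  unfolding pv_kernel_def by measurable

lemma pv_kernel_bound: "0 < e \<Longrightarrow> \<bar>pv_kernel e s\<bar> \<le> 1 / e"
  by (auto simp: pv_kernel_def frac_le)

definition truncated_hilbert :: "(real \<Rightarrow> complex) \<Rightarrow> real \<Rightarrow> real \<Rightarrow> complex" where
  "truncated_hilbert h e t = of_real (1 / pi) * (\<integral>x. h x * of_real (pv_kernel e (x - t)) \<partial>mu)"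

lemma space_mu: "space mu = {-1<..<1}" by (simp add: space_restrict_space)

lemma emeasure_mu: "A \<in> sets borel \<Longrightarrow> A \<subseteq> {-1<..<1} \<Longrightarrow> emeasure mu A = emeasure lborel A"
  by (subst emeasure_restrict_space) auto

lemma emeasure_space_mu: "emeasure mu {-1<..<1} = 2"
  by (subst emeasure_mu) auto

lemma finite_measure_mu: "finite_measure mu"
  by (rule finite_measureI) (simp add: emeasure_space_mu space_mu)

lemma sets_mu_iff: "A \<in> sets mu \<longleftrightarrow> A \<in> sets borel \<and> A \<subseteq> {-1<..<1}"
  by (subst sets_restrict_space_iff) auto

lemma borel_imp_L0: "f \<in> borel_measurable borel \<Longrightarrow> f \<in> borel_measurable mu"
  by (rule measurable_restrict_space1) simp

lemma integrable_pv:
  assumes h: "integrable mu h" and e: "0 < e"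
  shows "integrable mu (\<lambda>x. h x * complex_of_real (pv_kernel e (x - t)))"
proof -
  have [measurable]: "h \<in> borel_measurable mu" using h by auto
  have [measurable]: "(\<lambda>x. pv_kernel e (x - t)) \<in> borel_measurable mu" by (rule borel_imp_L0) measurable
  have i: "integrable mu (\<lambda>x. h x * complex_of_real (1 / e))" using h by simp
  show ?thesis
    by (rule Bochner_Integration.integrable_bound[OF i])
       (use mult_left_mono[OF pv_kernel_bound[OF e] norm_ge_zero] e in \<open>auto simp: norm_mult norm_divide intro!: AE_I2\<close>)
qed

text \<open>
  The two integrals in the definition are combined into one with the kernel \<open>pv_kernel\<close>.
\<close>

lemma finite_hilbert_transform_eq_Lim:
  assumes h: "integrable mu h"
  shows "\<H> h t = Lim (at_right 0) (\<lambda>e. truncated_hilbert h e t)"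
proof -
  have eq: "(LINT x:{-1<..<t - e}|mu. h x / complex_of_real (x - t)) + (LINT x:{t + e<..<1}|mu. h x / complex_of_real (x - t))
     = (\<integral>x. h x * of_real (pv_kernel e (x - t)) \<partial>mu)" if e: "0 < e" for e
  proof -
    have [measurable]: "h \<in> borel_measurable mu" using h by auto
    have [measurable]: "(\<lambda>x. complex_of_real (x - t)) \<in> L0" "(\<lambda>x. indicator {-1<..<t - e} x :: real) \<in> borel_measurable mu"
      "(\<lambda>x. indicator {t + e<..<1} x :: real) \<in> borel_measurable mu"
      by (rule borel_imp_L0; measurable)+
    have m: "(\<lambda>x. indicator {-1<..<t - e} x *\<^sub>R (h x / complex_of_real (x - t))) \<in> borel_measurable mu"
      "(\<lambda>x. indicator {t + e<..<1} x *\<^sub>R (h x / complex_of_real (x - t))) \<in> borel_measurable mu"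
      by measurable
    have k: "\<bar>indicator A x * (1 / (x - t))\<bar> \<le> 1 / e" if "A \<subseteq> {x. e < \<bar>x - t\<bar>}" for A x
      using that e by (auto simp: indicator_def frac_le)
    have i: "integrable mu (\<lambda>x. h x * complex_of_real (1 / e))" using h by simp
    have a: "norm (indicator A x *\<^sub>R (h x / complex_of_real (x - t))) \<le> norm (h x * complex_of_real (1 / e))"
      if "A \<subseteq> {x. e < \<bar>x - t\<bar>}" for A x
    proof -
      have "indicator A x *\<^sub>R (h x / complex_of_real (x - t)) = h x * complex_of_real (indicator A x * (1 / (x - t)))"
        by (simp add: scaleR_conv_of_real)
      then show ?thesis using mult_left_mono[OF k[OF that, of x] norm_ge_zero[of "h x"]] e
        by (simp add: norm_mult del: of_real_mult of_real_divide times_divide_eq_right)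
    qed
    have 1: "integrable mu (\<lambda>x. indicator {-1<..<t - e} x *\<^sub>R (h x / complex_of_real (x - t)))"
      by (rule Bochner_Integration.integrable_bound[OF i m(1) AE_I2[OF a]]) auto
    have 2: "integrable mu (\<lambda>x. indicator {t + e<..<1} x *\<^sub>R (h x / complex_of_real (x - t)))"
      by (rule Bochner_Integration.integrable_bound[OF i m(2) AE_I2[OF a]]) auto
    show ?thesis
      unfolding set_lebesgue_integral_def Bochner_Integration.integral_add[symmetric, OF 1 2]
      by (intro Bochner_Integration.integral_cong refl) (use e in \<open>auto simp: indicator_def pv_kernel_def\<close>)
  qed
  have "\<forall>\<^sub>F e in at_right 0. complex_of_real (1 / pi) *
      ((LINT x:{-1<..<t - e}|mu. h x / complex_of_real (x - t)) + (LINT x:{t + e<..<1}|mu. h x / complex_of_real (x - t)))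
      = truncated_hilbert h e t"
    by (rule eventually_mono[OF eventually_at_right_less[of 0]]) (simp only: eq truncated_hilbert_def)
  then show ?thesis
    unfolding finite_hilbert_transform_def Topological_Spaces.Lim_def
    by (intro arg_cong[where f=The] ext tendsto_cong)
qed

lemma finite_hilbert_transform_eqI:
  assumes "integrable mu h" "((\<lambda>e. truncated_hilbert h e t) \<longlongrightarrow> L) (at_right 0)" shows "\<H> h t = L"
  unfolding finite_hilbert_transform_eq_Lim[OF assms(1)]
  by (rule tendsto_Lim[OF _ assms(2)]) simp

lemma truncated_hilbert_cong_AE:
  assumes [measurable]: "h \<in> L0" "g \<in> L0" and "AE x in mu. h x = g x"
  shows "truncated_hilbert h e t = truncated_hilbert g e t"
proof -
  have [measurable]: "(\<lambda>x. pv_kernel e (x - t)) \<in> borel_measurable mu" by (rule borel_imp_L0) measurable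
  show ?thesis
    unfolding truncated_hilbert_def using assms(3)
    by (intro arg_cong[where f="(*) (complex_of_real (1/pi))"] integral_cong_AE) auto
qed

lemma finite_hilbert_transform_cong_AE:
  assumes "integrable mu h" "g \<in> L0" "AE x in mu. h x = g x"
  shows "\<H> h = \<H> g"
proof
  fix t
  have hm: "h \<in> L0" using assms by auto
  have g: "integrable mu g"
    using assms integrable_cong_AE[of h mu g] hm by simp
  show "\<H> h t = \<H> g t"
    unfolding finite_hilbert_transform_eq_Lim[OF assms(1)] finite_hilbert_transform_eq_Lim[OF g]
      truncated_hilbert_cong_AE[OF hm assms(2,3)] ..
qed

lemma truncated_hilbert_add:
  assumes "integrable mu f" "integrable mu g" "0 < e"
  shows "truncated_hilbert (\<lambda>x. f x + g x) e t = truncated_hilbert f e t + truncated_hilbert g e t"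
  unfolding truncated_hilbert_def distrib_right
  by (simp add: integrable_pv assms add_divide_distrib)

lemma truncated_hilbert_mult:
  "truncated_hilbert (\<lambda>x. c * f x) e t = c * truncated_hilbert f e t"
  unfolding truncated_hilbert_def by (simp add: mult.assoc mult.left_commute)

lemma tendsto_truncated_add:
  assumes "integrable mu f" "integrable mu g"
    and "((\<lambda>e. truncated_hilbert f e t) \<longlongrightarrow> a) (at_right 0)" "((\<lambda>e. truncated_hilbert g e t) \<longlongrightarrow> b) (at_right 0)"
  shows "((\<lambda>e. truncated_hilbert (\<lambda>x. f x + g x) e t) \<longlongrightarrow> a + b) (at_right 0)"
  by (rule Lim_transform_eventually[OF tendsto_add[OF assms(3,4)]], rule eventually_mono[OF eventually_at_right_less[of 0]])
     (simp add: truncated_hilbert_add assms)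

lemma positive_density_extension:
  fixes f :: "real \<Rightarrow> real"
  assumes "integrable mu f" "\<And>x. x \<in> {-1<..<1} \<Longrightarrow> 0 \<le> f x"
  shows "positive_density (\<lambda>x. indicator {-1<..<1} x * f x)"
    "(\<integral>x. indicator {-1<..<1} x * f x \<partial>lborel) = (\<integral>x. f x \<partial>mu)"
proof -
  show "positive_density (\<lambda>x. indicator {-1<..<1} x * f x)"
  proof
    show "integrable lborel (\<lambda>x. indicator {-1<..<1} x * f x)"
      using assms(1) by (subst (asm) integrable_restrict_space) auto
  qed (use assms(2) in \<open>auto simp: indicator_def\<close>)
  show "(\<integral>x. indicator {-1<..<1} x * f x \<partial>lborel) = (\<integral>x. f x \<partial>mu)"
    by (subst integral_restrict_space) auto
qed

lemma truncated_hilbert_of_real: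
  assumes "integrable mu f" "\<And>x. x \<in> {-1<..<1} \<Longrightarrow> 0 \<le> f x"
  shows "truncated_hilbert (\<lambda>x. complex_of_real (f x)) e t
    = of_real (positive_density.truncated (\<lambda>x. indicator {-1<..<1} x * f x) e t / pi)"
proof -
  interpret positive_density "\<lambda>x. indicator {-1<..<1} x * f x" using assms by (rule positive_density_extension)
  have "(\<integral>x. complex_of_real (f x) * of_real (pv_kernel e (x - t)) \<partial>mu) = of_real (\<integral>x. f x * pv_kernel e (x - t) \<partial>mu)"
    by (simp flip: of_real_mult)
  also have "(\<integral>x. f x * pv_kernel e (x - t) \<partial>mu) = truncated e t"
    unfolding truncated_def by (subst integral_restrict_space) (auto simp: pv_kernel_def mult.assoc)
  finally show ?thesis unfolding truncated_hilbert_def by simp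
qed

lemma AE_mu_iff: "(AE x in mu. P x) \<longleftrightarrow> (AE x in lborel. x \<in> {-1<..<1} \<longrightarrow> P x)"
  by (subst AE_restrict_space_iff) auto

lemma AE_mu_space: "AE x in mu. x \<in> {-1<..<1}" by (auto simp: AE_mu_iff)

lemma AE_truncated_hilbert_of_real:
  assumes "integrable mu f" "\<And>x. x \<in> {-1<..<1} \<Longrightarrow> 0 \<le> f x"
  shows "AE t in mu. \<exists>L. ((\<lambda>e. truncated_hilbert (\<lambda>x. complex_of_real (f x)) e t) \<longlongrightarrow> L) (at_right 0)"
proof -
  interpret positive_density "\<lambda>x. indicator {-1<..<1} x * f x" using assms by (rule positive_density_extension)
  have te: "truncated_hilbert (\<lambda>x. complex_of_real (f x)) e t = of_real (truncated e t / pi)" for e t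
    using assms by (rule truncated_hilbert_of_real)
  show ?thesis unfolding AE_mu_iff te
    using AE_truncated_convergent
  proof eventually_elim
    case (elim x)
    then obtain L where "((\<lambda>e. truncated e x) \<longlongrightarrow> L) (at_right 0)" by blast
    then have "((\<lambda>e. complex_of_real (truncated e x / pi)) \<longlongrightarrow> of_real (L / pi)) (at_right 0)"
      by (intro tendsto_intros) auto
    then show ?case by blast
  qed
qed

definition rpos :: "(real \<Rightarrow> real) \<Rightarrow> real \<Rightarrow> real" where "rpos f x = max (f x) 0"
definition rneg :: "(real \<Rightarrow> real) \<Rightarrow> real \<Rightarrow> real" where "rneg f x = max (- f x) 0"

lemma complex_parts:
  "h x = (complex_of_real (rpos (\<lambda>x. Re (h x)) x) + (-1) * complex_of_real (rneg (\<lambda>x. Re (h x)) x))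
       + (\<i> * complex_of_real (rpos (\<lambda>x. Im (h x)) x) + (- \<i>) * complex_of_real (rneg (\<lambda>x. Im (h x)) x))"
  by (auto simp: rpos_def rneg_def complex_eq_iff max_def)

lemma integrable_parts:
  fixes h :: "real \<Rightarrow> complex"
  assumes h: "integrable mu h"
  shows "integrable mu (rpos (\<lambda>x. Re (h x)))" "integrable mu (rneg (\<lambda>x. Re (h x)))"
    "integrable mu (rpos (\<lambda>x. Im (h x)))" "integrable mu (rneg (\<lambda>x. Im (h x)))"
  using h unfolding rpos_def[abs_def] rneg_def[abs_def] by (auto intro!: integrable_max)

lemma rpos_nonneg: "0 \<le> rpos f x" and rneg_nonneg: "0 \<le> rneg f x" by (auto simp: rpos_def rneg_def)

text \<open>
  A complex function is a combination of four nonnegative ones, whose principal values exist almost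
  everywhere.
\<close>

theorem AE_finite_hilbert_transform:
  assumes h: "integrable mu h"
  shows "AE t in mu. ((\<lambda>e. truncated_hilbert h e t) \<longlongrightarrow> \<H> h t) (at_right 0)"
proof -
  note i = integrable_parts[OF h]
  have ic: "integrable mu (\<lambda>x. c * complex_of_real (g x))" if "integrable mu g" for g and c :: complex using that by simp
  have "AE t in mu. \<exists>L. ((\<lambda>e. truncated_hilbert h e t) \<longlongrightarrow> L) (at_right 0)"
    using AE_truncated_hilbert_of_real[OF i(1) rpos_nonneg] AE_truncated_hilbert_of_real[OF i(2) rneg_nonneg]
      AE_truncated_hilbert_of_real[OF i(3) rpos_nonneg] AE_truncated_hilbert_of_real[OF i(4) rneg_nonneg]
  proof eventually_elim
    case (elim t)
    then obtain a b c d where L: "((\<lambda>e. truncated_hilbert (\<lambda>x. complex_of_real (rpos (\<lambda>x. Re (h x)) x)) e t) \<longlongrightarrow> a) (at_right 0)"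
      "((\<lambda>e. truncated_hilbert (\<lambda>x. complex_of_real (rneg (\<lambda>x. Re (h x)) x)) e t) \<longlongrightarrow> b) (at_right 0)"
      "((\<lambda>e. truncated_hilbert (\<lambda>x. complex_of_real (rpos (\<lambda>x. Im (h x)) x)) e t) \<longlongrightarrow> c) (at_right 0)"
      "((\<lambda>e. truncated_hilbert (\<lambda>x. complex_of_real (rneg (\<lambda>x. Im (h x)) x)) e t) \<longlongrightarrow> d) (at_right 0)"
      by blast
    have m: "((\<lambda>e. truncated_hilbert (\<lambda>x. k * g x) e t) \<longlongrightarrow> k * l) (at_right 0)"
      if "((\<lambda>e. truncated_hilbert g e t) \<longlongrightarrow> l) (at_right 0)" for k g l
      unfolding truncated_hilbert_mult using that by (intro tendsto_intros)
    have "((\<lambda>e. truncated_hilbert (\<lambda>x. (complex_of_real (rpos (\<lambda>x. Re (h x)) x) + (-1) * complex_of_real (rneg (\<lambda>x. Re (h x)) x))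
       + (\<i> * complex_of_real (rpos (\<lambda>x. Im (h x)) x) + (- \<i>) * complex_of_real (rneg (\<lambda>x. Im (h x)) x))) e t)
       \<longlongrightarrow> (a + (-1) * b) + (\<i> * c + (- \<i>) * d)) (at_right 0)"
      by (intro tendsto_truncated_add m L Bochner_Integration.integrable_add ic i) (use i in auto)
    then show ?case unfolding complex_parts[of h, symmetric] by blast
  qed
  then show ?thesis
    by (rule AE_mp) (auto intro!: AE_I2 simp: finite_hilbert_transform_eqI[OF h])
qed

lemma finite_hilbert_transform_add:
  assumes "integrable mu f" "integrable mu g"
  shows "AE t in mu. \<H> (\<lambda>x. f x + g x) t = \<H> f t + \<H> g t"
  using AE_finite_hilbert_transform[OF assms(1)] AE_finite_hilbert_transform[OF assms(2)]
  by eventually_elim (auto intro!: finite_hilbert_transform_eqI tendsto_truncated_add assms)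

lemma finite_hilbert_transform_mult:
  assumes "integrable mu f"
  shows "AE t in mu. \<H> (\<lambda>x. c * f x) t = c * \<H> f t"
  using AE_finite_hilbert_transform[OF assms]
  by eventually_elim (auto intro!: finite_hilbert_transform_eqI tendsto_intros simp: truncated_hilbert_mult assms)

lemma finite_hilbert_transform_diff:
  assumes "integrable mu f" "integrable mu g"
  shows "AE t in mu. \<H> (\<lambda>x. f x - g x) t = \<H> f t - \<H> g t"
proof -
  have "AE t in mu. \<H> (\<lambda>x. f x + (-1) * g x) t = \<H> f t + \<H> (\<lambda>x. (-1) * g x) t"
    using assms by (intro finite_hilbert_transform_add) auto
  with finite_hilbert_transform_mult[OF assms(2), of "-1"] show ?thesis
    by eventually_elim simp
qed

lemma finite_hilbert_transform_sum:
  assumes "finite I" "\<And>i. i \<in> I \<Longrightarrow> integrable mu (f i)"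
  shows "AE t in mu. \<H> (\<lambda>x. \<Sum>i\<in>I. f i x) t = (\<Sum>i\<in>I. \<H> (f i) t)"
  using assms
proof (induction I)
  case empty
  show ?case using finite_hilbert_transform_mult[of "\<lambda>x. 0" 0] by simp
next
  case (insert i I)
  have "AE t in mu. \<H> (\<lambda>x. f i x + (\<Sum>i\<in>I. f i x)) t = \<H> (f i) t + \<H> (\<lambda>x. \<Sum>i\<in>I. f i x) t"
    using insert by (intro finite_hilbert_transform_add) auto
  moreover have "AE t in mu. \<H> (\<lambda>x. \<Sum>i\<in>I. f i x) t = (\<Sum>i\<in>I. \<H> (f i) t)" using insert by auto
  ultimately show ?case by eventually_elim (simp add: insert(1,2))
qed

lemma truncated_hilbert_measurable:
  assumes [measurable]: "h \<in> L0" shows "truncated_hilbert h e \<in> borel_measurable borel"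
proof -
  interpret finite_measure mu by (rule finite_measure_mu)
  have "(\<lambda>t. \<integral>x. h x * of_real (pv_kernel e (x - t)) \<partial>mu) \<in> borel_measurable borel"
  proof (rule borel_measurable_lebesgue_integral)
    have [measurable]: "(\<lambda>p. snd p) \<in> borel_measurable (borel \<Otimes>\<^sub>M mu)"
      using measurable_compose[OF measurable_snd borel_imp_L0[OF measurable_ident]] by (simp add: id_def)
    have [measurable]: "(\<lambda>p. pv_kernel e (snd p - fst p)) \<in> borel_measurable (borel \<Otimes>\<^sub>M mu)"
      by measurable
    show "(\<lambda>(t, x). h x * complex_of_real (pv_kernel e (x - t))) \<in> borel_measurable (borel \<Otimes>\<^sub>M mu)"
      by (simp add: split_beta')
  qed
  then show ?thesis unfolding truncated_hilbert_def[abs_def] by measurable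
qed

text \<open>
  Approaching \<open>e\<close> from above makes the truncated kernels converge at every point, the end points
  included; so rational radii determine all truncations.
\<close>

lemma truncated_hilbert_right_continuous:
  assumes h: "integrable mu h" and e: "0 < e" and q: "q \<longlonglongrightarrow> e" "\<And>n. e \<le> q n"
  shows "(\<lambda>n. truncated_hilbert h (q n) t) \<longlonglongrightarrow> truncated_hilbert h e t"
  unfolding truncated_hilbert_def
proof (intro tendsto_mult tendsto_const integral_dominated_convergence[where w="\<lambda>x. norm (h x) * (1 / e)"])
  have [measurable]: "h \<in> L0" using h by auto
  have [measurable]: "(\<lambda>x. pv_kernel e (x - t)) \<in> borel_measurable mu" for e by (rule borel_imp_L0) measurable
  show "(\<lambda>x. h x * complex_of_real (pv_kernel e (x - t))) \<in> borel_measurable mu"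
    "(\<lambda>x. h x * complex_of_real (pv_kernel (q n) (x - t))) \<in> borel_measurable mu" for n by measurable
  show "integrable mu (\<lambda>x. norm (h x) * (1 / e))" using h by simp
  show "AE x in mu. (\<lambda>n. h x * complex_of_real (pv_kernel (q n) (x - t))) \<longlonglongrightarrow> h x * complex_of_real (pv_kernel e (x - t))"
  proof (intro AE_I2 tendsto_mult tendsto_const tendsto_of_real)
    fix x
    show "(\<lambda>n. pv_kernel (q n) (x - t)) \<longlonglongrightarrow> pv_kernel e (x - t)"
    proof (cases "e < \<bar>x - t\<bar>")
      case True
      show ?thesis
        by (rule tendsto_eventually, rule eventually_mono[OF order_tendstoD(2)[OF q(1) True]]) (use True in \<open>simp add: pv_kernel_def\<close>)
    next
      case False
      then have "pv_kernel (q n) (x - t) = 0" "pv_kernel e (x - t) = 0" for n using q(2)[of n] by (auto simp: pv_kernel_def)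
      then show ?thesis by simp
    qed
  qed
  show "AE x in mu. norm (h x * complex_of_real (pv_kernel (q n) (x - t))) \<le> norm (h x) * (1 / e)" for n
  proof (intro AE_I2)
    fix x
    have "\<bar>pv_kernel (q n) (x - t)\<bar> \<le> 1 / q n" using q(2)[of n] e by (intro pv_kernel_bound) auto
    also have "\<dots> \<le> 1 / e" using q(2)[of n] e by (auto simp: frac_le)
    finally show "norm (h x * complex_of_real (pv_kernel (q n) (x - t))) \<le> norm (h x) * (1 / e)"
      by (simp add: norm_mult mult_left_mono del: times_divide_eq_right)
  qed
qed

text \<open>
  By right continuity the limit exists exactly where a Cauchy condition over rational radii holds,
  and this set is Borel. Off it, \<open>Lim\<close> is the constant \<open>THE L. False\<close>.
\<close>

theorem finite_hilbert_transform_measurable: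
  assumes h: "integrable mu h" shows "\<H> h \<in> L0"
proof -
  have hm: "h \<in> L0" using h by auto
  define S where "S = truncated_hilbert h"
  have [measurable]: "S e \<in> borel_measurable borel" for e unfolding S_def by (rule truncated_hilbert_measurable[OF hm])
  define I where "I n = \<rat> \<inter> {0<..<1 / real (Suc n)}" for n
  define C where "C = {t. \<forall>k::nat. \<exists>n::nat. \<forall>p\<in>I n. \<forall>q\<in>I n. cmod (S p t - S q t) \<le> 1 / real (Suc k)}"
  have [measurable]: "C \<in> sets borel"
  proof -
    have "C = (\<Inter>k. \<Union>n. \<Inter>p\<in>I n. \<Inter>q\<in>I n. {t. cmod (S p t - S q t) \<le> 1 / real (Suc k)})"
      by (simp add: C_def set_eq_iff)
    also have "\<dots> \<in> sets borel"
    proof -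
      have cI: "countable (I n)" for n by (simp add: I_def countable_Int1 countable_rat)
      have U: "UNIV \<in> sets (borel :: real measure)" by simp
      have m: "{t. cmod (S p t - S q t) \<le> 1 / real (Suc k)} \<in> sets borel" for p q k by measurable
      have "(\<Inter>p\<in>I n. \<Inter>q\<in>I n. {t. cmod (S p t - S q t) \<le> 1 / real (Suc k)}) \<in> sets borel" for k n
        by (rule sets.countable_INT''[OF U cI sets.countable_INT''[OF U cI m]])
      then have "(\<Union>n. \<Inter>p\<in>I n. \<Inter>q\<in>I n. {t. cmod (S p t - S q t) \<le> 1 / real (Suc k)}) \<in> sets borel" for k
        by (intro sets.countable_UN'') simp_all
      then show ?thesis by (intro sets.countable_INT''[OF U]) simp_all
    qed
    finally show ?thesis .
  qed
  have CL: "(\<exists>L. ((\<lambda>e. S e t) \<longlongrightarrow> L) (at_right 0)) \<longleftrightarrow> t \<in> C" for t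
  proof
    assume "\<exists>L. ((\<lambda>e. S e t) \<longlongrightarrow> L) (at_right 0)"
    then obtain L where L: "((\<lambda>e. S e t) \<longlongrightarrow> L) (at_right 0)" by blast
    show "t \<in> C" unfolding C_def
    proof (intro CollectI allI)
      fix k :: nat
      have "eventually (\<lambda>e. dist (S e t) L < 1 / (2 * Suc k)) (at_right 0)" using L by (rule tendstoD) simp
      then obtain b where b: "0 < b" "\<And>e. 0 < e \<Longrightarrow> e < b \<Longrightarrow> dist (S e t) L < 1 / (2 * Suc k)"
        unfolding eventually_at_right_field by auto
      obtain n where n: "1 / real (Suc n) < b" using reals_Archimedean[OF b(1)] by (auto simp: inverse_eq_divide)
      show "\<exists>n::nat. \<forall>p\<in>I n. \<forall>q\<in>I n. cmod (S p t - S q t) \<le> 1 / real (Suc k)"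
      proof (intro exI[of _ n] ballI)
        fix p q assume "p \<in> I n" "q \<in> I n"
        then have "dist (S p t) L < 1 / (2 * Suc k)" "dist (S q t) L < 1 / (2 * Suc k)" using b n by (auto simp: I_def)
        then have "dist (S p t) (S q t) < 1 / (2 * Suc k) + 1 / (2 * Suc k)"
          by (meson add_strict_mono dist_triangle2 le_less_trans)
        also have "\<dots> = 1 / real (Suc k)" by (simp add: field_simps)
        finally show "cmod (S p t - S q t) \<le> 1 / real (Suc k)" by (simp add: dist_norm)
      qed
    qed
  next
    assume t: "t \<in> C"
    have cl: "\<exists>n::nat. \<forall>a b. 0 < a \<longrightarrow> a < 1 / real (Suc n) \<longrightarrow> 0 < b \<longrightarrow> b < 1 / real (Suc n) \<longrightarrow> cmod (S a t - S b t) \<le> 1 / real (Suc k)" for k :: nat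
    proof -
      obtain n :: nat where n: "\<And>p q. p\<in>I n \<Longrightarrow> q\<in>I n \<Longrightarrow> cmod (S p t - S q t) \<le> 1 / real (Suc k)"
        using t unfolding C_def by blast
      have appr: "\<exists>q. (\<forall>i. q i \<in> I n) \<and> (\<lambda>i. S (q i) t) \<longlonglongrightarrow> S a t" if a: "0 < a" "a < 1 / real (Suc n)" for a
      proof -
        have "\<forall>i::nat. \<exists>q. q \<in> \<rat> \<and> a < q \<and> q < min (a + 1 / real (Suc i)) (1 / real (Suc n))"
        proof
          fix i :: nat
          have "a < min (a + 1 / real (Suc i)) (1 / real (Suc n))" using a by simp
          from Rats_dense_in_real[OF this]
          show "\<exists>q. q \<in> \<rat> \<and> a < q \<and> q < min (a + 1 / real (Suc i)) (1 / real (Suc n))" by blast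
        qed
        from choice[OF this] obtain q where q: "\<And>i. q i \<in> \<rat>" "\<And>i. a < q i" "\<And>i. q i < min (a + 1 / real (Suc i)) (1 / real (Suc n))" by blast
        have "(\<lambda>i. a + 1 / real (Suc i)) \<longlonglongrightarrow> a + 0"
          using tendsto_add[OF tendsto_const[of a] LIMSEQ_inverse_real_of_nat] by (simp only: inverse_eq_divide)
        then have l: "(\<lambda>i. a + 1 / real (Suc i)) \<longlonglongrightarrow> a" by simp
        have "a \<le> q i" "q i \<le> a + 1 / real (Suc i)" for i using q(2)[of i] q(3)[of i] by simp_all
        then have "q \<longlonglongrightarrow> a"
          by (rule real_tendsto_sandwich[OF always_eventually[OF allI] always_eventually[OF allI] tendsto_const l])
        then have "(\<lambda>i. S (q i) t) \<longlonglongrightarrow> S a t" unfolding S_def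
          using a q(2) by (intro truncated_hilbert_right_continuous h) (auto intro: less_imp_le)
        moreover have "q i \<in> I n" for i using q(1)[of i] q(2)[of i] q(3)[of i] a by (simp add: I_def)
        ultimately show ?thesis by blast
      qed
      show ?thesis
      proof (intro exI[of _ n] allI impI)
        fix a b assume ab: "0 < a" "a < 1 / real (Suc n)" "0 < b" "b < 1 / real (Suc n)"
        obtain q where q1: "\<And>i. q i \<in> I n" "(\<lambda>i. S (q i) t) \<longlonglongrightarrow> S a t" using appr[OF ab(1,2)] by blast
        obtain q' where q2: "\<And>i. q' i \<in> I n" "(\<lambda>i. S (q' i) t) \<longlonglongrightarrow> S b t" using appr[OF ab(3,4)] by blast
        note q = q1 q2
        have "(\<lambda>i. cmod (S (q i) t - S (q' i) t)) \<longlonglongrightarrow> cmod (S a t - S b t)"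
          by (intro tendsto_intros q)
        then show "cmod (S a t - S b t) \<le> 1 / real (Suc k)"
          by (rule LIMSEQ_le_const2) (intro exI[of _ 0] allI impI n q)
      qed
    qed
    have "cauchy_filter (filtermap (\<lambda>e. S e t) (at_right 0))"
      unfolding cauchy_filter_metric_filtermap
    proof (intro allI impI)
      fix \<epsilon> :: real assume "0 < \<epsilon>"
      then obtain k :: nat where k: "1 / real (Suc k) < \<epsilon>" using reals_Archimedean[of \<epsilon>] by (auto simp: inverse_eq_divide)
      obtain n :: nat where n: "\<forall>a b. 0 < a \<longrightarrow> a < 1 / real (Suc n) \<longrightarrow> 0 < b \<longrightarrow> b < 1 / real (Suc n) \<longrightarrow> cmod (S a t - S b t) \<le> 1 / real (Suc k)"
        using cl by blast
      show "\<exists>P. eventually P (at_right 0) \<and> (\<forall>x y. P x \<and> P y \<longrightarrow> dist (S x t) (S y t) < \<epsilon>)"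
      proof (intro exI[of _ "\<lambda>e. 0 < e \<and> e < 1 / real (Suc n)"] conjI allI impI)
        show "\<forall>\<^sub>F e in at_right 0. 0 < e \<and> e < 1 / real (Suc n)"
          unfolding eventually_at_right_field by (intro exI[of _ "1 / real (Suc n)"]) auto
        show "dist (S x t) (S y t) < \<epsilon>" if "(0 < x \<and> x < 1 / real (Suc n)) \<and> (0 < y \<and> y < 1 / real (Suc n))" for x y
          using n[rule_format, of x y] that k by (simp add: dist_norm)
      qed
    qed
    moreover have "filtermap (\<lambda>e. S e t) (at_right 0) \<noteq> bot" by (simp add: filtermap_bot_iff)
    moreover have "filtermap (\<lambda>e. S e t) (at_right 0) \<le> principal UNIV" by simp
    ultimately have "\<exists>L. filtermap (\<lambda>e. S e t) (at_right 0) \<le> nhds L"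
      using complete_UNIV[unfolded complete_uniform] by blast
    then show "\<exists>L. ((\<lambda>e. S e t) \<longlongrightarrow> L) (at_right 0)" by (simp add: filterlim_def)
  qed
  have eq: "\<H> h t = (if t \<in> C then lim (\<lambda>n. S (1 / Suc n) t) else (THE L. False))" for t
  proof (cases "t \<in> C")
    case True
    then obtain L where L: "((\<lambda>e. S e t) \<longlongrightarrow> L) (at_right 0)" using CL by blast
    then have "\<H> h t = L" using h unfolding S_def by (intro finite_hilbert_transform_eqI)
    moreover have "lim (\<lambda>n. S (1 / Suc n) t) = L"
      using tendsto_at_right_imp_inverse_Suc[OF L] by (rule limI)
    ultimately show ?thesis using True by simp
  next
    case False
    then have "\<And>L. \<not> ((\<lambda>e. S e t) \<longlongrightarrow> L) (at_right 0)" using CL by blast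
    then show ?thesis using False by (simp add: finite_hilbert_transform_eq_Lim[OF h] Topological_Spaces.Lim_def S_def)
  qed
  have "(\<lambda>t. lim (\<lambda>n. S (1 / Suc n) t)) \<in> borel_measurable borel"
    by (rule borel_measurable_lim_metric) simp
  then have "(\<lambda>t. if t \<in> C then lim (\<lambda>n. S (1 / Suc n) t) else (THE L. False)) \<in> borel_measurable borel"
    by measurable
  then show ?thesis unfolding eq[abs_def] by (rule borel_imp_L0)
qed

text \<open>
  Passage from the half-plane to the finite Hilbert transform; the factor \<open>\<pi>\<close> is the normalisation of
  the latter.
\<close>

lemma emeasure_mu_le_of_real:
  assumes f: "integrable mu f" "\<And>x. x \<in> {-1<..<1} \<Longrightarrow> 0 \<le> f x"
    and b: "\<And>y. 0 < y \<Longrightarrow> emeasure lborel {x. pi * l < \<bar>Im (herglotz (\<lambda>x. indicator {-1<..<1} x * f x) (Complex x y))\<bar>} \<le> b"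
  shows "emeasure mu {x\<in>space mu. l < cmod (\<H> (\<lambda>x. complex_of_real (f x)) x)} \<le> b"
proof -
  interpret positive_density "\<lambda>x. indicator {-1<..<1} x * f x" using f by (rule positive_density_extension)
  have te: "truncated_hilbert (\<lambda>x. complex_of_real (f x)) e t = of_real (truncated e t / pi)" for e t
    using f by (rule truncated_hilbert_of_real)
  have fi: "integrable mu (\<lambda>x. complex_of_real (f x))" using f by simp
  obtain H where [measurable]: "H \<in> borel_measurable borel" and H: "AE x in lborel. ((\<lambda>e. truncated e x) \<longlongrightarrow> H x) (at_right 0)"
  proof -
    define g where "g x = lim (\<lambda>n. truncated (1 / Suc n) x)" for x
    have tm: "truncated e \<in> borel_measurable borel" for e
      unfolding truncated_def[abs_def] by (rule lborel.borel_measurable_lebesgue_integral) measurable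
    have "g \<in> borel_measurable borel" unfolding g_def[abs_def] by (rule borel_measurable_lim_metric) (rule tm)
    moreover have "AE x in lborel. ((\<lambda>e. truncated e x) \<longlongrightarrow> g x) (at_right 0)"
      using AE_truncated_convergent
    proof eventually_elim
      case (elim x)
      then obtain L where L: "((\<lambda>e. truncated e x) \<longlongrightarrow> L) (at_right 0)" by blast
      from tendsto_at_right_imp_inverse_Suc[OF this] have "g x = L" unfolding g_def by (rule limI)
      with L show ?case by simp
    qed
    ultimately show thesis by (rule that)
  qed
  have ae: "AE x in mu. \<H> (\<lambda>x. complex_of_real (f x)) x = complex_of_real (H x / pi)"
    unfolding AE_mu_iff using H
  proof eventually_elim
    case (elim x)
    show ?case
    proof
      show "\<H> (\<lambda>x. complex_of_real (f x)) x = complex_of_real (H x / pi)"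
        by (rule finite_hilbert_transform_eqI[OF fi], unfold te) (intro tendsto_intros elim, simp)
    qed
  qed
  have [measurable]: "\<H> (\<lambda>x. complex_of_real (f x)) \<in> L0" by (rule finite_hilbert_transform_measurable[OF fi])
  have [measurable]: "H \<in> borel_measurable mu" by (rule borel_imp_L0) simp
  have "emeasure mu {x\<in>space mu. l < cmod (\<H> (\<lambda>x. complex_of_real (f x)) x)} = emeasure mu {x\<in>space mu. l < \<bar>H x\<bar> / pi}"
  proof (rule emeasure_eq_AE)
    show "AE x in mu. (x \<in> {x\<in>space mu. l < cmod (\<H> (\<lambda>x. complex_of_real (f x)) x)}) = (x \<in> {x\<in>space mu. l < \<bar>H x\<bar> / pi})"
      using ae by eventually_elim (simp add: norm_divide)
  qed measurable
  also have "{x\<in>space mu. l < \<bar>H x\<bar> / pi} = {x. pi * l < \<bar>H x\<bar>} \<inter> {-1<..<1}"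
    by (auto simp: field_simps space_mu)
  also have "emeasure mu \<dots> = emeasure lborel ({x. pi * l < \<bar>H x\<bar>} \<inter> {-1<..<1})"
    by (rule emeasure_mu) auto
  also have "\<dots> \<le> emeasure lborel {x. pi * l < \<bar>H x\<bar>}" by (rule emeasure_mono) auto
  also have "\<dots> \<le> b" by (rule emeasure_truncated_limit_le[OF _ H b]) auto
  finally show ?thesis .
qed

lemma weak_type_nonneg:
  assumes f: "integrable mu f" "\<And>x. x \<in> {-1<..<1} \<Longrightarrow> 0 \<le> f x" and l: "0 < l"
  shows "emeasure mu {x\<in>space mu. l < cmod (\<H> (\<lambda>x. complex_of_real (f x)) x)} \<le> ennreal (2 * (\<integral>x. f x \<partial>mu) / l)"
proof (rule emeasure_mu_le_of_real[OF f])
  interpret positive_density "\<lambda>x. indicator {-1<..<1} x * f x" using f by (rule positive_density_extension)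
  fix y :: real assume y: "0 < y"
  have [measurable]: "(\<lambda>x. herglotz (\<lambda>x. indicator {-1<..<1} x * f x) (Complex x y)) \<in> borel_measurable borel"
    by (rule herglotz_measurable[OF y])
  have "emeasure lborel {x. pi * l < \<bar>Im (herglotz (\<lambda>x. indicator {-1<..<1} x * f x) (Complex x y))\<bar>}
      \<le> emeasure lborel {x. pi * l < cmod (herglotz (\<lambda>x. indicator {-1<..<1} x * f x) (Complex x y))}"
    by (intro emeasure_mono) (auto intro: less_le_trans abs_Im_le_cmod)
  also have "\<dots> \<le> ennreal (2 * pi * mass / (pi * l))" using y l by (intro herglotz_weak_type) auto
  also have "mass = (\<integral>x. f x \<partial>mu)"
    unfolding mass_def using f by (rule positive_density_extension(2))
  also have "2 * pi * (\<integral>x. f x \<partial>mu) / (pi * l) = 2 * (\<integral>x. f x \<partial>mu) / l" by simp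
  finally show "emeasure lborel {x. pi * l < \<bar>Im (herglotz (\<lambda>x. indicator {-1<..<1} x * f x) (Complex x y))\<bar>}
      \<le> ennreal (2 * (\<integral>x. f x \<partial>mu) / l)" .
qed

lemma exponential_type_le_1:
  assumes f: "integrable mu f" "\<And>x. x \<in> {-1<..<1} \<Longrightarrow> 0 \<le> f x" "\<And>x. x \<in> {-1<..<1} \<Longrightarrow> f x \<le> 1" and l: "3 \<le> l"
  shows "emeasure mu {x\<in>space mu. l < cmod (\<H> (\<lambda>x. complex_of_real (f x)) x)} \<le> ennreal (4 * (\<integral>x. f x \<partial>mu) * exp (- l / 2))"
proof (rule emeasure_mu_le_of_real[OF f(1,2)])
  interpret positive_density "\<lambda>x. indicator {-1<..<1} x * f x" using f(1,2) by (rule positive_density_extension)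
  fix y :: real assume y: "0 < y"
  have pl: "3 * l \<le> pi * l" using pi_gt3 l by (intro mult_right_mono) auto
  have "emeasure lborel {x. pi * l < \<bar>Im (herglotz (\<lambda>x. indicator {-1<..<1} x * f x) (Complex x y))\<bar>}
      \<le> ennreal (4 * mass * exp (- (pi * l) / 4))"
    using y f(3) pl l by (intro herglotz_exponential_type) (auto simp: indicator_def intro: order_trans[OF _ pl])
  also have "\<dots> \<le> ennreal (4 * mass * exp (- l / 2))"
    using pl l mass_nonneg by (intro ennreal_leI mult_left_mono) auto
  also have "mass = (\<integral>x. f x \<partial>mu)" unfolding mass_def using f(1,2) by (rule positive_density_extension(2))
  finally show "emeasure lborel {x. pi * l < \<bar>Im (herglotz (\<lambda>x. indicator {-1<..<1} x * f x) (Complex x y))\<bar>}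
      \<le> ennreal (4 * (\<integral>x. f x \<partial>mu) * exp (- l / 2))" .
qed

lemma exponential_type:
  assumes f: "integrable mu f" "\<And>x. x \<in> {-1<..<1} \<Longrightarrow> 0 \<le> f x" "\<And>x. x \<in> {-1<..<1} \<Longrightarrow> f x \<le> a" and a: "0 < a" and l: "3 \<le> l"
  shows "emeasure mu {x\<in>space mu. a * l < cmod (\<H> (\<lambda>x. complex_of_real (f x)) x)} \<le> ennreal (4 * ((\<integral>x. f x \<partial>mu) / a) * exp (- l / 2))"
proof -
  have [measurable]: "\<H> (\<lambda>x. complex_of_real (f x)) \<in> L0" "\<H> (\<lambda>x. complex_of_real (f x / a)) \<in> L0"
    using f by (auto intro!: finite_hilbert_transform_measurable)
  have "AE x in mu. \<H> (\<lambda>x. complex_of_real (1 / a) * complex_of_real (f x)) x = complex_of_real (1 / a) * \<H> (\<lambda>x. complex_of_real (f x)) x"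
    using f by (intro finite_hilbert_transform_mult) auto
  then have "emeasure mu {x\<in>space mu. a * l < cmod (\<H> (\<lambda>x. complex_of_real (f x)) x)} = emeasure mu {x\<in>space mu. l < cmod (\<H> (\<lambda>x. complex_of_real (f x / a)) x)}"
  proof (intro emeasure_eq_AE, goal_cases)
    case 1 then show ?case
    proof eventually_elim
      case (elim x)
      then have "cmod (\<H> (\<lambda>x. complex_of_real (f x / a)) x) = cmod (\<H> (\<lambda>x. complex_of_real (f x)) x) / a"
        using a by (simp add: norm_divide)
      moreover have "(a * l < b) = (l < b / a)" for b using a by (simp add: field_simps)
      ultimately show ?case by simp
    qed
  qed measurable
  also have "\<dots> \<le> ennreal (4 * (\<integral>x. f x / a \<partial>mu) * exp (- l / 2))"
    using f a l by (intro exponential_type_le_1) (auto simp: divide_le_eq_1)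
  finally show ?thesis by simp
qed

lemma finite_hilbert_transform_parts:
  assumes h: "integrable mu h"
  shows "AE x in mu. \<H> h x = (\<H> (\<lambda>x. complex_of_real (rpos (\<lambda>x. Re (h x)) x)) x + (-1) * \<H> (\<lambda>x. complex_of_real (rneg (\<lambda>x. Re (h x)) x)) x)
     + (\<i> * \<H> (\<lambda>x. complex_of_real (rpos (\<lambda>x. Im (h x)) x)) x + (- \<i>) * \<H> (\<lambda>x. complex_of_real (rneg (\<lambda>x. Im (h x)) x)) x)"
proof -
  note i = integrable_parts[OF h]
  define A where "A = (\<lambda>x. complex_of_real (rpos (\<lambda>x. Re (h x)) x))"
  define B where "B = (\<lambda>x. complex_of_real (rneg (\<lambda>x. Re (h x)) x))"
  define C where "C = (\<lambda>x. complex_of_real (rpos (\<lambda>x. Im (h x)) x))"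
  define D where "D = (\<lambda>x. complex_of_real (rneg (\<lambda>x. Im (h x)) x))"
  have ic: "integrable mu A" "integrable mu B" "integrable mu C" "integrable mu D"
    using i by (simp_all add: A_def B_def C_def D_def)
  have hp: "h = (\<lambda>x. (A x + (-1) * B x) + (\<i> * C x + (- \<i>) * D x))"
    by (rule ext) (unfold A_def B_def C_def D_def, rule complex_parts)
  have "AE x in mu. \<H> h x = (\<H> A x + (-1) * \<H> B x) + (\<i> * \<H> C x + (- \<i>) * \<H> D x)"
  proof -
    have ics: "integrable mu (\<lambda>x. c * g x)" if "integrable mu g" for c :: complex and g using that by simp
    have "AE x in mu. \<H> (\<lambda>x. A x + (-1) * B x) x = \<H> A x + \<H> (\<lambda>x. (-1) * B x) x"
      "AE x in mu. \<H> (\<lambda>x. \<i> * C x + (- \<i>) * D x) x = \<H> (\<lambda>x. \<i> * C x) x + \<H> (\<lambda>x. (- \<i>) * D x) x"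
      by (intro finite_hilbert_transform_add ics ic)+
    moreover have "AE x in mu. \<H> h x = \<H> (\<lambda>x. A x + (-1) * B x) x + \<H> (\<lambda>x. \<i> * C x + (- \<i>) * D x) x"
      unfolding hp by (intro finite_hilbert_transform_add Bochner_Integration.integrable_add ics ic)
    ultimately show ?thesis
      using finite_hilbert_transform_mult[OF ic(2), of "-1"] finite_hilbert_transform_mult[OF ic(3), of \<i>]
        finite_hilbert_transform_mult[OF ic(4), of "- \<i>"]
      by eventually_elim (simp only:)
  qed
  then show ?thesis unfolding A_def B_def C_def D_def .
qed

theorem weak_type:
  assumes h: "integrable mu h" and l: "0 < l"
  shows "emeasure mu {x\<in>space mu. l < cmod (\<H> h x)} \<le> ennreal (16 * (\<integral>x. cmod (h x) \<partial>mu) / l)"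
proof -
  note i = integrable_parts[OF h]
  define A where "A = (\<lambda>x. complex_of_real (rpos (\<lambda>x. Re (h x)) x))"
  define B where "B = (\<lambda>x. complex_of_real (rneg (\<lambda>x. Re (h x)) x))"
  define C where "C = (\<lambda>x. complex_of_real (rpos (\<lambda>x. Im (h x)) x))"
  define D where "D = (\<lambda>x. complex_of_real (rneg (\<lambda>x. Im (h x)) x))"
  have ic: "integrable mu A" "integrable mu B" "integrable mu C" "integrable mu D"
    using i by (simp_all add: A_def B_def C_def D_def)
  have [measurable]: "\<H> h \<in> L0" "\<H> A \<in> L0" "\<H> B \<in> L0" "\<H> C \<in> L0" "\<H> D \<in> L0"
    by (intro finite_hilbert_transform_measurable h ic)+
  have lin: "AE x in mu. \<H> h x = (\<H> A x + (-1) * \<H> B x) + (\<i> * \<H> C x + (- \<i>) * \<H> D x)"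
    unfolding A_def B_def C_def D_def by (rule finite_hilbert_transform_parts[OF h])
  define m where "m f = 2 * (\<integral>x. f x \<partial>mu) / (l / 4)" for f :: "real \<Rightarrow> real"
  have w: "emeasure mu {x\<in>space mu. l / 4 < cmod (\<H> (\<lambda>x. complex_of_real (f x)) x)} \<le> ennreal (m f)"
    if "integrable mu f" "\<And>x. 0 \<le> f x" for f
    unfolding m_def using that l by (intro weak_type_nonneg) auto
  let ?S = "\<lambda>g. {x\<in>space mu. l / 4 < cmod (\<H> g x)}"
  have S: "?S A \<in> sets mu" "?S B \<in> sets mu" "?S C \<in> sets mu" "?S D \<in> sets mu" by measurable
  have "emeasure mu {x\<in>space mu. l < cmod (\<H> h x)} \<le> emeasure mu ((?S A \<union> ?S B) \<union> (?S C \<union> ?S D))"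
  proof (intro emeasure_mono_AE)
    show "AE x in mu. x \<in> {x\<in>space mu. l < cmod (\<H> h x)} \<longrightarrow> x \<in> (?S A \<union> ?S B) \<union> (?S C \<union> ?S D)"
      using lin
    proof eventually_elim
      case (elim x)
      have "cmod (\<H> h x) \<le> (cmod (\<H> A x) + cmod (\<H> B x)) + (cmod (\<H> C x) + cmod (\<H> D x))"
        unfolding elim by (intro norm_triangle_le add_mono) (auto simp: norm_mult)
      then show ?case by auto
    qed
  qed (intro sets.Un S)
  also have "\<dots> \<le> (emeasure mu (?S A) + emeasure mu (?S B)) + (emeasure mu (?S C) + emeasure mu (?S D))"
    by (intro order_trans[OF emeasure_subadditive] add_mono emeasure_subadditive sets.Un S)
  also have "\<dots> \<le> (ennreal (m (rpos (\<lambda>x. Re (h x)))) + ennreal (m (rneg (\<lambda>x. Re (h x))))) + (ennreal (m (rpos (\<lambda>x. Im (h x)))) + ennreal (m (rneg (\<lambda>x. Im (h x)))))"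
    unfolding A_def B_def C_def D_def by (intro add_mono w i rpos_nonneg rneg_nonneg)
  also have "\<dots> = ennreal ((m (rpos (\<lambda>x. Re (h x))) + m (rneg (\<lambda>x. Re (h x)))) + (m (rpos (\<lambda>x. Im (h x))) + m (rneg (\<lambda>x. Im (h x)))))"
  proof -
    have "0 \<le> m f" if "\<And>x. 0 \<le> f x" for f using that l unfolding m_def by (intro divide_nonneg_pos mult_nonneg_nonneg Bochner_Integration.integral_nonneg) auto
    then show ?thesis by (simp add: rpos_nonneg rneg_nonneg)
  qed
  also have "\<dots> \<le> ennreal (16 * (\<integral>x. cmod (h x) \<partial>mu) / l)"
  proof (rule ennreal_leI)
    have "(\<integral>x. rpos (\<lambda>x. Re (h x)) x + rneg (\<lambda>x. Re (h x)) x + (rpos (\<lambda>x. Im (h x)) x + rneg (\<lambda>x. Im (h x)) x) \<partial>mu) \<le> (\<integral>x. 2 * cmod (h x) \<partial>mu)"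
    proof (intro integral_mono)
      show "rpos (\<lambda>x. Re (h x)) x + rneg (\<lambda>x. Re (h x)) x + (rpos (\<lambda>x. Im (h x)) x + rneg (\<lambda>x. Im (h x)) x) \<le> 2 * cmod (h x)" for x
        using abs_Re_le_cmod[of "h x"] abs_Im_le_cmod[of "h x"] by (auto simp: rpos_def rneg_def max_def)
    qed (use i h in auto)
    then have "((\<integral>x. rpos (\<lambda>x. Re (h x)) x \<partial>mu) + (\<integral>x. rneg (\<lambda>x. Re (h x)) x \<partial>mu))
        + ((\<integral>x. rpos (\<lambda>x. Im (h x)) x \<partial>mu) + (\<integral>x. rneg (\<lambda>x. Im (h x)) x \<partial>mu)) \<le> 2 * (\<integral>x. cmod (h x) \<partial>mu)"
      using i h by simp
    then have "8 * (((\<integral>x. rpos (\<lambda>x. Re (h x)) x \<partial>mu) + (\<integral>x. rneg (\<lambda>x. Re (h x)) x \<partial>mu))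
        + ((\<integral>x. rpos (\<lambda>x. Im (h x)) x \<partial>mu) + (\<integral>x. rneg (\<lambda>x. Im (h x)) x \<partial>mu))) / l \<le> 8 * (2 * (\<integral>x. cmod (h x) \<partial>mu)) / l"
      using l by (intro divide_right_mono mult_left_mono) auto
    then show "(m (rpos (\<lambda>x. Re (h x))) + m (rneg (\<lambda>x. Re (h x)))) + (m (rpos (\<lambda>x. Im (h x))) + m (rneg (\<lambda>x. Im (h x))))
        \<le> 16 * (\<integral>x. cmod (h x) \<partial>mu) / l"
      unfolding m_def by (simp add: add_divide_distrib distrib_left)
  qed
  finally show ?thesis .
qed

text \<open>
  Along a subsequence with errors below \<open>4\<^sup>-\<^sup>k\<close> in \<open>L\<^sup>1\<close> the weak type estimate and the Borel-Cantelli
  lemma give convergence almost everywhere.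
\<close>

theorem AE_subseq_finite_hilbert_transform:
  assumes hn: "\<And>n. integrable mu (h n)" and h: "integrable mu g"
    and conv: "(\<lambda>n. \<integral>x. cmod (h n x - g x) \<partial>mu) \<longlonglongrightarrow> 0"
  shows "\<exists>r. strict_mono (r :: nat \<Rightarrow> nat) \<and> (AE x in mu. (\<lambda>n. \<H> (h (r n)) x) \<longlonglongrightarrow> \<H> g x)"
proof -
  interpret finite_measure mu by (rule finite_measure_mu)
  have "\<exists>N. \<forall>n\<ge>N. (\<integral>x. cmod (h n x - g x) \<partial>mu) < (1/4)^k" for k :: nat
    using order_tendstoD(2)[OF conv, of "(1/4)^k"] by (auto simp: eventually_sequentially)
  then obtain N where N: "\<And>k n. N k \<le> n \<Longrightarrow> (\<integral>x. cmod (h n x - g x) \<partial>mu) < (1/4)^k" by metis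
  define r where "r = rec_nat (N 0) (\<lambda>k a. max (Suc a) (N (Suc k)))"
  have r: "r 0 = N 0" "r (Suc k) = max (Suc (r k)) (N (Suc k))" for k by (auto simp: r_def)
  have sm: "strict_mono r" by (auto simp: strict_mono_Suc_iff r)
  have rN: "N k \<le> r k" for k by (cases k) (auto simp: r)
  have id: "integrable mu (\<lambda>x. h n x - g x)" for n using hn h by auto
  have [measurable]: "\<H> (\<lambda>x. h n x - g x) \<in> L0" for n by (rule finite_hilbert_transform_measurable[OF id])
  define A where "A k = {x\<in>space mu. (1/2)^k < cmod (\<H> (\<lambda>x. h (r k) x - g x) x)}" for k
  have [measurable]: "A k \<in> sets mu" for k unfolding A_def by measurable
  have Ak: "measure mu (A k) \<le> 16 * (1/2)^k" for k
  proof -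
    have "emeasure mu (A k) \<le> ennreal (16 * (\<integral>x. cmod (h (r k) x - g x) \<partial>mu) / (1/2)^k)"
      unfolding A_def by (rule weak_type[OF id]) simp
    also have "\<dots> \<le> ennreal (16 * (1/4)^k / (1/2)^k)"
      using N[OF rN[of k]] by (intro ennreal_leI divide_right_mono mult_left_mono) auto
    also have "16 * (1/4)^k / (1/2)^k = 16 * ((1/2)^k :: real)" by (simp add: power_divide field_simps flip: power_mult_distrib)
    finally show ?thesis by (simp add: emeasure_eq_measure)
  qed
  have "summable (\<lambda>k. measure mu (A k))"
    by (rule summable_comparison_test[of _ "\<lambda>k. 16 * (1/2)^k"]) (use Ak in \<open>auto intro!: summable_mult\<close>)
  then have "AE x in mu. eventually (\<lambda>k. x \<in> space mu - A k) sequentially"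
    by (intro borel_cantelli_AE1) (auto simp: emeasure_eq_measure)
  moreover have "AE x in mu. \<forall>k. \<H> (\<lambda>x. h (r k) x - g x) x = \<H> (h (r k)) x - \<H> g x"
    by (intro AE_all_countable[THEN iffD2] allI finite_hilbert_transform_diff hn h)
  ultimately have "AE x in mu. (\<lambda>n. \<H> (h (r n)) x) \<longlonglongrightarrow> \<H> g x"
    using AE_mu_space
  proof eventually_elim
    case (elim x)
    then have "eventually (\<lambda>k. norm (\<H> (h (r k)) x - \<H> g x) \<le> (1/2)^k) sequentially"
      by (auto elim!: eventually_mono simp: A_def)
    then have "(\<lambda>k. \<H> (h (r k)) x - \<H> g x) \<longlonglongrightarrow> 0"
      by (rule Lim_null_comparison) (simp add: LIMSEQ_realpow_zero)
    then show ?case by (rule LIM_zero_cancel)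
  qed
  with sm show ?thesis by blast
qed

text \<open>
  Because \<open>x / (x - t) = 1 + t / (x - t)\<close>.
\<close>

theorem finite_hilbert_transform_times_id:
  assumes h: "integrable mu h"
  shows "AE t in mu. \<H> (\<lambda>x. of_real x * h x) t = of_real t * \<H> h t + of_real (1 / pi) * (\<integral>x. h x \<partial>mu)"
proof -
  have [measurable]: "h \<in> L0" using h by auto
  have [measurable]: "(\<lambda>x::real. x) \<in> borel_measurable mu" by (rule borel_imp_L0) measurable
  have xh: "integrable mu (\<lambda>x. complex_of_real x * h x)"
    by (rule Bochner_Integration.integrable_bound[OF h]) (auto simp: norm_mult space_mu intro!: AE_I2 mult_left_le_one_le)
  show ?thesis using AE_finite_hilbert_transform[OF h] AE_finite_hilbert_transform[OF xh]
  proof eventually_elim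
    case (elim t)
    define s where "s n = 1 / real (Suc n)" for n
    have s0: "0 < s n" for n by (simp add: s_def)
    have sl: "s \<longlonglongrightarrow> 0" using LIMSEQ_inverse_real_of_nat by (simp add: s_def[abs_def] inverse_eq_divide)
    have sr: "filterlim s (at_right 0) sequentially" using sl s0 unfolding at_within_def by (auto simp: filterlim_inf filterlim_principal)
    have 1: "(\<lambda>n. truncated_hilbert h (s n) t) \<longlonglongrightarrow> \<H> h t" by (rule filterlim_compose[OF elim(1) sr])
    have 2: "(\<lambda>n. truncated_hilbert (\<lambda>x. of_real x * h x) (s n) t) \<longlonglongrightarrow> \<H> (\<lambda>x. of_real x * h x) t" by (rule filterlim_compose[OF elim(2) sr])
    have [measurable]: "(\<lambda>x. indicator {x. a < \<bar>x - t\<bar>} x :: real) \<in> borel_measurable mu" for a by (rule borel_imp_L0) measurable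
    have im: "integrable mu (\<lambda>x. indicator {x. a < \<bar>x - t\<bar>} x *\<^sub>R h x)" for a
      by (rule Bochner_Integration.integrable_bound[OF h]) (auto simp: indicator_def)
    have eq: "truncated_hilbert (\<lambda>x. of_real x * h x) (s n) t = of_real t * truncated_hilbert h (s n) t
       + of_real (1 / pi) * (\<integral>x. indicator {x. s n < \<bar>x - t\<bar>} x *\<^sub>R h x \<partial>mu)" for n
    proof -
      have "(\<integral>x. of_real x * h x * of_real (pv_kernel (s n) (x - t)) \<partial>mu)
         = (\<integral>x. of_real t * (h x * of_real (pv_kernel (s n) (x - t))) + indicator {x. s n < \<bar>x - t\<bar>} x *\<^sub>R h x \<partial>mu)"
      proof (intro Bochner_Integration.integral_cong refl)
        fix x
        have k: "x * pv_kernel (s n) (x - t) = t * pv_kernel (s n) (x - t) + indicator {x. s n < \<bar>x - t\<bar>} x"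
        proof (cases "s n < \<bar>x - t\<bar>")
          case True
          then have "x - t \<noteq> 0" using s0[of n] by auto
          then show ?thesis using True by (simp add: pv_kernel_def field_simps)
        qed (simp add: pv_kernel_def)
        have "of_real x * h x * of_real (pv_kernel (s n) (x - t)) = h x * of_real (x * pv_kernel (s n) (x - t))" by simp
        also have "\<dots> = of_real t * (h x * of_real (pv_kernel (s n) (x - t))) + indicator {x. s n < \<bar>x - t\<bar>} x *\<^sub>R h x"
          unfolding k by (simp add: scaleR_conv_of_real algebra_simps)
        finally show "of_real x * h x * of_real (pv_kernel (s n) (x - t))
          = of_real t * (h x * of_real (pv_kernel (s n) (x - t))) + indicator {x. s n < \<bar>x - t\<bar>} x *\<^sub>R h x" .
      qed
      also have "\<dots> = of_real t * (\<integral>x. h x * of_real (pv_kernel (s n) (x - t)) \<partial>mu) + (\<integral>x. indicator {x. s n < \<bar>x - t\<bar>} x *\<^sub>R h x \<partial>mu)"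
        using im integrable_pv[OF h s0] by (subst Bochner_Integration.integral_add) auto
      finally show ?thesis unfolding truncated_hilbert_def by (simp add: algebra_simps)
    qed
    have 3: "(\<lambda>n. \<integral>x. indicator {x. s n < \<bar>x - t\<bar>} x *\<^sub>R h x \<partial>mu) \<longlonglongrightarrow> (\<integral>x. h x \<partial>mu)"
    proof (rule integral_dominated_convergence[where w="\<lambda>x. norm (h x)"])
      have "AE x in lborel. x \<noteq> t" by (rule AE_lborel_singleton)
      then have "AE x in mu. x \<noteq> t" unfolding AE_mu_iff by eventually_elim auto
      then show "AE x in mu. (\<lambda>n. indicator {x. s n < \<bar>x - t\<bar>} x *\<^sub>R h x) \<longlonglongrightarrow> h x"
      proof eventually_elim
        case (elim x)
        then have "eventually (\<lambda>n. s n < \<bar>x - t\<bar>) sequentially" using order_tendstoD(2)[OF sl] by simp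
        then show ?case by (intro tendsto_eventually) (auto elim!: eventually_mono)
      qed
    qed (use h in \<open>auto simp: indicator_def\<close>)
    have "(\<lambda>n. truncated_hilbert (\<lambda>x. of_real x * h x) (s n) t) \<longlonglongrightarrow> of_real t * \<H> h t + of_real (1 / pi) * (\<integral>x. h x \<partial>mu)"
      unfolding eq by (intro tendsto_intros 1 3)
    with 2 show ?case by (rule LIMSEQ_unique)
  qed
qed

section \<open>Banach function spaces\<close>

context banach_function_space begin

lemma in_L0: "f \<in> X \<Longrightarrow> f \<in> L0" using subset_L0 by blast

lemma zero_in: "(\<lambda>x. 0) \<in> X" by (rule simple) simp

lemma const_in: "(\<lambda>x. c) \<in> X" by (rule simple) simp

lemma N_zero: "N (\<lambda>x. 0) = 0" using norm_zero_iff[OF zero_in] by simp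

lemma N_nonneg: "f \<in> X \<Longrightarrow> 0 \<le> N f"
  using norm_mono[OF _ zero_in] N_zero by fastforce

lemma N_cong: "f \<in> X \<Longrightarrow> g \<in> L0 \<Longrightarrow> (AE x in mu. f x = g x) \<Longrightarrow> g \<in> X \<and> N g = N f"
proof -
  assume f: "f \<in> X" and g: "g \<in> L0" and e: "AE x in mu. f x = g x"
  have 1: "AE x in mu. cmod (g x) \<le> cmod (f x)" "AE x in mu. cmod (f x) \<le> cmod (g x)" using e by (eventually_elim, simp)+
  have gX: "g \<in> X" by (rule ideal[OF f g 1(1)])
  then show ?thesis using norm_mono[OF f gX 1(1)] norm_mono[OF gX f 1(2)] by simp
qed

lemma diff_in: "f \<in> X \<Longrightarrow> g \<in> X \<Longrightarrow> (\<lambda>x. f x - g x) \<in> X"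
  using add[OF _ scale[of g "-1"], of f] by simp

lemma N_diff_commute: "f \<in> X \<Longrightarrow> g \<in> X \<Longrightarrow> N (\<lambda>x. f x - g x) = N (\<lambda>x. g x - f x)"
  using norm_scale[OF diff_in, of f g "-1"] by simp

lemma N_diff_triangle: "f \<in> X \<Longrightarrow> g \<in> X \<Longrightarrow> N f \<le> N g + N (\<lambda>x. f x - g x)"
  using norm_triangle[of g "\<lambda>x. f x - g x"] diff_in by simp

lemma sum_in: "finite I \<Longrightarrow> (\<And>i. i \<in> I \<Longrightarrow> u i \<in> X) \<Longrightarrow> (\<lambda>x. \<Sum>i\<in>I. u i x) \<in> X \<and> N (\<lambda>x. \<Sum>i\<in>I. u i x) \<le> (\<Sum>i\<in>I. N (u i))"
proof (induction I rule: finite_induct)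
  case empty
  then show ?case by (simp add: zero_in N_zero)
next
  case (insert i I)
  then show ?case using norm_triangle[of "u i" "\<lambda>x. \<Sum>i\<in>I. u i x"] add[of "u i" "\<lambda>x. \<Sum>i\<in>I. u i x"] by auto
qed

lemma abs_in: "f \<in> X \<Longrightarrow> (\<lambda>x. complex_of_real (cmod (f x))) \<in> X \<and> N (\<lambda>x. complex_of_real (cmod (f x))) = N f"
proof -
  assume f: "f \<in> X"
  have [measurable]: "f \<in> L0" by (rule in_L0[OF f])
  have a: "(\<lambda>x. complex_of_real (cmod (f x))) \<in> X" by (rule ideal[OF f]) auto
  have "N (\<lambda>x. complex_of_real (cmod (f x))) \<le> N f" by (rule norm_mono[OF f a]) auto
  moreover have "N f \<le> N (\<lambda>x. complex_of_real (cmod (f x)))" by (rule norm_mono[OF a f]) auto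
  ultimately show ?thesis using a by simp
qed

lemma series_converges:
  assumes u: "\<And>n. u n \<in> X" and s: "summable (\<lambda>n. N (u n))"
  shows "\<exists>w\<in>X. (\<lambda>n. N (\<lambda>x. (\<Sum>i<n. u i x) - w x)) \<longlonglongrightarrow> 0 \<and> N w \<le> (\<Sum>n. N (u n))"
proof -
  define S where "S n x = (\<Sum>i<n. u i x)" for n x
  have S: "S n \<in> X" "N (S n) \<le> (\<Sum>i<n. N (u i))" for n
    using sum_in[of "{..<n}" u] u by (auto simp: S_def[abs_def])
  have Sd: "N (\<lambda>x. S n x - S m x) \<le> (\<Sum>i=m..<n. N (u i))" if "m \<le> n" for m n
  proof -
    have "(\<lambda>x. S n x - S m x) = (\<lambda>x. \<Sum>i=m..<n. u i x)"
      using that by (auto simp: S_def atLeast0LessThan[symmetric] sum_diff_nat_ivl)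
    then show ?thesis using sum_in[of "{m..<n}" u] u by auto
  qed
  have "\<exists>w\<in>X. (\<lambda>n. N (\<lambda>x. S n x - w x)) \<longlonglongrightarrow> 0"
  proof (rule complete[OF S(1)], intro allI impI)
    fix e :: real assume "0 < e"
    then obtain K where K: "\<And>m n. K \<le> m \<Longrightarrow> norm (\<Sum>i=m..<n. N (u i)) < e" using s unfolding summable_Cauchy by blast
    show "\<exists>K. \<forall>m\<ge>K. \<forall>n\<ge>K. N (\<lambda>x. S m x - S n x) < e"
    proof (intro exI[of _ K] allI impI)
      fix m n assume mn: "K \<le> m" "K \<le> n"
      consider "m \<le> n" | "n \<le> m" by linarith
      then show "N (\<lambda>x. S m x - S n x) < e"
      proof cases
        case 1
        then show ?thesis using Sd[OF 1] K[OF mn(1), of n] N_diff_commute[OF S(1) S(1), of n m] by auto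
      next
        case 2
        then show ?thesis using Sd[OF 2] K[OF mn(2), of m] by auto
      qed
    qed
  qed
  then obtain w where w: "w \<in> X" "(\<lambda>n. N (\<lambda>x. S n x - w x)) \<longlonglongrightarrow> 0" by blast
  have "N w \<le> (\<Sum>n. N (u n))"
  proof (rule LIMSEQ_le_const)
    show "(\<lambda>n. (\<Sum>i. N (u i)) + N (\<lambda>x. S n x - w x)) \<longlonglongrightarrow> (\<Sum>n. N (u n))" using tendsto_add[OF tendsto_const w(2)] by simp
    show "\<exists>M. \<forall>n\<ge>M. N w \<le> (\<Sum>i. N (u i)) + N (\<lambda>x. S n x - w x)"
    proof (intro exI[of _ 0] allI impI)
      fix n
      have "N w \<le> N (S n) + N (\<lambda>x. S n x - w x)"
        using N_diff_triangle[OF w(1) S(1)[of n]] N_diff_commute[OF w(1) S(1)[of n]] by simp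
      also have "N (S n) \<le> (\<Sum>i. N (u i))" using S(2)[of n] sum_le_suminf[OF s, of "{..<n}"] N_nonneg u by fastforce
      finally show "N w \<le> (\<Sum>i. N (u i)) + N (\<lambda>x. S n x - w x)" by simp
    qed
  qed
  then show ?thesis using w unfolding S_def by blast
qed

text \<open>
  The limit \<open>w\<close> of the series in norm dominates every partial sum \<open>S n\<close>: the positive part of
  \<open>S n - \<bar>w\<bar>\<close> is dominated by \<open>\<bar>S m - w\<bar>\<close> for all \<open>m \<ge> n\<close>, and the norm of the latter tends to \<open>0\<close>.
\<close>

lemma nonneg_series_dominated:
  assumes u: "\<And>n. (\<lambda>x. complex_of_real (u n x)) \<in> X" and u0: "\<And>n. AE x in mu. 0 \<le> u n x"
    and s: "summable (\<lambda>n. N (\<lambda>x. complex_of_real (u n x)))"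
  shows "\<exists>g\<in>X. AE x in mu. \<forall>n. (\<Sum>i<n. u i x) \<le> cmod (g x)"
proof -
  obtain w where w: "w \<in> X" "(\<lambda>n. N (\<lambda>x. (\<Sum>i<n. complex_of_real (u i x)) - w x)) \<longlonglongrightarrow> 0"
    using series_converges[of "\<lambda>n x. complex_of_real (u n x)"] u s by blast
  define S where "S n x = (\<Sum>i<n. u i x)" for n x
  have SX: "(\<lambda>x. complex_of_real (S n x)) \<in> X" for n
    using sum_in[of "{..<n}" "\<lambda>n x. complex_of_real (u n x)"] u by (simp add: S_def)
  have SwX: "(\<lambda>x. complex_of_real (S n x) - w x) \<in> X" for n by (rule diff_in[OF SX w(1)])
  have [measurable]: "w \<in> L0" by (rule in_L0[OF w(1)])
  have [measurable]: "S n \<in> borel_measurable mu" for n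
  proof -
    have "(\<lambda>x. Re (complex_of_real (S n x))) \<in> borel_measurable mu" using in_L0[OF SX[of n]] by measurable
    then show ?thesis by simp
  qed
  have "AE x in mu. S n x \<le> cmod (w x)" for n
  proof -
    define p where "p x = complex_of_real (max (S n x - cmod (w x)) 0)" for x
    have [measurable]: "p \<in> L0" unfolding p_def by measurable
    have le: "AE x in mu. cmod (p x) \<le> cmod (complex_of_real (S m x) - w x)" if "n \<le> m" for m
    proof -
      have "AE x in mu. \<forall>i. 0 \<le> u i x" using u0 by (simp add: AE_all_countable)
      then show ?thesis
      proof eventually_elim
        case (elim x)
        have "S n x \<le> S m x" unfolding S_def using that elim by (intro sum_mono2) auto
        moreover have "S m x - cmod (w x) \<le> cmod (complex_of_real (S m x) - w x)"
          using norm_triangle_ineq2[of "complex_of_real (S m x)" "w x"] by simp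
        ultimately show ?case by (auto simp: p_def)
      qed
    qed
    have pX: "p \<in> X" by (rule ideal[OF SwX _ le[of n]]) simp_all
    have "N p \<le> 0"
    proof (rule LIMSEQ_le_const[OF w(2)], intro exI[of _ n] allI impI)
      fix m assume "n \<le> m"
      from norm_mono[OF SwX pX le[OF this]]
      show "N p \<le> N (\<lambda>x. (\<Sum>i<m. complex_of_real (u i x)) - w x)" by (simp add: S_def)
    qed
    then have "N p = 0" using N_nonneg[OF pX] by simp
    then have "AE x in mu. p x = 0" using norm_zero_iff[OF pX] by simp
    then show ?thesis by eventually_elim (auto simp: p_def max_def split: if_splits)
  qed
  then have "AE x in mu. \<forall>n. S n x \<le> cmod (w x)" by (simp add: AE_all_countable)
  then show ?thesis using w(1) unfolding S_def by blast
qed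

text \<open>
  If \<open>N (f n) \<le> 1\<close> and \<open>N (A (f n)) > 4 ^ n\<close> for all \<open>n\<close>, then some \<open>g\<close> in \<open>X\<close> dominates every
  \<open>(1/2) ^ n * \<bar>f n\<bar>\<close>, and \<open>N (A g) > 2 ^ n\<close> for all \<open>n\<close>. For dilations this makes the real supremum
  \<open>op_norm\<close> the actual operator norm.
\<close>

lemma positive_operator_bounded:
  assumes A: "\<And>f. f \<in> X \<Longrightarrow> A f \<in> X"
    and mono: "\<And>f g. f \<in> X \<Longrightarrow> g \<in> X \<Longrightarrow> (AE x in mu. cmod (f x) \<le> cmod (g x)) \<Longrightarrow> (AE x in mu. cmod (A f x) \<le> cmod (A g x))"
    and hom: "\<And>f (c::complex). f \<in> X \<Longrightarrow> A (\<lambda>x. c * f x) = (\<lambda>x. c * A f x)"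
  shows "bdd_above ((\<lambda>f. N (A f)) ` {f \<in> X. N f \<le> 1})"
proof (rule ccontr)
  assume "\<not> ?thesis"
  then have "\<exists>f. f \<in> X \<and> N f \<le> 1 \<and> 4 ^ n < N (A f)" for n :: nat
    unfolding bdd_above_def by (auto simp: not_le)
  then have "\<forall>n::nat. \<exists>f. f \<in> X \<and> N f \<le> 1 \<and> 4 ^ n < N (A f)" by blast
  from choice[OF this] obtain f where f: "\<And>n. f n \<in> X" "\<And>n. N (f n) \<le> 1" "\<And>n. 4 ^ n < N (A (f n))" by blast
  define u where "u n x = (1/2)^n * cmod (f n x)" for n x
  have ueq: "(\<lambda>x. complex_of_real (u n x)) = (\<lambda>x. complex_of_real ((1/2)^n) * complex_of_real (cmod (f n x)))" for n
    by (simp add: u_def)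
  have uX: "(\<lambda>x. complex_of_real (u n x)) \<in> X" for n
    unfolding ueq using abs_in[OF f(1)[of n]] by (intro scale) simp
  have "N (\<lambda>x. complex_of_real (u n x)) = (1/2)^n * N (f n)" for n
    unfolding ueq using abs_in[OF f(1)[of n]] by (subst norm_scale) (auto simp: norm_power)
  then have "N (\<lambda>x. complex_of_real (u n x)) \<le> (1/2)^n" for n using f(2)[of n] by (simp add: mult_left_le)
  then have sm: "summable (\<lambda>n. N (\<lambda>x. complex_of_real (u n x)))"
    using N_nonneg[OF uX] by (intro summable_comparison_test[OF _ summable_geometric[of "1/2::real"]]) auto
  obtain g where g: "g \<in> X" "AE x in mu. \<forall>n. (\<Sum>i<n. u i x) \<le> cmod (g x)"
    using nonneg_series_dominated[of u, OF uX _ sm] by (auto simp: u_def)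
  have "4 ^ n < 2 ^ n * N (A g)" for n
  proof -
    define c where "c = complex_of_real ((1/2)^n)"
    have cn: "cmod c = (1/2)^n" by (simp add: c_def norm_power)
    have cf: "(\<lambda>x. c * f n x) \<in> X" by (rule scale[OF f(1)])
    have "AE x in mu. cmod (c * f n x) \<le> cmod (g x)"
      using g(2)
    proof eventually_elim
      case (elim x)
      have "u n x \<le> (\<Sum>i<Suc n. u i x)" by (rule member_le_sum) (auto simp: u_def)
      then show ?case using elim[rule_format, of "Suc n"] by (simp add: norm_mult cn u_def)
    qed
    then have "AE x in mu. cmod (A (\<lambda>x. c * f n x) x) \<le> cmod (A g x)" by (rule mono[OF cf g(1)])
    then have "N (A (\<lambda>x. c * f n x)) \<le> N (A g)" using A cf g(1) by (intro norm_mono) auto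
    also have "A (\<lambda>x. c * f n x) = (\<lambda>x. c * A (f n) x)" by (rule hom[OF f(1)])
    finally have "(1/2)^n * N (A (f n)) \<le> N (A g)" using norm_scale[OF A[OF f(1)[of n]], of c] cn by simp
    then have "N (A (f n)) \<le> 2 ^ n * N (A g)" by (simp add: field_simps power_divide)
    then show ?thesis using f(3)[of n] by linarith
  qed
  then have "2 ^ n < N (A g)" for n :: nat
  proof -
    assume a: "\<And>n. 4 ^ n < 2 ^ n * N (A g)"
    have "(4::real) ^ n = 2 ^ n * 2 ^ n" by (simp flip: power_mult_distrib)
    then show ?thesis using a[of n] by simp
  qed
  moreover obtain n where "N (A g) < 2 ^ n" using real_arch_pow[of 2 "N (A g)"] by auto
  ultimately show False by (metis less_asym)
qed

end

section \<open>Rearrangements and dilations\<close>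

lemma distribution_nonneg: "0 \<le> distribution_function f l" by (simp add: distribution_function_def)

lemma measurable_level:
  assumes [measurable]: "f \<in> L0" shows "{x \<in> space mu. l < cmod (f x)} \<in> sets mu"
  by measurable

lemma emeasure_level: "f \<in> L0 \<Longrightarrow> emeasure mu {x \<in> space mu. l < cmod (f x)} = ennreal (distribution_function f l)"
proof -
  interpret finite_measure mu by (rule finite_measure_mu)
  show ?thesis by (simp only: distribution_function_def emeasure_eq_measure)
qed

lemma distribution_le_2: "f \<in> L0 \<Longrightarrow> distribution_function f l \<le> 2"
proof -
  assume "f \<in> L0"
  interpret finite_measure mu by (rule finite_measure_mu)
  have "measure mu (space mu) = 2" by (simp add: measure_def space_mu emeasure_space_mu)
  then show ?thesis unfolding distribution_function_def using bounded_measure by metis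
qed

lemma distribution_antimono: "f \<in> L0 \<Longrightarrow> l \<le> l' \<Longrightarrow> distribution_function f l' \<le> distribution_function f l"
proof -
  assume f: "f \<in> L0" and l: "l \<le> l'"
  interpret finite_measure mu by (rule finite_measure_mu)
  show ?thesis unfolding distribution_function_def
    by (rule finite_measure_mono[OF _ measurable_level[OF f]]) (use l in auto)
qed

lemma distribution_tendsto_0: "f \<in> L0 \<Longrightarrow> (\<lambda>n. distribution_function f (real n)) \<longlonglongrightarrow> 0"
proof -
  assume f: "f \<in> L0"
  interpret finite_measure mu by (rule finite_measure_mu)
  have "(\<lambda>n. measure mu {x \<in> space mu. real n < cmod (f x)}) \<longlonglongrightarrow> measure mu (\<Inter>n. {x \<in> space mu. real n < cmod (f x)})"
    using measurable_level[OF f] by (intro finite_Lim_measure_decseq) (auto simp: decseq_def)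
  moreover have "(\<Inter>n. {x \<in> space mu. real n < cmod (f x)}) = {}"
    using reals_Archimedean2 by (auto simp: not_less dest: less_imp_le) (meson less_asym reals_Archimedean2)
  ultimately show ?thesis by (simp add: distribution_function_def)
qed

lemma distribution_right_continuous:
  assumes f: "f \<in> L0" and s: "\<And>e. 0 < e \<Longrightarrow> distribution_function f (l + e) \<le> s"
  shows "distribution_function f l \<le> s"
proof -
  interpret finite_measure mu by (rule finite_measure_mu)
  define A where "A n = {x \<in> space mu. l + 1 / real (Suc n) < cmod (f x)}" for n
  have A: "A n \<in> sets mu" for n unfolding A_def by (rule measurable_level[OF f])
  have "(\<lambda>n. measure mu (A n)) \<longlonglongrightarrow> measure mu (\<Union>n. A n)"
  proof (rule finite_Lim_measure_incseq)
    show "incseq A"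
    proof (rule incseq_SucI)
      fix n
      have "1 / real (Suc (Suc n)) \<le> 1 / real (Suc n)" by (simp add: frac_le)
      then show "A n \<le> A (Suc n)" by (auto simp: A_def simp del: of_nat_Suc)
    qed
  qed (use A in auto)
  moreover have "(\<Union>n. A n) = {x \<in> space mu. l < cmod (f x)}"
  proof safe
    fix x n assume "x \<in> A n"
    then have "l + 1 / real (Suc n) < cmod (f x)" and "x \<in> space mu" unfolding A_def by blast+
    moreover have "0 < 1 / real (Suc n)" by simp
    ultimately show "l < cmod (f x)" "x \<in> space mu" by linarith+
  next
    fix x assume x: "x \<in> space mu" "l < cmod (f x)"
    then obtain n where "inverse (real (Suc n)) < cmod (f x) - l" using reals_Archimedean[of "cmod (f x) - l"] by auto
    then have "l + 1 / real (Suc n) < cmod (f x)" by (simp add: inverse_eq_divide del: of_nat_Suc)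
    then have "x \<in> A n" using x unfolding A_def by blast
    then show "x \<in> (\<Union>n. A n)" by blast
  qed
  ultimately have "(\<lambda>n. measure mu (A n)) \<longlonglongrightarrow> distribution_function f l" by (simp add: distribution_function_def)
  then show ?thesis
  proof (rule LIMSEQ_le_const2, intro exI[of _ 0] allI impI)
    fix n show "measure mu (A n) \<le> s" using s[of "1 / real (Suc n)"] by (simp add: A_def distribution_function_def)
  qed
qed

text \<open>
  The decreasing rearrangement with real values. On \<open>(-\<infinity>, 0]\<close>, where the infimum may be infinite, it is
  set to \<open>0\<close>.
\<close>

definition rearr :: "(real \<Rightarrow> complex) \<Rightarrow> real \<Rightarrow> real" where
  "rearr f s = (if s \<le> 0 then 0 else Inf {l. 0 \<le> l \<and> distribution_function f l \<le> s})"

text \<open>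
  Right continuity of the distribution function makes the infimum in the definition of \<open>rearr\<close> a
  minimum.
\<close>

lemma rearr_le_iff:
  assumes f: "f \<in> L0" and s: "0 < s" and l: "0 \<le> l"
  shows "rearr f s \<le> l \<longleftrightarrow> distribution_function f l \<le> s"
proof
  have bdd: "bdd_below {l. 0 \<le> l \<and> distribution_function f l \<le> s}" by (rule bdd_belowI[of _ 0]) auto
  show "rearr f s \<le> l" if "distribution_function f l \<le> s"
    using s l that bdd by (auto simp: rearr_def intro: cInf_lower)
  have ne: "{l. 0 \<le> l \<and> distribution_function f l \<le> s} \<noteq> {}"
  proof -
    have "eventually (\<lambda>n. distribution_function f (real n) < s) sequentially"
      using distribution_tendsto_0[OF f] s by (rule order_tendstoD)
    then obtain n where "distribution_function f (real n) < s" by (auto simp: eventually_sequentially)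
    then have "real n \<in> {l. 0 \<le> l \<and> distribution_function f l \<le> s}" by simp
    then show ?thesis by blast
  qed
  assume r: "rearr f s \<le> l"
  show "distribution_function f l \<le> s"
  proof (rule distribution_right_continuous[OF f])
    fix e :: real assume "0 < e"
    then have "Inf {l. 0 \<le> l \<and> distribution_function f l \<le> s} < l + e" using r s by (simp add: rearr_def)
    then obtain l' where "0 \<le> l'" "distribution_function f l' \<le> s" "l' < l + e"
      using cInf_less_iff[OF ne bdd] by auto
    then show "distribution_function f (l + e) \<le> s"
      using distribution_antimono[OF f, of l' "l + e"] by linarith
  qed
qed

lemma rearr_nonneg: "f \<in> L0 \<Longrightarrow> 0 \<le> rearr f s"
proof (cases "s \<le> 0")
  case False
  assume f: "f \<in> L0"
  show ?thesis
  proof (rule ccontr)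
    assume a: "\<not> 0 \<le> rearr f s"
    have "Inf {l. 0 \<le> l \<and> distribution_function f l \<le> s} \<ge> 0"
    proof (rule cInf_greatest)
      obtain n where "distribution_function f (real n) < s"
        using order_tendstoD(2)[OF distribution_tendsto_0[OF f], of s] False by (auto simp: eventually_sequentially)
      then have "real n \<in> {l. 0 \<le> l \<and> distribution_function f l \<le> s}" by simp
      then show "{l. 0 \<le> l \<and> distribution_function f l \<le> s} \<noteq> {}" by blast
    qed auto
    then show False using a False by (simp add: rearr_def)
  qed
qed (simp add: rearr_def)

lemma less_rearr_iff:
  assumes f: "f \<in> L0" and s: "0 < s" and l: "0 \<le> l"
  shows "l < rearr f s \<longleftrightarrow> s < distribution_function f l"
  using rearr_le_iff[OF assms] by linarith

lemma rearr_antimono: "f \<in> L0 \<Longrightarrow> 0 < s \<Longrightarrow> s \<le> s' \<Longrightarrow> rearr f s' \<le> rearr f s"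
  using rearr_le_iff[of f s' "rearr f s"] rearr_le_iff[of f s "rearr f s"] rearr_nonneg[of f s] by auto

lemma rearr_eq_0: "f \<in> L0 \<Longrightarrow> 2 \<le> s \<Longrightarrow> rearr f s = 0"
  using rearr_le_iff[of f s 0] distribution_le_2[of f 0] rearr_nonneg[of f s] by (auto intro: antisym)

lemma distribution_rearr_le: "f \<in> L0 \<Longrightarrow> 0 < s \<Longrightarrow> distribution_function f (rearr f s) \<le> s"
  using rearr_le_iff[of f s "rearr f s"] rearr_nonneg[of f s] by auto

lemma rearr_measurable [measurable]: assumes f: "f \<in> L0" shows "rearr f \<in> borel_measurable borel"
proof (rule borel_measurableI_greater)
  fix l :: real
  show "{s \<in> space borel. l < rearr f s} \<in> sets borel"
  proof (cases "0 \<le> l")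
    case True
    then have "{s \<in> space borel. l < rearr f s} = {0<..<distribution_function f l}"
      using less_rearr_iff[OF f _ True] rearr_def[of f] by (auto simp: not_le split: if_splits)
    then show ?thesis by simp
  next
    case False
    then have "{s \<in> space borel. l < rearr f s} = UNIV" using rearr_nonneg[OF f] by (auto simp: not_le intro: less_le_trans)
    then show ?thesis by simp
  qed
qed

lemma emeasure_lborel_scale:
  fixes S :: "real set" assumes [measurable]: "S \<in> sets borel" and t: "0 < t"
  shows "ennreal t * emeasure lborel {x. t * x \<in> S} = emeasure lborel S"
proof -
  have [measurable]: "{x. t * x \<in> S} \<in> sets borel" by measurable
  have "emeasure lborel S = (\<integral>\<^sup>+x. indicator S x \<partial>lborel)" by simp
  also have "\<dots> = \<bar>t\<bar> * (\<integral>\<^sup>+x. indicator S (0 + t * x) \<partial>lborel)"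
    using t by (intro nn_integral_real_affine) auto
  also have "(\<integral>\<^sup>+x. indicator S (0 + t * x) \<partial>lborel) = (\<integral>\<^sup>+x. indicator {x. t * x \<in> S} x \<partial>lborel)"
    by (intro nn_integral_cong) (simp add: indicator_def)
  also have "\<dots> = emeasure lborel {x. t * x \<in> S}" by (rule nn_integral_indicator) simp
  finally show ?thesis using t by simp
qed

lemma L0_iff_extension: "f \<in> L0 \<longleftrightarrow> (\<lambda>x. indicator {-1<..<1} x *\<^sub>R f x) \<in> borel_measurable borel"
  by (subst borel_measurable_restrict_space_iff) auto

lemma dilation_measurable:
  assumes f: "f \<in> L0" shows "dilation t f \<in> L0"
proof (rule borel_imp_L0)
  have [measurable]: "(\<lambda>x. indicator {-1<..<1} x *\<^sub>R f x) \<in> borel_measurable borel" using f L0_iff_extension by blast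
  have "(\<lambda>x. (\<lambda>x. indicator {-1<..<1} x *\<^sub>R f x) (t * x)) \<in> borel_measurable borel"
    by (rule measurable_compose[of "\<lambda>x. t * x" borel borel]) simp_all
  also have "(\<lambda>x. (\<lambda>x. indicator {-1<..<1} x *\<^sub>R f x) (t * x)) = dilation t f"
    by (auto simp: dilation_def indicator_def)
  finally show "dilation t f \<in> borel_measurable borel" .
qed

lemma AE_dilation_le:
  assumes t: "0 < t" and le: "AE x in mu. cmod (f x) \<le> cmod (g x)"
  shows "AE x in mu. cmod (dilation t f x) \<le> cmod (dilation t g x)"
proof -
  have "AE x in lborel. x \<in> {-1<..<1} \<longrightarrow> cmod (f x) \<le> cmod (g x)" using le by (simp add: AE_mu_iff)
  then obtain Z where Z: "Z \<in> null_sets lborel" "{x. \<not> (x \<in> {-1<..<1} \<longrightarrow> cmod (f x) \<le> cmod (g x))} \<subseteq> Z"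
    unfolding eventually_ae_filter by auto
  have [measurable]: "Z \<in> sets borel" using Z by auto
  have "ennreal t * emeasure lborel {x. t * x \<in> Z} = 0"
    using emeasure_lborel_scale[of Z t] Z(1) t by auto
  then have "emeasure lborel {x. t * x \<in> Z} = 0" using t by simp
  moreover have "{x. t * x \<in> Z} \<in> sets borel" by measurable
  ultimately have "{x. t * x \<in> Z} \<in> null_sets lborel" by auto
  then have "AE x in lborel. x \<in> {-1<..<1} \<longrightarrow> cmod (dilation t f x) \<le> cmod (dilation t g x)"
    by (rule AE_I') (use Z(2) in \<open>auto simp: dilation_def split: if_splits\<close>)
  then show ?thesis by (simp add: AE_mu_iff)
qed

lemma measure_mu: "A \<in> sets borel \<Longrightarrow> A \<subseteq> {-1<..<1} \<Longrightarrow> measure mu A = measure lborel A"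
  by (simp add: measure_def emeasure_mu)

lemma distribution_dilation_le:
  assumes t: "0 < t" and f: "f \<in> L0" and l: "0 \<le> l"
  shows "distribution_function (dilation t f) l \<le> distribution_function f l / t"
proof -
  interpret finite_measure mu by (rule finite_measure_mu)
  define S where "S = {x \<in> space mu. l < cmod (f x)}"
  have "S \<in> sets mu" unfolding S_def by (rule measurable_level[OF f])
  then have S: "S \<in> sets borel" "S \<subseteq> {-1<..<1}" by (auto simp: sets_mu_iff)
  have S': "{x. t * x \<in> S} \<in> sets borel" using S(1) by measurable
  define D where "D = {x \<in> space mu. l < cmod (dilation t f x)}"
  have "D \<in> sets mu" unfolding D_def by (rule measurable_level[OF dilation_measurable[OF f]])
  then have D: "D \<in> sets borel" "D \<subseteq> {-1<..<1}" by (auto simp: sets_mu_iff)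
  have DS: "D \<subseteq> {x. t * x \<in> S}"
    using l by (auto simp: D_def S_def dilation_def space_mu split: if_splits)
  have "ennreal t * emeasure mu D \<le> ennreal t * emeasure lborel {x. t * x \<in> S}"
    using D DS S' by (subst emeasure_mu) (auto intro!: mult_left_mono emeasure_mono)
  also have "\<dots> = emeasure mu S" using emeasure_lborel_scale[OF S(1) t] S by (simp add: emeasure_mu)
  finally have "ennreal (t * measure mu D) \<le> ennreal (measure mu S)"
    using t by (simp add: emeasure_eq_measure ennreal_mult)
  then have "t * measure mu D \<le> measure mu S" by simp
  then show ?thesis unfolding distribution_function_def D_def[symmetric] S_def[symmetric] using t by (simp add: field_simps)
qed

context rearrangement_invariant_space begin

lemma ri_mono:
  assumes f: "f \<in> X" and g: "g \<in> L0" and le: "\<And>l. 0 \<le> l \<Longrightarrow> distribution_function g l \<le> distribution_function f l"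
  shows "g \<in> X"
proof (rule rearrangement[OF f g], intro ballI)
  fix s :: real
  show "decreasing_rearrangement g s \<le> decreasing_rearrangement f s"
    unfolding decreasing_rearrangement_def
    by (intro INF_superset_mono) (auto intro: order_trans[OF le])
qed

text \<open>
  The function \<open>rearr f (2 * \<bar>x\<bar>)\<close> has the distribution of \<open>f\<close>, and dilations act on it by scaling the
  argument of \<open>rearr f\<close>.
\<close>

lemma symmetric_rearrangement_in:
  assumes f: "f \<in> X"
  shows "(\<lambda>x. complex_of_real (rearr f (2 * \<bar>x\<bar>))) \<in> X"
proof (rule ri_mono[OF f])
  have fL: "f \<in> L0" by (rule in_L0[OF f])
  note [measurable] = rearr_measurable[OF fL]
  show "(\<lambda>x. complex_of_real (rearr f (2 * \<bar>x\<bar>))) \<in> L0" by (rule borel_imp_L0) measurable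
  fix l :: real assume l: "0 \<le> l"
  define d where "d = distribution_function f l"
  have d: "0 \<le> d" "d \<le> 2" unfolding d_def using distribution_nonneg distribution_le_2[OF fL] by auto
  have sub: "{x \<in> space mu. l < cmod (complex_of_real (rearr f (2 * \<bar>x\<bar>)))} \<subseteq> {-(d/2)<..<d/2}"
  proof
    fix x assume "x \<in> {x \<in> space mu. l < cmod (complex_of_real (rearr f (2 * \<bar>x\<bar>)))}"
    then have x: "l < rearr f (2 * \<bar>x\<bar>)" using rearr_nonneg[OF fL] by simp
    then have x0: "0 < 2 * \<bar>x\<bar>" using l by (cases "x = 0") (auto simp: rearr_def)
    show "x \<in> {-(d/2)<..<d/2}" using x less_rearr_iff[OF fL x0 l] by (auto simp: d_def)
  qed
  have "distribution_function (\<lambda>x. complex_of_real (rearr f (2 * \<bar>x\<bar>))) l \<le> measure mu {-(d/2)<..<d/2}"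
  proof -
    interpret finite_measure mu by (rule finite_measure_mu)
    show ?thesis unfolding distribution_function_def
      by (rule finite_measure_mono[OF sub]) (use d in \<open>auto simp: sets_mu_iff\<close>)
  qed
  also have "\<dots> = d" using d by (subst measure_mu) auto
  finally show "distribution_function (\<lambda>x. complex_of_real (rearr f (2 * \<bar>x\<bar>))) l \<le> distribution_function f l"
    by (simp add: d_def)
qed

text \<open>
  Put one copy of the rearrangement of \<open>f\<close>, restricted to \<open>(0,1)\<close>, on each half of the interval. Each
  copy belongs to \<open>X\<close> by rearrangement invariance, hence so does their sum, and its distribution
  function is doubled as far as the length \<open>2\<close> of the interval permits.
\<close>

lemma double_distribution:
  assumes f: "f \<in> X"
  shows "\<exists>v\<in>X. \<forall>l\<ge>0. min (2 * distribution_function f l) 2 \<le> distribution_function v l"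
proof -
  interpret m: finite_measure mu by (rule finite_measure_mu)
  have fL: "f \<in> L0" by (rule in_L0[OF f])
  note [measurable] = rearr_measurable[OF fL]
  define v1 where "v1 x = (if 0 < x \<and> x < 1 then complex_of_real (rearr f x) else 0)" for x :: real
  define v2 where "v2 x = (if -1 < x \<and> x < 0 then complex_of_real (rearr f (x + 1)) else 0)" for x :: real
  have v: "v1 \<in> L0" "v2 \<in> L0" unfolding v1_def v2_def by (rule borel_imp_L0; measurable)+
  have s1: "{x \<in> space mu. l < cmod (v1 x)} = {0<..<min (distribution_function f l) 1}" if l: "0 \<le> l" for l
  proof (intro set_eqI iffI)
    fix x assume "x \<in> {x \<in> space mu. l < cmod (v1 x)}"
    then have x: "x \<in> {0<..<1}" "l < rearr f x" using l rearr_nonneg[OF fL] by (auto simp: v1_def indicator_def split: if_splits)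
    then show "x \<in> {0<..<min (distribution_function f l) 1}" using less_rearr_iff[OF fL _ l, of x] by auto
  next
    fix x assume x: "x \<in> {0<..<min (distribution_function f l) 1}"
    then show "x \<in> {x \<in> space mu. l < cmod (v1 x)}" using less_rearr_iff[OF fL _ l, of x] rearr_nonneg[OF fL] by (auto simp: v1_def space_mu)
  qed
  have s2: "{x \<in> space mu. l < cmod (v2 x)} = {-1<..<min (distribution_function f l) 1 - 1}" if l: "0 \<le> l" for l
  proof (intro set_eqI iffI)
    fix x assume "x \<in> {x \<in> space mu. l < cmod (v2 x)}"
    then have x: "x \<in> {-1<..<0}" "l < rearr f (x + 1)" using l rearr_nonneg[OF fL] by (auto simp: v2_def indicator_def split: if_splits)
    then show "x \<in> {-1<..<min (distribution_function f l) 1 - 1}" using less_rearr_iff[OF fL _ l, of "x + 1"] by auto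
  next
    fix x assume x: "x \<in> {-1<..<min (distribution_function f l) 1 - 1}"
    then show "x \<in> {x \<in> space mu. l < cmod (v2 x)}" using less_rearr_iff[OF fL _ l, of "x + 1"] rearr_nonneg[OF fL] by (auto simp: v2_def space_mu)
  qed
  have d0: "0 \<le> min (distribution_function f l) 1" for l using distribution_nonneg[of f l] by simp
  have m1: "measure mu {0<..<min (distribution_function f l) 1} = min (distribution_function f l) 1" for l
    using d0[of l] by (subst measure_mu) auto
  have m2: "measure mu {-1<..<min (distribution_function f l) 1 - 1} = min (distribution_function f l) 1" for l
    using d0[of l] by (subst measure_mu) auto
  have dv: "distribution_function v1 l = min (distribution_function f l) 1" "distribution_function v2 l = min (distribution_function f l) 1"
    if "0 \<le> l" for l
    using m1[of l] m2[of l] s1[OF that] s2[OF that] by (simp_all only: distribution_function_def)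
  have v1X: "v1 \<in> X" by (rule ri_mono[OF f v(1)]) (simp add: dv)
  have v2X: "v2 \<in> X" by (rule ri_mono[OF f v(2)]) (simp add: dv)
  show ?thesis
  proof (intro bexI[of _ "\<lambda>x. v1 x + v2 x"] allI impI)
    fix l :: real assume l: "0 \<le> l"
    have eq: "{x \<in> space mu. l < cmod (v1 x + v2 x)} = {x \<in> space mu. l < cmod (v1 x)} \<union> {x \<in> space mu. l < cmod (v2 x)}"
      using l by (auto simp: v1_def v2_def indicator_def split: if_splits)
    have "distribution_function (\<lambda>x. v1 x + v2 x) l = measure mu {x \<in> space mu. l < cmod (v1 x)} + measure mu {x \<in> space mu. l < cmod (v2 x)}"
      unfolding distribution_function_def eq
    proof (rule m.finite_measure_Union[OF measurable_level[OF v(1)] measurable_level[OF v(2)]])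
      show "{x \<in> space mu. l < cmod (v1 x)} \<inter> {x \<in> space mu. l < cmod (v2 x)} = {}"
        unfolding s1[OF l] s2[OF l] by auto
    qed
    then show "min (2 * distribution_function f l) 2 \<le> distribution_function (\<lambda>x. v1 x + v2 x) l"
      unfolding s1[OF l] s2[OF l] m1 m2 by auto
  qed (rule add[OF v1X v2X])
qed

text \<open>
  Iterated doubling; it shows that \<open>X\<close> is closed under dilations by factors less than \<open>1\<close>, which
  enlarge distribution functions.
\<close>

lemma ri_mono_power:
  assumes "f \<in> X" and g: "g \<in> L0" and "\<And>l. 0 \<le> l \<Longrightarrow> distribution_function g l \<le> 2 ^ n * distribution_function f l"
  shows "g \<in> X"
  using assms(1,3)
proof (induction n arbitrary: f)
  case 0
  then show ?case using ri_mono[OF _ g] by simp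
next
  case (Suc n)
  obtain v where v: "v \<in> X" "\<And>l. 0 \<le> l \<Longrightarrow> min (2 * distribution_function f l) 2 \<le> distribution_function v l"
    using double_distribution[OF Suc.prems(1)] by blast
  show ?case
  proof (rule Suc.IH[OF v(1)])
    fix l :: real assume l: "0 \<le> l"
    have "(1::real) \<le> 2 ^ n" by simp
    then have "distribution_function g l \<le> 2 ^ n * 2" using distribution_le_2[OF g, of l] by linarith
    then have "distribution_function g l \<le> 2 ^ n * min (2 * distribution_function f l) 2"
      using Suc.prems(2)[OF l] by (cases "2 * distribution_function f l \<le> 2") (simp_all add: min_def)
    also have "\<dots> \<le> 2 ^ n * distribution_function v l" using v(2)[OF l] by (intro mult_left_mono) auto
    finally show "distribution_function g l \<le> 2 ^ n * distribution_function v l" .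
  qed
qed

text \<open>
  The dilation by \<open>t\<close> multiplies distribution functions by at most \<open>1 / t\<close>.
\<close>

lemma dilation_in: assumes t: "0 < t" and f: "f \<in> X" shows "dilation t f \<in> X"
proof -
  obtain n where n: "1 / t < 2 ^ n" using real_arch_pow[of 2 "1 / t"] by auto
  show ?thesis
  proof (rule ri_mono_power[OF f dilation_measurable[OF in_L0[OF f]], where n=n])
    fix l :: real assume l: "0 \<le> l"
    have "distribution_function (dilation t f) l \<le> (1 / t) * distribution_function f l"
      using distribution_dilation_le[OF t in_L0[OF f] l] by simp
    also have "\<dots> \<le> 2 ^ n * distribution_function f l" using n distribution_nonneg by (intro mult_right_mono) auto
    finally show "distribution_function (dilation t f) l \<le> 2 ^ n * distribution_function f l" .
  qed
qed

lemma dilation_mult: "dilation t (\<lambda>x. c * f x) = (\<lambda>x. c * dilation t f x)"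
  by (auto simp: dilation_def)

lemma dilation_bdd: assumes t: "0 < t" shows "bdd_above ((\<lambda>f. N (dilation t f)) ` {f \<in> X. N f \<le> 1})"
  using t by (intro positive_operator_bounded dilation_in AE_dilation_le dilation_mult)

lemma N_dilation_le:
  assumes t: "0 < t" and f: "f \<in> X"
  shows "N (dilation t f) \<le> op_norm X N (dilation t) * N f"
proof (cases "N f = 0")
  case True
  then have "AE x in mu. f x = 0" using norm_zero_iff[OF f] by simp
  then have "AE x in mu. cmod (f x) \<le> cmod 0" by eventually_elim simp
  from AE_dilation_le[OF t, of f "\<lambda>x. 0"] this have "AE x in mu. cmod (dilation t f x) \<le> cmod (dilation t (\<lambda>x. 0) x)" by simp
  then have "AE x in mu. dilation t f x = 0" by eventually_elim (simp add: dilation_def)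
  then have "N (dilation t f) = 0" using norm_zero_iff[OF dilation_in[OF t f]] by simp
  then show ?thesis using True by simp
next
  case False
  then have pos: "0 < N f" using N_nonneg[OF f] by simp
  define c where "c = complex_of_real (1 / N f)"
  have cf: "(\<lambda>x. c * f x) \<in> X" by (rule scale[OF f])
  have "N (\<lambda>x. c * f x) = 1" using norm_scale[OF f, of c] pos by (simp add: c_def norm_divide)
  then have "N (dilation t (\<lambda>x. c * f x)) \<le> op_norm X N (dilation t)"
    unfolding op_norm_def using cf by (intro cSUP_upper[OF _ dilation_bdd[OF t]]) auto
  then have "cmod c * N (dilation t f) \<le> op_norm X N (dilation t)"
    unfolding dilation_mult norm_scale[OF dilation_in[OF t f]] .
  then show ?thesis using pos by (simp add: c_def norm_divide field_simps)
qed

lemma op_norm_dilation_nonneg: assumes t: "0 < t" shows "0 \<le> op_norm X N (dilation t)"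
proof -
  have "N (dilation t (\<lambda>x. 0)) \<le> op_norm X N (dilation t)"
    unfolding op_norm_def using zero_in N_zero by (intro cSUP_upper[OF _ dilation_bdd[OF t]]) auto
  moreover have "dilation t (\<lambda>x. 0) = (\<lambda>x. 0)" by (auto simp: dilation_def)
  ultimately show ?thesis by (simp add: N_zero)
qed

text \<open>
  A positive term of the supremum has a negative numerator, since \<open>ln t < 0\<close>.
\<close>

lemma contraction_of_lower_boyd_index:
  assumes "0 < lower_boyd_index X N"
  shows "\<exists>A q. 1 < A \<and> 0 \<le> q \<and> q < 1 \<and> (\<forall>f\<in>X. N (dilation A f) \<le> q * N f)"
proof -
  obtain t where t: "0 < t" "t < 1" "0 < ereal (ln (op_norm X N (dilation (1 / t))) / ln t)"
    using assms unfolding lower_boyd_index_def less_SUP_iff by auto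
  define q where "q = op_norm X N (dilation (1 / t))"
  have q0: "0 \<le> q" unfolding q_def using t by (intro op_norm_dilation_nonneg) simp
  have "ln t < 0" using t by simp
  then have "ln q < 0" using t(3) unfolding q_def[symmetric] by (auto simp: zero_less_divide_iff zero_ereal_def)
  then have "q < 1" using q0 by (cases "q = 0") auto
  then show ?thesis using q0 t N_dilation_le[of "1 / t"] unfolding q_def[symmetric]
    by (intro exI[of _ "1 / t"] exI[of _ q]) auto
qed

lemma expansion_of_upper_boyd_index:
  assumes "upper_boyd_index X N < 1"
  shows "\<exists>B s. 1 < B \<and> 0 \<le> s \<and> s < B \<and> (\<forall>f\<in>X. N (dilation (1 / B) f) \<le> s * N f)"
proof -
  obtain t where t: "1 < t" "ereal (ln (op_norm X N (dilation (1 / t))) / ln t) < 1"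
    using assms unfolding upper_boyd_index_def INF_less_iff by auto
  define s where "s = op_norm X N (dilation (1 / t))"
  have s0: "0 \<le> s" unfolding s_def using t by (intro op_norm_dilation_nonneg) simp
  have "0 < ln t" using t by simp
  then have "ln s < ln t" using t(2) unfolding s_def[symmetric] by (simp add: one_ereal_def divide_less_eq)
  then have "s < t" using s0 t by (cases "s = 0") auto
  then show ?thesis using s0 t N_dilation_le[of "1 / t"] unfolding s_def[symmetric]
    by (intro exI[of _ t] exI[of _ s]) auto
qed

end

text \<open>
  Slice the large values of \<open>f\<close> at the levels \<open>rearr f (t / B ^ j)\<close>: on a slice \<open>f\<close> is at most the next
  level, and the set above a level has measure at most \<open>t / B ^ j\<close>.
\<close>

lemma nn_integral_large_values_le:
  assumes f: "f \<in> L0" and B: "1 < B" and t: "0 < t"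
  shows "(\<integral>\<^sup>+x. ennreal (cmod (f x)) * indicator {x. rearr f t < cmod (f x)} x \<partial>mu)
     \<le> (\<Sum>j. ennreal (rearr f (t / B ^ Suc j) * (t / B ^ j)))"
proof -
  interpret m: finite_measure mu by (rule finite_measure_mu)
  have pos: "0 < t / B ^ j" for j using B t by simp
  define L where "L j = {x \<in> space mu. rearr f (t / B ^ j) < cmod (f x)}" for j
  have L: "L j \<in> sets mu" for j unfolding L_def by (rule measurable_level[OF f])
  have Lm: "emeasure mu (L j) \<le> ennreal (t / B ^ j)" for j
    unfolding L_def emeasure_level[OF f] by (intro ennreal_leI distribution_rearr_le[OF f pos])
  have null: "emeasure mu (\<Inter>j. L j) = 0"
  proof -
    have "(\<lambda>j. t * (1 / B) ^ j) \<longlonglongrightarrow> t * 0" using B by (intro tendsto_intros LIMSEQ_realpow_zero) auto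
    then have lim: "(\<lambda>j. t / B ^ j) \<longlonglongrightarrow> 0" by (simp add: power_inverse divide_inverse)
    have "emeasure mu (\<Inter>j. L j) \<le> ennreal 0"
    proof (rule LIMSEQ_le_const[OF tendsto_ennrealI[OF lim]], intro exI[of _ 0] allI impI)
      fix j show "emeasure mu (\<Inter>j. L j) \<le> ennreal (t / B ^ j)"
        by (rule order_trans[OF emeasure_mono Lm[of j]]) (use L in auto)
    qed
    then show ?thesis by simp
  qed
  have "AE x in mu. x \<notin> (\<Inter>j. L j)"
    using null L by (intro AE_not_in) (auto simp: null_sets_def intro!: sets.countable_INT)
  then have "AE x in mu. ennreal (cmod (f x)) * indicator {x. rearr f t < cmod (f x)} x
      \<le> (\<Sum>j. ennreal (rearr f (t / B ^ Suc j)) * indicator (L j) x)"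
    using AE_space
  proof eventually_elim
    case (elim x)
    show ?case
    proof (cases "rearr f t < cmod (f x)")
      case True
      have ex: "\<exists>j. cmod (f x) \<le> rearr f (t / B ^ j)" using elim by (auto simp: L_def not_less)
      define k where "k = (LEAST j. cmod (f x) \<le> rearr f (t / B ^ j))"
      have k: "cmod (f x) \<le> rearr f (t / B ^ k)" unfolding k_def by (rule LeastI_ex[OF ex])
      have "k \<noteq> 0"
      proof
        assume "k = 0" then show False using k True by simp
      qed
      then obtain j where j: "k = Suc j" by (cases k) auto
      have "\<not> cmod (f x) \<le> rearr f (t / B ^ j)" using j unfolding k_def by (intro not_less_Least) simp
      then have "x \<in> L j" using elim by (simp add: L_def)
      then have "ennreal (cmod (f x)) * indicator {x. rearr f t < cmod (f x)} x \<le> ennreal (rearr f (t / B ^ Suc j)) * indicator (L j) x"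
        using k True j by (simp add: ennreal_leI)
      also have "\<dots> \<le> (\<Sum>j. ennreal (rearr f (t / B ^ Suc j)) * indicator (L j) x)"
        using sum_le_suminf[OF summableI, of "{j}" "\<lambda>j. ennreal (rearr f (t / B ^ Suc j)) * indicator (L j) x"]
        by (simp del: indicator_simps sum_mult_indicator power_Suc)
      finally show ?thesis .
    qed simp
  qed
  then have "(\<integral>\<^sup>+x. ennreal (cmod (f x)) * indicator {x. rearr f t < cmod (f x)} x \<partial>mu)
     \<le> (\<integral>\<^sup>+x. (\<Sum>j. ennreal (rearr f (t / B ^ Suc j)) * indicator (L j) x) \<partial>mu)"
    by (rule nn_integral_mono_AE)
  also have "\<dots> = (\<Sum>j. ennreal (rearr f (t / B ^ Suc j)) * emeasure mu (L j))"
  proof -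
    have meas: "(\<lambda>x. ennreal (rearr f (t / B ^ Suc j)) * indicator (L j) x) \<in> borel_measurable mu" for j
      using L[of j] by measurable
    show ?thesis unfolding nn_integral_suminf[OF meas] using L by (simp only: nn_integral_cmult_indicator)
  qed
  also have "\<dots> \<le> (\<Sum>j. ennreal (rearr f (t / B ^ Suc j) * (t / B ^ j)))"
  proof (intro suminf_le summableI)
    fix j
    have "ennreal (rearr f (t / B ^ Suc j)) * emeasure mu (L j) \<le> ennreal (rearr f (t / B ^ Suc j)) * ennreal (t / B ^ j)"
      by (intro mult_left_mono Lm) simp
    then show "ennreal (rearr f (t / B ^ Suc j)) * emeasure mu (L j) \<le> ennreal (rearr f (t / B ^ Suc j) * (t / B ^ j))"
      using rearr_nonneg[OF f] pos[of j] by (simp only: ennreal_mult less_imp_le)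
  qed
  finally show ?thesis .
qed

section \<open>Boundedness under the Boyd index conditions\<close>

lemma finite_hilbert_transform_null:
  assumes "h \<in> L0" "AE x in mu. h x = 0" shows "AE x in mu. \<H> h x = 0"
proof -
  have i0: "integrable mu (\<lambda>x. 0 :: complex)" by simp
  have "\<H> (\<lambda>x. 0) = \<H> h" by (rule finite_hilbert_transform_cong_AE[OF i0 assms(1)]) (use assms(2) in eventually_elim, simp)
  moreover have "AE x in mu. \<H> (\<lambda>x. 0 * 0) x = 0 * \<H> (\<lambda>x. 0) x" by (rule finite_hilbert_transform_mult[OF i0])
  ultimately show ?thesis by simp
qed

lemma emeasure_level_null: "f \<in> L0 \<Longrightarrow> AE x in mu. f x = 0 \<Longrightarrow> 0 \<le> l \<Longrightarrow> emeasure mu {x \<in> space mu. l < cmod (f x)} = 0"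
proof -
  assume f: "f \<in> L0" and ae: "AE x in mu. f x = 0" and l: "0 \<le> l"
  have "emeasure mu {x \<in> space mu. l < cmod (f x)} \<le> emeasure mu {}"
    by (rule emeasure_mono_AE) (use ae l in \<open>eventually_elim, simp\<close>, simp)
  then show ?thesis by simp
qed

text \<open>
  Split \<open>f\<close> at height \<open>rearr f t\<close>. The large values have integral at most \<open>t * B\<close> times the first series, so
  the weak type estimate controls their transform outside a set of measure \<open>t/2\<close>. The small
  values are sliced at the levels \<open>rearr f (A ^ k * t)\<close>; a slice is at most its level \<open>a\<close> and lives on a
  set of measure \<open>A ^ (k+1) * t\<close>. By the exponential estimate its transform exceeds a multiple of
  \<open>(k+1) * a\<close> only on a set of measure at most \<open>t/4 * 2\<^sup>-\<^sup>k\<close>, and these measures add up to at most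
  \<open>t/2\<close>.
\<close>

lemma calderon_bound:
  fixes f :: "real \<Rightarrow> real" and A B D t :: real
  defines "h \<equiv> \<lambda>x. complex_of_real (f x)"
  assumes f: "integrable mu f" "\<And>x. 0 \<le> f x" and A: "1 < A" and B: "1 < B" and t: "0 < t"
    and D: "3 \<le> D" "exp (- D / 2) \<le> 1 / (16 * A)"
    and S: "summable (\<lambda>j. rearr h (t / B ^ j) / B ^ j)"
  shows "distribution_function (\<H> h) (4 * B * (\<Sum>j. rearr h (t / B ^ j) / B ^ j) + (\<Sum>k. D * real (Suc k) * rearr h (A ^ k * t))) \<le> t"
proof -
  interpret m: finite_measure mu by (rule finite_measure_mu)
  have hi: "integrable mu h" using f by (simp add: h_def)
  have hL: "h \<in> L0" using hi by auto
  have [measurable]: "f \<in> borel_measurable mu" using f by auto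
  define \<phi> where "\<phi> = rearr h"
  have \<phi>0: "0 \<le> \<phi> s" for s unfolding \<phi>_def by (rule rearr_nonneg[OF hL])
  have cf: "cmod (h x) = f x" for x using f(2) by (simp add: h_def)
  have pw: "0 < A ^ k * t" for k using A t by simp
  have mono: "\<phi> (A ^ Suc k * t) \<le> \<phi> (A ^ k * t)" for k
    unfolding \<phi>_def using pw[of k] A t by (intro rearr_antimono[OF hL]) (auto simp: mult_right_mono)
  define W where "W = (\<Sum>j. \<phi> (t / B ^ j) / B ^ j)"
  have W0: "0 \<le> W" unfolding W_def using S \<phi>0 B by (intro suminf_nonneg) (auto simp: \<phi>_def)
  \<comment> \<open>The part of \<open>f\<close> above its rearrangement at \<open>t\<close>.\<close>
  define f1 where "f1 x = (if \<phi> t < f x then f x else 0)" for x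
  have f1i: "integrable mu f1"
    by (rule Bochner_Integration.integrable_bound[OF f(1)]) (use f(2) in \<open>auto simp: f1_def[abs_def]\<close>)
  have Ss: "summable (\<lambda>j. \<phi> (t / B ^ Suc j) / B ^ Suc j)"
    using S summable_Suc_iff[of "\<lambda>j. \<phi> (t / B ^ j) / B ^ j"] by (simp add: \<phi>_def)
  have f1m: "(\<integral>x. f1 x \<partial>mu) \<le> t * B * W"
  proof -
    have "ennreal (\<integral>x. f1 x \<partial>mu) = (\<integral>\<^sup>+x. ennreal (f1 x) \<partial>mu)"
      using f(2) by (subst nn_integral_eq_integral[OF f1i]) (auto simp: f1_def)
    also have "\<dots> = (\<integral>\<^sup>+x. ennreal (cmod (h x)) * indicator {x. rearr h t < cmod (h x)} x \<partial>mu)"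
      by (intro nn_integral_cong) (auto simp: f1_def cf \<phi>_def indicator_def)
    also have "\<dots> \<le> (\<Sum>j. ennreal (rearr h (t / B ^ Suc j) * (t / B ^ j)))"
      by (rule nn_integral_large_values_le[OF hL B t])
    also have "\<dots> = (\<Sum>j. ennreal (t * B * (\<phi> (t / B ^ Suc j) / B ^ Suc j)))"
      using B by (simp add: \<phi>_def field_simps)
    also have "\<dots> = ennreal (\<Sum>j. t * B * (\<phi> (t / B ^ Suc j) / B ^ Suc j))"
    proof (rule suminf_ennreal2)
      show "summable (\<lambda>j. t * B * (\<phi> (t / B ^ Suc j) / B ^ Suc j))"
        by (intro summable_mult Ss)
      show "0 \<le> t * B * (\<phi> (t / B ^ Suc j) / B ^ Suc j)" for j
        using t B \<phi>0 by (intro mult_nonneg_nonneg divide_nonneg_nonneg) auto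
    qed
    also have "(\<Sum>j. t * B * (\<phi> (t / B ^ Suc j) / B ^ Suc j)) = t * B * (W - \<phi> t)"
      unfolding suminf_mult[OF Ss] W_def suminf_split_head[OF S[folded \<phi>_def]] by simp
    also have "ennreal (t * B * (W - \<phi> t)) \<le> ennreal (t * B * W)"
      using t B \<phi>0[of t] by (intro ennreal_leI mult_left_mono) auto
    finally show ?thesis using t B W0 by simp
  qed
  define h1 where "h1 x = complex_of_real (f1 x)" for x
  have h1i: "integrable mu h1" using f1i by (simp add: h1_def[abs_def])
  have H1: "\<H> h1 \<in> L0" by (rule finite_hilbert_transform_measurable[OF h1i])
  have e1: "emeasure mu {x\<in>space mu. 4 * B * W < cmod (\<H> h1 x)} \<le> ennreal (t / 2)"
  proof (cases "W = 0")
    case True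
    have f10: "AE x in mu. 0 \<le> f1 x" using f(2) by (auto simp: f1_def)
    have "(\<integral>x. f1 x \<partial>mu) = 0" using f1m True f(2) by (intro antisym) (auto simp: f1_def intro!: Bochner_Integration.integral_nonneg)
    then have "AE x in mu. f1 x = 0" using integral_nonneg_eq_0_iff_AE[OF f1i f10] by simp
    then have "AE x in mu. h1 x = 0" by (simp add: h1_def)
    then have "AE x in mu. \<H> h1 x = 0" using h1i by (intro finite_hilbert_transform_null) auto
    from emeasure_level_null[OF H1 this, of "4 * B * W"] True show ?thesis by simp
  next
    case False
    then have Wp: "0 < 4 * B * W" using W0 B by simp
    have "emeasure mu {x\<in>space mu. 4 * B * W < cmod (\<H> h1 x)} \<le> ennreal (2 * (\<integral>x. f1 x \<partial>mu) / (4 * B * W))"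
      unfolding h1_def using f(2) by (intro weak_type_nonneg f1i Wp) (auto simp: f1_def)
    also have "\<dots> \<le> ennreal (2 * (t * B * W) / (4 * B * W))"
      using f1m Wp by (intro ennreal_leI divide_right_mono) auto
    also have "2 * (t * B * W) / (4 * B * W) = t / 2" using False B by simp
    finally show ?thesis .
  qed
  \<comment> \<open>The rest of \<open>f\<close>, cut along the values of its rearrangement at the points \<open>A ^ k * t\<close>.\<close>
  define F where "F k x = (if f x \<le> \<phi> (A ^ k * t) then f x else 0)" for k x
  define g where "g k x = F k x - F (Suc k) x" for k x
  have g_cases: "g k x = (if \<phi> (A ^ Suc k * t) < f x \<and> f x \<le> \<phi> (A ^ k * t) then f x else 0)" for k x
    using mono[of k] by (auto simp: g_def F_def)
  have g0: "0 \<le> g k x" for k x using f(2) by (simp add: g_cases)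
  have gi: "integrable mu (g k)" for k
    by (rule Bochner_Integration.integrable_bound[OF f(1)]) (use f(2) in \<open>auto simp: g_cases[abs_def]\<close>)
  define gh where "gh k x = complex_of_real (g k x)" for k x
  have ghi: "integrable mu (gh k)" for k using gi by (simp add: gh_def[abs_def])
  have Hg: "\<H> (gh k) \<in> L0" for k by (rule finite_hilbert_transform_measurable[OF ghi])
  have eg: "emeasure mu {x\<in>space mu. D * real (Suc k) * \<phi> (A ^ k * t) < cmod (\<H> (gh k) x)} \<le> ennreal (t / 4 * (1 / 2) ^ k)" for k
  proof (cases "\<phi> (A ^ k * t) = 0")
    case True
    have "g k x = 0" for x using True \<phi>0[of "A ^ Suc k * t"] by (auto simp: g_cases)
    then have "AE x in mu. gh k x = 0" by (simp add: gh_def)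
    then have "AE x in mu. \<H> (gh k) x = 0" using ghi by (intro finite_hilbert_transform_null) auto
    from emeasure_level_null[OF Hg this, of "D * real (Suc k) * \<phi> (A ^ k * t)"] True show ?thesis by simp
  next
    case False
    define a where "a = \<phi> (A ^ k * t)"
    have a: "0 < a" using False \<phi>0 by (simp add: a_def less_le)
    have l: "3 \<le> D * real (Suc k)" using D mult_mono[of 3 D 1 "real (Suc k)"] by simp
    have gm: "(\<integral>x. g k x \<partial>mu) \<le> a * (A ^ Suc k * t)"
    proof -
      have "ennreal (\<integral>x. g k x \<partial>mu) = (\<integral>\<^sup>+x. ennreal (g k x) \<partial>mu)"
        using g0 by (subst nn_integral_eq_integral[OF gi]) auto
      also have "\<dots> \<le> (\<integral>\<^sup>+x. ennreal a * indicator {x\<in>space mu. \<phi> (A ^ Suc k * t) < cmod (h x)} x \<partial>mu)"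
        by (intro nn_integral_mono) (auto simp: g_cases cf a_def indicator_def intro!: ennreal_leI)
      also have "\<dots> = ennreal a * ennreal (distribution_function h (\<phi> (A ^ Suc k * t)))"
        unfolding emeasure_level[OF hL, symmetric] by (rule nn_integral_cmult_indicator[OF measurable_level[OF hL]])
      also have "\<dots> \<le> ennreal a * ennreal (A ^ Suc k * t)"
        unfolding \<phi>_def by (intro mult_left_mono ennreal_leI distribution_rearr_le[OF hL pw]) simp
      also have "\<dots> = ennreal (a * (A ^ Suc k * t))" using a pw[of "Suc k"] by (simp add: ennreal_mult)
      finally show ?thesis using a pw[of "Suc k"] by simp
    qed
    have "emeasure mu {x\<in>space mu. a * (D * real (Suc k)) < cmod (\<H> (gh k) x)} \<le> ennreal (4 * ((\<integral>x. g k x \<partial>mu) / a) * exp (- (D * real (Suc k)) / 2))"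
      unfolding gh_def using g0 by (intro exponential_type gi a l) (auto simp: g_cases a_def \<phi>0)
    also have "\<dots> \<le> ennreal (4 * (A ^ Suc k * t) * (1 / (16 * A)) ^ Suc k)"
    proof (intro ennreal_leI mult_mono)
      show "(\<integral>x. g k x \<partial>mu) / a \<le> A ^ Suc k * t" using gm a by (simp add: field_simps)
      have "exp (- (D * real (Suc k)) / 2) = exp (- D / 2) ^ Suc k"
        unfolding exp_of_nat_mult[symmetric] by (simp add: field_simps)
      also have "\<dots> \<le> (1 / (16 * A)) ^ Suc k" by (intro power_mono D) simp
      finally show "exp (- (D * real (Suc k)) / 2) \<le> (1 / (16 * A)) ^ Suc k" .
    qed (use A t a g0 in auto)
    also have "4 * (A ^ Suc k * t) * (1 / (16 * A)) ^ Suc k = 4 * t * (A * (1 / (16 * A))) ^ Suc k"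
      by (simp only: power_mult_distrib) (simp only: mult_ac)
    also have "A * (1 / (16 * A)) = 1 / 16" using A by simp
    also have "4 * t * (1 / 16) ^ Suc k \<le> t / 4 * (1 / 2) ^ k"
      using t power_mono[of "1/16" "1/2::real" k] by simp
    finally have "emeasure mu {x\<in>space mu. a * (D * real (Suc k)) < cmod (\<H> (gh k) x)} \<le> ennreal (t / 4 * (1 / 2) ^ k)"
      by (simp add: ennreal_leI)
    then show ?thesis by (simp only: a_def mult.commute)
  qed
  \<comment> \<open>From index \<open>K\<close> on the levels vanish, so finitely many slices suffice.\<close>
  obtain K where K: "2 / t < A ^ K" using real_arch_pow[OF A] by blast
  have \<phi>K: "\<phi> (A ^ k * t) = 0" if "K \<le> k" for k
  proof -
    have "A ^ K \<le> A ^ k" using A that by (intro power_increasing) auto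
    then have "2 / t < A ^ k" using K by simp
    then have "2 \<le> A ^ k * t" using t by (simp add: field_simps)
    then show ?thesis unfolding \<phi>_def by (rule rearr_eq_0[OF hL])
  qed
  have "f x = f1 x + (\<Sum>k<K. g k x)" for x
  proof -
    have "(\<Sum>k<K. g k x) = F 0 x - F K x" unfolding g_def by (rule sum_lessThan_telescope')
    moreover have "F K x = 0" using \<phi>K[of K] f(2)[of x] by (simp add: F_def)
    ultimately show ?thesis by (simp add: F_def f1_def)
  qed
  then have hdec: "h = (\<lambda>x. h1 x + (\<Sum>k<K. gh k x))"
    by (simp add: fun_eq_iff h_def h1_def gh_def flip: of_real_sum of_real_add)
  have lin: "AE x in mu. \<H> h x = \<H> h1 x + (\<Sum>k<K. \<H> (gh k) x)"
  proof -
    have "AE x in mu. \<H> h x = \<H> h1 x + \<H> (\<lambda>x. \<Sum>k<K. gh k x) x"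
      unfolding hdec using h1i ghi by (intro finite_hilbert_transform_add) auto
    moreover have "AE x in mu. \<H> (\<lambda>x. \<Sum>k<K. gh k x) x = (\<Sum>k<K. \<H> (gh k) x)"
      using ghi by (intro finite_hilbert_transform_sum) auto
    ultimately show ?thesis by eventually_elim simp
  qed
  define l where "l = 4 * B * W + (\<Sum>k<K. D * real (Suc k) * \<phi> (A ^ k * t))"
  have HL: "\<H> h \<in> L0" by (rule finite_hilbert_transform_measurable[OF hi])
  let ?E1 = "{x\<in>space mu. 4 * B * W < cmod (\<H> h1 x)}"
  let ?E = "\<lambda>k. {x\<in>space mu. D * real (Suc k) * \<phi> (A ^ k * t) < cmod (\<H> (gh k) x)}"
  have EL: "?E1 \<in> sets mu" "?E k \<in> sets mu" for k
    by (rule measurable_level[OF H1], rule measurable_level[OF Hg])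
  have "emeasure mu {x\<in>space mu. l < cmod (\<H> h x)} \<le> emeasure mu (?E1 \<union> (\<Union>k<K. ?E k))"
  proof (rule emeasure_mono_AE)
    show "AE x in mu. x \<in> {x\<in>space mu. l < cmod (\<H> h x)} \<longrightarrow> x \<in> ?E1 \<union> (\<Union>k<K. ?E k)"
      using lin
    proof eventually_elim
      case (elim x)
      show ?case
      proof (intro impI, rule ccontr)
        assume x: "x \<in> {x\<in>space mu. l < cmod (\<H> h x)}" "x \<notin> ?E1 \<union> (\<Union>k<K. ?E k)"
        have "cmod (\<H> h x) \<le> cmod (\<H> h1 x) + (\<Sum>k<K. cmod (\<H> (gh k) x))"
          unfolding elim by (intro norm_triangle_le add_left_mono norm_sum)
        also have "\<dots> \<le> l" unfolding l_def using x by (intro add_mono sum_mono) (auto simp: not_less)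
        finally show False using x by simp
      qed
    qed
    show "?E1 \<union> (\<Union>k<K. ?E k) \<in> sets mu" by (intro sets.Un sets.finite_UN EL) simp
  qed
  also have "\<dots> \<le> emeasure mu ?E1 + (\<Sum>k<K. emeasure mu (?E k))"
  proof (rule order_trans[OF emeasure_subadditive])
    show "emeasure mu ?E1 + emeasure mu (\<Union>k<K. ?E k) \<le> emeasure mu ?E1 + (\<Sum>k<K. emeasure mu (?E k))"
      using EL(2) by (intro add_left_mono emeasure_subadditive_finite) auto
  qed (use EL in auto)
  also have "\<dots> \<le> ennreal (t / 2) + (\<Sum>k<K. ennreal (t / 4 * (1 / 2) ^ k))"
    by (intro add_mono sum_mono e1 eg)
  also have "\<dots> = ennreal (t / 2 + (\<Sum>k<K. t / 4 * (1 / 2) ^ k))"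
    using t by (subst sum_ennreal) (auto intro!: ennreal_plus[symmetric] sum_nonneg)
  also have "\<dots> \<le> ennreal t"
  proof (rule ennreal_leI)
    have "(\<Sum>k<K. (1 / 2 :: real) ^ k) \<le> (\<Sum>k. (1 / 2) ^ k)" by (intro sum_le_suminf) auto
    then have "(\<Sum>k<K. (1 / 2 :: real) ^ k) \<le> 2" by (simp add: suminf_geometric)
    then have "t / 4 * (\<Sum>k<K. (1 / 2) ^ k) \<le> t / 4 * 2" using t by (intro mult_left_mono) auto
    then show "t / 2 + (\<Sum>k<K. t / 4 * (1 / 2) ^ k) \<le> t" unfolding sum_distrib_left by linarith
  qed
  finally have "distribution_function (\<H> h) l \<le> t"
    using t unfolding emeasure_level[OF HL] by simp
  moreover have "(\<Sum>k. D * real (Suc k) * \<phi> (A ^ k * t)) = (\<Sum>k<K. D * real (Suc k) * \<phi> (A ^ k * t))"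
    by (rule suminf_finite) (auto simp: \<phi>K)
  ultimately show ?thesis unfolding l_def W_def \<phi>_def by simp
qed

context rearrangement_invariant_space begin

lemma N_one_pos: "0 < N (\<lambda>x. 1)"
proof -
  have "N (\<lambda>x. 1) \<noteq> 0"
  proof
    assume "N (\<lambda>x. 1) = 0"
    then have "AE x in mu. (1::complex) = 0" using norm_zero_iff[OF const_in[of 1]] by simp
    then have "emeasure mu (space mu) = 0" by (simp add: eventually_False ae_filter_eq_bot_iff)
    then show False using emeasure_space_mu by (simp add: space_mu)
  qed
  then show ?thesis using N_nonneg[OF const_in[of 1]] by simp
qed

text \<open>
  The dilation by \<open>c\<close> of the symmetric decreasing rearrangement of \<open>f\<close>.
\<close>

definition symmetric_rearr :: "(real \<Rightarrow> complex) \<Rightarrow> real \<Rightarrow> real \<Rightarrow> complex" where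
  "symmetric_rearr f c x = complex_of_real (rearr f (c * (2 * \<bar>x\<bar>)))"

lemma symmetric_rearr_measurable: "f \<in> L0 \<Longrightarrow> symmetric_rearr f c \<in> L0"
proof (rule borel_imp_L0)
  assume "f \<in> L0"
  note [measurable] = rearr_measurable[OF this]
  show "symmetric_rearr f c \<in> borel_measurable borel" unfolding symmetric_rearr_def[abs_def] by measurable
qed

lemma symmetric_rearr_shrink:
  assumes f: "f \<in> X" and A: "1 < A" and q: "0 \<le> q" "\<And>g. g \<in> X \<Longrightarrow> N (dilation A g) \<le> q * N g"
  shows "symmetric_rearr f (A ^ k) \<in> X \<and> N (symmetric_rearr f (A ^ k)) \<le> q ^ k * N (symmetric_rearr f 1)"
proof (induction k)
  case 0
  then show ?case using symmetric_rearrangement_in[OF f] by (simp add: symmetric_rearr_def[abs_def])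
next
  case (Suc k)
  have fL: "f \<in> L0" by (rule in_L0[OF f])
  have "dilation A (symmetric_rearr f (A ^ k)) x = symmetric_rearr f (A ^ Suc k) x" for x
  proof (cases "-1 < A * x \<and> A * x < 1")
    case True
    then show ?thesis using A by (simp add: dilation_def symmetric_rearr_def abs_mult mult_ac)
  next
    case False
    then have "1 \<le> \<bar>A * x\<bar>" by (auto simp: abs_if)
    then have "1 \<le> A * \<bar>x\<bar>" using A by (simp add: abs_mult)
    also have "\<dots> \<le> A ^ k * (A * \<bar>x\<bar>)" using A mult_right_mono[of 1 "A ^ k" "A * \<bar>x\<bar>"] by simp
    finally have "2 \<le> A ^ Suc k * (2 * \<bar>x\<bar>)" by (simp add: mult_ac)
    then show ?thesis using False rearr_eq_0[OF fL] by (auto simp: dilation_def symmetric_rearr_def)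
  qed
  then have eq: "dilation A (symmetric_rearr f (A ^ k)) = symmetric_rearr f (A ^ Suc k)" by auto
  have "N (symmetric_rearr f (A ^ Suc k)) \<le> q * N (symmetric_rearr f (A ^ k))" unfolding eq[symmetric] using Suc q by blast
  also have "\<dots> \<le> q * (q ^ k * N (symmetric_rearr f 1))" using Suc q by (intro mult_left_mono) auto
  finally show ?case using dilation_in[of A "symmetric_rearr f (A ^ k)"] A Suc eq by (simp add: mult.assoc)
qed

lemma symmetric_rearr_stretch:
  assumes f: "f \<in> X" and B: "1 < B" and s: "0 \<le> s" "\<And>g. g \<in> X \<Longrightarrow> N (dilation (1 / B) g) \<le> s * N g"
  shows "symmetric_rearr f (1 / B ^ k) \<in> X \<and> N (symmetric_rearr f (1 / B ^ k)) \<le> s ^ k * N (symmetric_rearr f 1)"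
proof (induction k)
  case 0
  then show ?case using symmetric_rearrangement_in[OF f] by (simp add: symmetric_rearr_def[abs_def])
next
  case (Suc k)
  have fL: "f \<in> L0" by (rule in_L0[OF f])
  have "AE x in mu. dilation (1 / B) (symmetric_rearr f (1 / B ^ k)) x = symmetric_rearr f (1 / B ^ Suc k) x"
    using AE_mu_space
  proof eventually_elim
    case (elim x)
    have "\<bar>x\<bar> * 1 \<le> \<bar>x\<bar> * B" using B by (intro mult_left_mono) auto
    then have "\<bar>x\<bar> < B" using elim B by auto
    then have "-1 < 1 / B * x \<and> 1 / B * x < 1" using B by (simp add: abs_less_iff field_simps)
    then show ?case using B by (simp add: dilation_def symmetric_rearr_def abs_mult mult_ac)
  qed
  from N_cong[OF dilation_in symmetric_rearr_measurable[OF fL] this] Suc B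
  have eq: "symmetric_rearr f (1 / B ^ Suc k) \<in> X" "N (symmetric_rearr f (1 / B ^ Suc k)) = N (dilation (1 / B) (symmetric_rearr f (1 / B ^ k)))"
    by auto
  have "N (symmetric_rearr f (1 / B ^ Suc k)) \<le> s * N (symmetric_rearr f (1 / B ^ k))" unfolding eq using Suc s by blast
  also have "\<dots> \<le> s * (s ^ k * N (symmetric_rearr f 1))" using Suc s by (intro mult_left_mono) auto
  finally show ?case using eq by (simp add: mult.assoc)
qed

text \<open>
  On \<open>(-1,1)\<close> the dilated symmetric rearrangement is at least the constant \<open>rearr f (2 / B ^ k)\<close>, while its
  norm is at most \<open>s ^ k\<close> times a constant.
\<close>

lemma rearr_decay:
  assumes f: "f \<in> X" and B: "1 < B" and s: "0 \<le> s" "\<And>g. g \<in> X \<Longrightarrow> N (dilation (1 / B) g) \<le> s * N g"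
  shows "rearr f (2 / B ^ k) \<le> N (symmetric_rearr f 1) / N (\<lambda>x. 1) * s ^ k"
proof -
  have fL: "f \<in> L0" by (rule in_L0[OF f])
  define c where "c = rearr f (2 / B ^ k)"
  have c0: "0 \<le> c" unfolding c_def by (rule rearr_nonneg[OF fL])
  have Bk: "0 < B ^ k" using B by simp
  have "AE x in lborel. x \<noteq> 0" by (rule AE_lborel_singleton)
  then have "AE x in mu. x \<noteq> 0" unfolding AE_mu_iff by eventually_elim auto
  then have "AE x in mu. cmod (complex_of_real c * 1) \<le> cmod (symmetric_rearr f (1 / B ^ k) x)"
    using AE_mu_space
  proof eventually_elim
    case (elim x)
    have "c \<le> rearr f (1 / B ^ k * (2 * \<bar>x\<bar>))"
      unfolding c_def using elim Bk by (intro rearr_antimono[OF fL]) (auto simp: field_simps)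
    then show ?case using c0 by (simp add: symmetric_rearr_def)
  qed
  then have "N (\<lambda>x. complex_of_real c * 1) \<le> N (symmetric_rearr f (1 / B ^ k))"
    using symmetric_rearr_stretch[OF f B s] by (intro norm_mono scale const_in) auto
  also have "\<dots> \<le> s ^ k * N (symmetric_rearr f 1)" using symmetric_rearr_stretch[OF f B s] by blast
  finally have "c * N (\<lambda>x. 1) \<le> s ^ k * N (symmetric_rearr f 1)"
    using norm_scale[OF const_in[of 1], of "complex_of_real c"] c0 by simp
  then show ?thesis using N_one_pos by (simp add: c_def field_simps)
qed

lemma summable_rearr:
  assumes f: "f \<in> X" and B: "1 < B" and s: "0 \<le> s" "s < B" "\<And>g. g \<in> X \<Longrightarrow> N (dilation (1 / B) g) \<le> s * N g" and t: "0 < t"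
  shows "summable (\<lambda>j. rearr f (t / B ^ j) / B ^ j)"
proof -
  have fL: "f \<in> L0" by (rule in_L0[OF f])
  obtain i where i: "2 / t < B ^ i" using real_arch_pow[OF B] by blast
  define K where "K = N (symmetric_rearr f 1) / N (\<lambda>x. 1)"
  show ?thesis
  proof (rule summable_comparison_test[of _ "\<lambda>j. K * s ^ i * (s / B) ^ j"], intro exI[of _ 0] allI impI)
    show "summable (\<lambda>j. K * s ^ i * (s / B) ^ j)" using s B by (intro summable_mult summable_geometric) simp
    fix j
    have Bp: "0 < B ^ i" "0 < B ^ j" using B by auto
    have "2 / B ^ (i + j) \<le> t / B ^ j"
      using i t Bp by (simp add: power_add field_simps)
    then have "rearr f (t / B ^ j) \<le> rearr f (2 / B ^ (i + j))"
      using Bp by (intro rearr_antimono[OF fL]) (auto simp: power_add)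
    also have "\<dots> \<le> K * s ^ (i + j)" unfolding K_def by (rule rearr_decay[OF f B s(1,3)])
    finally have "rearr f (t / B ^ j) / B ^ j \<le> K * s ^ (i + j) / B ^ j" using Bp by (intro divide_right_mono) auto
    also have "\<dots> = K * s ^ i * (s / B) ^ j" by (simp add: power_add power_divide)
    finally show "norm (rearr f (t / B ^ j) / B ^ j) \<le> K * s ^ i * (s / B) ^ j"
      using rearr_nonneg[OF fL] Bp by simp
  qed
qed

text \<open>
  For some \<open>B > 1\<close> and \<open>s < B\<close> one has \<open>rearr f (2 / B ^ k) = O(s ^ k)\<close>, which makes the rearrangement
  integrable near \<open>0\<close>.
\<close>

lemma X_integrable:
  assumes f: "f \<in> X" and u: "upper_boyd_index X N < 1"
  shows "integrable mu f"
proof -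
  have fL: "f \<in> L0" by (rule in_L0[OF f])
  obtain B s where B: "1 < B" and s: "0 \<le> s" "s < B" "\<And>g. g \<in> X \<Longrightarrow> N (dilation (1 / B) g) \<le> s * N g"
    using expansion_of_upper_boyd_index[OF u] by auto
  have S: "summable (\<lambda>j. rearr f (2 / B ^ j) / B ^ j)" using summable_rearr[OF f B s, of 2] by simp
  have "(\<integral>\<^sup>+x. ennreal (cmod (f x)) \<partial>mu) = (\<integral>\<^sup>+x. ennreal (cmod (f x)) * indicator {x. rearr f 2 < cmod (f x)} x \<partial>mu)"
    using rearr_eq_0[OF fL, of 2] by (intro nn_integral_cong) (auto simp: indicator_def)
  also have "\<dots> \<le> (\<Sum>j. ennreal (rearr f (2 / B ^ Suc j) * (2 / B ^ j)))"
    by (rule nn_integral_large_values_le[OF fL B]) simp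
  also have "\<dots> = (\<Sum>j. ennreal (2 * B * (rearr f (2 / B ^ Suc j) / B ^ Suc j)))"
    using B by (simp add: field_simps)
  also have "\<dots> = ennreal (\<Sum>j. 2 * B * (rearr f (2 / B ^ Suc j) / B ^ Suc j))"
  proof (rule suminf_ennreal2)
    show "summable (\<lambda>j. 2 * B * (rearr f (2 / B ^ Suc j) / B ^ Suc j))"
      using S summable_Suc_iff[of "\<lambda>j. rearr f (2 / B ^ j) / B ^ j"] by (intro summable_mult) simp
    show "0 \<le> 2 * B * (rearr f (2 / B ^ Suc j) / B ^ Suc j)" for j
      using B rearr_nonneg[OF fL] by (intro mult_nonneg_nonneg divide_nonneg_nonneg) auto
  qed
  also have "\<dots> < \<infinity>" by simp
  finally show ?thesis using fL by (simp add: integrable_iff_bounded)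
qed

text \<open>
  The bound \<open>W t\<close> of the rearrangement of the transform gives the function \<open>W (2 * \<bar>x\<bar>)\<close>, a series of
  dilated symmetric rearrangements of \<open>f\<close> whose norms are summable. It belongs to \<open>X\<close>, and it has a
  larger distribution function than the transform.
\<close>

theorem finite_hilbert_transform_nonneg_in:
  fixes f :: "real \<Rightarrow> real"
  defines "h \<equiv> \<lambda>x. complex_of_real (f x)"
  assumes lower: "0 < lower_boyd_index X N" and upper: "upper_boyd_index X N < 1"
    and h: "h \<in> X" and f0: "\<And>x. 0 \<le> f x"
  shows "\<H> h \<in> X"
proof -
  interpret m: finite_measure mu by (rule finite_measure_mu)
  have hL: "h \<in> L0" by (rule in_L0[OF h])
  have hi: "integrable mu h" by (rule X_integrable[OF h upper])
  have fi: "integrable mu f" using integrable_Re[OF hi] by (simp add: h_def)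
  obtain A q where A: "1 < A" and q: "0 \<le> q" "q < 1" "\<And>g. g \<in> X \<Longrightarrow> N (dilation A g) \<le> q * N g"
    using contraction_of_lower_boyd_index[OF lower] by auto
  obtain B s where B: "1 < B" and s: "0 \<le> s" "s < B" "\<And>g. g \<in> X \<Longrightarrow> N (dilation (1 / B) g) \<le> s * N g"
    using expansion_of_upper_boyd_index[OF upper] by auto
  \<comment> \<open>With this \<open>D\<close> the decay of the exponential beats the growth \<open>A ^ k\<close> of the measures.\<close>
  define D where "D = max 3 (2 * ln (16 * A))"
  have D3: "3 \<le> D" by (simp add: D_def)
  have DA: "exp (- D / 2) \<le> 1 / (16 * A)"
  proof -
    have "exp (- D / 2) \<le> exp (- ln (16 * A))" by (simp add: D_def)
    also have "\<dots> = 1 / (16 * A)" using A by (simp add: exp_minus inverse_eq_divide)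
    finally show ?thesis .
  qed
  define u where "u k t = 4 * B * (rearr h (t / B ^ k) / B ^ k) + D * real (Suc k) * rearr h (A ^ k * t)" for k t
  have u0: "0 \<le> u k t" for k t
    unfolding u_def using B D3 rearr_nonneg[OF hL] by (intro add_nonneg_nonneg mult_nonneg_nonneg divide_nonneg_nonneg) auto
  have us: "summable (\<lambda>k. u k t)" and us1: "summable (\<lambda>k. D * real (Suc k) * rearr h (A ^ k * t))" if t: "0 < t" for t
  proof -
    obtain K where K: "2 / t < A ^ K" using real_arch_pow[OF A] by blast
    have "rearr h (A ^ k * t) = 0" if "k \<notin> {..<K}" for k
    proof -
      have "A ^ K \<le> A ^ k" using A that by (intro power_increasing) auto
      then have "2 / t < A ^ k" using K by simp
      then have "2 \<le> A ^ k * t" using t by (simp add: field_simps)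
      then show ?thesis by (rule rearr_eq_0[OF hL])
    qed
    then show 1: "summable (\<lambda>k. D * real (Suc k) * rearr h (A ^ k * t))" by (intro summable_finite[of "{..<K}"]) auto
    show "summable (\<lambda>k. u k t)" unfolding u_def by (intro summable_add summable_mult 1 summable_rearr[OF h B s t])
  qed
  define W where "W t = (\<Sum>k. u k t)" for t
  have bound: "distribution_function (\<H> h) (W t) \<le> t" if t: "0 < t" for t
  proof -
    have S: "summable (\<lambda>j. rearr h (t / B ^ j) / B ^ j)" by (rule summable_rearr[OF h B s t])
    have "W t = 4 * B * (\<Sum>j. rearr h (t / B ^ j) / B ^ j) + (\<Sum>k. D * real (Suc k) * rearr h (A ^ k * t))"
      unfolding W_def u_def using suminf_add[OF summable_mult[OF S, of "4 * B"] us1[OF t]] suminf_mult[OF S, of "4 * B"] by simp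
    then show ?thesis using calderon_bound[OF fi f0 A B t D3 DA] S unfolding h_def by simp
  qed
  have Wmono: "W t' \<le> W t" if t: "0 < t" "t \<le> t'" for t t'
    unfolding W_def
  proof (intro suminf_le us)
    show "u k t' \<le> u k t" for k
      unfolding u_def using t A B D3
      by (intro add_mono mult_left_mono divide_right_mono rearr_antimono[OF hL]) (auto simp: divide_right_mono)
  qed (use t in auto)
  define w where "w x = W (2 * \<bar>x\<bar>)" for x
  have wX: "(\<lambda>x. complex_of_real (w x)) \<in> X"
  proof -
    note [measurable] = rearr_measurable[OF hL]
    have ueq: "(\<lambda>x. complex_of_real (u k (2 * \<bar>x\<bar>))) = (\<lambda>x. complex_of_real (4 * B / B ^ k) * symmetric_rearr h (1 / B ^ k) x + complex_of_real (D * real (Suc k)) * symmetric_rearr h (A ^ k) x)" for k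
      by (simp add: u_def symmetric_rearr_def)
    have sh: "symmetric_rearr h (A ^ k) \<in> X" "N (symmetric_rearr h (A ^ k)) \<le> q ^ k * N (symmetric_rearr h 1)" for k
      using symmetric_rearr_shrink[OF h A q(1,3)] by blast+
    have st: "symmetric_rearr h (1 / B ^ k) \<in> X" "N (symmetric_rearr h (1 / B ^ k)) \<le> s ^ k * N (symmetric_rearr h 1)" for k
      using symmetric_rearr_stretch[OF h B s(1,3)] by blast+
    have uX: "(\<lambda>x. complex_of_real (u k (2 * \<bar>x\<bar>))) \<in> X" for k
      unfolding ueq by (intro add scale sh st)
    have uN: "N (\<lambda>x. complex_of_real (u k (2 * \<bar>x\<bar>))) \<le> 4 * B * N (symmetric_rearr h 1) * (s / B) ^ k + D * N (symmetric_rearr h 1) * (real (Suc k) * q ^ k)" for k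
    proof -
      have "N (\<lambda>x. complex_of_real (u k (2 * \<bar>x\<bar>))) \<le> (4 * B / B ^ k) * N (symmetric_rearr h (1 / B ^ k)) + (D * real (Suc k)) * N (symmetric_rearr h (A ^ k))"
        unfolding ueq using B D3
        by (intro order_trans[OF norm_triangle[OF scale[OF st(1)] scale[OF sh(1)]]])
           (simp add: norm_scale[OF st(1)] norm_scale[OF sh(1)] norm_mult norm_divide norm_power del: of_real_mult of_real_divide of_nat_Suc)
      also have "\<dots> \<le> (4 * B / B ^ k) * (s ^ k * N (symmetric_rearr h 1)) + (D * real (Suc k)) * (q ^ k * N (symmetric_rearr h 1))"
        using B D3 by (intro add_mono mult_left_mono sh st) auto
      finally show ?thesis by (simp add: power_divide mult_ac)
    qed
    have "summable (\<lambda>k. real (Suc k) * q ^ k)"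
      using geometric_deriv_sums[of q] q by (auto simp: sums_iff)
    then have "summable (\<lambda>k. 4 * B * N (symmetric_rearr h 1) * (s / B) ^ k + D * N (symmetric_rearr h 1) * (real (Suc k) * q ^ k))"
      using s B by (intro summable_add summable_mult summable_geometric) auto
    then have sm: "summable (\<lambda>k. N (\<lambda>x. complex_of_real (u k (2 * \<bar>x\<bar>))))"
      by (rule summable_comparison_test') (use uN N_nonneg[OF uX] in simp)
    obtain g where g: "g \<in> X" "AE x in mu. \<forall>n. (\<Sum>i<n. u i (2 * \<bar>x\<bar>)) \<le> cmod (g x)"
      using nonneg_series_dominated[of "\<lambda>k x. u k (2 * \<bar>x\<bar>)", OF uX _ sm] u0 by auto
    show ?thesis
    proof (rule ideal[OF g(1)])
      have "(\<lambda>x. u k (2 * \<bar>x\<bar>)) \<in> borel_measurable borel" for k unfolding u_def by measurable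
      then have "w \<in> borel_measurable borel" unfolding w_def[abs_def] W_def by (rule borel_measurable_suminf)
      then show "(\<lambda>x. complex_of_real (w x)) \<in> L0" by (intro borel_imp_L0) measurable
      have "AE x in lborel. x \<noteq> 0" by (rule AE_lborel_singleton)
      then have "AE x in mu. x \<noteq> 0" unfolding AE_mu_iff by eventually_elim auto
      then show "AE x in mu. cmod (complex_of_real (w x)) \<le> cmod (g x)"
        using g(2)
      proof eventually_elim
        case (elim x)
        then have sx: "summable (\<lambda>k. u k (2 * \<bar>x\<bar>))" by (intro us) simp
        then have "w x \<le> cmod (g x)" unfolding w_def W_def using elim(2) by (intro suminf_le_const) auto
        moreover have "0 \<le> w x" unfolding w_def W_def using sx u0 by (rule suminf_nonneg)
        ultimately show ?case by simp
      qed
    qed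
  qed
  show ?thesis
  proof (rule ri_mono[OF wX finite_hilbert_transform_measurable[OF hi]])
    fix l :: real assume l: "0 \<le> l"
    define d where "d = distribution_function (\<lambda>x. complex_of_real (w x)) l"
    have d0: "0 \<le> d" unfolding d_def by (rule distribution_nonneg)
    show "distribution_function (\<H> h) l \<le> d"
    proof (rule ccontr)
      assume "\<not> ?thesis"
      \<comment> \<open>If the claim fails at \<open>l\<close>, a number \<open>t\<close> between the two distribution functions leads to a contradiction: \<open>W t \<le> l\<close>, as otherwise \<open>w\<close> exceeds \<open>l\<close> on a set of measure \<open>t\<close>.\<close>
      then obtain t where t: "d < t" "t < distribution_function (\<H> h) l" using dense[of d] by (auto simp: not_le)
      have HL: "\<H> h \<in> L0" by (rule finite_hilbert_transform_measurable[OF hi])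
      have t0: "0 < t" "t < 2" using t d0 distribution_le_2[OF HL, of l] by auto
      have "W t \<le> l"
      proof (rule ccontr)
        assume Wl: "\<not> W t \<le> l"
        have "measure mu ({-(t/2)<..<0} \<union> {0<..<t/2}) \<le> d"
          unfolding d_def distribution_function_def
        proof (rule m.finite_measure_mono[OF _ measurable_level[OF in_L0[OF wX]]])
          show "{-(t/2)<..<0} \<union> {0<..<t/2} \<subseteq> {x \<in> space mu. l < cmod (complex_of_real (w x))}"
          proof
            fix x assume x: "x \<in> {-(t/2)<..<0} \<union> {0<..<t/2}"
            then have "W t \<le> w x" unfolding w_def using t0 by (intro Wmono) auto
            then show "x \<in> {x \<in> space mu. l < cmod (complex_of_real (w x))}" using x t0 Wl by (auto simp: space_mu)
          qed
        qed
        moreover have "measure mu ({-(t/2)<..<0} \<union> {0<..<t/2}) = t"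
        proof -
          have "measure mu ({-(t/2)<..<0} \<union> {0<..<t/2}) = measure mu {-(t/2)<..<0} + measure mu {0<..<t/2}"
            using t0 by (intro m.finite_measure_Union) (auto simp: sets_mu_iff)
          also have "measure mu {-(t/2)<..<0} = t/2" using t0 by (subst measure_mu) auto
          also have "measure mu {0<..<t/2} = t/2" using t0 by (subst measure_mu) auto
          finally show ?thesis by simp
        qed
        ultimately show False using t by simp
      qed
      then have "distribution_function (\<H> h) l \<le> distribution_function (\<H> h) (W t)" by (rule distribution_antimono[OF HL])
      also have "\<dots> \<le> t" by (rule bound[OF t0(1)])
      finally show False using t by simp
    qed
  qed
qed

lemma X_parts:
  assumes h: "h \<in> X"
  shows "(\<lambda>x. complex_of_real (rpos (\<lambda>x. Re (h x)) x)) \<in> X" "(\<lambda>x. complex_of_real (rneg (\<lambda>x. Re (h x)) x)) \<in> X"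
    "(\<lambda>x. complex_of_real (rpos (\<lambda>x. Im (h x)) x)) \<in> X" "(\<lambda>x. complex_of_real (rneg (\<lambda>x. Im (h x)) x)) \<in> X"
proof -
  have [measurable]: "h \<in> L0" by (rule in_L0[OF h])
  have b: "\<bar>rpos (\<lambda>x. Re (h x)) x\<bar> \<le> cmod (h x)" "\<bar>rneg (\<lambda>x. Re (h x)) x\<bar> \<le> cmod (h x)"
    "\<bar>rpos (\<lambda>x. Im (h x)) x\<bar> \<le> cmod (h x)" "\<bar>rneg (\<lambda>x. Im (h x)) x\<bar> \<le> cmod (h x)" for x
    using abs_Re_le_cmod[of "h x"] abs_Im_le_cmod[of "h x"] by (auto simp: rpos_def rneg_def max_def)
  show "(\<lambda>x. complex_of_real (rpos (\<lambda>x. Re (h x)) x)) \<in> X" "(\<lambda>x. complex_of_real (rneg (\<lambda>x. Re (h x)) x)) \<in> X"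
    "(\<lambda>x. complex_of_real (rpos (\<lambda>x. Im (h x)) x)) \<in> X" "(\<lambda>x. complex_of_real (rneg (\<lambda>x. Im (h x)) x)) \<in> X"
    by (rule ideal[OF h]; use b in \<open>simp add: rpos_def[abs_def] rneg_def[abs_def]\<close>)+
qed

theorem finite_hilbert_transform_in:
  assumes lower: "0 < lower_boyd_index X N" and upper: "upper_boyd_index X N < 1" and h: "h \<in> X"
  shows "\<H> h \<in> X"
proof -
  have hi: "integrable mu h" by (rule X_integrable[OF h upper])
  define A where "A = (\<lambda>x. complex_of_real (rpos (\<lambda>x. Re (h x)) x))"
  define B where "B = (\<lambda>x. complex_of_real (rneg (\<lambda>x. Re (h x)) x))"
  define C where "C = (\<lambda>x. complex_of_real (rpos (\<lambda>x. Im (h x)) x))"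
  define D where "D = (\<lambda>x. complex_of_real (rneg (\<lambda>x. Im (h x)) x))"
  have X: "\<H> A \<in> X" "\<H> B \<in> X" "\<H> C \<in> X" "\<H> D \<in> X"
    unfolding A_def B_def C_def D_def
    by (intro finite_hilbert_transform_nonneg_in[OF lower upper] X_parts[OF h] rpos_nonneg rneg_nonneg)+
  have "(\<lambda>x. (\<H> A x + (-1) * \<H> B x) + (\<i> * \<H> C x + (- \<i>) * \<H> D x)) \<in> X"
    by (intro add scale X)
  moreover have "AE x in mu. (\<H> A x + (-1) * \<H> B x) + (\<i> * \<H> C x + (- \<i>) * \<H> D x) = \<H> h x"
    using finite_hilbert_transform_parts[OF hi] unfolding A_def B_def C_def D_def by eventually_elim simp
  ultimately show ?thesis using N_cong[OF _ finite_hilbert_transform_measurable[OF hi]] by blast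
qed

end

section \<open>The optimal domain\<close>

lemma L1_rapidly_Cauchy_converges:
  fixes s :: "nat \<Rightarrow> real \<Rightarrow> complex"
  assumes s: "\<And>n. integrable M (s n)" and b: "summable b"
    and le: "\<And>n. (\<integral>x. cmod (s (Suc n) x - s n x) \<partial>M) \<le> b n"
  shows "\<exists>h. integrable M h \<and> (AE x in M. (\<lambda>n. s n x) \<longlonglongrightarrow> h x) \<and>
    (AE x in M. summable (\<lambda>n. cmod (s (Suc n) x - s n x))) \<and>
    (\<forall>n. (\<integral>x. cmod (h x - s n x) \<partial>M) \<le> (\<Sum>i. b (i + n)))"
proof -
  define d where "d n x = s (Suc n) x - s n x" for n x
  have di: "integrable M (d n)" for n using s by (simp add: d_def[abs_def])
  have [measurable]: "s n \<in> borel_measurable M" for n using s by auto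
  have [measurable]: "d n \<in> borel_measurable M" for n using di by auto
  have b0: "0 \<le> b n" for n by (rule order_trans[OF _ le[of n]]) simp
  have dn: "(\<integral>\<^sup>+x. ennreal (cmod (d n x)) \<partial>M) \<le> ennreal (b n)" for n
    using le[of n] by (subst nn_integral_eq_integral[OF integrable_norm[OF di]]) (auto simp: d_def intro: ennreal_leI)
  have tail: "(\<integral>\<^sup>+x. (\<Sum>i. ennreal (cmod (d (i + n) x))) \<partial>M) \<le> ennreal (\<Sum>i. b (i + n))" for n
  proof -
    have "(\<integral>\<^sup>+x. (\<Sum>i. ennreal (cmod (d (i + n) x))) \<partial>M) = (\<Sum>i. \<integral>\<^sup>+x. ennreal (cmod (d (i + n) x)) \<partial>M)"
      by (rule nn_integral_suminf) measurable
    also have "\<dots> \<le> (\<Sum>i. ennreal (b (i + n)))" by (intro suminf_le summableI dn)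
    also have "\<dots> = ennreal (\<Sum>i. b (i + n))" using b b0 by (intro suminf_ennreal2) (auto intro: summable_ignore_initial_segment)
    finally show ?thesis .
  qed
  have "AE x in M. (\<Sum>i. ennreal (cmod (d i x))) \<noteq> \<infinity>"
    by (rule nn_integral_noteq_infinite) (use tail[of 0] in \<open>auto simp: top_unique\<close>)
  then have sm: "AE x in M. summable (\<lambda>n. cmod (d n x))"
    by eventually_elim (auto intro: summable_suminf_not_top)
  define h where "h x = lim (\<lambda>n. s n x)" for x
  have [measurable]: "h \<in> borel_measurable M" unfolding h_def by (rule borel_measurable_lim_metric) simp
  have conv: "AE x in M. (\<lambda>n. s n x) \<longlonglongrightarrow> h x"
    using sm
  proof eventually_elim
    case (elim x)
    then have "summable (\<lambda>n. d n x)" by (rule summable_norm_cancel)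
    then have "convergent (\<lambda>n. \<Sum>k<n. d k x)" by (simp add: summable_iff_convergent)
    then have "convergent (\<lambda>n. s n x - s 0 x)"
      unfolding d_def sum_lessThan_telescope[of "\<lambda>k. s k x"] .
    from convergent_add[OF this convergent_const[of "s 0 x"]]
    have "convergent (\<lambda>k. s k x)" by simp
    then show ?case unfolding h_def by (simp add: convergent_LIMSEQ_iff)
  qed
  have hn: "(\<integral>\<^sup>+x. ennreal (cmod (h x - s n x)) \<partial>M) \<le> ennreal (\<Sum>i. b (i + n))" for n
  proof -
    have "(\<integral>\<^sup>+x. ennreal (cmod (h x - s n x)) \<partial>M) \<le> (\<integral>\<^sup>+x. (\<Sum>i. ennreal (cmod (d (i + n) x))) \<partial>M)"
    proof (rule nn_integral_mono_AE)
      show "AE x in M. ennreal (cmod (h x - s n x)) \<le> (\<Sum>i. ennreal (cmod (d (i + n) x)))"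
        using conv sm
      proof eventually_elim
        case (elim x)
        have s1: "summable (\<lambda>i. cmod (d (i + n) x))" by (rule summable_ignore_initial_segment[OF elim(2)])
        have "cmod (h x - s n x) \<le> (\<Sum>i. cmod (d (i + n) x))"
        proof (rule LIMSEQ_le_const2)
          show "(\<lambda>m. cmod (s m x - s n x)) \<longlonglongrightarrow> cmod (h x - s n x)" by (intro tendsto_intros elim(1))
          show "\<exists>N. \<forall>m\<ge>N. cmod (s m x - s n x) \<le> (\<Sum>i. cmod (d (i + n) x))"
          proof (intro exI[of _ n] allI impI)
            fix m assume "n \<le> m"
            then obtain k where m: "m = n + k" using le_Suc_ex by blast
            have "s m x - s n x = (\<Sum>i<k. d (i + n) x)"
              unfolding m d_def using sum_lessThan_telescope[of "\<lambda>i. s (i + n) x" k] by (simp add: add.commute)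
            also have "cmod \<dots> \<le> (\<Sum>i<k. cmod (d (i + n) x))" by (rule norm_sum)
            also have "\<dots> \<le> (\<Sum>i. cmod (d (i + n) x))" by (rule sum_le_suminf[OF s1]) auto
            finally show "cmod (s m x - s n x) \<le> (\<Sum>i. cmod (d (i + n) x))" .
          qed
        qed
        then have "ennreal (cmod (h x - s n x)) \<le> ennreal (\<Sum>i. cmod (d (i + n) x))" by (rule ennreal_leI)
        also have "\<dots> = (\<Sum>i. ennreal (cmod (d (i + n) x)))" by (rule suminf_ennreal2[symmetric, OF _ s1]) simp
        finally show ?case .
      qed
    qed
    then show ?thesis using tail[of n] by (rule order_trans)
  qed
  have hsi: "integrable M (\<lambda>x. h x - s n x)" for n
  proof -
    have "(\<integral>\<^sup>+x. ennreal (norm (h x - s n x)) \<partial>M) < \<infinity>" using hn[of n] by (rule order.strict_trans1) simp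
    then show ?thesis by (simp add: integrable_iff_bounded)
  qed
  have "integrable M (\<lambda>x. (h x - s 0 x) + s 0 x)" by (intro Bochner_Integration.integrable_add hsi s)
  then have hi: "integrable M h" by simp
  have "(\<integral>x. cmod (h x - s n x) \<partial>M) \<le> (\<Sum>i. b (i + n))" for n
  proof -
    have "ennreal (\<integral>x. cmod (h x - s n x) \<partial>M) \<le> ennreal (\<Sum>i. b (i + n))"
      using hn[of n] by (subst (asm) nn_integral_eq_integral[OF integrable_norm[OF hsi]]) auto
    moreover have "0 \<le> (\<Sum>i. b (i + n))" using b b0 by (intro suminf_nonneg summable_ignore_initial_segment)
    ultimately show ?thesis by simp
  qed
  then show ?thesis using hi conv sm unfolding d_def by blast
qed

text \<open>
  Everything about the optimal domain follows from the two assumptions of this locale, which hold under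
  the Boyd index conditions by \<open>X_integrable\<close> and \<open>finite_hilbert_transform_in\<close>.
\<close>

locale hilbert_invariant_space = rearrangement_invariant_space +
  assumes subset_L1: "\<And>f. f \<in> X \<Longrightarrow> integrable mu f"
    and transform_in: "\<And>f. f \<in> X \<Longrightarrow> \<H> f \<in> X"
begin

text \<open>
  By \<open>finite_hilbert_transform_times_id\<close>, the constant \<open>(1/\<pi>) \<integral> h\<close> is the difference of \<open>H (x h)\<close> and
  \<open>x H h\<close>, and \<open>\<bar>x\<bar> \<le> 1\<close>.
\<close>

lemma integral_bound:
  assumes h: "integrable mu h" and H: "\<H> h \<in> X" "\<H> (\<lambda>x. of_real x * h x) \<in> X"
  shows "cmod (\<integral>x. h x \<partial>mu) * N (\<lambda>x. 1) \<le> pi * (N (\<H> (\<lambda>x. of_real x * h x)) + N (\<H> h))"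
proof -
  define c where "c = of_real (1 / pi) * (\<integral>x. h x \<partial>mu)"
  have [measurable]: "(\<lambda>x. complex_of_real x) \<in> L0" by (rule borel_imp_L0) measurable
  have [measurable]: "\<H> h \<in> L0" by (rule in_L0[OF H(1)])
  have le: "AE x in mu. cmod (of_real x * \<H> h x) \<le> cmod (\<H> h x)"
    using AE_mu_space by eventually_elim (auto simp: norm_mult intro!: mult_left_le_one_le)
  have tX: "(\<lambda>x. of_real x * \<H> h x) \<in> X" by (rule ideal[OF H(1) _ le]) measurable
  have tN: "N (\<lambda>x. of_real x * \<H> h x) \<le> N (\<H> h)" by (rule norm_mono[OF H(1) tX le])
  have "AE x in mu. \<H> (\<lambda>x. of_real x * h x) x - of_real x * \<H> h x = c * 1"
    using finite_hilbert_transform_times_id[OF h] unfolding c_def by eventually_elim simp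
  from N_cong[OF diff_in[OF H(2) tX] _ this]
  have "N (\<lambda>x. c * 1) = N (\<lambda>x. \<H> (\<lambda>x. of_real x * h x) x - of_real x * \<H> h x)" by simp
  also have "\<dots> \<le> N (\<H> (\<lambda>x. of_real x * h x)) + N (\<lambda>x. of_real x * \<H> h x)"
    using norm_triangle[OF H(2) scale[OF tX, of "-1"]] norm_scale[OF tX, of "-1"] by simp
  also have "\<dots> \<le> N (\<H> (\<lambda>x. of_real x * h x)) + N (\<H> h)" using tN by simp
  finally have "cmod c * N (\<lambda>x. 1) \<le> N (\<H> (\<lambda>x. of_real x * h x)) + N (\<H> h)"
    by (simp only: norm_scale[OF const_in])
  then show ?thesis by (simp add: c_def norm_mult norm_divide field_simps)
qed

text \<open>
  Along a subsequence the transforms converge almost everywhere. Then the infima \<open>u k\<close> of the tails of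
  their absolute values increase to \<open>\<bar>H g\<bar>\<close>, and the Fatou property applies to them.
\<close>

lemma norm_lower_semicontinuous:
  assumes hn: "\<And>n. integrable mu (h n)" and g: "integrable mu g"
    and conv: "(\<lambda>n. \<integral>x. cmod (h n x - g x) \<partial>mu) \<longlonglongrightarrow> 0"
    and X: "\<And>n. \<H> (h n) \<in> X" and C: "\<And>n. N (\<H> (h n)) \<le> C"
  shows "\<H> g \<in> X \<and> N (\<H> g) \<le> C"
proof -
  obtain r where r: "strict_mono (r :: nat \<Rightarrow> nat)" and ae: "AE x in mu. (\<lambda>n. \<H> (h (r n)) x) \<longlonglongrightarrow> \<H> g x"
    using AE_subseq_finite_hilbert_transform[OF hn g conv] by blast
  define v where "v n x = cmod (\<H> (h (r n)) x)" for n x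
  have [measurable]: "\<H> g \<in> L0" by (rule finite_hilbert_transform_measurable[OF g])
  have [measurable]: "v n \<in> borel_measurable mu" for n
    unfolding v_def using in_L0[OF X] by measurable
  define u where "u k x = (INF n\<in>{k..}. v n x)" for k x
  have bdd: "bdd_below ((\<lambda>n. v n x) ` A)" for x A by (rule bdd_belowI[of _ 0]) (auto simp: v_def)
  have [measurable]: "u k \<in> borel_measurable mu" for k
    unfolding u_def using bdd by (intro borel_measurable_cINF) auto
  have u0: "0 \<le> u k x" for k x unfolding u_def by (rule cINF_greatest) (auto simp: v_def)
  have uv: "u k x \<le> v k x" for k x unfolding u_def by (rule cINF_lower[OF bdd]) simp
  have um: "u k x \<le> u (Suc k) x" for k x unfolding u_def by (rule cINF_superset_mono[OF _ bdd]) auto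
  have uX: "(\<lambda>x. complex_of_real (u k x)) \<in> X" for k
    by (rule ideal[OF X[of "r k"]]) (use uv[of k] u0[of k] in \<open>auto simp: v_def\<close>)
  have uN: "N (\<lambda>x. complex_of_real (u k x)) \<le> C" for k
    by (rule order_trans[OF norm_mono[OF X[of "r k"] uX] C]) (use uv[of k] u0[of k] in \<open>auto simp: v_def\<close>)
  have lim: "AE x in mu. ereal (cmod (\<H> g x)) = (SUP n. ereal (u n x))"
    using ae
  proof eventually_elim
    case (elim x)
    have vl: "(\<lambda>n. v n x) \<longlonglongrightarrow> cmod (\<H> g x)" unfolding v_def by (intro tendsto_norm elim)
    have "(\<lambda>n. u n x) \<longlonglongrightarrow> cmod (\<H> g x)"
    proof (rule LIMSEQ_I)
      fix e :: real assume "0 < e"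
      then obtain M where M: "\<And>n. M \<le> n \<Longrightarrow> norm (v n x - cmod (\<H> g x)) < e / 2" using LIMSEQ_D[OF vl, of "e / 2"] by auto
      show "\<exists>no. \<forall>n\<ge>no. norm (u n x - cmod (\<H> g x)) < e"
      proof (intro exI[of _ M] allI impI)
        fix n assume n: "M \<le> n"
        have "cmod (\<H> g x) - e / 2 \<le> u n x" unfolding u_def
        proof (rule cINF_greatest)
          fix i assume "i \<in> {n..}"
          then have "M \<le> i" using n by simp
          from M[OF this] show "cmod (\<H> g x) - e / 2 \<le> v i x" unfolding real_norm_def by linarith
        qed simp
        moreover have "u n x < cmod (\<H> g x) + e / 2" using uv[of n x] M[OF n] unfolding real_norm_def by linarith
        ultimately show "norm (u n x - cmod (\<H> g x)) < e" using \<open>0 < e\<close> unfolding real_norm_def by linarith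
      qed
    qed
    then have "(\<lambda>n. ereal (u n x)) \<longlonglongrightarrow> ereal (cmod (\<H> g x))" by simp
    moreover have "incseq (\<lambda>n. ereal (u n x))" by (rule incseq_SucI) (simp add: um)
    ultimately show ?case using LIMSEQ_unique LIMSEQ_SUP by blast
  qed
  have fat: "(\<lambda>x. complex_of_real (cmod (\<H> g x))) \<in> X \<and>
      (\<lambda>n. N (\<lambda>x. complex_of_real (u n x))) \<longlonglongrightarrow> N (\<lambda>x. complex_of_real (cmod (\<H> g x)))"
  proof (rule fatou[unfolded fatou_property_def, rule_format])
    show "bdd_above (range (\<lambda>n. N (\<lambda>x. complex_of_real (u n x))))" using uN by (intro bdd_aboveI[of _ C]) auto
    show "AE x in mu. ereal (cmod (\<H> g x)) = (SUP n. ereal (u n x))" by (rule lim)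
  qed (use uX u0 um in auto)
  have gX: "\<H> g \<in> X" by (rule ideal[OF conjunct1[OF fat]]) auto
  moreover have "N (\<lambda>x. complex_of_real (cmod (\<H> g x))) \<le> C"
    by (rule LIMSEQ_le_const2[OF conjunct2[OF fat]]) (use uN in auto)
  ultimately show ?thesis using abs_in[OF gX] by simp
qed

lemma opt_domain_iff: "f \<in> opt_domain X \<longleftrightarrow> integrable mu f \<and> (\<forall>h\<in>dominated f. \<H> h \<in> X)"
  by (simp add: opt_domain_def)

lemma dominated_integrable: "integrable mu f \<Longrightarrow> h \<in> dominated f \<Longrightarrow> integrable mu h"
  by (rule Bochner_Integration.integrable_bound) (auto simp: dominated_def)

lemma zero_dominated: "(\<lambda>x. 0) \<in> dominated f" by (simp add: dominated_def)

text \<open>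
  A gliding hump argument. Otherwise one adds to a partial sum \<open>s\<close> a small multiple \<open>c * g\<close> of a function
  \<open>g\<close> dominated by \<open>f\<close> whose transform has a huge norm. Lower semicontinuity turns the large norm of
  the transform of the new sum into a whole \<open>L\<^sup>1\<close> ball of dominated functions with that property. The
  balls are nested, and their common point is dominated by \<open>f\<close> and would have a transform of infinite
  norm.
\<close>

lemma dominated_norm_bounded:
  assumes f: "f \<in> opt_domain X"
  shows "bdd_above ((\<lambda>h. N (\<H> h)) ` dominated f)"
proof (rule ccontr)
  assume "\<not> ?thesis"
  then have unb: "\<exists>g\<in>dominated f. M < N (\<H> g)" for M
    unfolding bdd_above_def by (auto simp: not_le)
  have fi: "integrable mu f" and fX: "\<And>h. h \<in> dominated f \<Longrightarrow> \<H> h \<in> X" using f by (auto simp: opt_domain_iff)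
  have [measurable]: "f \<in> L0" using fi by auto
  define m where "m = (\<integral>x. cmod (f x) \<partial>mu)"
  have m0: "0 \<le> m" unfolding m_def by simp
  \<comment> \<open>A pair consists of a partial sum and of the radius of a ball around it. The factor \<open>1 - (1/2) ^ j\<close> leaves room for further summands.\<close>
  define P where "P j p \<longleftrightarrow> (0 < snd p \<and> fst p \<in> L0 \<and> (AE x in mu. cmod (fst p x) \<le> (1 - (1/2)^j) * cmod (f x)) \<and>
     (\<forall>h\<in>dominated f. (\<integral>x. cmod (h x - fst p x) \<partial>mu) < snd p \<longrightarrow> real j \<le> N (\<H> h)))"
     for j :: nat and p :: "(real \<Rightarrow> complex) \<times> real"
  define Q where "Q p p' \<longleftrightarrow> (snd p' \<le> snd p / 2 \<and> (\<integral>x. cmod (fst p' x - fst p x) \<partial>mu) \<le> snd p / 4)"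
     for p p' :: "(real \<Rightarrow> complex) \<times> real"
  have sub: "fst p \<in> dominated f" if "P j p" for j p
  proof -
    have "AE x in mu. cmod (fst p x) \<le> (1 - (1/2)^j) * cmod (f x)" using that by (simp add: P_def)
    then have "AE x in mu. cmod (fst p x) \<le> cmod (f x)"
    proof eventually_elim
      case (elim x)
      have "(1 - (1/2)^j) * cmod (f x) \<le> 1 * cmod (f x)" by (intro mult_right_mono) auto
      with elim show ?case by simp
    qed
    then show ?thesis using that by (simp add: P_def dominated_def)
  qed
  have base: "P 0 (\<lambda>x. 0, 1)" by (auto simp: P_def N_nonneg fX)
  have step: "\<exists>p'. P (Suc j) p' \<and> Q p p'" if Pj: "P j p" for j p
  proof -
    define s where "s = fst p"
    define \<delta> where "\<delta> = snd p"
    have sd: "s \<in> dominated f" unfolding s_def by (rule sub[OF Pj])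
    have \<delta>: "0 < \<delta>" and sle: "AE x in mu. cmod (s x) \<le> (1 - (1/2)^j) * cmod (f x)" using Pj by (auto simp: P_def s_def \<delta>_def)
    have si: "integrable mu s" by (rule dominated_integrable[OF fi sd])
    \<comment> \<open>The second bound keeps the new centre within \<open>\<delta> / 4\<close> of the old one.\<close>
    define c where "c = min ((1/2)^Suc j) (\<delta> / (4 * (m + 1)))"
    have "0 < c" using \<delta> m0 by (simp add: c_def)
    moreover have "c \<le> (1/2)^Suc j" unfolding c_def by (rule min.cobounded1)
    moreover have "c \<le> \<delta> / (4 * (m + 1))" unfolding c_def by (rule min.cobounded2)
    ultimately have c: "0 < c" "c \<le> (1/2)^Suc j" "c \<le> \<delta> / (4 * (m + 1))" .
    obtain g where g: "g \<in> dominated f" "(N (\<H> s) + real j + 1) / c < N (\<H> g)" using unb by blast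
    have gi: "integrable mu g" by (rule dominated_integrable[OF fi g(1)])
    define s' where "s' x = s x + complex_of_real c * g x" for x
    have [measurable]: "s \<in> L0" "g \<in> L0" using si gi by auto
    have s'i: "integrable mu s'" unfolding s'_def using si gi by simp
    have [measurable]: "s' \<in> L0" using s'i by auto
    have "AE x in mu. cmod (g x) \<le> cmod (f x)" using g by (simp add: dominated_def)
    with sle have s'le: "AE x in mu. cmod (s' x) \<le> (1 - (1/2)^Suc j) * cmod (f x)"
    proof eventually_elim
      case (elim x)
      have "cmod (s' x) \<le> cmod (s x) + c * cmod (g x)"
        unfolding s'_def using c norm_triangle_ineq[of "s x" "complex_of_real c * g x"] by (simp add: norm_mult)
      also have "\<dots> \<le> (1 - (1/2)^j) * cmod (f x) + (1/2)^Suc j * cmod (f x)"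
        using elim c by (intro add_mono mult_mono) auto
      also have "\<dots> = (1 - (1/2)^Suc j) * cmod (f x)" by (simp add: algebra_simps)
      finally show ?case .
    qed
    have s'd: "s' \<in> dominated f"
    proof -
      have "AE x in mu. cmod (s' x) \<le> cmod (f x)" using s'le
      proof eventually_elim
        case (elim x)
        have "(1 - (1/2)^Suc j) * cmod (f x) \<le> 1 * cmod (f x)" by (intro mult_right_mono) auto
        with elim show ?case by simp
      qed
      then show ?thesis by (simp add: dominated_def)
    qed
    have "real j + 1 < N (\<H> s')"
    proof -
      have cgi: "integrable mu (\<lambda>x. complex_of_real c * g x)" using gi by simp
      have "AE x in mu. \<H> s' x = \<H> s x + \<H> (\<lambda>x. complex_of_real c * g x) x"
        unfolding s'_def by (rule finite_hilbert_transform_add[OF si cgi])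
      with finite_hilbert_transform_mult[OF gi, of "complex_of_real c"]
      have "AE x in mu. \<H> s' x - \<H> s x = complex_of_real c * \<H> g x" by eventually_elim simp
      from N_cong[OF diff_in[OF fX[OF s'd] fX[OF sd]] _ this] in_L0[OF scale[OF fX[OF g(1)]]]
      have "N (\<lambda>x. complex_of_real c * \<H> g x) = N (\<lambda>x. \<H> s' x - \<H> s x)" by blast
      also have "\<dots> \<le> N (\<H> s') + N (\<H> s)"
        using norm_triangle[OF fX[OF s'd] scale[OF fX[OF sd], of "-1"]] norm_scale[OF fX[OF sd], of "-1"] by simp
      finally have "c * N (\<H> g) \<le> N (\<H> s') + N (\<H> s)" using norm_scale[OF fX[OF g(1)], of "complex_of_real c"] c by simp
      moreover have "N (\<H> s) + real j + 1 < c * N (\<H> g)" using g(2) c by (simp add: field_simps)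
      ultimately show ?thesis by simp
    qed
    then have Ns': "real (Suc j) < N (\<H> s')" by simp
    have "\<exists>n::nat. \<forall>h\<in>dominated f. (\<integral>x. cmod (h x - s' x) \<partial>mu) < 1 / real (Suc n) \<longrightarrow> real (Suc j) \<le> N (\<H> h)"
    proof (rule ccontr)
      assume "\<not> ?thesis"
      then have "\<forall>n::nat. \<exists>h. h \<in> dominated f \<and> (\<integral>x. cmod (h x - s' x) \<partial>mu) < 1 / real (Suc n) \<and> N (\<H> h) \<le> real (Suc j)"
        by (auto simp: not_le intro: less_imp_le)
      from choice[OF this] obtain h where h: "\<And>n::nat. h n \<in> dominated f" "\<And>n. (\<integral>x. cmod (h n x - s' x) \<partial>mu) < 1 / real (Suc n)"
        "\<And>n. N (\<H> (h n)) \<le> real (Suc j)" by blast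
      have "(\<lambda>n. \<integral>x. cmod (h n x - s' x) \<partial>mu) \<longlonglongrightarrow> 0"
      proof (rule real_tendsto_sandwich[OF always_eventually[OF allI] always_eventually[OF allI] tendsto_const])
        show "(\<lambda>n. 1 / real (Suc n)) \<longlonglongrightarrow> 0" using LIMSEQ_inverse_real_of_nat by (simp only: inverse_eq_divide)
        show "0 \<le> (\<integral>x. cmod (h n x - s' x) \<partial>mu)" for n by simp
        show "(\<integral>x. cmod (h n x - s' x) \<partial>mu) \<le> 1 / real (Suc n)" for n using h(2)[of n] by simp
      qed
      then have "N (\<H> s') \<le> real (Suc j)"
        using norm_lower_semicontinuous[of h s', OF _ s'i _ _ h(3)] dominated_integrable[OF fi h(1)] fX[OF h(1)] by blast
      with Ns' show False by simp
    qed
    then obtain n :: nat where n: "\<forall>h\<in>dominated f. (\<integral>x. cmod (h x - s' x) \<partial>mu) < 1 / real (Suc n) \<longrightarrow> real (Suc j) \<le> N (\<H> h)" by blast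
    define \<delta>' where "\<delta>' = min (\<delta> / 2) (1 / real (Suc n))"
    have "P (Suc j) (s', \<delta>')"
      unfolding P_def using \<delta> n s'le by (auto simp: \<delta>'_def)
    moreover have "Q p (s', \<delta>')"
    proof -
      have "(\<integral>x. cmod (s' x - s x) \<partial>mu) = (\<integral>x. c * cmod (g x) \<partial>mu)"
        using c by (simp add: s'_def norm_mult)
      also have "\<dots> = c * (\<integral>x. cmod (g x) \<partial>mu)" by simp
      also have "\<dots> \<le> c * m" unfolding m_def
        using c g(1) fi gi by (intro mult_left_mono integral_mono_AE) (auto simp: dominated_def)
      also have "\<dots> \<le> \<delta> / (4 * (m + 1)) * (m + 1)" using c m0 \<delta> by (intro mult_mono) auto
      also have "\<dots> = \<delta> / 4" using m0 by (simp add: field_simps add_eq_0_iff)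
      finally show ?thesis by (simp add: Q_def \<delta>'_def \<delta>_def s_def)
    qed
    ultimately show ?thesis by blast
  qed
  obtain p where p: "\<And>j. P j (p j)" "\<And>j. Q (p j) (p (Suc j))"
    using dependent_nat_choice[of P "\<lambda>_. Q"] base step by blast
  define s where "s j = fst (p j)" for j
  define \<delta> where "\<delta> j = snd (p j)" for j
  have \<delta>0: "0 < \<delta> j" for j using p(1)[of j] by (simp add: P_def \<delta>_def)
  have \<delta>le: "\<delta> (i + j) \<le> \<delta> j * (1/2)^i" for i j
  proof (induction i)
    case (Suc i)
    have "\<delta> (Suc i + j) \<le> \<delta> (i + j) / 2" using p(2)[of "i + j"] by (simp add: Q_def \<delta>_def)
    with Suc show ?case by simp
  qed simp
  have sd: "s j \<in> dominated f" for j unfolding s_def by (rule sub[OF p(1)])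
  have si: "integrable mu (s j)" for j by (rule dominated_integrable[OF fi sd])
  have summ: "summable (\<lambda>i. \<delta> j * (1/2)^i / 4)" for j by (intro summable_divide summable_mult summable_geometric) simp
  have summ2: "summable (\<lambda>i. \<delta> i / 4)"
    by (rule summable_comparison_test'[OF summ[of 0], of 0]) (use \<delta>le[of _ 0] \<delta>0 in \<open>simp add: less_imp_le\<close>)
  have sq: "(\<integral>x. cmod (s (Suc n) x - s n x) \<partial>mu) \<le> \<delta> n / 4" for n
    using p(2)[of n] by (simp add: Q_def s_def \<delta>_def)
  obtain h where h: "integrable mu h" "AE x in mu. (\<lambda>n. s n x) \<longlonglongrightarrow> h x" "\<And>n. (\<integral>x. cmod (h x - s n x) \<partial>mu) \<le> (\<Sum>i. \<delta> (i + n) / 4)"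
    using L1_rapidly_Cauchy_converges[of mu s "\<lambda>n. \<delta> n / 4", OF si summ2 sq] by blast
  have "AE x in mu. \<forall>n. cmod (s n x) \<le> cmod (f x)" using sd by (simp add: AE_all_countable dominated_def)
  with h(2) have "AE x in mu. cmod (h x) \<le> cmod (f x)"
  proof eventually_elim
    case (elim x)
    show ?case by (rule LIMSEQ_le_const2[OF tendsto_norm[OF elim(1)]]) (use elim(2) in auto)
  qed
  then have hd: "h \<in> dominated f" using h(1) by (auto simp: dominated_def)
  have "real j \<le> N (\<H> h)" for j
  proof -
    have "(\<Sum>i. \<delta> (i + j) / 4) \<le> (\<Sum>i. \<delta> j * (1/2)^i / 4)"
      using summ summ2 \<delta>le by (intro suminf_le summable_ignore_initial_segment[of "\<lambda>i. \<delta> i / 4"]) (auto intro: divide_right_mono)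
    also have "\<dots> = \<delta> j / 2"
      by (subst suminf_divide, intro summable_mult summable_geometric, simp, subst suminf_mult) (auto simp: suminf_geometric)
    also have "\<dots> < \<delta> j" using \<delta>0[of j] by simp
    finally have "(\<integral>x. cmod (h x - s j x) \<partial>mu) < \<delta> j" using h(3)[of j] by linarith
    then show ?thesis using p(1)[of j] hd by (simp add: P_def s_def \<delta>_def)
  qed
  moreover obtain j where "N (\<H> h) < real j" using reals_Archimedean2 by blast
  ultimately show False by (meson not_le)
qed

abbreviation rho :: "(real \<Rightarrow> complex) \<Rightarrow> real" where "rho \<equiv> opt_domain_norm N"

lemma rho_upper: "f \<in> opt_domain X \<Longrightarrow> h \<in> dominated f \<Longrightarrow> N (\<H> h) \<le> rho f"
  unfolding opt_domain_norm_def by (rule cSUP_upper[OF _ dominated_norm_bounded])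

lemma rho_least: "(\<And>h. h \<in> dominated f \<Longrightarrow> N (\<H> h) \<le> C) \<Longrightarrow> rho f \<le> C"
  unfolding opt_domain_norm_def using zero_dominated by (intro cSUP_least) auto

lemma opt_domain_integrable: "f \<in> opt_domain X \<Longrightarrow> integrable mu f" by (simp add: opt_domain_iff)

lemma opt_domain_transform_in: "f \<in> opt_domain X \<Longrightarrow> h \<in> dominated f \<Longrightarrow> \<H> h \<in> X" by (simp add: opt_domain_iff)

lemma self_dominated: "f \<in> L0 \<Longrightarrow> f \<in> dominated f" by (simp add: dominated_def)

lemma rho_nonneg: "f \<in> opt_domain X \<Longrightarrow> 0 \<le> rho f"
  using rho_upper[OF _ zero_dominated] N_nonneg[OF opt_domain_transform_in[OF _ zero_dominated]] by fastforce

lemma dominated_subset: "AE x in mu. cmod (g x) \<le> cmod (f x) \<Longrightarrow> dominated g \<subseteq> dominated f"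
proof
  fix h assume "AE x in mu. cmod (g x) \<le> cmod (f x)" "h \<in> dominated g"
  then have "AE x in mu. cmod (h x) \<le> cmod (f x)" unfolding dominated_def by (auto elim: eventually_elim2)
  then show "h \<in> dominated f" using \<open>h \<in> dominated g\<close> by (simp add: dominated_def)
qed

lemma opt_domain_ideal:
  assumes f: "f \<in> opt_domain X" and g: "g \<in> L0" and le: "AE x in mu. cmod (g x) \<le> cmod (f x)"
  shows "g \<in> opt_domain X \<and> rho g \<le> rho f"
proof -
  have "g \<in> dominated f" using g le by (simp add: dominated_def)
  then have "integrable mu g" by (rule dominated_integrable[OF opt_domain_integrable[OF f]])
  then show ?thesis using dominated_subset[OF le] opt_domain_transform_in[OF f] rho_upper[OF f]
    by (auto simp: opt_domain_iff intro!: rho_least)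
qed

lemma times_id_dominated: "h \<in> dominated f \<Longrightarrow> (\<lambda>x. of_real x * h x) \<in> dominated f"
proof -
  assume h: "h \<in> dominated f"
  have [measurable]: "(\<lambda>x. complex_of_real x) \<in> L0" by (rule borel_imp_L0) measurable
  have [measurable]: "h \<in> L0" using h by (simp add: dominated_def)
  have "AE x in mu. cmod (h x) \<le> cmod (f x)" using h by (simp add: dominated_def)
  then have "AE x in mu. cmod (of_real x * h x) \<le> cmod (f x)"
    using AE_mu_space
  proof eventually_elim
    case (elim x)
    have "cmod (of_real x * h x) \<le> 1 * cmod (h x)" unfolding norm_mult using elim by (intro mult_right_mono) auto
    then show ?case using elim by simp
  qed
  then show ?thesis by (simp add: dominated_def)
qed

text \<open>
  Use \<open>integral_bound\<close> for \<open>\<bar>f\<bar>\<close>.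
\<close>

lemma L1_norm_le_rho:
  assumes f: "f \<in> opt_domain X"
  shows "(\<integral>x. cmod (f x) \<partial>mu) \<le> 2 * pi / N (\<lambda>x. 1) * rho f"
proof -
  have [measurable]: "f \<in> L0" using opt_domain_integrable[OF f] by auto
  define h where "h x = complex_of_real (cmod (f x))" for x
  have hd: "h \<in> dominated f" unfolding h_def dominated_def by simp
  have hi: "integrable mu h" by (rule dominated_integrable[OF opt_domain_integrable[OF f] hd])
  note xd = times_id_dominated[OF hd]
  have "cmod (\<integral>x. h x \<partial>mu) * N (\<lambda>x. 1) \<le> pi * (N (\<H> (\<lambda>x. of_real x * h x)) + N (\<H> h))"
    by (rule integral_bound[OF hi opt_domain_transform_in[OF f hd] opt_domain_transform_in[OF f xd]])
  also have "\<dots> \<le> pi * (rho f + rho f)" by (intro mult_left_mono add_mono rho_upper[OF f] hd xd) simp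
  also have "cmod (\<integral>x. h x \<partial>mu) = (\<integral>x. cmod (f x) \<partial>mu)" by (simp add: h_def)
  finally show ?thesis using N_one_pos by (simp add: field_simps)
qed

text \<open>
  Distribute \<open>h\<close> in the proportion \<open>\<bar>f\<bar> : \<bar>g\<bar>\<close>.
\<close>

lemma split_dominated:
  assumes h: "h \<in> dominated (\<lambda>x. f x + g x)" and f: "f \<in> L0" and g: "g \<in> L0"
  shows "\<exists>a\<in>dominated f. \<exists>b\<in>dominated g. AE x in mu. h x = a x + b x"
proof -
  note [measurable] = f g
  have [measurable]: "h \<in> L0" and hle: "AE x in mu. cmod (h x) \<le> cmod (f x + g x)" using h by (auto simp: dominated_def)
  define a where "a x = h x * complex_of_real (cmod (f x) / (cmod (f x) + cmod (g x)))" for x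
  define b where "b x = h x * complex_of_real (cmod (g x) / (cmod (f x) + cmod (g x)))" for x
  have [measurable]: "a \<in> L0" "b \<in> L0" unfolding a_def b_def by measurable
  have "AE x in mu. cmod (a x) \<le> cmod (f x) \<and> cmod (b x) \<le> cmod (g x) \<and> h x = a x + b x"
    using hle
  proof eventually_elim
    case (elim x)
    have le: "cmod (h x) \<le> cmod (f x) + cmod (g x)" using elim norm_triangle_ineq order_trans by blast
    show ?case
    proof (cases "cmod (f x) + cmod (g x) = 0")
      case True
      then have "h x = 0" using le by simp
      then show ?thesis by (simp add: a_def b_def)
    next
      case False
      then have pos: "0 < cmod (f x) + cmod (g x)" by (metis add_nonneg_nonneg norm_ge_zero less_le)
      have na: "cmod (a x) = cmod (h x) * (cmod (f x) / (cmod (f x) + cmod (g x)))"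
        unfolding a_def norm_mult norm_of_real using pos by simp
      have nb: "cmod (b x) = cmod (h x) * (cmod (g x) / (cmod (f x) + cmod (g x)))"
        unfolding b_def norm_mult norm_of_real using pos by simp
      have "cmod (a x) \<le> (cmod (f x) + cmod (g x)) * (cmod (f x) / (cmod (f x) + cmod (g x)))"
        unfolding na using le pos by (intro mult_right_mono) auto
      moreover have "cmod (b x) \<le> (cmod (f x) + cmod (g x)) * (cmod (g x) / (cmod (f x) + cmod (g x)))"
        unfolding nb using le pos by (intro mult_right_mono) auto
      moreover have "a x + b x = h x * complex_of_real ((cmod (f x) + cmod (g x)) / (cmod (f x) + cmod (g x)))"
        unfolding a_def b_def distrib_left[symmetric] of_real_add[symmetric] add_divide_distrib[symmetric] ..
      ultimately show ?thesis using pos by simp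
    qed
  qed
  then have "AE x in mu. cmod (a x) \<le> cmod (f x)" "AE x in mu. cmod (b x) \<le> cmod (g x)" "AE x in mu. h x = a x + b x"
    by (eventually_elim, simp)+
  then show ?thesis by (intro bexI[of _ a] bexI[of _ b]) (auto simp: dominated_def)
qed

lemma transform_of_sum:
  assumes "integrable mu a" "integrable mu b" "\<H> a \<in> X" "\<H> b \<in> X" "h \<in> L0" "AE x in mu. h x = a x + b x"
  shows "\<H> h \<in> X \<and> N (\<H> h) \<le> N (\<H> a) + N (\<H> b)"
proof -
  have abi: "integrable mu (\<lambda>x. a x + b x)" using assms by simp
  have e: "\<H> (\<lambda>x. a x + b x) = \<H> h"
    by (rule finite_hilbert_transform_cong_AE[OF abi assms(5)]) (use assms(6) in eventually_elim, simp)
  have "AE x in mu. \<H> a x + \<H> b x = \<H> h x"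
    using finite_hilbert_transform_add[OF assms(1,2)] unfolding e by eventually_elim simp
  moreover have "\<H> h \<in> L0" unfolding e[symmetric] by (rule finite_hilbert_transform_measurable[OF abi])
  ultimately show ?thesis using N_cong[OF add[OF assms(3,4)]] norm_triangle[OF assms(3,4)] by simp
qed

lemma opt_domain_add:
  assumes f: "f \<in> opt_domain X" and g: "g \<in> opt_domain X"
  shows "(\<lambda>x. f x + g x) \<in> opt_domain X \<and> rho (\<lambda>x. f x + g x) \<le> rho f + rho g"
proof -
  have fL: "f \<in> L0" "g \<in> L0" using opt_domain_integrable f g by auto
  have "\<H> h \<in> X \<and> N (\<H> h) \<le> rho f + rho g" if h: "h \<in> dominated (\<lambda>x. f x + g x)" for h
  proof -
    obtain a b where ab: "a \<in> dominated f" "b \<in> dominated g" "AE x in mu. h x = a x + b x"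
      using split_dominated[OF h fL] by blast
    have "\<H> h \<in> X \<and> N (\<H> h) \<le> N (\<H> a) + N (\<H> b)"
      using ab f g h by (intro transform_of_sum opt_domain_transform_in[OF f] opt_domain_transform_in[OF g] dominated_integrable[OF opt_domain_integrable[OF f]] dominated_integrable[OF opt_domain_integrable[OF g]]) (auto simp: dominated_def)
    then show ?thesis using rho_upper[OF f ab(1)] rho_upper[OF g ab(2)] by auto
  qed
  then show ?thesis using opt_domain_integrable[OF f] opt_domain_integrable[OF g] by (auto simp: opt_domain_iff intro: rho_least)
qed

lemma opt_domain_scale_le:
  assumes f: "f \<in> opt_domain X" and c: "c \<noteq> 0"
  shows "(\<lambda>x. c * f x) \<in> opt_domain X \<and> rho (\<lambda>x. c * f x) \<le> cmod c * rho f"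
proof -
  have "\<H> h \<in> X \<and> N (\<H> h) \<le> cmod c * rho f" if h: "h \<in> dominated (\<lambda>x. c * f x)" for h
  proof -
    define k where "k x = (1 / c) * h x" for x
    have [measurable]: "h \<in> L0" using h by (simp add: dominated_def)
    have "AE x in mu. cmod (h x) \<le> cmod (c * f x)" using h by (simp add: dominated_def)
    then have "AE x in mu. cmod (k x) \<le> cmod (f x)"
      by eventually_elim (use c in \<open>simp add: k_def norm_mult norm_divide divide_le_eq mult.commute\<close>)
    moreover have "k \<in> L0" unfolding k_def by measurable
    ultimately have kd: "k \<in> dominated f" by (simp add: dominated_def)
    have ki: "integrable mu k" by (rule dominated_integrable[OF opt_domain_integrable[OF f] kd])
    have hk: "h = (\<lambda>x. c * k x)" using c by (auto simp: k_def)
    have hi: "integrable mu h" unfolding hk using ki by simp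
    have "AE x in mu. c * \<H> k x = \<H> h x"
      using finite_hilbert_transform_mult[OF ki, of c] unfolding hk[symmetric] by eventually_elim simp
    from N_cong[OF scale[OF opt_domain_transform_in[OF f kd]] finite_hilbert_transform_measurable[OF hi] this]
    have "\<H> h \<in> X \<and> N (\<H> h) = cmod c * N (\<H> k)" using norm_scale[OF opt_domain_transform_in[OF f kd]] by simp
    then show ?thesis using rho_upper[OF f kd] by (auto intro: mult_left_mono)
  qed
  then show ?thesis using opt_domain_integrable[OF f] by (auto simp: opt_domain_iff intro: rho_least)
qed

lemma subset_opt_domain: "X \<subseteq> opt_domain X"
proof
  fix f assume f: "f \<in> X"
  have "\<H> h \<in> X" if "h \<in> dominated f" for h
    using that by (intro transform_in ideal[OF f]) (auto simp: dominated_def)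
  then show "f \<in> opt_domain X" using subset_L1[OF f] by (simp add: opt_domain_iff)
qed

lemma opt_domain_null: "f \<in> L0 \<Longrightarrow> AE x in mu. f x = 0 \<Longrightarrow> f \<in> opt_domain X \<and> rho f = 0"
proof -
  assume f: "f \<in> L0" and n: "AE x in mu. f x = 0"
  have "f \<in> X" by (rule ideal[OF zero_in f]) (use n in eventually_elim, simp)
  then have fd: "f \<in> opt_domain X" using subset_opt_domain by blast
  have "rho f \<le> 0"
  proof (rule rho_least)
    fix h assume h: "h \<in> dominated f"
    then have "AE x in mu. cmod (h x) \<le> cmod (f x)" by (simp add: dominated_def)
    with n have "AE x in mu. h x = 0" by eventually_elim simp
    then have "AE x in mu. \<H> h x = 0" using h by (intro finite_hilbert_transform_null) (auto simp: dominated_def)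
    then show "N (\<H> h) \<le> 0" using norm_zero_iff[OF opt_domain_transform_in[OF fd h]] by simp
  qed
  then show ?thesis using fd rho_nonneg[OF fd] by simp
qed

lemma opt_domain_scale:
  assumes f: "f \<in> opt_domain X"
  shows "(\<lambda>x. c * f x) \<in> opt_domain X \<and> rho (\<lambda>x. c * f x) = cmod c * rho f"
proof (cases "c = 0")
  case True
  then show ?thesis using opt_domain_null[of "\<lambda>x. 0"] by simp
next
  case False
  note 1 = opt_domain_scale_le[OF f False]
  have "rho (\<lambda>x. (1 / c) * (c * f x)) \<le> cmod (1 / c) * rho (\<lambda>x. c * f x)"
    using opt_domain_scale_le[OF conjunct1[OF 1], of "1 / c"] False by simp
  then have "rho f \<le> rho (\<lambda>x. c * f x) / cmod c" using False by (simp add: norm_divide)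
  then show ?thesis using 1 False by (simp add: field_simps)
qed

lemma opt_domain_diff: "f \<in> opt_domain X \<Longrightarrow> g \<in> opt_domain X \<Longrightarrow> (\<lambda>x. f x - g x) \<in> opt_domain X \<and> rho (\<lambda>x. f x - g x) \<le> rho f + rho g"
  using opt_domain_add[of f "\<lambda>x. (-1) * g x"] opt_domain_scale[of g "-1"] by simp

text \<open>
  The sequence converges in \<open>L\<^sup>1\<close> to some \<open>f\<close>, and \<open>f - s k\<close> is dominated by \<open>G\<close>, the sum of the
  \<open>\<bar>d i\<bar>\<close> with \<open>i \<ge> k\<close>. If \<open>h\<close> is dominated by \<open>f - s k\<close>, its parts \<open>h \<bar>d i\<bar> / G\<close> are dominated by
  the \<open>d i\<close>, so the transforms of their partial sums have norm at most \<open>2 * (1/2) ^ k\<close>. These sums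
  converge to \<open>h\<close> in \<open>L\<^sup>1\<close>, and lower semicontinuity applies.
\<close>

lemma opt_domain_rapid_limit:
  assumes s: "\<And>n. s n \<in> opt_domain X" and r: "\<And>n. rho (\<lambda>x. s (Suc n) x - s n x) \<le> (1/2)^n"
  shows "\<exists>f\<in>opt_domain X. \<forall>k. rho (\<lambda>x. f x - s k x) \<le> 2 * (1/2)^k"
proof -
  define d where "d n x = s (Suc n) x - s n x" for n x
  have dd: "d n \<in> opt_domain X" for n using opt_domain_diff[OF s s, of "Suc n" n] by (simp add: d_def[abs_def])
  have dr: "rho (d n) \<le> (1/2)^n" for n using r[of n] by (simp add: d_def[abs_def])
  define K where "K = 2 * pi / N (\<lambda>x. 1)"
  have K0: "0 \<le> K" using N_one_pos by (simp add: K_def)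
  have b: "(\<integral>x. cmod (s (Suc n) x - s n x) \<partial>mu) \<le> K * (1/2)^n" for n
  proof -
    have "(\<integral>x. cmod (d n x) \<partial>mu) \<le> K * rho (d n)" unfolding K_def by (rule L1_norm_le_rho[OF dd])
    also have "\<dots> \<le> K * (1/2)^n" using K0 dr by (intro mult_left_mono)
    finally show ?thesis by (simp add: d_def)
  qed
  have si: "integrable mu (s n)" for n by (rule opt_domain_integrable[OF s])
  have Ks: "summable (\<lambda>n. K * (1/2)^n)" by (intro summable_mult summable_geometric) simp
  obtain f where f: "integrable mu f" "AE x in mu. (\<lambda>n. s n x) \<longlonglongrightarrow> f x" "AE x in mu. summable (\<lambda>n. cmod (d n x))"
    using L1_rapidly_Cauchy_converges[of mu s "\<lambda>n. K * (1/2)^n", OF si Ks b] unfolding d_def by blast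
  have [measurable]: "f \<in> L0" "s n \<in> L0" "d n \<in> L0" for n
    using f si opt_domain_integrable[OF dd] by auto
  have e: "(\<lambda>x. f x - s k x) \<in> opt_domain X \<and> rho (\<lambda>x. f x - s k x) \<le> 2 * (1/2)^k" for k
  proof -
    have ei: "integrable mu (\<lambda>x. f x - s k x)" using f si by simp
    have "\<H> h \<in> X \<and> N (\<H> h) \<le> 2 * (1/2)^k" if h: "h \<in> dominated (\<lambda>x. f x - s k x)" for h
    proof -
      have [measurable]: "h \<in> L0" and hle: "AE x in mu. cmod (h x) \<le> cmod (f x - s k x)" using h by (auto simp: dominated_def)
      have hi: "integrable mu h" by (rule dominated_integrable[OF ei h])
      define G where "G x = (\<Sum>i. cmod (d (i + k) x))" for x
      have [measurable]: "G \<in> borel_measurable mu" unfolding G_def by (rule borel_measurable_suminf) measurable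
      define a where "a i x = h x * complex_of_real (cmod (d (i + k) x) / G x)" for i x
      have [measurable]: "a i \<in> L0" for i unfolding a_def by measurable
      have main: "AE x in mu. summable (\<lambda>i. cmod (d (i + k) x)) \<and> cmod (h x) \<le> G x"
        using hle f(2,3)
      proof eventually_elim
        case (elim x)
        have s1: "summable (\<lambda>i. cmod (d (i + k) x))" by (rule summable_ignore_initial_segment[OF elim(3)])
        have "cmod (f x - s k x) \<le> G x" unfolding G_def
        proof (rule LIMSEQ_le_const2)
          show "(\<lambda>m. cmod (s m x - s k x)) \<longlonglongrightarrow> cmod (f x - s k x)" by (intro tendsto_intros elim(2))
          show "\<exists>N. \<forall>m\<ge>N. cmod (s m x - s k x) \<le> (\<Sum>i. cmod (d (i + k) x))"
          proof (intro exI[of _ k] allI impI)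
            fix m assume "k \<le> m"
            then obtain j where m: "m = k + j" using le_Suc_ex by blast
            have "s m x - s k x = (\<Sum>i<j. d (i + k) x)"
              unfolding m d_def using sum_lessThan_telescope[of "\<lambda>i. s (i + k) x" j] by (simp add: add.commute)
            also have "cmod \<dots> \<le> (\<Sum>i<j. cmod (d (i + k) x))" by (rule norm_sum)
            also have "\<dots> \<le> (\<Sum>i. cmod (d (i + k) x))" by (rule sum_le_suminf[OF s1]) auto
            finally show "cmod (s m x - s k x) \<le> (\<Sum>i. cmod (d (i + k) x))" .
          qed
        qed
        then show ?case using elim(1) s1 by simp
      qed
      have ad: "a i \<in> dominated (d (i + k))" for i
      proof -
        have "AE x in mu. cmod (a i x) \<le> cmod (d (i + k) x)"
          using main
        proof eventually_elim
          case (elim x)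
          then have G0: "0 \<le> G x" by (meson norm_ge_zero order_trans)
          have "cmod (a i x) = cmod (h x) * (cmod (d (i + k) x) / G x)"
            unfolding a_def norm_mult norm_of_real using G0 by simp
          also have "\<dots> \<le> G x * (cmod (d (i + k) x) / G x)" using elim G0 by (intro mult_right_mono) auto
          also have "\<dots> \<le> cmod (d (i + k) x)" by simp
          finally show ?case .
        qed
        then show ?thesis by (simp add: dominated_def)
      qed
      have ai: "integrable mu (a i)" for i by (rule dominated_integrable[OF opt_domain_integrable[OF dd] ad])
      define q where "q m x = (\<Sum>i<m. a i x)" for m x
      have qi: "integrable mu (q m)" for m unfolding q_def[abs_def] using ai by (intro Bochner_Integration.integrable_sum)
      have qH: "\<H> (q m) \<in> X \<and> N (\<H> (q m)) \<le> 2 * (1/2)^k" for m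
      proof -
        have HX: "\<H> (a i) \<in> X" for i by (rule opt_domain_transform_in[OF dd ad])
        have "AE x in mu. (\<Sum>i<m. \<H> (a i) x) = \<H> (q m) x"
          using finite_hilbert_transform_sum[of "{..<m}" a] ai unfolding q_def[abs_def] by (auto elim!: eventually_mono)
        from N_cong[OF conjunct1[OF sum_in[of "{..<m}" "\<lambda>i. \<H> (a i)"]] finite_hilbert_transform_measurable[OF qi] this] HX
        have 1: "\<H> (q m) \<in> X" "N (\<H> (q m)) = N (\<lambda>x. \<Sum>i<m. \<H> (a i) x)" by auto
        have "N (\<lambda>x. \<Sum>i<m. \<H> (a i) x) \<le> (\<Sum>i<m. N (\<H> (a i)))" using sum_in[of "{..<m}" "\<lambda>i. \<H> (a i)"] HX by auto
        also have "\<dots> \<le> (\<Sum>i<m. (1/2)^k * (1/2)^i)"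
        proof (rule sum_mono)
          fix i
          have "N (\<H> (a i)) \<le> (1/2)^(i + k)" by (rule order_trans[OF rho_upper[OF dd ad] dr])
          then show "N (\<H> (a i)) \<le> (1/2)^k * (1/2)^i" by (simp add: power_add mult.commute)
        qed
        also have "\<dots> = (1/2)^k * (\<Sum>i<m. (1/2)^i)" by (simp add: sum_distrib_left)
        also have "\<dots> \<le> (1/2)^k * (\<Sum>i. (1/2)^i)" by (intro mult_left_mono sum_le_suminf) auto
        also have "\<dots> = 2 * (1/2)^k" by (simp add: suminf_geometric)
        finally show ?thesis using 1 by simp
      qed
      have "(\<lambda>m. \<integral>x. cmod (q m x - h x) \<partial>mu) \<longlonglongrightarrow> (\<integral>x. 0 \<partial>mu)"
      proof (rule integral_dominated_convergence[where w="\<lambda>x. 2 * cmod (h x)"])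
        have [measurable]: "q m \<in> L0" for m using qi by auto
        show "(\<lambda>x. cmod (q m x - h x)) \<in> borel_measurable mu" for m by measurable
        show "integrable mu (\<lambda>x. 2 * cmod (h x))" using hi by simp
        have qeq: "q m x = h x * complex_of_real ((\<Sum>i<m. cmod (d (i + k) x)) / G x)" for m x
          unfolding q_def a_def by (simp add: sum_distrib_left sum_divide_distrib)
        show "AE x in mu. (\<lambda>m. cmod (q m x - h x)) \<longlonglongrightarrow> 0"
          using main
        proof eventually_elim
          case (elim x)
          show ?case
          proof (cases "G x = 0")
            case True
            then have "h x = 0" using elim by simp
            then show ?thesis by (simp add: qeq)
          next
            case False
            have "(\<lambda>m. \<Sum>i<m. cmod (d (i + k) x)) \<longlonglongrightarrow> G x" unfolding G_def using elim by (intro summable_LIMSEQ) simp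
            then have "(\<lambda>m. cmod (h x * complex_of_real ((\<Sum>i<m. cmod (d (i + k) x)) / G x) - h x)) \<longlonglongrightarrow> cmod (h x * complex_of_real (G x / G x) - h x)"
              using False by (intro tendsto_intros)
            then show ?thesis using False by (simp add: qeq)
          qed
        qed
        show "AE x in mu. norm (cmod (q m x - h x)) \<le> 2 * cmod (h x)" for m
          using main
        proof eventually_elim
          case (elim x)
          then have G0: "0 \<le> G x" by (meson norm_ge_zero order_trans)
          have "(\<Sum>i<m. cmod (d (i + k) x)) \<le> G x" unfolding G_def using elim by (intro sum_le_suminf) auto
          then have c1: "(\<Sum>i<m. cmod (d (i + k) x)) / G x \<le> 1" using G0 by (auto simp: divide_le_eq_1)
          have "cmod (q m x) = cmod (h x) * ((\<Sum>i<m. cmod (d (i + k) x)) / G x)"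
            unfolding qeq norm_mult norm_of_real using G0 by (simp add: sum_nonneg)
          also have "\<dots> \<le> cmod (h x) * 1" using c1 by (intro mult_left_mono) auto
          finally show ?case using norm_triangle_ineq4[of "q m x" "h x"] by simp
        qed
      qed simp
      then have "(\<lambda>m. \<integral>x. cmod (q m x - h x) \<partial>mu) \<longlonglongrightarrow> 0" by simp
      from norm_lower_semicontinuous[OF qi hi this] qH show ?thesis by blast
    qed
    then show ?thesis using ei by (auto simp: opt_domain_iff intro: rho_least)
  qed
  have "(\<lambda>x. (f x - s 0 x) + s 0 x) \<in> opt_domain X" using opt_domain_add[OF conjunct1[OF e] s] by blast
  then have "f \<in> opt_domain X" by simp
  then show ?thesis using e by blast
qed

lemma opt_domain_complete:
  assumes F: "\<And>n. F n \<in> opt_domain X"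
    and C: "\<forall>e>0. \<exists>K. \<forall>m\<ge>K. \<forall>n\<ge>K. rho (\<lambda>x. F m x - F n x) < e"
  shows "\<exists>f\<in>opt_domain X. (\<lambda>n. rho (\<lambda>x. F n x - f x)) \<longlonglongrightarrow> 0"
proof -
  have "\<forall>k::nat. \<exists>K. \<forall>m\<ge>K. \<forall>n\<ge>K. rho (\<lambda>x. F m x - F n x) < (1/2)^k" using C by simp
  from choice[OF this] obtain K where K: "\<And>k m n. K k \<le> m \<Longrightarrow> K k \<le> n \<Longrightarrow> rho (\<lambda>x. F m x - F n x) < (1/2)^k" by blast
  define r where "r = rec_nat (K 0) (\<lambda>k a. max (Suc a) (K (Suc k)))"
  have r: "r 0 = K 0" "r (Suc k) = max (Suc (r k)) (K (Suc k))" for k by (auto simp: r_def)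
  have rK: "K k \<le> r k" for k by (cases k) (auto simp: r)
  have "K k \<le> r (Suc k)" for k using rK[of k] by (simp add: r)
  then have "rho (\<lambda>x. F (r (Suc n)) x - F (r n) x) \<le> (1/2)^n" for n using K[of n "r (Suc n)" "r n"] rK[of n] by (simp add: less_imp_le)
  from opt_domain_rapid_limit[of "\<lambda>n. F (r n)", OF F this]
  obtain f where f: "f \<in> opt_domain X" "\<And>k. rho (\<lambda>x. f x - F (r k) x) \<le> 2 * (1/2)^k" by blast
  have "(\<lambda>n. rho (\<lambda>x. F n x - f x)) \<longlonglongrightarrow> 0"
  proof (rule LIMSEQ_I)
    fix e :: real assume e: "0 < e"
    obtain k where k: "(1/2)^k < e / 3" using real_arch_pow_inv[of "e / 3" "1/2"] e by auto
    show "\<exists>no. \<forall>n\<ge>no. norm (rho (\<lambda>x. F n x - f x) - 0) < e"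
    proof (intro exI[of _ "K k"] allI impI)
      fix n assume n: "K k \<le> n"
      have 1: "(\<lambda>x. F n x - F (r k) x) \<in> opt_domain X" and 2: "(\<lambda>x. f x - F (r k) x) \<in> opt_domain X"
        using opt_domain_diff F f(1) by blast+
      have "rho (\<lambda>x. (F n x - F (r k) x) - (f x - F (r k) x)) \<le> rho (\<lambda>x. F n x - F (r k) x) + rho (\<lambda>x. f x - F (r k) x)"
        using opt_domain_diff[OF 1 2] by blast
      also have "\<dots> \<le> (1/2)^k + 2 * (1/2)^k" using K[OF n rK[of k]] f(2)[of k] by simp
      finally have "rho (\<lambda>x. F n x - f x) < e" using k by simp
      moreover have "0 \<le> rho (\<lambda>x. F n x - f x)" using opt_domain_diff[OF F f(1)] rho_nonneg by blast
      ultimately show "norm (rho (\<lambda>x. F n x - f x) - 0) < e" by simp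
    qed
  qed
  with f(1) show ?thesis by blast
qed

theorem opt_domain_banach: "banach_function_space (opt_domain X) rho"
proof
  show "opt_domain X \<subseteq> L0" using opt_domain_integrable by auto
  show "(\<lambda>x. f x + g x) \<in> opt_domain X" if "f \<in> opt_domain X" "g \<in> opt_domain X" for f g using opt_domain_add that by blast
  show "(\<lambda>x. c * f x) \<in> opt_domain X" if "f \<in> opt_domain X" for c f using opt_domain_scale that by blast
  show "g \<in> opt_domain X" if "f \<in> opt_domain X" "g \<in> L0" "AE x in mu. cmod (g x) \<le> cmod (f x)" for f g
    using opt_domain_ideal that by blast
  show "f \<in> opt_domain X" if "simple_function mu f" for f using simple[OF that] subset_opt_domain by blast
  show "rho f = 0 \<longleftrightarrow> (AE x in mu. f x = 0)" if f: "f \<in> opt_domain X" for f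
  proof
    assume "rho f = 0"
    then have "(\<integral>x. cmod (f x) \<partial>mu) = 0" using L1_norm_le_rho[OF f] by (intro antisym) auto
    then show "AE x in mu. f x = 0"
      using integral_nonneg_eq_0_iff_AE[OF integrable_norm[OF opt_domain_integrable[OF f]]] by simp
  next
    assume "AE x in mu. f x = 0"
    then show "rho f = 0" using opt_domain_null opt_domain_integrable[OF f] by auto
  qed
  show "rho (\<lambda>x. c * f x) = cmod c * rho f" if "f \<in> opt_domain X" for c f using opt_domain_scale that by blast
  show "rho (\<lambda>x. f x + g x) \<le> rho f + rho g" if "f \<in> opt_domain X" "g \<in> opt_domain X" for f g using opt_domain_add that by blast
  show "rho g \<le> rho f" if "f \<in> opt_domain X" "g \<in> opt_domain X" "AE x in mu. cmod (g x) \<le> cmod (f x)" for f g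
    using opt_domain_ideal[OF that(1) _ that(3)] opt_domain_integrable[OF that(2)] by auto
  show "\<exists>f\<in>opt_domain X. (\<lambda>n. rho (\<lambda>x. F n x - f x)) \<longlonglongrightarrow> 0"
    if "\<And>n. F n \<in> opt_domain X" "\<forall>e>0. \<exists>K. \<forall>m\<ge>K. \<forall>n\<ge>K. rho (\<lambda>x. F m x - F n x) < e" for F :: "nat \<Rightarrow> real \<Rightarrow> complex"
    using opt_domain_complete that by blast
qed

theorem opt_domain_admits_extension: "admits_extension (opt_domain X) rho X N"
  unfolding admits_extension_def continuous_linear_operator_def
proof (intro exI[of _ "\<H>"] conjI ballI allI impI)
  have HX: "\<H> f \<in> X" if "f \<in> opt_domain X" for f
    using opt_domain_transform_in[OF that self_dominated] opt_domain_integrable[OF that] by auto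
  show "\<H> f \<in> X" if "f \<in> opt_domain X" for f by (rule HX[OF that])
  show "AE x in mu. \<H> (\<lambda>y. f y + g y) x = \<H> f x + \<H> g x" if "f \<in> opt_domain X" "g \<in> opt_domain X" for f g
    by (intro finite_hilbert_transform_add opt_domain_integrable that)
  show "AE x in mu. \<H> (\<lambda>y. c * f y) x = c * \<H> f x" if "f \<in> opt_domain X" for c f
    by (intro finite_hilbert_transform_mult opt_domain_integrable that)
  show "AE x in mu. \<H> f x = \<H> f x" for f by simp
  show "\<exists>d>0. \<forall>g\<in>opt_domain X. rho (\<lambda>x. g x - f x) < d \<longrightarrow> N (\<lambda>x. \<H> g x - \<H> f x) < e"
    if f: "f \<in> opt_domain X" and e: "0 < e" for f e
  proof (intro exI[of _ e] conjI ballI impI e)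
    fix g assume g: "g \<in> opt_domain X" and lt: "rho (\<lambda>x. g x - f x) < e"
    have d: "(\<lambda>x. g x - f x) \<in> opt_domain X" using opt_domain_diff[OF g f] by blast
    have "AE x in mu. \<H> (\<lambda>x. g x - f x) x = \<H> g x - \<H> f x"
      by (intro finite_hilbert_transform_diff opt_domain_integrable f g)
    from N_cong[OF HX[OF d] in_L0[OF diff_in[OF HX[OF g] HX[OF f]]] this]
    have "N (\<lambda>x. \<H> g x - \<H> f x) = N (\<H> (\<lambda>x. g x - f x))" by simp
    also have "\<dots> \<le> rho (\<lambda>x. g x - f x)"
      using rho_upper[OF d self_dominated] opt_domain_integrable[OF d] by auto
    finally show "N (\<lambda>x. \<H> g x - \<H> f x) < e" using lt by simp
  qed
qed

text \<open>
  A continuous extension is bounded on \<open>{g. \<bar>g\<bar> \<le> \<bar>f\<bar>}\<close>, and it agrees with \<open>H\<close> on the bounded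
  functions of this set. Applying \<open>integral_bound\<close> to truncations of \<open>\<bar>f\<bar>\<close> shows that \<open>f\<close> is
  integrable; after that the truncations of a dominated \<open>h\<close> converge to \<open>h\<close> in \<open>L\<^sup>1\<close>, and lower
  semicontinuity carries the bound over to \<open>h\<close>.
\<close>

theorem opt_domain_maximal:
  assumes Z: "banach_function_space Z NZ" and XZ: "X \<subseteq> Z" and adm: "admits_extension Z NZ X N"
  shows "Z \<subseteq> opt_domain X"
proof
  interpret Z: banach_function_space Z NZ by (rule Z)
  obtain S where S: "\<And>f. f \<in> Z \<Longrightarrow> S f \<in> X"
    and Sc: "\<And>c f. f \<in> Z \<Longrightarrow> AE x in mu. S (\<lambda>y. c * f y) x = c * S f x"
    and cont: "\<And>f e. f \<in> Z \<Longrightarrow> 0 < e \<Longrightarrow> \<exists>d>0. \<forall>g\<in>Z. NZ (\<lambda>x. g x - f x) < d \<longrightarrow> N (\<lambda>x. S g x - S f x) < e"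
    and ext: "\<And>f. f \<in> X \<Longrightarrow> AE x in mu. S f x = \<H> f x"
    using adm unfolding admits_extension_def continuous_linear_operator_def by blast
  obtain d where d: "0 < d" "\<And>g. g \<in> Z \<Longrightarrow> NZ (\<lambda>x. g x - 0) < d \<Longrightarrow> N (\<lambda>x. S g x - S (\<lambda>x. 0) x) < 1"
    using cont[OF Z.zero_in, of 1] by auto
  have S0: "AE x in mu. S (\<lambda>x. 0) x = 0" using Sc[OF Z.zero_in, of 0] by simp
  have small: "N (S g) < 1" if g: "g \<in> Z" "NZ g < d" for g
  proof -
    have "AE x in mu. S g x - S (\<lambda>x. 0) x = S g x" using S0 by eventually_elim simp
    from N_cong[OF diff_in[OF S[OF g(1)] S[OF Z.zero_in]] in_L0[OF S[OF g(1)]] this]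
    show ?thesis using d(2)[of g] g by simp
  qed
  fix f assume f: "f \<in> Z"
  have [measurable]: "f \<in> L0" by (rule Z.in_L0[OF f])
  define M where "M = 2 * (NZ f + 1) / d"
  have NZf: "0 \<le> NZ f" by (rule Z.N_nonneg[OF f])
  have M: "N (\<H> g) \<le> M" if g: "g \<in> X" "AE x in mu. cmod (g x) \<le> cmod (f x)" for g
  proof -
    have gZ: "g \<in> Z" using g XZ by blast
    \<comment> \<open>Scaling by \<open>c\<close> moves \<open>g\<close> into the ball of radius \<open>d\<close> in \<open>Z\<close>.\<close>
    define c where "c = d / (2 * (NZ f + 1))"
    have c: "0 < c" using d NZf by (simp add: c_def)
    have "NZ g \<le> NZ f" by (rule Z.norm_mono[OF f gZ g(2)])
    then have "c * NZ g \<le> c * (NZ f + 1)" using c by (intro mult_left_mono) auto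
    also have "\<dots> = d / 2" using NZf by (simp add: c_def field_simps)
    also have "\<dots> < d" using d by simp
    finally have "NZ (\<lambda>x. complex_of_real c * g x) < d" using Z.norm_scale[OF gZ, of "complex_of_real c"] c by simp
    then have "N (S (\<lambda>x. complex_of_real c * g x)) < 1" by (rule small[OF Z.scale[OF gZ]])
    moreover have "AE x in mu. complex_of_real c * \<H> g x = S (\<lambda>x. complex_of_real c * g x) x"
      using Sc[OF gZ, of "complex_of_real c"] ext[OF g(1)] by eventually_elim simp
    from N_cong[OF scale[OF transform_in[OF g(1)]] in_L0[OF S[OF Z.scale[OF gZ]]] this]
    have "N (S (\<lambda>x. complex_of_real c * g x)) = c * N (\<H> g)" using norm_scale[OF transform_in[OF g(1)], of "complex_of_real c"] c by simp
    ultimately have "N (\<H> g) < 1 / c" using c by (simp add: field_simps)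
    then show ?thesis by (simp add: c_def M_def)
  qed
  define cut where "cut h n x = (if cmod (h x) \<le> real n then h x else 0)" for h :: "real \<Rightarrow> complex" and n x
  have cutL: "cut h n \<in> L0" if "h \<in> L0" for h n
    using that unfolding cut_def[abs_def] by measurable
  have cutX: "cut h n \<in> X" if "h \<in> L0" for h n
    by (rule ideal[OF const_in[of "of_nat n"] cutL[OF that]]) (simp add: cut_def)
  have cutle: "cmod (cut h n x) \<le> cmod (h x)" for h n x by (simp add: cut_def)
  have cutlim: "(\<lambda>n. cut h n x) \<longlonglongrightarrow> h x" for h x
  proof (rule tendsto_eventually)
    obtain k where "cmod (h x) < real k" using reals_Archimedean2 by blast
    then show "\<forall>\<^sub>F n in sequentially. cut h n x = h x"
      unfolding eventually_sequentially by (intro exI[of _ k]) (auto simp: cut_def)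
  qed
  have fi: "integrable mu f"
  proof -
    define a where "a x = complex_of_real (cmod (f x))" for x
    have aL: "a \<in> L0" unfolding a_def by measurable
    have "(\<integral>\<^sup>+x. ennreal (cmod (cut a n x)) \<partial>mu) \<le> ennreal (2 * pi * M / N (\<lambda>x. 1))" for n
    proof -
      have ci: "integrable mu (cut a n)" by (rule subset_L1[OF cutX[OF aL]])
      have "cut a n \<in> dominated (cut a n)" by (rule self_dominated[OF cutL[OF aL]])
      from times_id_dominated[OF this]
      have xd: "(\<lambda>x. of_real x * cut a n x) \<in> L0" "AE x in mu. cmod (of_real x * cut a n x) \<le> cmod (cut a n x)"
        by (auto simp: dominated_def)
      have xX: "(\<lambda>x. of_real x * cut a n x) \<in> X" by (rule ideal[OF cutX[OF aL] xd])
      have le: "AE x in mu. cmod (cut a n x) \<le> cmod (f x)" using cutle[of a n] by (auto simp: a_def)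
      with xd(2) have le2: "AE x in mu. cmod (of_real x * cut a n x) \<le> cmod (f x)" by eventually_elim simp
      have pos: "cut a n x = complex_of_real (cmod (cut a n x))" for x by (simp add: cut_def a_def)
      have "(\<integral>x. cut a n x \<partial>mu) = complex_of_real (\<integral>x. cmod (cut a n x) \<partial>mu)"
        unfolding integral_complex_of_real[symmetric] by (subst pos) simp
      then have "(\<integral>x. cmod (cut a n x) \<partial>mu) = cmod (\<integral>x. cut a n x \<partial>mu)" by simp
      then have "(\<integral>x. cmod (cut a n x) \<partial>mu) * N (\<lambda>x. 1) \<le> pi * (N (\<H> (\<lambda>x. of_real x * cut a n x)) + N (\<H> (cut a n)))"
        using integral_bound[OF ci transform_in[OF cutX[OF aL]] transform_in[OF xX]] by simp
      also have "\<dots> \<le> pi * (M + M)" by (intro mult_left_mono add_mono M xX le le2 cutX[OF aL]) simp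
      finally have "(\<integral>x. cmod (cut a n x) \<partial>mu) \<le> 2 * pi * M / N (\<lambda>x. 1)" using N_one_pos by (simp add: field_simps)
      then show ?thesis by (subst nn_integral_eq_integral[OF integrable_norm[OF ci]]) (auto intro: ennreal_leI)
    qed
    note bnd = this
    have "(\<integral>\<^sup>+x. ennreal (cmod (f x)) \<partial>mu) = (\<integral>\<^sup>+x. liminf (\<lambda>n. ennreal (cmod (cut a n x))) \<partial>mu)"
    proof (rule nn_integral_cong)
      fix x
      have "(\<lambda>n. ennreal (cmod (cut a n x))) \<longlonglongrightarrow> ennreal (cmod (a x))" by (intro tendsto_intros cutlim)
      from lim_imp_Liminf[OF _ this] show "ennreal (cmod (f x)) = liminf (\<lambda>n. ennreal (cmod (cut a n x)))" by (simp add: a_def)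
    qed
    also have "\<dots> \<le> liminf (\<lambda>n. \<integral>\<^sup>+x. ennreal (cmod (cut a n x)) \<partial>mu)"
      by (rule nn_integral_liminf) (use cutL[OF aL] in measurable)
    also have "\<dots> \<le> liminf (\<lambda>n. ennreal (2 * pi * M / N (\<lambda>x. 1)))"
      by (intro Liminf_mono always_eventually allI bnd)
    also have "\<dots> < \<infinity>" by (simp add: Liminf_const)
    finally show ?thesis by (simp add: integrable_iff_bounded)
  qed
  have "\<H> h \<in> X" if h: "h \<in> dominated f" for h
  proof -
    have hL: "h \<in> L0" and hle: "AE x in mu. cmod (h x) \<le> cmod (f x)" using h by (auto simp: dominated_def)
    note [measurable] = hL cutL[OF hL]
    have hi: "integrable mu h" by (rule dominated_integrable[OF fi h])
    have le: "AE x in mu. cmod (cut h n x) \<le> cmod (f x)" for n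
      using hle by eventually_elim (use cutle order_trans in blast)
    have "(\<lambda>n. \<integral>x. cmod (cut h n x - h x) \<partial>mu) \<longlonglongrightarrow> (\<integral>x. 0 \<partial>mu)"
    proof (rule integral_dominated_convergence[where w="\<lambda>x. 2 * cmod (h x)"])
      show "AE x in mu. (\<lambda>n. cmod (cut h n x - h x)) \<longlonglongrightarrow> 0"
        using cutlim[of h] by (intro AE_I2) (auto intro!: tendsto_norm_zero LIM_zero)
      show "AE x in mu. norm (cmod (cut h n x - h x)) \<le> 2 * cmod (h x)" for n
        by (intro AE_I2) (simp add: cut_def)
    qed (use hi in \<open>auto simp: \<close>)
    then have "(\<lambda>n. \<integral>x. cmod (cut h n x - h x) \<partial>mu) \<longlonglongrightarrow> 0" by simp
    then show ?thesis
      using norm_lower_semicontinuous[of "cut h" h M, OF _ hi] subset_L1[OF cutX[OF hL]] transform_in[OF cutX[OF hL]] M[OF cutX[OF hL] le] by blast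
  qed
  then show "f \<in> opt_domain X" using fi by (simp add: opt_domain_iff)
qed

end

theorem proposition2p7:
  fixes X :: "(real \<Rightarrow> complex) set" and N :: "(real \<Rightarrow> complex) \<Rightarrow> real"
  assumes "rearrangement_invariant_space X N"
    and "0 < lower_boyd_index X N"
    and "lower_boyd_index X N \<le> upper_boyd_index X N"
    and "upper_boyd_index X N < 1"
  shows "(\<forall>f\<in>opt_domain X. bdd_above ((\<lambda>h. N (finite_hilbert_transform h)) ` dominated f)) \<and>
    banach_function_space (opt_domain X) (opt_domain_norm N) \<and>
    X \<subseteq> opt_domain X \<and>
    admits_extension (opt_domain X) (opt_domain_norm N) X N \<and>
    (\<forall>Z NZ. banach_function_space Z NZ \<and> X \<subseteq> Z \<and> admits_extension Z NZ X N
      \<longrightarrow> Z \<subseteq> opt_domain X)"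
proof -
  interpret rearrangement_invariant_space X N by (rule assms(1))
  interpret hilbert_invariant_space X N
  proof
    show "integrable mu f" if "f \<in> X" for f by (rule X_integrable[OF that assms(4)])
    show "finite_hilbert_transform f \<in> X" if "f \<in> X" for f by (rule finite_hilbert_transform_in[OF assms(2,4) that])
  qed
  show ?thesis
  proof (intro conjI ballI allI impI)
    show "bdd_above ((\<lambda>h. N (finite_hilbert_transform h)) ` dominated f)" if "f \<in> opt_domain X" for f
      by (rule dominated_norm_bounded[OF that])
    show "Z \<subseteq> opt_domain X" if "banach_function_space Z NZ \<and> X \<subseteq> Z \<and> admits_extension Z NZ X N" for Z NZ
      using that by (intro opt_domain_maximal[of Z NZ]) simp_all
  qed (rule opt_domain_banach subset_opt_domain opt_domain_admits_extension)+
qed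

end
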